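(* (a) There is a constant $C>0$ such that for every finite measure $X_0$ on $\mathbb{R}$, $P_{X_0}(0<X(t,x)\le a)\le C\,X_0(\mathbb{R})\,t^{-(1/2)-\lambda_0}a^{2\lambda_0-1}$ for all $a,t>0$ and $x\in\mathbb{R}$. (b) For all $K\ge1$ there is $\underline C(K)>0$ such that for all $t>0$, $x\in\mathbb{R}$ and finite measures $X_0$ with $X_0(\mathbb{R})\le Kt$ and $X_0([x-K\sqrt t,x+K\sqrt t])/X_0(\mathbb{R})\ge K^{-2}$, \[P_{X_0}(0<X(t,x)\le a)\ge\underline C(K)X_0(\mathbb{R})\,t^{-(1/2)-\lambda_0}a^{2\lambda_0-1}\quad\forall\,0\le a\le\sqrt t.\] In particular, if $|x-x_0|\le K\sqrt t$ and $t\ge K^{-1}$, then \[P_{\delta_{x_0}}(0<X(t,x)\le a)\ge\underline C(K)\,t^{-(1/2)-\lambda_0}a^{2\lambda_0-1}\quad\forall\,0\le a\le\sqrt t,\] and if $X_0(\mathbb{R})\le K$, $X_0([-K,K])\ge K^{-1}$, $t\ge K^{-1}$ and $|x|\le K$, then \[P_{X_0}(0<X(t,x)\le a)\ge\underline C(K^2)K^{-1}t^{-(1/2)-\lambda_0}a^{2\lambda_0-1}\quad\forall\,0\le a\le\sqrt t.\]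
   Context: For a finite measure $X_0$ on $\mathbb{R}$, $X(t,x)$ ($t>0$) is the jointly continuous density of one-dimensional super-Brownian motion started at $X_0$, i.e. the (unique in law) nonnegative solution of $\partial_tX=\frac12\partial_x^2X+\sqrt X\dot W$, $\dot W$ space-time white noise; $P_{X_0}$ is its law. $F(x)=-\log P_{\delta_x}(X(1,0)=0)$. $m$ is the standard normal law; the operator $L^Fh=\frac12h''-\frac x2h'-Fh$ (generator on $L^2(m)$ of the Ornstein–Uhlenbeck semigroup killed at rate $F$) has a complete orthonormal system of $C^2$ eigenfunctions with eigenvalues $-\lambda_n$, $0\le\lambda_0<\lambda_1\le\dots$; $\lambda_0$ is the lowest value (and $1/2<\lambda_0<1$). *)

theory Defs
  imports "HOL-Probability.Probability"
begin

definition fin_meas :: "real measure \<Rightarrow> bool" where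
  "fin_meas X0 \<longleftrightarrow> finite_measure X0 \<and> sets X0 = sets borel"

definition test_fun :: "(real \<Rightarrow> real) \<Rightarrow> bool" where
  "test_fun \<phi> \<longleftrightarrow> continuous_on UNIV \<phi> \<and> (\<forall>y. 0 \<le> \<phi> y) \<and>
     (\<exists>R. \<forall>y. R < \<bar>y\<bar> \<longrightarrow> \<phi> y = 0)"

text \<open>Bounded nonnegative classical solution u(s,y) of the log-Laplace equation
  of super-Brownian motion (branching rate 1):
  d/ds u = 1/2 u'' - 1/2 u^2,  u(0,.) = phi.\<close>
definition log_laplace_sol :: "(real \<Rightarrow> real) \<Rightarrow> (real \<Rightarrow> real \<Rightarrow> real) \<Rightarrow> bool" where
  "log_laplace_sol \<phi> u \<longleftrightarrow>
     u 0 = \<phi> \<and>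
     (\<exists>B. \<forall>s\<ge>0. \<forall>y. \<bar>u s y\<bar> \<le> B) \<and>
     (\<forall>s\<ge>0. \<forall>y. 0 \<le> u s y) \<and>
     continuous_on ({0..} \<times> UNIV) (\<lambda>(s, y). u s y) \<and>
     (\<forall>s>0. \<forall>y. (u s) differentiable (at y) \<and> (deriv (u s)) differentiable (at y) \<and>
        ((\<lambda>r. u r y) has_real_derivative
           (deriv (deriv (u s)) y / 2 - (u s y)^2 / 2)) (at s))"

text \<open>Q is the law (on the space of bounded continuous functions y \<mapsto> X(t,y))
  of the density X(t,.) at time t of super-Brownian motion started at X0,
  characterised by its Laplace functional.\<close>
definition is_sbm_law :: "real measure \<Rightarrow> real \<Rightarrow> (real \<Rightarrow>\<^sub>C real) measure \<Rightarrow> bool" where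
  "is_sbm_law X0 t Q \<longleftrightarrow>
     prob_space Q \<and> sets Q = sets borel \<and>
     (AE f in Q. \<forall>y. 0 \<le> apply_bcontfun f y) \<and>
     (\<forall>\<phi> u. test_fun \<phi> \<longrightarrow> log_laplace_sol \<phi> u \<longrightarrow>
        (\<integral>f. exp (- (\<integral>y. apply_bcontfun f y * \<phi> y \<partial>lborel)) \<partial>Q) = exp (- (\<integral>y. u t y \<partial>X0)))"

definition sbmF :: "(real measure \<Rightarrow> real \<Rightarrow> (real \<Rightarrow>\<^sub>C real) measure) \<Rightarrow> real \<Rightarrow> real" where
  "sbmF Q x = - ln (measure (Q (return borel x) 1) {f. apply_bcontfun f 0 = 0})"

definition LF_eigen :: "(real \<Rightarrow> real) \<Rightarrow> real \<Rightarrow> (real \<Rightarrow> real) \<Rightarrow> bool" where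
  "LF_eigen F lam h \<longleftrightarrow>
     (\<forall>x. h differentiable (at x)) \<and> (\<forall>x. (deriv h) differentiable (at x)) \<and>
     continuous_on UNIV (deriv (deriv h)) \<and>
     integrable lborel (\<lambda>x. (h x)^2 * std_normal_density x) \<and>
     (\<exists>x. h x \<noteq> 0) \<and>
     (\<forall>x. deriv (deriv h) x / 2 - x / 2 * deriv h x - F x * h x = - lam * h x)"

definition lambda0 :: "(real \<Rightarrow> real) \<Rightarrow> real" where
  "lambda0 F = Inf {lam. \<exists>h. LF_eigen F lam h}"

end

(* Proof idea. Put v = -log E_{delta_x} exp(-l X(1,0)). The log-Laplace equation
   u_t = u''/2 - u^2/2 and Brownian scaling give v = V(l, x), with V(l, .) increasing to F as
   l -> infinity and F'' = F^2 - 2 F - x F', and everything reduces to the two-sided estimate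
   F - V(l, .) ~ l^(-2 beta), where beta = lambda_0 - 1/2. The self-similar solution
   t^(-1) F(x / sqrt t) of the log-Laplace equation has the linearisation
   t^(-1-beta) (exp(-z^2/2) psi)(x / sqrt t), where psi is the ground state of L^F; sub- and
   supersolutions built from these two functions, started at time 1, give the estimate.
   The ground state is obtained by shooting: lambda_0 is the infimum of the mu for which the even
   solution of y'' = x y' + 2 (F - mu) y has a zero. The explicit solutions exp(x^2/2) F, for
   mu = 1/2 with 2 F replaced by F, and -exp(x^2/2) F', for mu = 1, give 1/2 < lambda_0 < 1, and
   hence psi is of larger order than |x| and of smaller order than x^2. The tail estimates follow
   from E exp(-l X(t,x)) by Chebyshev arguments. *)

theory Submission
  imports Defs "HOL-Real_Asymp.Real_Asymp"
begin

section \<open>Calculus tools\<close>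

text \<open>The hypothesis speaks about a law only where a bounded classical solution of the
  log-Laplace equation is at hand, and a point mass is not an admissible initial value. Solutions
  are therefore built for smooth bumps of mass \<open>l\<close> and width of order
  \<open>1 / N\<close>; their uniqueness comes back from the law, whose Laplace functional under a
  unit mass determines them. Point evaluation is the limit in \<open>N\<close>, taken along
  arbitrary convergent parameter sequences in place of uniform estimates. Derivative bounds are not
  carried through this limit, so the equation of \<open>F\<close> is obtained in integrated form
  before \<open>F\<close> is known to be smooth. The growth of \<open>psi\<close> serves the tails
  of the comparison functions at time 1. As \<open>exp (x^2 / 2) * F\<close> is at most linear, a
  superlinear \<open>psi\<close> lets every multiple of \<open>Psi\<close> dominate \<open>F\<close>
  far out, where the subsolution may then be negative. As \<open>psi\<close> is
  \<open>o(x^2)\<close>, a multiple of \<open>z^2 * gw z\<close> outweighs it there, so that the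
  supersolution does not drop below \<open>F\<close>. Scaling exchanges time \<open>t\<close> for a
  Laplace parameter of order \<open>sqrt t\<close>; a decay rate in time thus becomes the power
  \<open>- 2 * \<beta>\<close>.\<close>

abbreviation "gw z \<equiv> exp (- z\<^sup>2 / 2 :: real)"

text \<open>Differentiability is required near \<open>x\<close> only, because a barrier glued from
  two formulas is smooth only off the seam.\<close>

lemma second_derivative_at_max:
  fixes f f' :: "real \<Rightarrow> real"
  assumes e: "e > 0" and f': "\<And>y. \<bar>y - x\<bar> < e \<Longrightarrow> DERIV f y :> f' y"
    and f'': "DERIV f' x :> f2"
    and mx: "\<And>y. f y \<le> f x"
  shows "f2 \<le> 0"
proof (rule ccontr)
  assume "\<not> f2 \<le> 0"
  then have "f2 > 0" by simp
  have 0: "f' x = 0"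
    using DERIV_local_max[OF f'[of x] zero_less_one] mx e by auto
  obtain d where d: "d > 0" "\<And>h. 0 < h \<Longrightarrow> h < d \<Longrightarrow> f' x < f' (x + h)"
    using DERIV_pos_inc_right[OF f'' \<open>f2 > 0\<close>] by blast
  define h where "h = min d e / 2"
  have h: "0 < h" "h < d" "h < e" using d(1) e by (auto simp: h_def min_def)
  have "\<exists>\<xi>>x. \<xi> < x + h \<and> f (x + h) - f x = (x + h - x) * f' \<xi>"
    by (rule MVT2) (use h f' in auto)
  then obtain \<xi> where \<xi>: "x < \<xi>" "\<xi> < x + h" "f (x + h) - f x = h * f' \<xi>" by auto
  have "f' \<xi> > 0" using d(2)[of "\<xi> - x"] \<xi> h 0 by auto
  then have "f (x + h) - f x > 0" unfolding \<xi>(3) using h by simp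
  then show False using mx[of "x + h"] by simp
qed

text \<open>A function that is merely bounded above may miss its supremum on the line, so a small
  multiple of \<open>exp (2 * (t - t0)) * (1 + x^2)\<close> is subtracted. That function is a strict
  supersolution of the heat equation and grows at infinity, which forces a maximum in a compact box
  and contradicts the inequality there. The inequality is demanded only where \<open>z\<close> is
  positive, so a comparison has to be checked only at points where it would fail.\<close>

lemma heat_max_principle:
  fixes z :: "real \<Rightarrow> real \<Rightarrow> real"
  assumes cont: "continuous_on ({t0..} \<times> UNIV) (\<lambda>(t, x). z t x)"
    and bdd: "\<And>t x. t0 \<le> t \<Longrightarrow> z t x \<le> B"
    and init: "\<And>x. z t0 x \<le> 0"
    and ineq: "\<And>t x. t0 < t \<Longrightarrow> 0 < z t x \<Longrightarrow>
      \<exists>zt z1 z2 e. DERIV (\<lambda>r. z r x) t :> zt \<and> e > 0 \<and>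
        (\<forall>y. \<bar>y - x\<bar> < e \<longrightarrow> DERIV (z t) y :> z1 y) \<and>
        DERIV z1 x :> z2 \<and> zt \<le> z2 / 2"
    and t: "t0 \<le> t1"
  shows "z t1 x1 \<le> 0"
proof (rule ccontr)
  assume "\<not> z t1 x1 \<le> 0"
  then have pos: "z t1 x1 > 0" by simp
  define H where "H t x = exp (2 * (t - t0)) * (1 + x\<^sup>2)" for t x :: real
  have Hpos: "H t x > 0" for t x unfolding H_def by (intro mult_pos_pos) (auto simp: add_pos_nonneg)
  define \<eta> where "\<eta> = z t1 x1 / (2 * H t1 x1)"
  have \<eta>: "\<eta> > 0" using pos Hpos by (simp add: \<eta>_def)
  define y where "y t x = z t x - \<eta> * H t x" for t x
  have y1: "y t1 x1 > 0" using pos Hpos[of t1 x1] by (simp add: y_def \<eta>_def)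
  define R where "R = sqrt (\<bar>B\<bar> / \<eta>)"
  have far: "y t x \<le> 0" if "t0 \<le> t" "\<bar>x\<bar> > R" for t x
  proof -
    have "\<bar>B\<bar> / \<eta> \<le> R\<^sup>2" using \<eta> by (simp add: R_def)
    also have "R\<^sup>2 \<le> x\<^sup>2"
    proof -
      have "R \<ge> 0" using \<eta> by (simp add: R_def)
      then show ?thesis using that(2) by (simp add: abs_le_square_iff[symmetric])
    qed
    finally have "\<bar>B\<bar> \<le> \<eta> * (1 + x\<^sup>2)" using \<eta> by (simp add: field_simps)
    also have "1 * (1 + x\<^sup>2) \<le> H t x" unfolding H_def
      by (rule mult_right_mono) (use that(1) in auto)
    then have "\<eta> * (1 + x\<^sup>2) \<le> \<eta> * H t x" using \<eta> by simp
    finally show ?thesis using bdd[OF that(1), of x] by (simp add: y_def)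
  qed
  have "continuous_on ({t0..t1} \<times> {-R..R}) (\<lambda>(t, x). z t x)"
    by (rule continuous_on_subset[OF cont]) auto
  then have cy: "continuous_on ({t0..t1} \<times> {-R..R}) (\<lambda>p. y (fst p) (snd p))"
    unfolding y_def H_def case_prod_unfold by (auto intro!: continuous_intros)
  have "\<bar>x1\<bar> \<le> R" using far[OF t, of x1] y1 by linarith
  then have ne: "(t1, x1) \<in> {t0..t1} \<times> {-R..R}" using t by auto
  obtain p where p: "p \<in> {t0..t1} \<times> {-R..R}"
    "\<And>q. q \<in> {t0..t1} \<times> {-R..R} \<Longrightarrow> y (fst q) (snd q) \<le> y (fst p) (snd p)"
    using continuous_attains_sup[OF _ _ cy] ne by (metis compact_Icc compact_Times empty_iff)
  obtain t x where tx: "p = (t, x)" by (cases p)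
  have t': "t0 \<le> t" "t \<le> t1" using p(1) tx by auto
  have ytx: "y t x > 0" using p(2)[OF ne] y1 tx by simp
  have mx: "y s w \<le> y t x" if "t0 \<le> s" "s \<le> t" for s w
  proof (cases "\<bar>w\<bar> \<le> R")
    case True
    then show ?thesis using p(2)[of "(s, w)"] that t' tx by (simp add: abs_le_iff)
  next
    case False
    then show ?thesis using far[OF that(1), of w] ytx by simp
  qed
  have zpos: "z t x > 0" using ytx mult_pos_pos[OF \<eta> Hpos[of t x]] unfolding y_def by linarith
  have "t \<noteq> t0" using init[of x] zpos by auto
  then have t0: "t0 < t" using t' by simp
  obtain zt z1 z2 e where D: "DERIV (\<lambda>r. z r x) t :> zt" "e > 0"
     "\<And>y. \<bar>y - x\<bar> < e \<Longrightarrow> DERIV (z t) y :> z1 y"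
     "DERIV z1 x :> z2" "zt \<le> z2 / 2"
    using ineq[OF t0 zpos] by blast
  define E where "E = exp (2 * (t - t0))"
  have E: "E > 0" by (simp add: E_def)
  have yt: "DERIV (\<lambda>r. y r x) t :> zt - \<eta> * (2 * E * (1 + x\<^sup>2))"
    unfolding y_def H_def E_def by (auto intro!: derivative_eq_intros D(1))
  \<comment> \<open>The maximum may lie on the top edge \<open>t = t1\<close>, so only earlier times
    are available for comparison; they still give a nonnegative time derivative.\<close>
  have "zt - \<eta> * (2 * E * (1 + x\<^sup>2)) \<ge> 0"
  proof (rule ccontr)
    assume "\<not> ?thesis"
    then obtain d where d: "d > 0" "\<And>h. 0 < h \<Longrightarrow> h < d \<Longrightarrow> y t x < y (t - h) x"
      using DERIV_neg_dec_left[OF yt] by auto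
    define h where "h = min d (t - t0) / 2"
    have "0 < h" "h < d" "h \<le> t - t0" using d(1) t0 by (auto simp: h_def min_def)
    then show False using d(2)[of h] mx[of "t - h" x] by auto
  qed
  moreover have "\<eta> * (2 * E * (1 + x\<^sup>2)) \<ge> \<eta> * (2 * E)"
    using \<eta> E by simp
  ultimately have zt: "zt \<ge> \<eta> * (2 * E)" by linarith
  have "z2 - \<eta> * (2 * E) \<le> 0"
  proof (rule second_derivative_at_max[OF D(2), of x "y t" "\<lambda>w. z1 w - \<eta> * (2 * E * w)"])
    show "DERIV (y t) w :> z1 w - \<eta> * (2 * E * w)" if "\<bar>w - x\<bar> < e" for w
      unfolding y_def H_def E_def by (auto intro!: derivative_eq_intros D(3) that simp: algebra_simps)
    show "DERIV (\<lambda>w. z1 w - \<eta> * (2 * E * w)) x :> z2 - \<eta> * (2 * E)"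
      by (auto intro!: derivative_eq_intros D(4))
    show "y t w \<le> y t x" for w using mx[of t w] t0 by simp
  qed
  then show False using zt D(5) mult_pos_pos[OF \<eta> E] by linarith
qed

text \<open>The primitive vanishing at 0 on the whole line. The sign for negative arguments is
  spelled out, since the integral over the empty interval \<open>{0..x}\<close> would be 0.\<close>

definition antideriv :: "(real \<Rightarrow> real) \<Rightarrow> real \<Rightarrow> real" where
  "antideriv h x = (if 0 \<le> x then integral {0..x} h else - integral {x..0} h)"

lemma antideriv_0 [simp]: "antideriv h 0 = 0"
  by (simp add: antideriv_def)

lemma antideriv_alt:
  assumes "h integrable_on {-R..R}" "\<bar>x\<bar> \<le> R"
  shows "antideriv h x = integral {-R..x} h - integral {-R..0} h"
proof (cases "0 \<le> x")
  case True
  have "integral {-R..0} h + integral {0..x} h = integral {-R..x} h"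
    by (rule Henstock_Kurzweil_Integration.integral_combine)
      (use assms True in \<open>auto intro: integrable_subinterval_real\<close>)
  then show ?thesis using True by (simp add: antideriv_def)
next
  case False
  have "integral {-R..x} h + integral {x..0} h = integral {-R..0} h"
    by (rule Henstock_Kurzweil_Integration.integral_combine)
      (use assms False in \<open>auto intro: integrable_subinterval_real\<close>)
  then show ?thesis using False by (simp add: antideriv_def)
qed

lemma antideriv_has_derivative:
  assumes "continuous_on UNIV h"
  shows "DERIV (antideriv h) x :> h x"
proof -
  define R where "R = \<bar>x\<bar> + 1"
  have c: "continuous_on {-R..R} h" using assms continuous_on_subset by blast
  have "((\<lambda>x. integral {-R..x} h) has_real_derivative h x) (at x within {-R..R})"
    by (rule integral_has_real_derivative[OF c]) (auto simp: R_def)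
  then have "DERIV (\<lambda>x. integral {-R..x} h) x :> h x"
    by (subst (asm) at_within_Icc_at) (auto simp: R_def)
  then have "DERIV (\<lambda>x. integral {-R..x} h - integral {-R..0} h) x :> h x"
    by (auto intro!: derivative_eq_intros)
  then show ?thesis
  proof (rule DERIV_cong_ev[THEN iffD1, rotated 3])
    have "integral {-R..y} h - integral {-R..0} h = antideriv h y" if "\<bar>y - x\<bar> < 1" for y
      by (rule antideriv_alt[symmetric]) (use that c in \<open>auto simp: R_def intro: integrable_continuous_real\<close>)
    then show "\<forall>\<^sub>F y in nhds x. integral {-R..y} h - integral {-R..0} h = antideriv h y"
      unfolding eventually_nhds_metric by (intro exI[of _ 1]) (auto simp: dist_real_def)
  qed simp_all
qed

lemma antideriv_unique:
  assumes "continuous_on UNIV h" "\<And>x. DERIV H x :> h x"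
  shows "antideriv h x = H x - H 0"
proof -
  have "DERIV (\<lambda>x. H x - antideriv h x) x :> 0" for x
    using assms(2)[of x] antideriv_has_derivative[OF assms(1), of x]
    by (auto intro!: derivative_eq_intros)
  then have "(\<lambda>x. H x - antideriv h x) x = (\<lambda>x. H x - antideriv h x) 0"
    using DERIV_isconst_all by blast
  then show ?thesis by simp
qed

text \<open>Moving the variable endpoint into the integrand makes it a parameter of an integral over
  \<open>{0..1}\<close>, for which continuity and differentiation under the integral sign are at
  hand.\<close>

lemma antideriv_scale:
  assumes "continuous_on UNIV h"
  shows "antideriv h x = x * integral {0..1} (\<lambda>\<theta>. h (\<theta> * x))"
proof -
  have "((\<lambda>\<theta>. x * h (\<theta> * x)) has_integral antideriv h (1 * x) - antideriv h (0 * x)) {0..1}"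
  proof (rule fundamental_theorem_of_calculus)
    fix \<theta> :: real
    have "DERIV (\<lambda>\<theta>. antideriv h (\<theta> * x)) \<theta> :> h (\<theta> * x) * x"
      by (rule DERIV_chain2[OF antideriv_has_derivative[OF assms]]) (auto intro!: derivative_eq_intros)
    then show "((\<lambda>\<theta>. antideriv h (\<theta> * x)) has_vector_derivative x * h (\<theta> * x)) (at \<theta> within {0..1})"
      by (simp add: has_real_derivative_iff_has_vector_derivative mult.commute has_vector_derivative_at_within)
  qed simp
  then have "antideriv h x = integral {0..1} (\<lambda>\<theta>. x * h (\<theta> * x))"
    by (simp add: has_integral_iff)
  then show ?thesis by simp
qed

lemma continuous_on_antideriv2:
  assumes "continuous_on UNIV (\<lambda>(p, s). h p s)"
  shows "continuous_on UNIV (\<lambda>(p :: 'a :: metric_space, x). antideriv (h p) x)"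
proof -
  have c: "continuous_on UNIV (h p)" for p
  proof -
    have "continuous_on UNIV (\<lambda>s. (\<lambda>(p, s). h p s) (p, s))"
      by (rule continuous_on_compose2[OF assms]) (auto intro!: continuous_intros)
    then show ?thesis by simp
  qed
  have "continuous_on UNIV (\<lambda>q :: 'a \<times> real. integral (cbox 0 1) (\<lambda>\<theta>. h (fst q) (\<theta> * snd q)))"
  proof (rule integral_continuous_on_param)
    show "continuous_on (UNIV \<times> cbox 0 1) (\<lambda>(q :: 'a \<times> real, \<theta>). h (fst q) (\<theta> * snd q))"
    proof -
      have "continuous_on (UNIV \<times> cbox 0 1) (\<lambda>r :: ('a \<times> real) \<times> real. (\<lambda>(p, s). h p s) (fst (fst r), snd r * snd (fst r)))"
        by (rule continuous_on_compose2[OF assms]) (auto intro!: continuous_intros)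
      then show ?thesis by (simp add: case_prod_unfold)
    qed
  qed
  then have "continuous_on UNIV (\<lambda>q :: 'a \<times> real. snd q * integral (cbox 0 1) (\<lambda>\<theta>. h (fst q) (\<theta> * snd q)))"
    by (intro continuous_intros)
  then show ?thesis by (simp add: antideriv_scale[OF c] case_prod_unfold)
qed

lemma antideriv_bound:
  assumes h: "continuous_on UNIV h" and w: "\<And>s. DERIV W s :> w s"
    and le: "\<And>s. min 0 x \<le> s \<Longrightarrow> s \<le> max 0 x \<Longrightarrow> \<bar>h s\<bar> \<le> w s"
  shows "\<bar>antideriv h x\<bar> \<le> \<bar>W x - W 0\<bar>"
proof -
  have D1: "DERIV (\<lambda>s. W s - antideriv h s) s :> w s - h s"
    and D2: "DERIV (\<lambda>s. W s + antideriv h s) s :> w s + h s" for s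
    using w[of s] antideriv_has_derivative[OF h, of s] by (auto intro!: derivative_eq_intros)
  show ?thesis
  proof (cases "0 \<le> x")
    case True
    have "W 0 - antideriv h 0 \<le> W x - antideriv h x"
      by (rule DERIV_nonneg_imp_nondecreasing[OF True]) (use D1 le True in \<open>fastforce simp: abs_le_iff\<close>)
    moreover have "W 0 + antideriv h 0 \<le> W x + antideriv h x"
      by (rule DERIV_nonneg_imp_nondecreasing[OF True]) (use D2 le True in \<open>fastforce simp: abs_le_iff\<close>)
    ultimately show ?thesis by simp
  next
    case False
    have "W x - antideriv h x \<le> W 0 - antideriv h 0"
      by (rule DERIV_nonneg_imp_nondecreasing) (use D1 le False in \<open>fastforce simp: abs_le_iff\<close>)+
    moreover have "W x + antideriv h x \<le> W 0 + antideriv h 0"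
      by (rule DERIV_nonneg_imp_nondecreasing) (use D2 le False in \<open>fastforce simp: abs_le_iff\<close>)+
    ultimately show ?thesis by simp
  qed
qed

text \<open>The completeness step of a Picard iteration that contracts only in a weighted norm. In
  the applications the weight grows exponentially in time or in \<open>x^2\<close>, so the
  convergence is merely locally uniform.\<close>

lemma weighted_limit:
  fixes f :: "nat \<Rightarrow> 'a \<Rightarrow> real"
  assumes step: "\<And>k x. \<bar>f (Suc k) x - f k x\<bar> \<le> C * r ^ k * W x" and r: "0 \<le> r" "r < 1"
  obtains F where "\<And>k x. \<bar>F x - f k x\<bar> \<le> C / (1 - r) * r ^ k * W x"
proof -
  have s: "summable (\<lambda>k. C * W x * r ^ k)" for x
    using r by (intro summable_mult summable_geometric) auto
  have sm: "summable (\<lambda>k. f (Suc k) x - f k x)" for x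
    by (rule summable_comparison_test'[OF s[of x], of 0]) (use step[of _ x] in \<open>simp add: mult_ac\<close>)
  define F where "F x = f 0 x + (\<Sum>k. f (Suc k) x - f k x)" for x
  have "\<bar>F x - f k x\<bar> \<le> C / (1 - r) * r ^ k * W x" for k x
  proof -
    have "f 0 x + (\<Sum>i<k. f (Suc i) x - f i x) = f k x"
      using sum_lessThan_telescope[of "\<lambda>i. f i x" k] by simp
    then have "F x - f k x = (\<Sum>i. f (Suc (i + k)) x - f (i + k) x)"
      using suminf_minus_initial_segment[OF sm[of x], of k] by (simp add: F_def)
    moreover have "\<bar>\<Sum>i. f (Suc (i + k)) x - f (i + k) x\<bar> \<le> (\<Sum>i. C * W x * r ^ k * r ^ i)"
      unfolding real_norm_def[symmetric]
    proof (rule norm_suminf_le)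
      show "norm (f (Suc (i + k)) x - f (i + k) x) \<le> C * W x * r ^ k * r ^ i" for i
        using step[of "i + k" x] by (simp add: power_add mult_ac)
      show "summable (\<lambda>i. C * W x * r ^ k * r ^ i)"
        using r by (intro summable_mult summable_geometric) auto
    qed
    moreover have "(\<Sum>i. C * W x * r ^ k * r ^ i) = C / (1 - r) * r ^ k * W x"
      using r by (subst suminf_mult) (auto simp: suminf_geometric summable_geometric)
    ultimately show ?thesis by simp
  qed
  then show ?thesis using that by blast
qed

lemma weighted_limit_tendsto:
  fixes f :: "nat \<Rightarrow> 'a \<Rightarrow> real"
  assumes "\<And>k x. \<bar>F x - f k x\<bar> \<le> C * r ^ k * W x" and r: "0 \<le> r" "r < 1"
  shows "(\<lambda>k. f k x) \<longlonglongrightarrow> F x"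
proof -
  have "(\<lambda>k. C * r ^ k * W x) \<longlonglongrightarrow> C * 0 * W x"
    using r by (intro tendsto_intros LIMSEQ_power_zero) auto
  then have l: "(\<lambda>k. C * r ^ k * W x) \<longlonglongrightarrow> 0" by simp
  have "(\<lambda>k. f k x - F x) \<longlonglongrightarrow> 0"
  proof (rule Lim_null_comparison[rotated])
    have "norm (f k x - F x) \<le> C * r ^ k * W x" for k
      using assms(1)[of x k] by (simp only: real_norm_def abs_minus_commute)
    then show "\<forall>\<^sub>F k in sequentially. norm (f k x - F x) \<le> C * r ^ k * W x" by simp
  qed (rule l)
  then show ?thesis by (simp add: LIM_zero_iff)
qed

lemma weighted_limit_continuous:
  fixes f :: "nat \<Rightarrow> 'a :: metric_space \<Rightarrow> real"
  assumes b: "\<And>k x. \<bar>F x - f k x\<bar> \<le> C * r ^ k * W x" and r: "0 \<le> r" "r < 1"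
    and W: "continuous_on UNIV W" and f: "\<And>k. continuous_on UNIV (f k)"
  shows "continuous_on UNIV F"
proof -
  have "isCont F x" for x
  proof -
    define B where "B = \<bar>C\<bar> * (\<bar>W x\<bar> + 1)"
    have B: "B \<ge> 0" by (simp add: B_def)
    obtain U where U: "open U" "x \<in> U" "\<And>y. y \<in> U \<Longrightarrow> \<bar>W y - W x\<bar> < 1"
      using W[unfolded continuous_on_open_vimage[OF open_UNIV], rule_format, of "ball (W x) 1"]
      by (metis (no_types, lifting) Int_UNIV_right centre_in_ball dist_commute dist_real_def mem_ball open_ball vimageE vimageI zero_less_one)
    have "uniform_limit U f F sequentially"
    proof (rule uniform_limitI)
      fix e :: real assume "e > 0"
      have "(\<lambda>k. B * r ^ k) \<longlonglongrightarrow> B * 0"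
        using r by (intro tendsto_intros LIMSEQ_power_zero) auto
      then have "\<forall>\<^sub>F k in sequentially. B * r ^ k < e"
        using \<open>e > 0\<close> by (simp add: order_tendstoD(2))
      then show "\<forall>\<^sub>F k in sequentially. \<forall>y\<in>U. dist (f k y) (F y) < e"
      proof eventually_elim
        case (elim k)
        show ?case
        proof
          fix y assume "y \<in> U"
          have "\<bar>F y - f k y\<bar> \<le> C * r ^ k * W y" by (rule b)
          also have "\<dots> \<le> \<bar>C\<bar> * r ^ k * \<bar>W y\<bar>"
            by (rule order_trans[OF abs_ge_self]) (use r in \<open>simp add: abs_mult\<close>)
          also have "\<dots> \<le> \<bar>C\<bar> * r ^ k * (\<bar>W x\<bar> + 1)"
            using U(3)[OF \<open>y \<in> U\<close>] r by (intro mult_left_mono) auto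
          also have "\<dots> = B * r ^ k" by (simp add: B_def)
          finally show "dist (f k y) (F y) < e" using elim by (simp add: dist_real_def abs_minus_commute)
        qed
      qed
    qed
    then have "continuous_on U F"
    proof (rule uniform_limit_theorem[rotated])
      have "continuous_on U (f k)" for k using f[of k] continuous_on_subset by blast
      then show "\<forall>\<^sub>F k in sequentially. continuous_on U (f k)" by simp
    qed simp
    then show ?thesis using U(1,2) continuous_on_eq_continuous_at by blast
  qed
  then show ?thesis by (simp add: continuous_at_imp_continuous_on)
qed

lemma has_derivative_uniform_limit:
  fixes f f' :: "nat \<Rightarrow> real \<Rightarrow> real"
  assumes "\<And>k x. DERIV (f k) x :> f' k x"
    and "\<And>x. (\<lambda>k. f k x) \<longlonglongrightarrow> F x"
    and b: "\<And>k x. \<bar>F' x - f' k x\<bar> \<le> C * r ^ k" and r: "0 \<le> r" "r < 1"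
  shows "DERIV F x :> F' x"
proof -
  have "\<exists>g. \<forall>x\<in>UNIV. (\<lambda>k. f k x) \<longlonglongrightarrow> g x \<and> (g has_derivative (*) (F' x)) (at x within UNIV)"
  proof (rule has_derivative_sequence)
    show "convex (UNIV :: real set)" by simp
    show "(f k has_derivative (*) (f' k x)) (at x within UNIV)" for k x
      using assms(1) by (simp add: has_field_derivative_def)
    show "\<forall>\<^sub>F k in sequentially. \<forall>x\<in>UNIV. \<forall>h. norm (f' k x * h - F' x * h) \<le> e * norm h" if "e > 0" for e
    proof -
      have "(\<lambda>k. C * r ^ k) \<longlonglongrightarrow> C * 0"
        using r by (intro tendsto_intros LIMSEQ_power_zero) auto
      then have "\<forall>\<^sub>F k in sequentially. C * r ^ k < e"
        using \<open>e > 0\<close> by (simp add: order_tendstoD(2))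
      then show ?thesis
      proof eventually_elim
        case (elim k)
        have "\<bar>f' k x - F' x\<bar> \<le> e" for x
          using b[of x k] elim by (simp add: abs_minus_commute)
        then have "\<bar>f' k x - F' x\<bar> * \<bar>h\<bar> \<le> e * \<bar>h\<bar>" for x h
          by (rule mult_right_mono) simp
        then show ?case by (simp add: left_diff_distrib[symmetric] abs_mult)
      qed
    qed
    show "(\<lambda>k. f k 0) \<longlonglongrightarrow> F 0" "0 \<in> (UNIV :: real set)" using assms(2) by auto
  qed
  then obtain g where g: "\<And>x. (\<lambda>k. f k x) \<longlonglongrightarrow> g x" "\<And>x. (g has_derivative (*) (F' x)) (at x)" by auto
  have "g = F" using LIMSEQ_unique[OF g(1) assms(2)] by auto
  then show ?thesis using g by (simp add: has_field_derivative_def)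
qed

text \<open>The mean value theorem bounds the difference quotients by \<open>w\<close>, and
  dominated convergence does the rest. The derivative bound is asked for on a fixed neighbourhood of
  \<open>t0\<close> only, which suits the heat semigroup, where \<open>sqrt t\<close> is singular at
  time 0.\<close>

lemma has_derivative_integral:
  fixes f f' :: "real \<Rightarrow> 'a \<Rightarrow> real"
  assumes e: "0 < e" and m: "\<And>t. f t \<in> borel_measurable M"
    and d: "\<And>t z. \<bar>t - t0\<bar> < e \<Longrightarrow> DERIV (\<lambda>t. f t z) t :> f' t z"
    and i: "integrable M (f t0)" and m': "f' t0 \<in> borel_measurable M"
    and w: "integrable M w" and b: "\<And>t z. \<bar>t - t0\<bar> < e \<Longrightarrow> \<bar>f' t z\<bar> \<le> w z"
  shows "DERIV (\<lambda>t. \<integral>z. f t z \<partial>M) t0 :> (\<integral>z. f' t0 z \<partial>M)"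
proof -
  have mvt: "\<bar>f (t0 + h) z - f t0 z\<bar> \<le> \<bar>h\<bar> * w z" if "\<bar>h\<bar> < e" for h z
  proof -
    have "norm (f (t0 + h) z - f t0 z) \<le> w z * norm (t0 + h - t0)"
    proof (rule field_differentiable_bound[where S = "ball t0 e" and f' = "\<lambda>t. f' t z"])
      show "((\<lambda>t. f t z) has_field_derivative f' t z) (at t within ball t0 e)" if "t \<in> ball t0 e" for t
        using d[of t z] that by (auto simp: dist_real_def abs_minus_commute intro: has_field_derivative_at_within)
      show "norm (f' t z) \<le> w z" if "t \<in> ball t0 e" for t
        using b[of t z] that by (auto simp: dist_real_def abs_minus_commute)
    qed (use that e in \<open>auto simp: dist_real_def\<close>)
    then show ?thesis by (simp add: mult.commute)
  qed
  have int: "integrable M (f (t0 + h))" if "\<bar>h\<bar> < e" for h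
  proof -
    have "integrable M (\<lambda>z. f (t0 + h) z - f t0 z)"
      by (rule Bochner_Integration.integrable_bound[of _ "\<lambda>z. \<bar>h\<bar> * w z"])
        (use mvt[OF that] w m in \<open>auto intro!: order_trans[OF mvt[OF that]]\<close>)
    from Bochner_Integration.integrable_add[OF this i] show ?thesis by simp
  qed
  show ?thesis unfolding has_field_derivative_iff tendsto_at_iff_sequentially
  proof (intro allI impI)
    fix X :: "nat \<Rightarrow> real" assume X: "\<forall>i. X i \<in> UNIV - {t0}" "X \<longlonglongrightarrow> t0"
    have ev: "\<forall>\<^sub>F n in sequentially. \<bar>X n - t0\<bar> < e"
      using X(2) e by (auto simp: tendsto_iff dist_real_def)
    then obtain N where N: "\<And>n. n \<ge> N \<Longrightarrow> \<bar>X n - t0\<bar> < e" by (auto simp: eventually_sequentially)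
    \<comment> \<open>Dominated convergence wants its bound for all indices, while the quotients are
      controlled from \<open>N\<close> on; hence the shift.\<close>
    have "(\<lambda>n. \<integral>z. (f (X (n + N)) z - f t0 z) / (X (n + N) - t0) \<partial>M) \<longlonglongrightarrow> (\<integral>z. f' t0 z \<partial>M)"
    proof (rule integral_dominated_convergence[OF m' _ w])
      show "(\<lambda>z. (f (X (n + N)) z - f t0 z) / (X (n + N) - t0)) \<in> borel_measurable M" for n
        using m by measurable
      show "AE z in M. (\<lambda>n. (f (X (n + N)) z - f t0 z) / (X (n + N) - t0)) \<longlonglongrightarrow> f' t0 z"
      proof (rule AE_I2)
        fix z
        have "DERIV (\<lambda>t. f t z) t0 :> f' t0 z" using d[of t0 z] e by simp
        then have "((\<lambda>n. (f (X n) z - f t0 z) / (X n - t0)) \<longlonglongrightarrow> f' t0 z)"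
          unfolding has_field_derivative_iff tendsto_at_iff_sequentially comp_def using X by auto
        then show "(\<lambda>n. (f (X (n + N)) z - f t0 z) / (X (n + N) - t0)) \<longlonglongrightarrow> f' t0 z"
          by (rule LIMSEQ_ignore_initial_segment)
      qed
      show "AE z in M. norm ((f (X (n + N)) z - f t0 z) / (X (n + N) - t0)) \<le> w z" for n
      proof (rule AE_I2)
        fix z
        have "\<bar>f (X (n + N)) z - f t0 z\<bar> \<le> \<bar>X (n + N) - t0\<bar> * w z"
          using mvt[of "X (n + N) - t0" z] N[of "n + N"] by simp
        moreover have "\<bar>X (n + N) - t0\<bar> > 0" using X(1) by auto
        ultimately show "norm ((f (X (n + N)) z - f t0 z) / (X (n + N) - t0)) \<le> w z"
          by (simp add: abs_divide pos_divide_le_eq mult.commute)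
      qed
    qed
    moreover have "(\<integral>z. (f (X (n + N)) z - f t0 z) / (X (n + N) - t0) \<partial>M)
       = ((\<integral>z. f (X (n + N)) z \<partial>M) - (\<integral>z. f t0 z \<partial>M)) / (X (n + N) - t0)" for n
    proof -
      have "integrable M (f (X (n + N)))" using int[of "X (n + N) - t0"] N[of "n + N"] by simp
      then show ?thesis using i by simp
    qed
    ultimately have "(\<lambda>n. ((\<integral>z. f (X (n + N)) z \<partial>M) - (\<integral>z. f t0 z \<partial>M)) / (X (n + N) - t0)) \<longlonglongrightarrow> (\<integral>z. f' t0 z \<partial>M)"
      by (simp only:)
    then show "((\<lambda>t. ((\<integral>z. f t z \<partial>M) - (\<integral>z. f t0 z \<partial>M)) / (t - t0)) \<circ> X) \<longlonglongrightarrow> (\<integral>z. f' t0 z \<partial>M)"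
      unfolding comp_def by (rule LIMSEQ_offset)
  qed
qed

text \<open>Continuous induction at the first point where \<open>h\<close> fails to be positive. In
  the applications positivity up to \<open>b\<close> makes some ratio or slope monotone, which keeps
  it from vanishing at \<open>b\<close>.\<close>

lemma stay_positive:
  fixes h :: "real \<Rightarrow> real"
  assumes c: "continuous_on {a..} h" and a: "h a > 0"
    and step: "\<And>b. a < b \<Longrightarrow> (\<And>x. a \<le> x \<Longrightarrow> x < b \<Longrightarrow> h x > 0) \<Longrightarrow> h b > 0"
    and x: "a \<le> x"
  shows "h x > 0"
proof (rule ccontr)
  assume "\<not> h x > 0"
  define S where "S = {y \<in> {a..x}. h y \<le> 0}"
  have "closed S"
  proof -
    have "continuous_on {a..x} h" by (rule continuous_on_subset[OF c]) auto
    then have "closed ({a..x} \<inter> h -` {..0})"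
      by (intro continuous_closed_preimage) auto
    moreover have "{a..x} \<inter> h -` {..0} = S" by (auto simp: S_def)
    ultimately show ?thesis by simp
  qed
  moreover have "x \<in> S" using x \<open>\<not> h x > 0\<close> by (auto simp: S_def)
  moreover have bb: "bdd_below S" by (auto simp: S_def bdd_below_def)
  ultimately have I: "Inf S \<in> S" using closed_contains_Inf[of S] by auto
  have "h y > 0" if "a \<le> y" "y < Inf S" for y
  proof (rule ccontr)
    assume "\<not> h y > 0"
    then have "y \<in> S" using that I by (auto simp: S_def)
    then show False using cInf_lower[OF _ bb] that by fastforce
  qed
  moreover have "a < Inf S" using I a by (auto simp: S_def less_le)
  ultimately have "h (Inf S) > 0" using step by blast
  then show False using I by (simp add: S_def)
qed

text \<open>Only the second partial derivative has to be continuous. This fits solutions of a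
  parabolic equation with time as the first variable: their space derivative is continuous
  everywhere, while a time derivative is known for positive times only.\<close>

lemma DERIV_two_variables:
  fixes f :: "real \<Rightarrow> real \<Rightarrow> real"
  assumes fx: "DERIV (\<lambda>x. f x (b t)) (a t) :> fx"
    and fy: "\<And>x y. DERIV (f x) y :> fy x y"
    and c: "continuous (at (a t, b t)) (\<lambda>(x, y). fy x y)"
    and a: "DERIV a t :> a'" and b: "DERIV b t :> b'"
  shows "DERIV (\<lambda>t. f (a t) (b t)) t :> fx * a' + fy (a t) (b t) * b'"
proof -
  have "((\<lambda>(x, y). f x y) has_derivative (\<lambda>(tx, ty). (*) fx tx + blinfun_mult_right (fy (a t) (b t)) ty))
    (at (a t, b t) within UNIV \<times> UNIV)"
  proof (rule has_derivative_partialsI)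
    show "((\<lambda>x. f x (b t)) has_derivative (*) fx) (at (a t) within UNIV)"
      using fx by (simp add: has_field_derivative_def)
    show "(f x has_derivative blinfun_apply (blinfun_mult_right (fy x y))) (at y within UNIV)" for x y
      using fy[of x y] by (simp add: has_field_derivative_def)
    have "continuous (at (a t, b t)) (\<lambda>q. blinfun_mult_right ((\<lambda>(x, y). fy x y) q))"
      using c by (rule bounded_linear.continuous[OF bounded_linear_blinfun_mult_right])
    then show "continuous (at (a t, b t) within UNIV \<times> UNIV) (\<lambda>(x, y). blinfun_mult_right (fy x y))"
      by (simp add: case_prod_unfold)
  qed auto
  then have D: "((\<lambda>q. f (fst q) (snd q)) has_derivative (\<lambda>q. fx * fst q + fy (a t) (b t) * snd q)) (at (a t, b t))"
    by (simp add: case_prod_unfold)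
  have "((\<lambda>t. (a t, b t)) has_derivative (\<lambda>h. (a' * h, b' * h))) (at t)"
    using a b by (auto simp: has_field_derivative_def intro!: has_derivative_Pair)
  from diff_chain_at[OF this D]
  have "((\<lambda>t. f (a t) (b t)) has_derivative (\<lambda>h. fx * (a' * h) + fy (a t) (b t) * (b' * h))) (at t)"
    by (simp add: comp_def)
  moreover have "(\<lambda>h. fx * (a' * h) + fy (a t) (b t) * (b' * h)) = (*) (fx * a' + fy (a t) (b t) * b')"
    by (simp add: fun_eq_iff algebra_simps)
  ultimately show ?thesis by (simp add: has_field_derivative_def)
qed

lemma antideriv_param_has_derivative:
  assumes h: "continuous_on UNIV (\<lambda>(p, s). h p s)" and h': "continuous_on UNIV (\<lambda>(p, s). h' p s)"
    and d: "\<And>p s. DERIV (\<lambda>p. h p s) p :> h' p s"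
  shows "DERIV (\<lambda>p. antideriv (h p) x) p :> antideriv (h' p) x"
proof -
  have c: "continuous_on UNIV (\<lambda>s. k q s)" if "continuous_on UNIV (\<lambda>(p, s). k p s)" for k :: "real \<Rightarrow> real \<Rightarrow> real" and q
  proof -
    have "continuous_on UNIV (\<lambda>s. (\<lambda>(p, s). k p s) (q, s))"
      by (rule continuous_on_compose2[OF that]) (auto intro!: continuous_intros)
    then show ?thesis by simp
  qed
  have "((\<lambda>p. integral (cbox 0 1) (\<lambda>\<theta>. h p (\<theta> * x))) has_field_derivative
      integral (cbox 0 1) (\<lambda>\<theta>. h' p (\<theta> * x))) (at p within UNIV)"
  proof (rule leibniz_rule_field_derivative)
    show "((\<lambda>p. h p (\<theta> * x)) has_field_derivative h' p (\<theta> * x)) (at p within UNIV)" for p \<theta>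
      using d by simp
    have "continuous_on {0..1} (\<lambda>\<theta>. h p (\<theta> * x))" for p
      by (rule continuous_on_compose2[OF c[OF h]]) (auto intro!: continuous_intros)
    then show "(\<lambda>\<theta>. h p (\<theta> * x)) integrable_on cbox 0 1" for p
      by (simp add: integrable_continuous_real)
    have "continuous_on (UNIV \<times> cbox 0 1) (\<lambda>q. (\<lambda>(p, s). h' p s) (fst q, snd q * x))"
      by (rule continuous_on_compose2[OF h']) (auto intro!: continuous_intros)
    then show "continuous_on (UNIV \<times> cbox 0 1) (\<lambda>(p, \<theta>). h' p (\<theta> * x))"
      by (simp add: case_prod_unfold)
  qed auto
  then have "((\<lambda>p. x * integral (cbox 0 1) (\<lambda>\<theta>. h p (\<theta> * x))) has_field_derivative
      x * integral (cbox 0 1) (\<lambda>\<theta>. h' p (\<theta> * x))) (at p)"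
    by (auto intro!: derivative_eq_intros)
  then show ?thesis by (simp add: antideriv_scale[OF c[OF h]] antideriv_scale[OF c[OF h']])
qed

lemma antideriv_diagonal_has_derivative:
  assumes h: "continuous_on UNIV (\<lambda>(p, s). h p s)" and h': "continuous_on UNIV (\<lambda>(p, s). h' p s)"
    and d: "\<And>p s. DERIV (\<lambda>p. h p s) p :> h' p s"
  shows "DERIV (\<lambda>t. antideriv (h t) t) t :> antideriv (h' t) t + h t t"
proof -
  have c: "continuous_on UNIV (h q)" for q
  proof -
    have "continuous_on UNIV (\<lambda>s. (\<lambda>(p, s). h p s) (q, s))"
      by (rule continuous_on_compose2[OF h]) (auto intro!: continuous_intros)
    then show ?thesis by simp
  qed
  have "DERIV (\<lambda>t. antideriv (h t) t) t :> antideriv (h' t) t * 1 + h t t * 1"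
  proof (rule DERIV_two_variables[where a = "\<lambda>t. t" and b = "\<lambda>t. t" and f = "\<lambda>p. antideriv (h p)" and fy = h])
    show "DERIV (\<lambda>x. antideriv (h x) t) t :> antideriv (h' t) t"
      by (rule antideriv_param_has_derivative[OF assms])
    show "DERIV (antideriv (h x)) y :> h x y" for x y
      by (rule antideriv_has_derivative[OF c])
    show "continuous (at (t, t)) (\<lambda>(x, y). h x y)"
      using h by (simp add: continuous_on_eq_continuous_at)
  qed auto
  then show ?thesis by simp
qed

section \<open>The heat semigroup\<close>

definition gauss :: "real measure" where
  "gauss = density lborel std_normal_density"

lemma space_gauss [simp]: "space gauss = UNIV" and sets_gauss [measurable_cong]: "sets gauss = sets borel"
  by (simp_all add: gauss_def)

lemma prob_gauss: "prob_space gauss"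
  unfolding gauss_def by (rule prob_space_normal_density) simp

lemma measure_gauss_UNIV [simp]: "measure gauss UNIV = 1"
  using prob_space.prob_space[OF prob_gauss] by simp

lemma integrable_gauss_bounded:
  assumes "f \<in> borel_measurable borel" "\<And>z. \<bar>f z\<bar> \<le> B"
  shows "integrable gauss (f :: real \<Rightarrow> real)"
proof -
  interpret prob_space gauss by (rule prob_gauss)
  show ?thesis by (rule integrable_const_bound[of _ B]) (use assms in \<open>auto cong: measurable_cong_sets simp: sets_gauss\<close>)
qed

lemma integrable_gauss_abs: "integrable gauss (\<lambda>z. \<bar>z\<bar>)"
  unfolding gauss_def using integrable_std_normal_moment_abs[of 1]
  by (subst integrable_density) auto

text \<open>Stein's identity: the derivative of the normal density times \<open>\<psi>\<close>
  integrates to zero over the line, because the density kills the bounded \<open>\<psi>\<close> at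
  both ends.\<close>

lemma gauss_integration_by_parts:
  fixes \<psi> \<psi>' :: "real \<Rightarrow> real"
  assumes d: "\<And>z. DERIV \<psi> z :> \<psi>' z" and c: "continuous_on UNIV \<psi>'"
    and b: "\<And>z. \<bar>\<psi> z\<bar> \<le> B" "\<And>z. \<bar>\<psi>' z\<bar> \<le> B'"
  shows "(\<integral>z. z * \<psi> z \<partial>gauss) = (\<integral>z. \<psi>' z \<partial>gauss)"
proof -
  let ?n = std_normal_density
  have c\<psi>: "continuous_on UNIV \<psi>" using d by (meson DERIV_continuous_on has_field_derivative_at_within)
  have [measurable]: "\<psi> \<in> borel_measurable borel" "\<psi>' \<in> borel_measurable borel"
    using c c\<psi> by (auto intro: borel_measurable_continuous_onI)
  have n': "DERIV ?n z :> - z * ?n z" for z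
    unfolding std_normal_density_def by (auto intro!: derivative_eq_intros simp: field_simps)
  have i1: "integrable gauss \<psi>'" by (rule integrable_gauss_bounded) (use b in auto)
  have i2: "integrable gauss (\<lambda>z. z * \<psi> z)"
  proof (rule Bochner_Integration.integrable_bound[of _ "\<lambda>z. B * \<bar>z\<bar>"])
    have "norm (z * \<psi> z) \<le> norm (B * \<bar>z\<bar>)" for z
      using mult_right_mono[OF order_trans[OF b(1)[of z] abs_ge_self], of "\<bar>z\<bar>"] by (simp add: abs_mult mult.commute)
    then show "AE z in gauss. norm (z * \<psi> z) \<le> norm (B * \<bar>z\<bar>)" by simp
  qed (use integrable_gauss_abs in \<open>auto cong: measurable_cong_sets simp: sets_gauss\<close>)
  have i3: "integrable lborel (\<lambda>z. ?n z * (\<psi>' z - z * \<psi> z))"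
    using Bochner_Integration.integrable_diff[OF i1 i2] unfolding gauss_def by (subst (asm) integrable_density) auto
  have "LBINT z=-\<infinity>..\<infinity>. ?n z * (\<psi>' z - z * \<psi> z) = 0 - 0"
  proof (rule interval_integral_FTC_integrable[where F = "\<lambda>z. ?n z * \<psi> z"])
    show "((\<lambda>z. ?n z * \<psi> z) has_vector_derivative ?n z * (\<psi>' z - z * \<psi> z)) (at z)" for z
      unfolding has_real_derivative_iff_has_vector_derivative[symmetric]
      by (auto intro!: derivative_eq_intros n' d simp: algebra_simps)
    show "isCont (\<lambda>z. ?n z * (\<psi>' z - z * \<psi> z)) z" for z
      using c c\<psi> DERIV_isCont[OF n'[of z]] by (auto simp: continuous_on_eq_continuous_at intro!: continuous_intros)
    show "set_integrable lborel (einterval (- \<infinity>) \<infinity>) (\<lambda>z. ?n z * (\<psi>' z - z * \<psi> z))"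
      using i3 by (simp add: set_integrable_def einterval_def)
    have n0: "(?n \<longlongrightarrow> 0) at_top" "(?n \<longlongrightarrow> 0) at_bot"
      unfolding std_normal_density_def by real_asymp+
    have "((\<lambda>z. ?n z * \<psi> z) \<longlongrightarrow> 0) F" if "(?n \<longlongrightarrow> 0) F" for F
    proof (rule Lim_null_comparison)
      show "\<forall>\<^sub>F z in F. norm (?n z * \<psi> z) \<le> B * ?n z"
        by (intro always_eventually allI) (use b(1) in \<open>simp add: abs_mult mult.commute mult_right_mono\<close>)
      show "((\<lambda>z. B * ?n z) \<longlongrightarrow> 0) F" using tendsto_mult_right_zero[OF that] by simp
    qed
    then show "(((\<lambda>z. ?n z * \<psi> z) \<circ> real_of_ereal) \<longlongrightarrow> 0) (at_right (- \<infinity>))"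
      "(((\<lambda>z. ?n z * \<psi> z) \<circ> real_of_ereal) \<longlongrightarrow> 0) (at_left \<infinity>)"
      using n0 by (simp_all add: ereal_tendsto_simps)
  qed simp
  then have "(\<integral>z. ?n z * (\<psi>' z - z * \<psi> z) \<partial>lborel) = 0"
    by (simp add: interval_lebesgue_integral_def set_lebesgue_integral_def einterval_def)
  then have "(\<integral>z. \<psi>' z - z * \<psi> z \<partial>gauss) = 0"
    unfolding gauss_def by (subst integral_density) auto
  then show ?thesis using i1 i2 by simp
qed

text \<open>Brownian expectation at time \<open>t\<close>, written with one fixed Gaussian so that
  \<open>t\<close> enters through the integrand alone. As \<open>sqrt\<close> is an odd function on
  the reals, negative times give a continuous extension, and \<open>heat (t - s)\<close> may be
  written for \<open>s > t\<close> without a case distinction.\<close>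

definition heat :: "real \<Rightarrow> (real \<Rightarrow> real) \<Rightarrow> real \<Rightarrow> real" where
  "heat t f x = (\<integral>z. f (x + sqrt t * z) \<partial>gauss)"

lemma heat_0 [simp]: "heat 0 f x = f x"
  by (simp add: heat_def)

lemma heat_abs_le:
  assumes "\<And>x. \<bar>f x\<bar> \<le> B"
  shows "\<bar>heat t f x\<bar> \<le> B"
proof -
  interpret prob_space gauss by (rule prob_gauss)
  have B: "0 \<le> B" using assms[of 0] by linarith
  show ?thesis
  proof (cases "integrable gauss (\<lambda>z. f (x + sqrt t * z))")
    case True
    have "norm (\<integral>z. f (x + sqrt t * z) \<partial>gauss) \<le> (\<integral>z. B \<partial>gauss)"
      by (rule Bochner_Integration.integral_norm_bound_integral[OF True]) (use assms in auto)
    then show ?thesis by (simp add: heat_def)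
  next
    case False
    then show ?thesis using B by (simp add: heat_def not_integrable_integral_eq)
  qed
qed

lemma heat_diff:
  assumes f: "continuous_on UNIV f" "\<And>x. \<bar>f x\<bar> \<le> B" and g: "continuous_on UNIV g" "\<And>x. \<bar>g x\<bar> \<le> B'"
  shows "heat t f x - heat t g x = heat t (\<lambda>x. f x - g x) x"
proof -
  have "integrable gauss (\<lambda>z. f (x + sqrt t * z))" "integrable gauss (\<lambda>z. g (x + sqrt t * z))"
    by (rule integrable_gauss_bounded, rule borel_measurable_continuous_onI,
        rule continuous_on_compose2[OF f(1)] continuous_on_compose2[OF g(1)], auto intro!: continuous_intros f(2) g(2))+
  then show ?thesis by (simp add: heat_def)
qed

text \<open>The class in which the Picard iteration lives: the iterates are bounded in space on
  every bounded time interval but may grow exponentially in time.\<close>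

definition loc_bdd_cont :: "(real \<Rightarrow> real \<Rightarrow> real) \<Rightarrow> bool" where
  "loc_bdd_cont g \<longleftrightarrow> continuous_on UNIV (\<lambda>(s, x). g s x) \<and> (\<forall>T. \<exists>B. \<forall>s x. \<bar>s\<bar> \<le> T \<longrightarrow> \<bar>g s x\<bar> \<le> B)"

lemma loc_bdd_cont_slice:
  assumes "loc_bdd_cont g"
  shows "continuous_on UNIV (g s)" "\<exists>B. \<forall>x. \<bar>g s x\<bar> \<le> B"
proof -
  have "continuous_on UNIV (\<lambda>x. (\<lambda>(s, x). g s x) (s, x))"
    by (rule continuous_on_compose2[OF conjunct1[OF assms[unfolded loc_bdd_cont_def]]]) (auto intro!: continuous_intros)
  then show "continuous_on UNIV (g s)" by simp
  show "\<exists>B. \<forall>x. \<bar>g s x\<bar> \<le> B" using assms unfolding loc_bdd_cont_def by (metis order_refl)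
qed

lemma heat_continuous:
  assumes "loc_bdd_cont g"
  shows "continuous_on UNIV (\<lambda>(t, s, x). heat t (g s) x)"
proof -
  have g: "continuous_on UNIV (\<lambda>(s, x). g s x)" and lb: "\<And>T. \<exists>B. \<forall>s x. \<bar>s\<bar> \<le> T \<longrightarrow> \<bar>g s x\<bar> \<le> B"
    using assms by (auto simp: loc_bdd_cont_def)
  have gc: "isCont (\<lambda>(s, x). g s x) q" for q using g unfolding continuous_on_eq_continuous_at[OF open_UNIV] by blast
  have "isCont (\<lambda>(t, s, x). heat t (g s) x) q" for q
  proof (rule continuous_at_sequentiallyI)
    fix u :: "nat \<Rightarrow> real \<times> real \<times> real" assume u: "u \<longlonglongrightarrow> q"
    define t s x where "t n = fst (u n)" and "s n = fst (snd (u n))" and "x n = snd (snd (u n))" for n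
    have tsx: "t \<longlonglongrightarrow> fst q" "s \<longlonglongrightarrow> fst (snd q)" "x \<longlonglongrightarrow> snd (snd q)"
      unfolding t_def s_def x_def using u by (auto intro!: tendsto_intros)
    obtain T where T: "\<And>n. \<bar>s n\<bar> \<le> T"
      using convergent_imp_bounded[OF tsx(2)] by (auto simp: bounded_iff)
    obtain B where B: "\<And>s x. \<bar>s\<bar> \<le> T \<Longrightarrow> \<bar>g s x\<bar> \<le> B" using lb by blast
    have m: "(\<lambda>z. g (s n) (x n + sqrt (t n) * z)) \<in> borel_measurable gauss" for n
      by (rule measurable_cong_sets[THEN equalityD1, THEN subsetD, OF sets_gauss[symmetric] refl], rule borel_measurable_continuous_onI)
        (rule continuous_on_compose2[OF loc_bdd_cont_slice(1)[OF assms]], auto intro!: continuous_intros)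
    have m': "(\<lambda>z. g (fst (snd q)) (snd (snd q) + sqrt (fst q) * z)) \<in> borel_measurable gauss"
      by (rule measurable_cong_sets[THEN equalityD1, THEN subsetD, OF sets_gauss[symmetric] refl], rule borel_measurable_continuous_onI)
        (rule continuous_on_compose2[OF loc_bdd_cont_slice(1)[OF assms]], auto intro!: continuous_intros)
    interpret prob_space gauss by (rule prob_gauss)
    have "(\<lambda>n. \<integral>z. g (s n) (x n + sqrt (t n) * z) \<partial>gauss) \<longlonglongrightarrow> (\<integral>z. g (fst (snd q)) (snd (snd q) + sqrt (fst q) * z) \<partial>gauss)"
    proof (rule integral_dominated_convergence[OF m' m, of "\<lambda>_. B"])
      show "AE z in gauss. (\<lambda>n. g (s n) (x n + sqrt (t n) * z)) \<longlonglongrightarrow> g (fst (snd q)) (snd (snd q) + sqrt (fst q) * z)"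
      proof (rule AE_I2)
        fix z
        have "(\<lambda>n. (s n, x n + sqrt (t n) * z)) \<longlonglongrightarrow> (fst (snd q), snd (snd q) + sqrt (fst q) * z)"
          by (intro tendsto_intros tsx)
        from isCont_tendsto_compose[OF gc this]
        show "(\<lambda>n. g (s n) (x n + sqrt (t n) * z)) \<longlonglongrightarrow> g (fst (snd q)) (snd (snd q) + sqrt (fst q) * z)" by simp
      qed
      show "AE z in gauss. norm (g (s n) (x n + sqrt (t n) * z)) \<le> B" for n
        using B[OF T] by simp
    qed simp
    then show "(\<lambda>n. (\<lambda>(t, s, x). heat t (g s) x) (u n)) \<longlonglongrightarrow> (\<lambda>(t, s, x). heat t (g s) x) q"
      by (simp add: case_prod_unfold heat_def t_def s_def x_def)
  qed
  then show ?thesis by (simp add: continuous_at_imp_continuous_on)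
qed

lemma measurable_gaussI: "continuous_on UNIV f \<Longrightarrow> (f :: real \<Rightarrow> real) \<in> borel_measurable gauss"
  using borel_measurable_continuous_onI measurable_cong_sets[OF sets_gauss refl] by blast

lemma heat_has_derivative_x:
  assumes d: "\<And>x. DERIV f x :> f' x" and c: "continuous_on UNIV f'"
    and b: "\<And>x. \<bar>f x\<bar> \<le> B" "\<And>x. \<bar>f' x\<bar> \<le> B'"
  shows "DERIV (heat t f) x :> heat t f' x"
  unfolding heat_def
proof (rule has_derivative_integral[where e = 1 and w = "\<lambda>_. B'"])
  interpret prob_space gauss by (rule prob_gauss)
  have cf: "continuous_on UNIV f" using d by (meson DERIV_continuous_on has_field_derivative_at_within)
  show m: "(\<lambda>z. f (y + sqrt t * z)) \<in> borel_measurable gauss" for y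
    by (intro measurable_gaussI continuous_on_compose2[OF cf]) (auto intro!: continuous_intros)
  show "(\<lambda>z. f' (x + sqrt t * z)) \<in> borel_measurable gauss"
    by (intro measurable_gaussI continuous_on_compose2[OF c]) (auto intro!: continuous_intros)
  show "integrable gauss (\<lambda>z. f (x + sqrt t * z))"
    by (rule integrable_const_bound[of _ B]) (use b m in auto)
  show "DERIV (\<lambda>y. f (y + sqrt t * z)) y :> f' (y + sqrt t * z)" for y z
    using DERIV_shift[of f "f' (y + sqrt t * z)" y "sqrt t * z"] d by simp
qed (use b prob_gauss in \<open>auto simp: prob_space.emeasure_space_1 intro: finite_measure.integrable_const prob_space.finite_measure\<close>)

text \<open>Differentiation under the integral produces the factor \<open>z / (2 * sqrt t)\<close>;
  Gaussian integration by parts trades \<open>z\<close> for another space derivative, and the powers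
  of \<open>sqrt t\<close> cancel.\<close>

lemma heat_has_derivative_t:
  assumes d: "\<And>x. DERIV f x :> f' x" "\<And>x. DERIV f' x :> f'' x"
    and c: "continuous_on UNIV f''"
    and b: "\<And>x. \<bar>f x\<bar> \<le> B" "\<And>x. \<bar>f' x\<bar> \<le> B'" "\<And>x. \<bar>f'' x\<bar> \<le> B''" and t: "0 < t"
  shows "DERIV (\<lambda>t. heat t f x) t :> heat t f'' x / 2"
proof -
  interpret prob_space gauss by (rule prob_gauss)
  have cf: "continuous_on UNIV f" and cf': "continuous_on UNIV f'"
    using d by (meson DERIV_continuous_on has_field_derivative_at_within)+
  have B': "B' \<ge> 0" using b(2)[of 0] by linarith
  \<comment> \<open>For times above \<open>t / 2\<close> the singular factor
    \<open>1 / sqrt r\<close> stays bounded.\<close>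
  define w where "w z = B' * (1 / sqrt (t / 2)) * \<bar>z\<bar>" for z :: real
  have "((\<lambda>r. \<integral>z. f (x + sqrt r * z) \<partial>gauss) has_real_derivative
      (\<integral>z. f' (x + sqrt t * z) * (z * (inverse (sqrt t) / 2)) \<partial>gauss)) (at t)"
  proof (rule has_derivative_integral[where e = "t / 2" and w = w])
    show m: "(\<lambda>z. f (x + sqrt r * z)) \<in> borel_measurable gauss" for r
      by (intro measurable_gaussI continuous_on_compose2[OF cf]) (auto intro!: continuous_intros)
    show "(\<lambda>z. f' (x + sqrt t * z) * (z * (inverse (sqrt t) / 2))) \<in> borel_measurable gauss"
      by (intro measurable_gaussI continuous_intros continuous_on_compose2[OF cf']) auto
    show "integrable gauss (\<lambda>z. f (x + sqrt t * z))"
      by (rule integrable_const_bound[of _ B]) (use b m in auto)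
    show "integrable gauss w" unfolding w_def using integrable_gauss_abs by simp
    show "DERIV (\<lambda>r. f (x + sqrt r * z)) r :> f' (x + sqrt r * z) * (z * (inverse (sqrt r) / 2))"
      if "\<bar>r - t\<bar> < t / 2" for r z
    proof -
      have r: "r > 0" using that t by linarith
      have "DERIV (\<lambda>r. x + sqrt r * z) r :> z * (inverse (sqrt r) / 2)"
        using DERIV_add[OF DERIV_const[of x] DERIV_cmult_right[OF DERIV_real_sqrt[OF r], of z]] by (simp add: mult.commute)
      from DERIV_chain2[OF d(1) this] show ?thesis .
    qed
    show "\<bar>f' (x + sqrt r * z) * (z * (inverse (sqrt r) / 2))\<bar> \<le> w z" if "\<bar>r - t\<bar> < t / 2" for r z
    proof -
      have r: "r > t / 2" using that by linarith
      then have "inverse (sqrt r) / 2 \<le> 1 / sqrt (t / 2)" using t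
        by (auto simp: field_simps intro: order_trans[of _ "sqrt r"])
      then have "\<bar>f' (x + sqrt r * z)\<bar> * (\<bar>z\<bar> * (inverse (sqrt r) / 2)) \<le> B' * (\<bar>z\<bar> * (1 / sqrt (t / 2)))"
        using b(2) B' r t by (intro mult_mono mult_left_mono) auto
      then show ?thesis using r t by (simp add: abs_mult w_def mult_ac)
    qed
  qed (use t in auto)
  also have "(\<integral>z. f' (x + sqrt t * z) * (z * (inverse (sqrt t) / 2)) \<partial>gauss)
      = inverse (sqrt t) / 2 * (\<integral>z. z * f' (x + sqrt t * z) \<partial>gauss)"
    by (subst Bochner_Integration.integral_mult_right_zero[symmetric]) (simp add: mult_ac)
  also have "(\<integral>z. z * f' (x + sqrt t * z) \<partial>gauss) = (\<integral>z. sqrt t * f'' (x + sqrt t * z) \<partial>gauss)"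
  proof (rule gauss_integration_by_parts)
    show "DERIV (\<lambda>z. f' (x + sqrt t * z)) z :> sqrt t * f'' (x + sqrt t * z)" for z
    proof -
      have "DERIV (\<lambda>z. x + sqrt t * z) z :> sqrt t" by (auto intro!: derivative_eq_intros)
      from DERIV_chain2[OF d(2) this] show ?thesis by (simp add: mult.commute)
    qed
    show "continuous_on UNIV (\<lambda>z. sqrt t * f'' (x + sqrt t * z))"
      by (intro continuous_intros continuous_on_compose2[OF c]) auto
    show "\<bar>sqrt t * f'' (x + sqrt t * z)\<bar> \<le> sqrt t * B''" for z
      using b(3) t by (simp add: abs_mult)
  qed (rule b(2))
  finally show ?thesis using t by (simp add: heat_def inverse_eq_divide)
qed

text \<open>Unlike the time derivative above, this reaches down to \<open>t = 0\<close>. Moreover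
  its right-hand side is differentiable in \<open>t\<close> across 0, which is what Duhamel's
  formula needs on the diagonal.\<close>

lemma heat_eq_antideriv:
  assumes d: "\<And>x. DERIV f x :> f' x" "\<And>x. DERIV f' x :> f'' x"
    and c: "continuous_on UNIV f''"
    and b: "\<And>x. \<bar>f x\<bar> \<le> B" "\<And>x. \<bar>f' x\<bar> \<le> B'" "\<And>x. \<bar>f'' x\<bar> \<le> B''" and t: "0 \<le> t"
  shows "heat t f x = f x + antideriv (\<lambda>r. heat r f'' x) t / 2"
proof -
  have cf: "continuous_on UNIV f" using d by (meson DERIV_continuous_on has_field_derivative_at_within)
  have hc: "continuous_on UNIV (\<lambda>r. heat r k x)" if "continuous_on UNIV k" "\<And>x. \<bar>k x\<bar> \<le> D" for k D
  proof -
    have "continuous_on UNIV (\<lambda>q :: real \<times> real. k (snd q))"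
      by (rule continuous_on_compose2[OF that(1)]) (auto intro!: continuous_intros)
    then have "loc_bdd_cont (\<lambda>s. k)" unfolding loc_bdd_cont_def
      using that(2) by (auto simp: case_prod_unfold)
    from heat_continuous[OF this]
    have "continuous_on UNIV (\<lambda>r. (\<lambda>(t, s, x). heat t k x) (r, 0 :: real, x))"
      by (rule continuous_on_compose2) (auto intro!: continuous_intros)
    then show ?thesis by simp
  qed
  define D where "D t = heat t f x - antideriv (\<lambda>r. heat r f'' x) t / 2" for t
  have ad: "DERIV (antideriv (\<lambda>r. heat r f'' x)) t :> heat t f'' x" for t
    by (rule antideriv_has_derivative[OF hc[OF c b(3)]])
  have "D t = D 0"
  proof (cases "t = 0")
    case False
    then have t: "0 < t" using t by simp
    have "continuous_on {0..t} D" unfolding D_def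
      by (intro continuous_intros continuous_on_subset[OF hc[OF cf b(1)]] DERIV_continuous_on[OF has_field_derivative_at_within[OF ad]]) auto
    moreover have "DERIV D r :> 0" if "0 < r" "r < t" for r
      unfolding D_def using heat_has_derivative_t[OF d c b that(1), of x] ad[of r]
      by (auto intro!: derivative_eq_intros)
    ultimately show ?thesis using DERIV_isconst_end[OF t, of D] by auto
  qed simp
  then show ?thesis by (simp add: D_def)
qed

lemma heat_nonneg: "(\<And>x. 0 \<le> f x) \<Longrightarrow> 0 \<le> heat t f x"
  by (simp add: heat_def)

section \<open>Time-dependent sources and Duhamel's formula\<close>

lemma loc_bdd_contD:
  assumes "loc_bdd_cont g"
  shows "continuous_on UNIV (\<lambda>(s, x). g s x)" "\<And>T. \<exists>B. \<forall>s x. \<bar>s\<bar> \<le> T \<longrightarrow> \<bar>g s x\<bar> \<le> B"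
  using assms by (auto simp: loc_bdd_cont_def)

lemma loc_bdd_contI:
  assumes "continuous_on UNIV (\<lambda>(s, x). g s x)" "\<And>T. \<exists>B. \<forall>s x. \<bar>s\<bar> \<le> T \<longrightarrow> \<bar>g s x\<bar> \<le> B"
  shows "loc_bdd_cont g"
  using assms by (auto simp: loc_bdd_cont_def)

lemma loc_bdd_cont_diff:
  assumes "loc_bdd_cont f" "loc_bdd_cont g"
  shows "loc_bdd_cont (\<lambda>s x. f s x - g s x)"
proof (rule loc_bdd_contI)
  show "continuous_on UNIV (\<lambda>(s, x). f s x - g s x)"
    using loc_bdd_contD(1)[OF assms(1)] loc_bdd_contD(1)[OF assms(2)]
    by (auto simp: case_prod_unfold intro!: continuous_intros)
  fix T
  obtain B where B: "\<And>s x. \<bar>s\<bar> \<le> T \<Longrightarrow> \<bar>f s x\<bar> \<le> B" using loc_bdd_contD(2)[OF assms(1), of T] by blast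
  obtain B' where B': "\<And>s x. \<bar>s\<bar> \<le> T \<Longrightarrow> \<bar>g s x\<bar> \<le> B'" using loc_bdd_contD(2)[OF assms(2), of T] by blast
  show "\<exists>B. \<forall>s x. \<bar>s\<bar> \<le> T \<longrightarrow> \<bar>f s x - g s x\<bar> \<le> B"
  proof (intro exI[of _ "B + B'"] allI impI)
    show "\<bar>f s x - g s x\<bar> \<le> B + B'" if "\<bar>s\<bar> \<le> T" for s x
      using B[OF that, of x] B'[OF that, of x] by linarith
  qed
qed

lemma loc_bdd_cont_mult:
  assumes "loc_bdd_cont f" "loc_bdd_cont g"
  shows "loc_bdd_cont (\<lambda>s x. f s x * g s x)"
proof (rule loc_bdd_contI)
  show "continuous_on UNIV (\<lambda>(s, x). f s x * g s x)"
    using loc_bdd_contD(1)[OF assms(1)] loc_bdd_contD(1)[OF assms(2)]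
    by (auto simp: case_prod_unfold intro!: continuous_intros)
  fix T
  obtain B where B: "\<And>s x. \<bar>s\<bar> \<le> T \<Longrightarrow> \<bar>f s x\<bar> \<le> B" using loc_bdd_contD(2)[OF assms(1), of T] by blast
  obtain B' where B': "\<And>s x. \<bar>s\<bar> \<le> T \<Longrightarrow> \<bar>g s x\<bar> \<le> B'" using loc_bdd_contD(2)[OF assms(2), of T] by blast
  have "\<bar>f s x * g s x\<bar> \<le> \<bar>B\<bar> * \<bar>B'\<bar>" if "\<bar>s\<bar> \<le> T" for s x
    unfolding abs_mult by (rule mult_mono) (use B[OF that, of x] B'[OF that, of x] in auto)
  then show "\<exists>B. \<forall>s x. \<bar>s\<bar> \<le> T \<longrightarrow> \<bar>f s x * g s x\<bar> \<le> B" by blast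
qed

lemma loc_bdd_cont_time:
  assumes "continuous_on UNIV (f :: real \<Rightarrow> real)"
  shows "loc_bdd_cont (\<lambda>s x. f s)"
proof (rule loc_bdd_contI)
  show "continuous_on UNIV (\<lambda>(s :: real, x :: real). f s)"
    using continuous_on_compose2[OF assms, of UNIV fst] by (simp add: case_prod_unfold continuous_on_fst continuous_on_id)
  fix T :: real
  have "compact (f ` {-T..T})"
    using assms by (intro compact_continuous_image) (auto intro: continuous_on_subset)
  then have "bounded (f ` {-T..T})" by (rule compact_imp_bounded)
  then obtain B where "\<forall>y\<in>f ` {-T..T}. norm y \<le> B" unfolding bounded_iff by blast
  then show "\<exists>B. \<forall>s x :: real. \<bar>s\<bar> \<le> T \<longrightarrow> \<bar>f s\<bar> \<le> B" by (auto simp: abs_le_iff intro!: exI[of _ B])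
qed

text \<open>Variation of constants for the heat equation with source \<open>g\<close>. Freezing the
  time at 0 for negative arguments keeps it continuous on the whole plane.\<close>

definition duhamel :: "(real \<Rightarrow> real) \<Rightarrow> (real \<Rightarrow> real \<Rightarrow> real) \<Rightarrow> real \<Rightarrow> real \<Rightarrow> real" where
  "duhamel \<phi> g t x = heat (max 0 t) \<phi> x + antideriv (\<lambda>s. heat (max 0 t - s) (g s) x) (max 0 t)"

lemma duhamel_0: "t \<le> 0 \<Longrightarrow> duhamel \<phi> g t x = \<phi> x"
  by (simp add: duhamel_def max_absorb1)

lemma heat_kernel_continuous:
  assumes "loc_bdd_cont g"
  shows "continuous_on UNIV (\<lambda>((t, x), s). heat (t - s) (g s) x)"
proof -
  have "continuous_on UNIV (\<lambda>q :: (real \<times> real) \<times> real. (\<lambda>(t, s, x). heat t (g s) x) (fst (fst q) - snd q, snd q, snd (fst q)))"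
    by (rule continuous_on_compose2[OF heat_continuous[OF assms]]) (auto intro!: continuous_intros)
  then show ?thesis by (simp add: case_prod_unfold)
qed

lemma heat_kernel_continuous_s:
  assumes "loc_bdd_cont g"
  shows "continuous_on UNIV (\<lambda>s. heat (t - s) (g s) x)"
proof -
  have "continuous_on UNIV (\<lambda>s. (\<lambda>((t, x), s). heat (t - s) (g s) x) ((t, x), s))"
    by (rule continuous_on_compose2[OF heat_kernel_continuous[OF assms]]) (auto intro!: continuous_intros)
  then show ?thesis by simp
qed

lemma loc_bdd_cont_space:
  assumes "continuous_on UNIV \<phi>" "\<And>x. \<bar>\<phi> x\<bar> \<le> A"
  shows "loc_bdd_cont (\<lambda>s. \<phi>)"
proof (rule loc_bdd_contI)
  have "continuous_on UNIV (\<lambda>q :: real \<times> real. \<phi> (snd q))"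
    by (rule continuous_on_compose2[OF assms(1)]) (auto intro!: continuous_intros)
  then show "continuous_on UNIV (\<lambda>(s :: real, x). \<phi> x)" by (simp add: case_prod_unfold)
qed (use assms(2) in auto)

text \<open>The heat semigroup does not increase the sup norm, so a source bounded by
  \<open>w s\<close> contributes at most the integral of \<open>w\<close>, which is read off an
  explicit primitive \<open>W\<close>.\<close>

lemma duhamel_abs_le:
  assumes g: "loc_bdd_cont g" and A: "\<And>x. \<bar>\<phi> x\<bar> \<le> A"
    and W: "\<And>s. DERIV W s :> w s"
    and b: "\<And>s x. 0 \<le> s \<Longrightarrow> s \<le> t \<Longrightarrow> \<bar>g s x\<bar> \<le> w s"
  shows "\<bar>duhamel \<phi> g t x\<bar> \<le> A + \<bar>W (max 0 t) - W 0\<bar>"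
proof -
  have "\<bar>antideriv (\<lambda>s. heat (max 0 t - s) (g s) x) (max 0 t)\<bar> \<le> \<bar>W (max 0 t) - W 0\<bar>"
  proof (cases "0 \<le> t")
    case True
    show ?thesis
      by (rule antideriv_bound[OF heat_kernel_continuous_s[OF g] W])
        (use True b in \<open>auto intro!: heat_abs_le\<close>)
  qed (simp add: max_absorb1)
  moreover have "\<bar>heat (max 0 t) \<phi> x\<bar> \<le> A" by (rule heat_abs_le[OF A])
  ultimately show ?thesis unfolding duhamel_def by linarith
qed

lemma duhamel_nonneg:
  assumes "\<And>x. 0 \<le> \<phi> x" and "\<And>s x. 0 \<le> s \<Longrightarrow> s \<le> t \<Longrightarrow> 0 \<le> g s x"
  shows "0 \<le> duhamel \<phi> g t x"
proof (cases "0 \<le> t")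
  case True
  have "0 \<le> integral {0..t} (\<lambda>s. heat (t - s) (g s) x)"
  proof (cases "(\<lambda>s. heat (t - s) (g s) x) integrable_on {0..t}")
    case True
    then show ?thesis
      by (rule Henstock_Kurzweil_Integration.integral_nonneg) (use assms in \<open>auto intro!: heat_nonneg\<close>)
  qed (simp add: not_integrable_integral)
  then show ?thesis using True heat_nonneg[OF assms(1)]
    by (simp add: duhamel_def antideriv_def max_absorb2 add_nonneg_nonneg)
next
  case False
  then show ?thesis using assms by (simp add: duhamel_0)
qed

lemma duhamel_loc_bdd_cont:
  assumes c: "continuous_on UNIV \<phi>" and A: "\<And>x. \<bar>\<phi> x\<bar> \<le> A" and g: "loc_bdd_cont g"
  shows "loc_bdd_cont (duhamel \<phi> g)"
proof (rule loc_bdd_contI)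
  have 1: "continuous_on UNIV (\<lambda>q :: real \<times> real. (\<lambda>(t, s, x). heat t \<phi> x) (max 0 (fst q), 0 :: real, snd q))"
    by (rule continuous_on_compose2[OF heat_continuous[OF loc_bdd_cont_space[OF c A]]])
      (auto intro!: continuous_intros)
  have "continuous_on UNIV (\<lambda>(p, s). (\<lambda>p s. heat (fst p - s) (g s) (snd p)) p s)"
    using heat_kernel_continuous[OF g] by (simp add: case_prod_unfold)
  from continuous_on_antideriv2[OF this]
  have "continuous_on UNIV (\<lambda>q :: real \<times> real. (\<lambda>(p, y). antideriv (\<lambda>s. heat (fst p - s) (g s) (snd p)) y) ((max 0 (fst q), snd q), max 0 (fst q)))"
    by (rule continuous_on_compose2) (auto intro!: continuous_intros)
  with 1 show "continuous_on UNIV (\<lambda>(t, x). duhamel \<phi> g t x)"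
    by (simp add: duhamel_def case_prod_unfold continuous_on_add)
  fix T
  obtain B where B: "\<And>s x. \<bar>s\<bar> \<le> T \<Longrightarrow> \<bar>g s x\<bar> \<le> B" using loc_bdd_contD(2)[OF g, of T] by blast
  have "\<bar>duhamel \<phi> g t x\<bar> \<le> A + \<bar>B\<bar> * \<bar>T\<bar>" if "\<bar>t\<bar> \<le> T" for t x
  proof -
    have "DERIV (\<lambda>s. B * s) s :> B" for s by (auto intro!: derivative_eq_intros)
    from duhamel_abs_le[OF g A this, where t = t and x = x]
    have "\<bar>duhamel \<phi> g t x\<bar> \<le> A + \<bar>B * max 0 t - B * 0\<bar>"
      using B that by auto
    also have "\<bar>B * max 0 t - B * 0\<bar> \<le> \<bar>B\<bar> * \<bar>T\<bar>"
      unfolding mult_zero_right diff_zero abs_mult using that by (intro mult_left_mono) auto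
    finally show ?thesis by simp
  qed
  then show "\<exists>B. \<forall>s x. \<bar>s\<bar> \<le> T \<longrightarrow> \<bar>duhamel \<phi> g s x\<bar> \<le> B" by blast
qed

lemma duhamel_diff:
  assumes "loc_bdd_cont g" "loc_bdd_cont h"
  shows "duhamel \<phi> g t x - duhamel \<phi> h t x = duhamel (\<lambda>x. 0) (\<lambda>s x. g s x - h s x) t x"
proof -
  define T where "T = max 0 t"
  have hd: "heat (T - s) (\<lambda>x. g s x - h s x) x = heat (T - s) (g s) x - heat (T - s) (h s) x" for s
  proof -
    obtain B B' where "\<And>x. \<bar>g s x\<bar> \<le> B" "\<And>x. \<bar>h s x\<bar> \<le> B'"
      using loc_bdd_cont_slice(2)[OF assms(1)] loc_bdd_cont_slice(2)[OF assms(2)] by meson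
    then show ?thesis
      using heat_diff[OF loc_bdd_cont_slice(1)[OF assms(1)] _ loc_bdd_cont_slice(1)[OF assms(2)]] by metis
  qed
  have "antideriv (\<lambda>s. heat (T - s) (\<lambda>x. g s x - h s x) x) T
     = (antideriv (\<lambda>s. heat (T - s) (g s) x) T - antideriv (\<lambda>s. heat (T - s) (h s) x) T)
     - (antideriv (\<lambda>s. heat (T - s) (g s) x) 0 - antideriv (\<lambda>s. heat (T - s) (h s) x) 0)"
  proof (rule antideriv_unique[where H = "\<lambda>T'. antideriv (\<lambda>s. heat (T - s) (g s) x) T' - antideriv (\<lambda>s. heat (T - s) (h s) x) T'"])
    show "continuous_on UNIV (\<lambda>s. heat (T - s) (\<lambda>x. g s x - h s x) x)"
      by (rule heat_kernel_continuous_s[OF loc_bdd_cont_diff[OF assms]])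
    show "DERIV (\<lambda>T'. antideriv (\<lambda>s. heat (T - s) (g s) x) T' - antideriv (\<lambda>s. heat (T - s) (h s) x) T') s :> heat (T - s) (\<lambda>x. g s x - h s x) x" for s
      unfolding hd
      by (intro DERIV_diff antideriv_has_derivative heat_kernel_continuous_s assms)
  qed
  moreover have "heat T (\<lambda>x. 0) x = 0" by (simp add: heat_def)
  ultimately show ?thesis by (simp add: duhamel_def T_def)
qed

lemma duhamel_has_derivative_x:
  assumes d: "\<And>x. DERIV \<phi> x :> \<phi>' x" and c: "continuous_on UNIV \<phi>'"
    and b: "\<And>x. \<bar>\<phi> x\<bar> \<le> A" "\<And>x. \<bar>\<phi>' x\<bar> \<le> A'"
    and g: "loc_bdd_cont g" "loc_bdd_cont g'" and dg: "\<And>s x. DERIV (g s) x :> g' s x"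
  shows "DERIV (duhamel \<phi> g t) x :> duhamel \<phi>' g' t x"
proof -
  define T where "T = max 0 t"
  have ch: "continuous_on UNIV (\<lambda>(x, s). heat (T - s) (k s) x)" if "loc_bdd_cont k" for k
  proof -
    have "continuous_on UNIV (\<lambda>q :: real \<times> real. (\<lambda>((t, x), s). heat (t - s) (k s) x) ((T, fst q), snd q))"
      by (rule continuous_on_compose2[OF heat_kernel_continuous[OF that]]) (auto intro!: continuous_intros)
    then show ?thesis by (simp add: case_prod_unfold)
  qed
  have "DERIV (\<lambda>x. antideriv (\<lambda>s. heat (T - s) (g s) x) T) x :> antideriv (\<lambda>s. heat (T - s) (g' s) x) T"
  proof (rule antideriv_param_has_derivative[OF ch[OF g(1)] ch[OF g(2)]])
    fix x s
    obtain B B' where "\<And>x. \<bar>g s x\<bar> \<le> B" "\<And>x. \<bar>g' s x\<bar> \<le> B'"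
      using loc_bdd_cont_slice(2)[OF g(1)] loc_bdd_cont_slice(2)[OF g(2)] by meson
    then show "DERIV (\<lambda>x. heat (T - s) (g s) x) x :> heat (T - s) (g' s) x"
      by (intro heat_has_derivative_x dg loc_bdd_cont_slice(1)[OF g(2)])
  qed
  with heat_has_derivative_x[OF d c b] show ?thesis
    unfolding duhamel_def T_def by (intro DERIV_add)
qed

text \<open>At the moving endpoint \<open>s = t\<close> the integrand
  \<open>heat (t - s) (g s) x\<close> is not known to be differentiable in \<open>t\<close>. It is
  replaced by \<open>\<kappa>\<close>, which agrees with it for \<open>s \<le> r\<close> and is
  differentiable in \<open>r\<close> everywhere; then the Leibniz rule on the diagonal
  applies.\<close>

lemma duhamel_has_derivative_t:
  assumes d: "\<And>x. DERIV \<phi> x :> \<phi>' x" "\<And>x. DERIV \<phi>' x :> \<phi>'' x"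
    and c: "continuous_on UNIV \<phi>''"
    and b: "\<And>x. \<bar>\<phi> x\<bar> \<le> A" "\<And>x. \<bar>\<phi>' x\<bar> \<le> A'" "\<And>x. \<bar>\<phi>'' x\<bar> \<le> A''"
    and g: "loc_bdd_cont g" "loc_bdd_cont g'" "loc_bdd_cont g''"
    and dg: "\<And>s x. DERIV (g s) x :> g' s x" "\<And>s x. DERIV (g' s) x :> g'' s x"
    and t: "0 < t"
  shows "DERIV (\<lambda>t. duhamel \<phi> g t x) t :> g t x + duhamel \<phi>'' g'' t x / 2"
proof -
  define \<kappa> where "\<kappa> r s = g s x + antideriv (\<lambda>u. heat u (g'' s) x) (r - s) / 2" for r s
  have eq: "heat (r - s) (g s) x = \<kappa> r s" if "s \<le> r" for r s
  proof -
    obtain B B' B'' where "\<And>x. \<bar>g s x\<bar> \<le> B" "\<And>x. \<bar>g' s x\<bar> \<le> B'" "\<And>x. \<bar>g'' s x\<bar> \<le> B''"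
      using loc_bdd_cont_slice(2)[OF g(1)] loc_bdd_cont_slice(2)[OF g(2)] loc_bdd_cont_slice(2)[OF g(3)] by meson
    then show ?thesis unfolding \<kappa>_def using that
      by (intro heat_eq_antideriv[OF dg(1) dg(2) loc_bdd_cont_slice(1)[OF g(3)]]) auto
  qed
  have c1: "continuous_on UNIV (\<lambda>(s, u). heat u (g'' s) x)"
  proof -
    have "continuous_on UNIV (\<lambda>q :: real \<times> real. (\<lambda>(t, s, x). heat t (g'' s) x) (snd q, fst q, x))"
      by (rule continuous_on_compose2[OF heat_continuous[OF g(3)]]) (auto intro!: continuous_intros)
    then show ?thesis by (simp add: case_prod_unfold)
  qed
  have c1s: "continuous_on UNIV (\<lambda>u. heat u (g'' s) x)" for s
  proof -
    have "continuous_on UNIV (\<lambda>u. (\<lambda>(s, u). heat u (g'' s) x) (s, u))"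
      by (rule continuous_on_compose2[OF c1]) (auto intro!: continuous_intros)
    then show ?thesis by simp
  qed
  have c\<kappa>: "continuous_on UNIV (\<lambda>(r, s). \<kappa> r s)"
  proof -
    have 1: "continuous_on UNIV (\<lambda>q :: real \<times> real. (\<lambda>(s, u). antideriv (\<lambda>u. heat u (g'' s) x) u) (snd q, fst q - snd q))"
      by (rule continuous_on_compose2[OF continuous_on_antideriv2[OF c1]]) (auto intro!: continuous_intros)
    have 2: "continuous_on UNIV (\<lambda>q :: real \<times> real. (\<lambda>(s, x). g s x) (snd q, x))"
      by (rule continuous_on_compose2[OF loc_bdd_contD(1)[OF g(1)]]) (auto intro!: continuous_intros)
    show ?thesis using 1 2 unfolding \<kappa>_def case_prod_unfold fst_conv snd_conv by (intro continuous_intros) auto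
  qed
  have c\<kappa>': "continuous_on UNIV (\<lambda>(r, s). heat (r - s) (g'' s) x / 2)"
  proof -
    have "continuous_on UNIV (\<lambda>q :: real \<times> real. (\<lambda>(s, u). heat u (g'' s) x) (snd q, fst q - snd q))"
      by (rule continuous_on_compose2[OF c1]) (auto intro!: continuous_intros)
    then show ?thesis unfolding case_prod_unfold by (intro continuous_intros) auto
  qed
  have d\<kappa>: "DERIV (\<lambda>r. \<kappa> r s) r :> heat (r - s) (g'' s) x / 2" for r s
  proof -
    have "DERIV (\<lambda>r. antideriv (\<lambda>u. heat u (g'' s) x) (r - s)) r :> heat (r - s) (g'' s) x * 1"
      by (rule DERIV_chain2[OF antideriv_has_derivative[OF c1s]]) (auto intro!: derivative_eq_intros)
    then show ?thesis unfolding \<kappa>_def by (auto intro!: derivative_eq_intros)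
  qed
  have "DERIV (\<lambda>t. antideriv (\<kappa> t) t) t :> antideriv (\<lambda>s. heat (t - s) (g'' s) x / 2) t + \<kappa> t t"
    by (rule antideriv_diagonal_has_derivative[OF c\<kappa> c\<kappa>' d\<kappa>])
  moreover have "antideriv (\<lambda>s. heat (t - s) (g'' s) x / 2) t = antideriv (\<lambda>s. heat (t - s) (g'' s) x) t / 2"
    using t by (simp add: antideriv_def)
  moreover have "\<kappa> t t = g t x" by (simp add: \<kappa>_def)
  moreover have "DERIV (\<lambda>t. heat t \<phi> x) t :> heat t \<phi>'' x / 2"
    by (rule heat_has_derivative_t[OF d c b t])
  ultimately have D: "((\<lambda>t. heat t \<phi> x + antideriv (\<kappa> t) t) has_real_derivative
      g t x + duhamel \<phi>'' g'' t x / 2) (at t)"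
    using t by (auto intro!: derivative_eq_intros simp: duhamel_def max_absorb2 field_simps)
  have "duhamel \<phi> g r x = heat r \<phi> x + antideriv (\<kappa> r) r" if "0 < r" for r
  proof -
    have "integral {0..r} (\<lambda>s. heat (r - s) (g s) x) = integral {0..r} (\<kappa> r)"
      by (rule Henstock_Kurzweil_Integration.integral_cong) (simp add: eq)
    then show ?thesis using that by (simp add: duhamel_def antideriv_def max_absorb2)
  qed
  then have "\<forall>\<^sub>F r in nhds t. duhamel \<phi> g r x = heat r \<phi> x + antideriv (\<kappa> r) r"
    using eventually_nhds_in_open[of "{0<..}" t] t by (auto elim!: eventually_mono)
  from DERIV_cong_ev[OF refl this refl] D show ?thesis by blast
qed

section \<open>Classical solutions of the log-Laplace equation\<close>

text \<open>Stronger than \<open>log_laplace_sol\<close>: the space derivatives are jointly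
  continuous and the domain includes negative times, so that slices, chain rules and rescalings come
  without side conditions.\<close>

definition strong_sol :: "(real \<Rightarrow> real) \<Rightarrow> (real \<Rightarrow> real \<Rightarrow> real) \<Rightarrow> bool" where
  "strong_sol \<phi> u \<longleftrightarrow> u 0 = \<phi> \<and> (\<forall>t x. 0 \<le> u t x) \<and> (\<exists>B. \<forall>t x. u t x \<le> B) \<and>
     continuous_on UNIV (\<lambda>(t, x). u t x) \<and>
     (\<exists>p q. continuous_on UNIV (\<lambda>(t, x). p t x) \<and> continuous_on UNIV (\<lambda>(t, x). q t x) \<and>
        (\<forall>t x. DERIV (u t) x :> p t x) \<and>
        (\<forall>t x. DERIV (p t) x :> q t x) \<and>
        (\<forall>t>0. \<forall>x. DERIV (\<lambda>r. u r x) t :> q t x / 2 - (u t x)\<^sup>2 / 2))"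

text \<open>Picard iteration for \<open>v = e\<^sup>M\<^sup>t u\<close>, where M bounds the initial value: the factor makes the
  nonlinearity increasing on the range of v, so that the bounds 0 \<le> u \<le> M survive each step. The
  iterates of the two space derivatives are carried along.\<close>
locale picard =
  fixes \<phi> \<phi>' \<phi>'' :: "real \<Rightarrow> real" and M A B :: real
  assumes d\<phi>: "\<And>x. DERIV \<phi> x :> \<phi>' x" "\<And>x. DERIV \<phi>' x :> \<phi>'' x"
    and c\<phi>: "continuous_on UNIV \<phi>''"
    and \<phi>0: "\<And>x. 0 \<le> \<phi> x" and \<phi>M: "\<And>x. \<phi> x \<le> M"
    and \<phi>A: "\<And>x. \<bar>\<phi>' x\<bar> \<le> A" and \<phi>B: "\<And>x. \<bar>\<phi>'' x\<bar> \<le> B"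
    and M1: "1 \<le> M" and AB: "A\<^sup>2 \<le> B"
begin

lemma A0: "0 \<le> A" using \<phi>A[of 0] by linarith
lemma B0: "0 \<le> B" using \<phi>B[of 0] by linarith
lemma \<phi>abs: "\<bar>\<phi> x\<bar> \<le> M" using \<phi>0[of x] \<phi>M[of x] by simp
lemma cont\<phi>: "continuous_on UNIV \<phi>" "continuous_on UNIV \<phi>'"
  using d\<phi> by (meson DERIV_continuous_on has_field_derivative_at_within)+

text \<open>The source in \<open>v_t = v'' / 2 + M * v - exp (- M * t) * v^2 / 2\<close>, followed
  by its two formal space derivatives.\<close>

definition "G1 u s x = M * u s x - exp (- M * s) * (u s x * u s x) / 2"
  for u :: "real \<Rightarrow> real \<Rightarrow> real" and s x :: real
definition "G2 u p s x = (M - exp (- M * s) * u s x) * p s x"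
  for u p :: "real \<Rightarrow> real \<Rightarrow> real" and s x :: real
definition "G3 u p q s x = (M - exp (- M * s) * u s x) * q s x - exp (- M * s) * (p s x * p s x)"
  for u p q :: "real \<Rightarrow> real \<Rightarrow> real" and s x :: real

text \<open>The first space derivative enters the equation of the second one quadratically. The
  doubled rate in the bound on \<open>q\<close> absorbs this source, by \<open>A^2 \<le> B\<close>
  and \<open>1 \<le> M\<close>.\<close>

definition "admissible u p q \<longleftrightarrow> loc_bdd_cont u \<and> loc_bdd_cont p \<and> loc_bdd_cont q \<and>
  (\<forall>t x. 0 \<le> u t x \<and> u t x \<le> M * exp (M * max 0 t)) \<and>
  (\<forall>t x. \<bar>p t x\<bar> \<le> A * exp (M * max 0 t)) \<and> (\<forall>t x. \<bar>q t x\<bar> \<le> B * exp (2 * M * max 0 t))"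
  for u p q :: "real \<Rightarrow> real \<Rightarrow> real"

lemma admissibleD:
  assumes "admissible u p q" "0 \<le> s"
  shows "0 \<le> u s x" "u s x \<le> M * exp (M * s)" "\<bar>p s x\<bar> \<le> A * exp (M * s)" "\<bar>q s x\<bar> \<le> B * exp (2 * M * s)"
proof -
  have "0 \<le> u s x" "u s x \<le> M * exp (M * max 0 s)" "\<bar>p s x\<bar> \<le> A * exp (M * max 0 s)" "\<bar>q s x\<bar> \<le> B * exp (2 * M * max 0 s)"
    using assms(1) unfolding admissible_def by blast+
  then show "0 \<le> u s x" "u s x \<le> M * exp (M * s)" "\<bar>p s x\<bar> \<le> A * exp (M * s)" "\<bar>q s x\<bar> \<le> B * exp (2 * M * s)"
    using assms(2) by (simp_all add: max_absorb2)
qed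

lemma loc_bdd_cont_const: "loc_bdd_cont (\<lambda>s x. c)"
  by (rule loc_bdd_cont_time) (rule continuous_on_const)

lemma loc_bdd_cont_exp: "loc_bdd_cont (\<lambda>s x. exp (- M * s))"
  by (rule loc_bdd_cont_time) (auto intro!: continuous_intros)

lemma G_loc_bdd_cont:
  assumes "loc_bdd_cont u" "loc_bdd_cont p" "loc_bdd_cont q"
  shows "loc_bdd_cont (G1 u)" "loc_bdd_cont (G2 u p)" "loc_bdd_cont (G3 u p q)"
proof -
  note [intro!] = loc_bdd_cont_diff loc_bdd_cont_mult loc_bdd_cont_const loc_bdd_cont_exp
  have "loc_bdd_cont (\<lambda>s x. M * u s x - (1 / 2) * (exp (- M * s) * (u s x * u s x)))"
    by (intro loc_bdd_cont_diff loc_bdd_cont_mult loc_bdd_cont_const loc_bdd_cont_exp assms)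
  then show "loc_bdd_cont (G1 u)" unfolding G1_def[abs_def] by simp
  show "loc_bdd_cont (G2 u p)" "loc_bdd_cont (G3 u p q)" unfolding G2_def[abs_def] G3_def[abs_def]
    by (intro loc_bdd_cont_diff loc_bdd_cont_mult loc_bdd_cont_const loc_bdd_cont_exp assms)+
qed

lemma G_bounds:
  fixes u p q :: "real \<Rightarrow> real \<Rightarrow> real"
  assumes s: "0 \<le> s" and u: "0 \<le> u s x" "u s x \<le> M * exp (M * s)"
    and p: "\<bar>p s x\<bar> \<le> A * exp (M * s)" and q: "\<bar>q s x\<bar> \<le> B * exp (2 * M * s)"
  shows "0 \<le> G1 u s x" "\<bar>G1 u s x\<bar> \<le> M * M / 2 * exp (M * s)" "\<bar>G2 u p s x\<bar> \<le> A * (M * exp (M * s))"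
    "\<bar>G3 u p q s x\<bar> \<le> B * (2 * M * exp (2 * M * s))"
proof -
  define e where "e = exp (M * s)"
  have e: "e > 0" "exp (- M * s) = 1 / e" "exp (2 * M * s) = e * e"
    by (simp_all add: e_def exp_minus exp_add[symmetric] inverse_eq_divide)
  \<comment> \<open>Back to the scale without the exponential factor: \<open>y\<close> lies between
    0 and \<open>M\<close>, where \<open>M * y - y^2 / 2\<close> is nonnegative and at most
    \<open>M^2 / 2\<close>.\<close>
  define y where "y = u s x / e"
  have y: "0 \<le> y" "y \<le> M" "u s x = e * y" using u e by (auto simp: y_def e_def[symmetric] field_simps)
  have G1: "G1 u s x = e * (M * y - y * y / 2)" using e by (simp add: G1_def y(3) field_simps)
  have "y * y \<le> M * y" using y by (simp add: mult_right_mono)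
  then have 1: "0 \<le> M * y - y * y / 2" using y M1 mult_nonneg_nonneg[of M y] by linarith
  have "0 \<le> (M - y) * (M - y)" by simp
  then have 2: "M * y - y * y / 2 \<le> M * M / 2" by (simp add: algebra_simps)
  show G1': "0 \<le> G1 u s x" unfolding G1 using 1 e by simp
  show "\<bar>G1 u s x\<bar> \<le> M * M / 2 * exp (M * s)"
    using G1' mult_left_mono[OF 2, of e] e(1) unfolding G1 by (simp add: e_def mult.commute)
  have my: "\<bar>M - exp (- M * s) * u s x\<bar> \<le> M" using y e by (simp add: e(2))
  show "\<bar>G2 u p s x\<bar> \<le> A * (M * exp (M * s))"
    unfolding G2_def abs_mult using mult_mono[OF my p] M1 by (simp add: mult_ac)
  have "\<bar>M - exp (- M * s) * u s x\<bar> * \<bar>q s x\<bar> \<le> M * (B * (e * e))"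
    using mult_mono[OF my q] M1 e(3) by simp
  moreover have "\<bar>p s x\<bar> * \<bar>p s x\<bar> \<le> (A * e) * (A * e)"
    using p A0 e(1) by (intro mult_mono) (auto simp: e_def)
  then have "1 / e * (\<bar>p s x\<bar> * \<bar>p s x\<bar>) \<le> 1 / e * ((A * e) * (A * e))"
    using e(1) by (intro mult_left_mono) auto
  moreover have "1 / e * ((A * e) * (A * e)) = A\<^sup>2 * e" using e(1) by (simp add: power2_eq_square)
  moreover have "A\<^sup>2 * e \<le> B * e" using AB e(1) by simp
  moreover have "B * e \<le> M * (B * (e * e))"
  proof -
    have "1 \<le> e" using s M1 by (simp add: e_def)
    then have "1 * 1 \<le> M * e" using M1 by (intro mult_mono) auto
    then have "B * e * 1 \<le> B * e * (M * e)" using B0 e(1) by (intro mult_left_mono) auto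
    then show ?thesis by (simp add: mult_ac)
  qed
  ultimately have "\<bar>M - exp (- M * s) * u s x\<bar> * \<bar>q s x\<bar> + 1 / e * (\<bar>p s x\<bar> * \<bar>p s x\<bar>) \<le> 2 * (M * (B * (e * e)))"
    by linarith
  moreover have "\<bar>G3 u p q s x\<bar> \<le> \<bar>M - exp (- M * s) * u s x\<bar> * \<bar>q s x\<bar> + 1 / e * (\<bar>p s x\<bar> * \<bar>p s x\<bar>)"
    unfolding G3_def e(2) using e(1)
    by (intro order_trans[OF abs_triangle_ineq4]) (simp add: abs_mult)
  ultimately show "\<bar>G3 u p q s x\<bar> \<le> B * (2 * M * exp (2 * M * s))" using e(3) by (simp add: mult_ac)
qed

lemma exp_deriv: "DERIV (\<lambda>s. c * exp (k * s)) s :> c * (k * exp (k * s))" for c k :: real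
  by (auto intro!: derivative_eq_intros)

text \<open>The exponential bounds reproduce themselves: the integral of the bound on a source is at
  most the bound on the function minus its initial value.\<close>

lemma admissible_step:
  assumes "admissible u p q"
  shows "admissible (duhamel \<phi> (G1 u)) (duhamel \<phi>' (G2 u p)) (duhamel \<phi>'' (G3 u p q))"
proof -
  have l: "loc_bdd_cont u" "loc_bdd_cont p" "loc_bdd_cont q" using assms by (auto simp: admissible_def)
  have Gb: "0 \<le> G1 u s x" "\<bar>G1 u s x\<bar> \<le> M * M / 2 * exp (M * s)" "\<bar>G2 u p s x\<bar> \<le> A * (M * exp (M * s))"
    "\<bar>G3 u p q s x\<bar> \<le> B * (2 * M * exp (2 * M * s))" if "0 \<le> s" for s x
    using G_bounds[OF that, of u x p q] admissibleD[OF assms that, of x] by blast+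
  have "0 \<le> duhamel \<phi> (G1 u) t x" for t x
    by (rule duhamel_nonneg[OF \<phi>0]) (use Gb(1) in blast)
  moreover have "duhamel \<phi> (G1 u) t x \<le> M * exp (M * max 0 t)" for t x
  proof -
    have "\<bar>duhamel \<phi> (G1 u) t x\<bar> \<le> M + \<bar>M / 2 * exp (M * max 0 t) - M / 2 * exp (M * 0)\<bar>"
    proof (rule duhamel_abs_le[OF G_loc_bdd_cont(1)[OF l] \<phi>abs exp_deriv])
      show "\<bar>G1 u s x\<bar> \<le> M / 2 * (M * exp (M * s))" if "0 \<le> s" for s x
        using Gb(2)[OF that, of x] by (simp add: mult_ac)
    qed
    also have "\<dots> = M + M / 2 * (exp (M * max 0 t) - 1)"
      using M1 by (simp add: algebra_simps)
    also have "\<dots> \<le> M + M * (exp (M * max 0 t) - 1)"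
      using M1 by (intro add_mono mult_right_mono) auto
    finally show ?thesis by (simp add: algebra_simps)
  qed
  moreover have "\<bar>duhamel \<phi>' (G2 u p) t x\<bar> \<le> A * exp (M * max 0 t)" for t x
  proof -
    have "\<bar>duhamel \<phi>' (G2 u p) t x\<bar> \<le> A + \<bar>A * exp (M * max 0 t) - A * exp (M * 0)\<bar>"
      by (rule duhamel_abs_le[OF G_loc_bdd_cont(2)[OF l] \<phi>A exp_deriv]) (use Gb(3) in blast)
    also have "\<bar>A * exp (M * max 0 t) - A * exp (M * 0)\<bar> = A * exp (M * max 0 t) - A"
      using M1 A0 by (simp add: mult_le_cancel_left1)
    finally show ?thesis by simp
  qed
  moreover have "\<bar>duhamel \<phi>'' (G3 u p q) t x\<bar> \<le> B * exp (2 * M * max 0 t)" for t x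
  proof -
    have "\<bar>duhamel \<phi>'' (G3 u p q) t x\<bar> \<le> B + \<bar>B * exp (2 * M * max 0 t) - B * exp (2 * M * 0)\<bar>"
      by (rule duhamel_abs_le[OF G_loc_bdd_cont(3)[OF l] \<phi>B exp_deriv]) (use Gb(4) in blast)
    also have "\<bar>B * exp (2 * M * max 0 t) - B * exp (2 * M * 0)\<bar> = B * exp (2 * M * max 0 t) - B"
      using M1 B0 by (simp add: mult_le_cancel_left1)
    finally show ?thesis by simp
  qed
  ultimately show ?thesis unfolding admissible_def
    using duhamel_loc_bdd_cont[OF cont\<phi>(1) \<phi>abs G_loc_bdd_cont(1)[OF l]]
      duhamel_loc_bdd_cont[OF cont\<phi>(2) \<phi>A G_loc_bdd_cont(2)[OF l]]
      duhamel_loc_bdd_cont[OF c\<phi> \<phi>B G_loc_bdd_cont(3)[OF l]] by blast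
qed

text \<open>A common Lipschitz constant of the three sources. In the weight with rate
  \<open>\<kappa> = 2 * D\<close> one Duhamel integration gains the factor
  \<open>D / \<kappa> = 1 / 2\<close>.\<close>

definition "D = M + B + 2 * A"
definition "\<kappa> = 2 * D"

lemma D_pos: "0 < D" "M \<le> D" using M1 A0 B0 by (auto simp: D_def)
lemma \<kappa>_pos: "0 < \<kappa>" "M \<le> \<kappa>" using D_pos by (auto simp: \<kappa>_def)

text \<open>The additional \<open>exp (M * t)\<close> in the third component pays for the
  coefficient \<open>q' / exp (M * s)\<close> in the difference of the \<open>G3\<close>, which
  itself grows like \<open>exp (M * s)\<close>.\<close>

definition "close c u p q u' p' q' \<longleftrightarrow> (\<forall>t x. \<bar>u t x - u' t x\<bar> \<le> c * exp (\<kappa> * max 0 t) \<and>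
   \<bar>p t x - p' t x\<bar> \<le> c * exp (\<kappa> * max 0 t) \<and> \<bar>q t x - q' t x\<bar> \<le> c * exp ((\<kappa> + M) * max 0 t))"
  for c and u p q u' p' q' :: "real \<Rightarrow> real \<Rightarrow> real"

lemma abs_diff_le: "z = x - y \<Longrightarrow> \<bar>x\<bar> \<le> a \<Longrightarrow> \<bar>y\<bar> \<le> b \<Longrightarrow> \<bar>z\<bar> \<le> a + b" for x y z a b :: real
  by linarith

lemma G_differences:
  assumes s: "0 \<le> s" and ad: "admissible u p q" "admissible u' p' q'" and cl: "close c u p q u' p' q'" and c: "0 \<le> c"
  shows "\<bar>G1 u s x - G1 u' s x\<bar> \<le> D * (c * exp (\<kappa> * s))"
    "\<bar>G2 u p s x - G2 u' p' s x\<bar> \<le> D * (c * exp (\<kappa> * s))"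
    "\<bar>G3 u p q s x - G3 u' p' q' s x\<bar> \<le> D * (c * exp ((\<kappa> + M) * s))"
proof -
  define e where "e = exp (M * s)"
  have e: "e > 0" "exp (- M * s) = 1 / e" "exp (2 * M * s) = e * e"
    by (simp_all add: e_def exp_minus exp_add[symmetric] inverse_eq_divide)
  have e1: "1 \<le> e" using s M1 by (simp add: e_def)
  have b: "0 \<le> u s x / e" "u s x / e \<le> M" "\<bar>p s x\<bar> / e \<le> A"
    "0 \<le> u' s x / e" "u' s x / e \<le> M" "\<bar>p' s x\<bar> / e \<le> A" "\<bar>q' s x\<bar> / e \<le> B * e"
    using admissibleD[OF ad(1) s, of x] admissibleD[OF ad(2) s, of x] e(1)
    unfolding e(3) e_def[symmetric] by (simp_all add: divide_le_eq mult.assoc)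
  define k where "k = exp (\<kappa> * s)"
  have k: "k > 0" by (simp add: k_def)
  have ke: "exp ((\<kappa> + M) * s) = k * e" by (simp add: k_def e_def exp_add[symmetric] algebra_simps)
  have df: "\<bar>u s x - u' s x\<bar> \<le> c * k" "\<bar>p s x - p' s x\<bar> \<le> c * k" "\<bar>q s x - q' s x\<bar> \<le> c * (k * e)"
  proof -
    have "\<bar>u s x - u' s x\<bar> \<le> c * exp (\<kappa> * max 0 s)" "\<bar>p s x - p' s x\<bar> \<le> c * exp (\<kappa> * max 0 s)"
      "\<bar>q s x - q' s x\<bar> \<le> c * exp ((\<kappa> + M) * max 0 s)"
      using cl unfolding close_def by blast+
    then show "\<bar>u s x - u' s x\<bar> \<le> c * k" "\<bar>p s x - p' s x\<bar> \<le> c * k" "\<bar>q s x - q' s x\<bar> \<le> c * (k * e)"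
      using s by (simp_all add: max_absorb2 ke k_def)
  qed
  have ck: "0 \<le> c * k" using c k by simp
  have cke: "c * k \<le> c * (k * e)" using e1 c k by (simp add: mult_left_mono)
  have "G1 u s x - G1 u' s x = (M - (u s x / e + u' s x / e) / 2) * (u s x - u' s x)"
    unfolding G1_def e(2) by (simp add: algebra_simps diff_divide_distrib add_divide_distrib)
  moreover have "\<bar>M - (a + b) / 2\<bar> \<le> M" if "0 \<le> a" "a \<le> M" "0 \<le> b" "b \<le> M" for a b
    using that by (simp add: abs_le_iff)
  then have Mu': "\<bar>M - (u s x / e + u' s x / e) / 2\<bar> \<le> M" using b(1,2,4,5) by blast
  have "\<bar>(M - (u s x / e + u' s x / e) / 2) * (u s x - u' s x)\<bar> \<le> M * (c * k)"
    unfolding abs_mult by (rule mult_mono[OF Mu' df(1)]) (use M1 in auto)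
  ultimately have "\<bar>G1 u s x - G1 u' s x\<bar> \<le> M * (c * k)" by (simp only:)
  also have "\<dots> \<le> D * (c * k)" using D_pos ck by (intro mult_right_mono) auto
  finally show "\<bar>G1 u s x - G1 u' s x\<bar> \<le> D * (c * exp (\<kappa> * s))" by (simp add: k_def)
  have "\<bar>M - a\<bar> \<le> M" if "0 \<le> a" "a \<le> M" for a using that by linarith
  then have Mu: "\<bar>M - u s x / e\<bar> \<le> M" using b(1,2) by blast
  have "G2 u p s x - G2 u' p' s x = (M - u s x / e) * (p s x - p' s x) - (p' s x / e) * (u s x - u' s x)"
    unfolding G2_def e(2) by (simp add: algebra_simps diff_divide_distrib add_divide_distrib)
  note abs_diff_le[OF this]
  moreover have "\<bar>(M - u s x / e) * (p s x - p' s x)\<bar> \<le> M * (c * k)"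
    unfolding abs_mult by (rule mult_mono[OF Mu df(2)]) (use M1 in auto)
  moreover have "\<bar>(p' s x / e) * (u s x - u' s x)\<bar> \<le> A * (c * k)"
    unfolding abs_mult by (rule mult_mono[OF _ df(1)]) (use b(6) e(1) A0 in auto)
  ultimately have "\<bar>G2 u p s x - G2 u' p' s x\<bar> \<le> M * (c * k) + A * (c * k)" by blast
  also have "\<dots> = (M + A) * (c * k)" by (simp add: algebra_simps)
  also have "\<dots> \<le> D * (c * k)" using A0 B0 ck by (intro mult_right_mono) (auto simp: D_def)
  finally show "\<bar>G2 u p s x - G2 u' p' s x\<bar> \<le> D * (c * exp (\<kappa> * s))" by (simp add: k_def)
  have "G3 u p q s x - G3 u' p' q' s x = (M - u s x / e) * (q s x - q' s x) - (q' s x / e) * (u s x - u' s x)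
      - (p s x / e + p' s x / e) * (p s x - p' s x)"
    unfolding G3_def e(2) by (simp add: algebra_simps diff_divide_distrib add_divide_distrib)
  note * = abs_diff_le[OF this abs_diff_le[OF refl]]
  have "\<bar>(M - u s x / e) * (q s x - q' s x)\<bar> \<le> M * (c * (k * e))"
    unfolding abs_mult by (rule mult_mono[OF Mu df(3)]) (use M1 in auto)
  moreover have "\<bar>(q' s x / e) * (u s x - u' s x)\<bar> \<le> (B * e) * (c * k)"
    unfolding abs_mult by (rule mult_mono[OF _ df(1)]) (use b(7) e(1) B0 in auto)
  moreover have "\<bar>p s x / e + p' s x / e\<bar> \<le> 2 * A"
    using b(3,6) abs_triangle_ineq[of "p s x / e" "p' s x / e"] e(1) by (simp add: abs_divide)
  then have "\<bar>(p s x / e + p' s x / e) * (p s x - p' s x)\<bar> \<le> (2 * A) * (c * (k * e))"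
    unfolding abs_mult by (rule mult_mono[OF _ order_trans[OF df(2) cke]]) (use A0 in auto)
  ultimately have "\<bar>G3 u p q s x - G3 u' p' q' s x\<bar> \<le> M * (c * (k * e)) + (B * e) * (c * k) + (2 * A) * (c * (k * e))"
    by (rule *)
  also have "\<dots> = D * (c * (k * e))" by (simp add: D_def algebra_simps)
  finally show "\<bar>G3 u p q s x - G3 u' p' q' s x\<bar> \<le> D * (c * exp ((\<kappa> + M) * s))" by (simp add: ke)
qed

lemma close_step:
  assumes ad: "admissible u p q" "admissible u' p' q'" and cl: "close c u p q u' p' q'" and c: "0 \<le> c"
  shows "close (c / 2) (duhamel \<phi> (G1 u)) (duhamel \<phi>' (G2 u p)) (duhamel \<phi>'' (G3 u p q))
    (duhamel \<phi> (G1 u')) (duhamel \<phi>' (G2 u' p')) (duhamel \<phi>'' (G3 u' p' q'))"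
proof -
  have l: "loc_bdd_cont u" "loc_bdd_cont p" "loc_bdd_cont q" "loc_bdd_cont u'" "loc_bdd_cont p'" "loc_bdd_cont q'"
    using ad by (auto simp: admissible_def)
  note L = G_loc_bdd_cont[OF l(1-3)] and L' = G_loc_bdd_cont[OF l(4-6)]
  note Gd = G_differences[OF _ ad cl c]
  have *: "\<bar>duhamel \<psi> g t x - duhamel \<psi> g' t x\<bar> \<le> c / 2 * exp (k * max 0 t)"
    if lb: "loc_bdd_cont g" "loc_bdd_cont g'" and k: "\<kappa> \<le> k"
      and dg: "\<And>s x. 0 \<le> s \<Longrightarrow> \<bar>g s x - g' s x\<bar> \<le> D * (c * exp (k * s))" for \<psi> g g' k t x
  proof -
    have k0: "k > 0" using k \<kappa>_pos by simp
    have "\<bar>duhamel (\<lambda>x. 0) (\<lambda>s x. g s x - g' s x) t x\<bar>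
       \<le> 0 + \<bar>(D * c / k) * exp (k * max 0 t) - (D * c / k) * exp (k * 0)\<bar>"
    proof (rule duhamel_abs_le[OF loc_bdd_cont_diff[OF lb] _ exp_deriv])
      show "\<bar>g s x - g' s x\<bar> \<le> D * c / k * (k * exp (k * s))" if "0 \<le> s" for s x
        using dg[OF that, of x] k0 by (simp add: mult_ac)
    qed simp
    also have "\<dots> = (D * c / k) * (exp (k * max 0 t) - 1)"
    proof -
      have "0 \<le> (D * c / k) * (exp (k * max 0 t) - 1)" using D_pos c k0 by (intro mult_nonneg_nonneg) auto
      then show ?thesis by (simp add: right_diff_distrib)
    qed
    also have "\<dots> \<le> (D * c / k) * exp (k * max 0 t)"
      using D_pos c k0 by (intro mult_left_mono) auto
    also have "\<dots> \<le> c / 2 * exp (k * max 0 t)"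
    proof (rule mult_right_mono)
      have "c * (2 * D) \<le> c * k" using c k by (intro mult_left_mono) (auto simp: \<kappa>_def)
      then show "D * c / k \<le> c / 2" using k0 by (simp add: field_simps)
    qed simp
    finally show ?thesis by (simp add: duhamel_diff[OF lb])
  qed
  show ?thesis unfolding close_def
    using *[OF L(1) L'(1) order_refl Gd(1)] *[OF L(2) L'(2) order_refl Gd(2)] *[OF L(3) L'(3) _ Gd(3)] M1 by auto
qed

primrec iter :: "nat \<Rightarrow> (real \<Rightarrow> real \<Rightarrow> real) \<times> (real \<Rightarrow> real \<Rightarrow> real) \<times> (real \<Rightarrow> real \<Rightarrow> real)" where
  "iter 0 = (\<lambda>_ _. 0, \<lambda>_ _. 0, \<lambda>_ _. 0)"
| "iter (Suc k) = (case iter k of (u, p, q) \<Rightarrow> (duhamel \<phi> (G1 u), duhamel \<phi>' (G2 u p), duhamel \<phi>'' (G3 u p q)))"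

definition "U k = fst (iter k)"
definition "P k = fst (snd (iter k))"
definition "R k = snd (snd (iter k))"

lemma iter_simps: "U (Suc k) = duhamel \<phi> (G1 (U k))" "P (Suc k) = duhamel \<phi>' (G2 (U k) (P k))"
  "R (Suc k) = duhamel \<phi>'' (G3 (U k) (P k) (R k))" "U 0 = (\<lambda>_ _. 0)" "P 0 = (\<lambda>_ _. 0)" "R 0 = (\<lambda>_ _. 0)"
  by (simp_all add: U_def P_def R_def case_prod_unfold)

lemma admissible_iter: "admissible (U k) (P k) (R k)"
proof (induction k)
  case 0
  then show ?case using M1 A0 B0 loc_bdd_cont_const[of 0] by (simp add: iter_simps admissible_def)
next
  case (Suc k)
  then show ?case unfolding iter_simps by (rule admissible_step)
qed

lemma exp_mono_max: "k \<le> k' \<Longrightarrow> exp (k * max 0 t) \<le> exp (k' * max 0 t)" for k k' t :: real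
  by (simp add: mult_right_mono max_def)

lemma close_iter: "close ((M + A + B) * (1 / 2) ^ k) (U (Suc k)) (P (Suc k)) (R (Suc k)) (U k) (P k) (R k)"
proof (induction k)
  case 0
  have "admissible (U 1) (P 1) (R 1)" by (rule admissible_iter)
  then have b: "\<bar>U 1 t x\<bar> \<le> M * exp (M * max 0 t)" "\<bar>P 1 t x\<bar> \<le> A * exp (M * max 0 t)" "\<bar>R 1 t x\<bar> \<le> B * exp (2 * M * max 0 t)" for t x
    unfolding admissible_def by auto
  have "\<bar>U 1 t x\<bar> \<le> (M + A + B) * exp (\<kappa> * max 0 t)" for t x
    by (rule order_trans[OF b(1)], rule mult_mono) (use M1 A0 B0 exp_mono_max[OF \<kappa>_pos(2), of t] in auto)
  moreover have "\<bar>P 1 t x\<bar> \<le> (M + A + B) * exp (\<kappa> * max 0 t)" for t x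
    by (rule order_trans[OF b(2)], rule mult_mono) (use M1 A0 B0 exp_mono_max[OF \<kappa>_pos(2), of t] in auto)
  moreover have "\<bar>R 1 t x\<bar> \<le> (M + A + B) * exp ((\<kappa> + M) * max 0 t)" for t x
    by (rule order_trans[OF b(3)], rule mult_mono) (use M1 A0 B0 \<kappa>_pos exp_mono_max[of "2 * M" "\<kappa> + M" t] in auto)
  ultimately show ?case by (simp add: close_def iter_simps(4-6))
next
  case (Suc k)
  have "0 \<le> (M + A + B) * (1 / 2) ^ k" using M1 A0 B0 by simp
  from close_step[OF admissible_iter admissible_iter Suc this]
  show ?case by (simp only: iter_simps[symmetric]) (simp add: field_simps)
qed

lemma iter_has_derivative:
  "DERIV (U k t) x :> P k t x" "DERIV (P k t) x :> R k t x"
proof (induction k arbitrary: t x)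
  case 0
  { case 1 then show ?case by (simp add: iter_simps) }
  { case 2 then show ?case by (simp add: iter_simps) }
next
  case (Suc k)
  have l: "loc_bdd_cont (U k)" "loc_bdd_cont (P k)" "loc_bdd_cont (R k)"
    using admissible_iter[of k] by (auto simp: admissible_def)
  note L = G_loc_bdd_cont[OF l]
  { case 1
    have "DERIV (G1 (U k) s) x :> G2 (U k) (P k) s x" for s x
      unfolding G1_def[abs_def] G2_def by (auto intro!: derivative_eq_intros Suc simp: algebra_simps)
    then show ?case unfolding iter_simps
      by (rule duhamel_has_derivative_x[OF d\<phi>(1) cont\<phi>(2) \<phi>abs \<phi>A L(1) L(2)]) }
  { case 2
    have "DERIV (G2 (U k) (P k) s) x :> G3 (U k) (P k) (R k) s x" for s x
      unfolding G2_def[abs_def] G3_def by (auto intro!: derivative_eq_intros Suc simp: algebra_simps)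
    then show ?case unfolding iter_simps
      by (rule duhamel_has_derivative_x[OF d\<phi>(2) c\<phi> \<phi>A \<phi>B L(2) L(3)]) }
qed

lemma ex_strong_sol: "\<exists>u. strong_sol \<phi> u"
proof -
  define C where "C = M + A + B"
  have C0: "0 \<le> C" using M1 A0 B0 by (simp add: C_def)
  have cl: "\<bar>U (Suc k) t x - U k t x\<bar> \<le> C * (1 / 2) ^ k * exp (\<kappa> * max 0 t)"
    "\<bar>P (Suc k) t x - P k t x\<bar> \<le> C * (1 / 2) ^ k * exp (\<kappa> * max 0 t)"
    "\<bar>R (Suc k) t x - R k t x\<bar> \<le> C * (1 / 2) ^ k * exp ((\<kappa> + M) * max 0 t)" for k t x
    using close_iter[of k] unfolding close_def C_def by blast+
  have ex: "\<exists>F. \<forall>k t x. \<bar>F t x - f k t x\<bar> \<le> 2 * C * (1 / 2) ^ k * exp (m * max 0 t)"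
    if "\<And>k t x. \<bar>f (Suc k) t x - f k t x\<bar> \<le> C * (1 / 2) ^ k * exp (m * max 0 t)"
    for f :: "nat \<Rightarrow> real \<Rightarrow> real \<Rightarrow> real" and m
  proof -
    have "\<bar>f (Suc k) (fst q) (snd q) - f k (fst q) (snd q)\<bar> \<le> C * (1 / 2) ^ k * exp (m * max 0 (fst q))" for k q
      by (rule that)
    from weighted_limit[of "\<lambda>k q. f k (fst q) (snd q)" C "1 / 2" "\<lambda>q. exp (m * max 0 (fst q))", OF this]
    obtain F where "\<And>k q. \<bar>F q - f k (fst q) (snd q)\<bar> \<le> C / (1 - 1 / 2) * (1 / 2) ^ k * exp (m * max 0 (fst q))"
      by auto
    then show ?thesis by (intro exI[of _ "\<lambda>t x. F (t, x)"]) (auto simp: mult.commute)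
  qed
  obtain u where u: "\<And>k t x. \<bar>u t x - U k t x\<bar> \<le> 2 * C * (1 / 2) ^ k * exp (\<kappa> * max 0 t)" using ex[of U \<kappa>, OF cl(1)] by blast
  obtain p where p: "\<And>k t x. \<bar>p t x - P k t x\<bar> \<le> 2 * C * (1 / 2) ^ k * exp (\<kappa> * max 0 t)" using ex[of P \<kappa>, OF cl(2)] by blast
  obtain q where q: "\<And>k t x. \<bar>q t x - R k t x\<bar> \<le> 2 * C * (1 / 2) ^ k * exp ((\<kappa> + M) * max 0 t)" using ex[of R "\<kappa> + M", OF cl(3)] by blast
  have lim: "(\<lambda>k. f k t x) \<longlonglongrightarrow> F t x"
    if "\<And>k t x. \<bar>F t x - f k t x\<bar> \<le> 2 * C * (1 / 2) ^ k * exp (m * max 0 t)"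
    for f :: "nat \<Rightarrow> real \<Rightarrow> real \<Rightarrow> real" and m F t x
    using weighted_limit_tendsto[of "\<lambda>x. F t x" "\<lambda>k x. f k t x" "2 * C" "1 / 2" "\<lambda>x. exp (m * max 0 t)"] that by auto
  have lu: "(\<lambda>k. U k t x) \<longlonglongrightarrow> u t x" and lp: "(\<lambda>k. P k t x) \<longlonglongrightarrow> p t x" and lq: "(\<lambda>k. R k t x) \<longlonglongrightarrow> q t x" for t x
    using lim[of u U \<kappa> t x, OF u] lim[of p P \<kappa> t x, OF p] lim[of q R "\<kappa> + M" t x, OF q] by blast+
  have ai: "loc_bdd_cont (U k)" "loc_bdd_cont (P k)" "loc_bdd_cont (R k)"
    "0 \<le> U k t x" "U k t x \<le> M * exp (M * max 0 t)" "\<bar>P k t x\<bar> \<le> A * exp (M * max 0 t)"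
    "\<bar>R k t x\<bar> \<le> B * exp (2 * M * max 0 t)" for k t x
    using admissible_iter[of k] unfolding admissible_def by blast+
  have cont: "continuous_on UNIV (\<lambda>(t, x). F t x)"
    if "\<And>k t x. \<bar>F t x - f k t x\<bar> \<le> 2 * C * (1 / 2) ^ k * exp (m * max 0 t)" "\<And>k. loc_bdd_cont (f k)"
    for f :: "nat \<Rightarrow> real \<Rightarrow> real \<Rightarrow> real" and m F
  proof -
    have "continuous_on UNIV (\<lambda>q. F (fst q) (snd q))"
    proof (rule weighted_limit_continuous[where f = "\<lambda>k q. f k (fst q) (snd q)" and r = "1 / 2" and W = "\<lambda>q. exp (m * max 0 (fst q))"])
      show "\<bar>F (fst q) (snd q) - f k (fst q) (snd q)\<bar> \<le> 2 * C * (1 / 2) ^ k * exp (m * max 0 (fst q))" for k q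
        by (rule that(1))
      show "continuous_on UNIV (\<lambda>q. f k (fst q) (snd q))" for k
        using loc_bdd_contD(1)[OF that(2)[of k]] by (simp add: case_prod_unfold)
    qed (auto intro!: continuous_intros)
    then show ?thesis by (simp add: case_prod_unfold)
  qed
  note uc = cont[OF u ai(1)] and pc = cont[OF p ai(2)] and qc = cont[OF q ai(3)]
  have ub: "0 \<le> u t x" "u t x \<le> M * exp (M * max 0 t)" "\<bar>p t x\<bar> \<le> A * exp (M * max 0 t)"
    "\<bar>q t x\<bar> \<le> B * exp (2 * M * max 0 t)" for t x
  proof -
    show "0 \<le> u t x" using LIMSEQ_le_const[OF lu] ai(4) by blast
    show "u t x \<le> M * exp (M * max 0 t)" using LIMSEQ_le_const2[OF lu] ai(5) by blast
    show "\<bar>p t x\<bar> \<le> A * exp (M * max 0 t)" using LIMSEQ_le_const2[OF tendsto_rabs[OF lp]] ai(6) by blast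
    show "\<bar>q t x\<bar> \<le> B * exp (2 * M * max 0 t)" using LIMSEQ_le_const2[OF tendsto_rabs[OF lq]] ai(7) by blast
  qed
  have lbc: "loc_bdd_cont F" if "continuous_on UNIV (\<lambda>(t, x). F t x)" "\<And>t x. \<bar>F t x\<bar> \<le> K * exp (m * max 0 t)" "0 \<le> K" "0 \<le> m"
    for F :: "real \<Rightarrow> real \<Rightarrow> real" and K m
  proof (rule loc_bdd_contI[OF that(1)])
    fix T :: real
    have "\<bar>F s x\<bar> \<le> K * exp (m * \<bar>T\<bar>)" if "\<bar>s\<bar> \<le> T" for s x
      by (rule order_trans[OF \<open>\<bar>F s x\<bar> \<le> K * exp (m * max 0 s)\<close>], rule mult_left_mono)
        (use that \<open>0 \<le> K\<close> \<open>0 \<le> m\<close> in \<open>auto intro!: mult_left_mono\<close>)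
    then show "\<exists>B. \<forall>s x. \<bar>s\<bar> \<le> T \<longrightarrow> \<bar>F s x\<bar> \<le> B" by blast
  qed
  have ul: "loc_bdd_cont u" "loc_bdd_cont p" "loc_bdd_cont q"
    using lbc[OF uc, of M M] lbc[OF pc, of A M] lbc[OF qc, of B "2 * M"] ub M1 A0 B0 by auto
  have adm: "admissible u p q" unfolding admissible_def using ul ub by blast
  \<comment> \<open>The limit is a fixed point because the contraction brings its image to half the
    distance that the limit has to the iterates. Duhamel's formula is the only source of the time
    derivative, so this has to be known for the function and for its second space
    derivative.\<close>
  have fix_eq: "duhamel \<phi> (G1 u) t x = u t x" "duhamel \<phi>'' (G3 u p q) t x = q t x" for t x
  proof -
    have "close (2 * C * (1 / 2) ^ k) u p q (U k) (P k) (R k)" for k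
      unfolding close_def using u p q by blast
    then have "close (2 * C * (1 / 2) ^ k / 2) (duhamel \<phi> (G1 u)) (duhamel \<phi>' (G2 u p)) (duhamel \<phi>'' (G3 u p q))
        (U (Suc k)) (P (Suc k)) (R (Suc k))" for k
      unfolding iter_simps using C0 by (intro close_step adm admissible_iter) auto
    then have b: "\<bar>duhamel \<phi> (G1 u) t x - U (Suc k) t x\<bar> \<le> C * (1 / 2) ^ k * exp (\<kappa> * max 0 t)"
      "\<bar>duhamel \<phi>'' (G3 u p q) t x - R (Suc k) t x\<bar> \<le> C * (1 / 2) ^ k * exp ((\<kappa> + M) * max 0 t)" for k t x
      unfolding close_def by auto
    have "(\<lambda>k. U (Suc k) t x) \<longlonglongrightarrow> duhamel \<phi> (G1 u) t x"
      using weighted_limit_tendsto[of "\<lambda>x. duhamel \<phi> (G1 u) t x" "\<lambda>k x. U (Suc k) t x" C "1 / 2" "\<lambda>x. exp (\<kappa> * max 0 t)"] b(1) by auto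
    then show "duhamel \<phi> (G1 u) t x = u t x" using LIMSEQ_unique LIMSEQ_Suc[OF lu] by blast
    have "(\<lambda>k. R (Suc k) t x) \<longlonglongrightarrow> duhamel \<phi>'' (G3 u p q) t x"
      using weighted_limit_tendsto[of "\<lambda>x. duhamel \<phi>'' (G3 u p q) t x" "\<lambda>k x. R (Suc k) t x" C "1 / 2" "\<lambda>x. exp ((\<kappa> + M) * max 0 t)"] b(2) by auto
    then show "duhamel \<phi>'' (G3 u p q) t x = q t x" using LIMSEQ_unique LIMSEQ_Suc[OF lq] by blast
  qed
  have du: "DERIV (u t) x :> p t x" for t x
    by (rule has_derivative_uniform_limit[where F' = "p t" and C = "2 * C * exp (\<kappa> * max 0 t)" and r = "1 / 2", OF iter_has_derivative(1) lu])
      (use p[of t] in \<open>simp_all add: mult_ac\<close>)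
  have dp: "DERIV (p t) x :> q t x" for t x
    by (rule has_derivative_uniform_limit[where F' = "q t" and C = "2 * C * exp ((\<kappa> + M) * max 0 t)" and r = "1 / 2", OF iter_has_derivative(2) lp])
      (use q[of t] in \<open>simp_all add: mult_ac\<close>)
  have dt: "DERIV (\<lambda>t. u t x) t :> G1 u t x + q t x / 2" if "0 < t" for t x
  proof -
    have "DERIV (\<lambda>t. duhamel \<phi> (G1 u) t x) t :> G1 u t x + duhamel \<phi>'' (G3 u p q) t x / 2"
    proof (rule duhamel_has_derivative_t[OF d\<phi> c\<phi> \<phi>abs \<phi>A \<phi>B G_loc_bdd_cont[OF ul] _ _ that])
      show "DERIV (G1 u s) x :> G2 u p s x" for s x
        unfolding G1_def[abs_def] G2_def by (auto intro!: derivative_eq_intros du simp: algebra_simps)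
      show "DERIV (G2 u p s) x :> G3 u p q s x" for s x
        unfolding G2_def[abs_def] G3_def by (auto intro!: derivative_eq_intros du dp simp: algebra_simps)
    qed
    then show ?thesis by (simp add: fix_eq)
  qed
  \<comment> \<open>Undoes the exponential substitution, and is frozen at negative times in the same
    way as \<open>duhamel\<close>.\<close>
  define E where "E t = exp (- M * max 0 t)" for t
  have cE: "continuous_on UNIV (\<lambda>q :: real \<times> real. E (fst q))"
    unfolding E_def by (auto intro!: continuous_intros)
  have E1: "E t * exp (M * max 0 t) = 1" for t by (simp add: E_def exp_add[symmetric])
  show ?thesis
  proof (rule exI[of _ "\<lambda>t x. E t * u t x"], unfold strong_sol_def, intro conjI)
    show "(\<lambda>x. E 0 * u 0 x) = \<phi>" by (simp add: E_def fix_eq[symmetric] duhamel_0)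
    show "\<forall>t x. 0 \<le> E t * u t x" using ub by (simp add: E_def)
    have "E t * u t x \<le> M" for t x
    proof -
      have "E t * u t x \<le> E t * (M * exp (M * max 0 t))" by (rule mult_left_mono[OF ub(2)]) (simp add: E_def)
      also have "\<dots> = M * (E t * exp (M * max 0 t))" by simp
      finally show ?thesis by (simp add: E1)
    qed
    then show "\<exists>B. \<forall>t x. E t * u t x \<le> B" by blast
    show "continuous_on UNIV (\<lambda>(t, x). E t * u t x)"
      using cE uc by (auto simp: case_prod_unfold intro!: continuous_intros)
    show "\<exists>p q. continuous_on UNIV (\<lambda>(t, x). p t x) \<and> continuous_on UNIV (\<lambda>(t, x). q t x) \<and>
        (\<forall>t x. DERIV (\<lambda>x. E t * u t x) x :> p t x) \<and>
        (\<forall>t x. DERIV (p t) x :> q t x) \<and>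
        (\<forall>t>0. \<forall>x. DERIV (\<lambda>r. E r * u r x) t :> q t x / 2 - (E t * u t x)\<^sup>2 / 2)"
    proof (rule exI[of _ "\<lambda>t x. E t * p t x"], rule exI[of _ "\<lambda>t x. E t * q t x"], intro conjI allI impI)
      show "continuous_on UNIV (\<lambda>(t, x). E t * p t x)" "continuous_on UNIV (\<lambda>(t, x). E t * q t x)"
        using cE pc qc by (auto simp: case_prod_unfold intro!: continuous_intros)
      show "DERIV (\<lambda>x. E t * u t x) x :> E t * p t x" for t x
        by (rule DERIV_cmult[OF du])
      show "DERIV (\<lambda>x. E t * p t x) x :> E t * q t x" for t x
        by (rule DERIV_cmult[OF dp])
      fix t x :: real assume t: "0 < t"
      have Et: "E t = exp (- M * t)" using t by (simp add: E_def)
      have D: "DERIV (\<lambda>r. exp (- M * r) * u r x) t :> E t * q t x / 2 - (E t * u t x)\<^sup>2 / 2"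
        unfolding Et by (auto intro!: derivative_eq_intros dt[OF t] simp: G1_def algebra_simps power2_eq_square)
      have ev: "\<forall>\<^sub>F r in nhds t. E r * u r x = exp (- M * r) * u r x"
        using eventually_nhds_in_open[of "{0<..}" t] t by (auto elim!: eventually_mono simp: E_def)
      show "DERIV (\<lambda>r. E r * u r x) t :> E t * q t x / 2 - (E t * u t x)\<^sup>2 / 2"
        by (rule DERIV_cong_ev[OF refl ev refl, THEN iffD2]) (rule D)
    qed
  qed
qed

end

lemma strong_sol_exists:
  assumes "\<And>x. DERIV \<phi> x :> \<phi>' x" "\<And>x. DERIV \<phi>' x :> \<phi>'' x"
    and "continuous_on UNIV \<phi>''" "\<And>x. 0 \<le> \<phi> x" "\<And>x. \<phi> x \<le> M" "\<And>x. \<bar>\<phi>' x\<bar> \<le> A" "\<And>x. \<bar>\<phi>'' x\<bar> \<le> B"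
  shows "\<exists>u. strong_sol \<phi> u"
proof -
  \<comment> \<open>The constants are enlarged to meet the normalisations \<open>1 \<le> M\<close>
    and \<open>A^2 \<le> B\<close> of the locale.\<close>
  interpret picard \<phi> \<phi>' \<phi>'' "max 1 M" A "max B (A\<^sup>2)"
    by unfold_locales (use assms in \<open>auto simp: le_max_iff_disj\<close>)
  show ?thesis by (rule ex_strong_sol)
qed

lemma strong_sol_log_laplace_sol:
  assumes "strong_sol \<phi> u"
  shows "log_laplace_sol \<phi> u"
proof -
  obtain B p q where u: "u 0 = \<phi>" "\<And>t x. 0 \<le> u t x" "\<And>t x. u t x \<le> B"
     "continuous_on UNIV (\<lambda>(t, x). u t x)"
     "\<And>t x. DERIV (u t) x :> p t x" "\<And>t x. DERIV (p t) x :> q t x"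
     "\<And>t x. 0 < t \<Longrightarrow> DERIV (\<lambda>r. u r x) t :> q t x / 2 - (u t x)\<^sup>2 / 2"
    using assms unfolding strong_sol_def by blast
  have d1: "deriv (u t) = p t" for t using DERIV_imp_deriv[OF u(5)] by blast
  have d2: "deriv (p t) = q t" for t using DERIV_imp_deriv[OF u(6)] by blast
  show ?thesis unfolding log_laplace_sol_def
  proof (intro conjI allI impI)
    show "\<exists>B. \<forall>s\<ge>0. \<forall>y. \<bar>u s y\<bar> \<le> B" using u(2,3) by (intro exI[of _ B]) auto
    show "continuous_on ({0..} \<times> UNIV) (\<lambda>(s, y). u s y)" using u(4) continuous_on_subset by blast
    show "u s differentiable at y" "deriv (u s) differentiable at y" for s y
      unfolding d1 real_differentiable_def using u(5,6) by blast+
  qed (use u d1 d2 in auto)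
qed

section \<open>Approximate point masses and their solutions\<close>

lemma DERIV_pos_part_power:
  fixes y :: real assumes "2 \<le> n"
  shows "DERIV (\<lambda>y. max 0 y ^ n) y :> real n * max 0 y ^ (n - 1)"
proof -
  consider "y > 0" | "y < 0" | "y = 0" by linarith
  then show ?thesis
  proof cases
    case 1
    have D: "DERIV (\<lambda>y. y ^ n) y :> real n * max 0 y ^ (n - 1)"
      using DERIV_pow[of n y] 1 by (simp add: max_absorb2)
    have "\<forall>\<^sub>F x in nhds y. max 0 x ^ n = x ^ n"
      using eventually_nhds_in_open[of "{0<..}" y] 1 by (auto elim!: eventually_mono)
    from DERIV_cong_ev[OF refl this refl, THEN iffD2, OF D] show ?thesis .
  next
    case 2
    have D: "DERIV (\<lambda>y. 0) y :> real n * max 0 y ^ (n - 1)"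
      using 2 assms by (simp add: max_absorb1 power_0_left)
    have "\<forall>\<^sub>F x in nhds y. max 0 x ^ n = 0"
      using eventually_nhds_in_open[of "{..<0}" y] 2 assms by (auto elim!: eventually_mono)
    from DERIV_cong_ev[OF refl this refl, THEN iffD2, OF D] show ?thesis .
  next
    case 3
    have "((\<lambda>h :: real. max 0 h ^ n / h) \<longlongrightarrow> 0) (at 0)"
    proof (rule Lim_null_comparison)
      have "norm (max 0 h ^ n / h) \<le> \<bar>h\<bar> ^ (n - 1)" if "h \<noteq> 0" for h :: real
      proof (cases "h > 0")
        case True
        have "h ^ n = h * h ^ (n - 1)" using assms by (cases n) auto
        then show ?thesis using True by (simp add: max_absorb2)
      qed (use assms in \<open>simp add: max_absorb1 power_0_left\<close>)
      then show "\<forall>\<^sub>F h in at 0. norm (max 0 h ^ n / h) \<le> \<bar>h :: real\<bar> ^ (n - 1)"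
        by (simp add: eventually_at_filter)
      have "((\<lambda>h :: real. \<bar>h\<bar> ^ (n - 1)) \<longlongrightarrow> \<bar>0\<bar> ^ (n - 1)) (at 0)" by (intro tendsto_intros)
      then show "((\<lambda>h :: real. \<bar>h\<bar> ^ (n - 1)) \<longlongrightarrow> 0) (at 0)" using assms by (simp add: power_0_left)
    qed
    then show ?thesis using 3 assms by (simp add: has_field_derivative_iff power_0_left)
  qed
qed

text \<open>The third power makes the truncation twice continuously differentiable, as the Picard
  construction demands of initial values.\<close>

definition bump :: "real \<Rightarrow> real" where "bump x = max 0 (1 - x\<^sup>2) ^ 3"
definition bump' :: "real \<Rightarrow> real" where "bump' x = - 6 * x * max 0 (1 - x\<^sup>2) ^ 2"
definition bump'' :: "real \<Rightarrow> real" where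
  "bump'' x = 24 * x\<^sup>2 * max 0 (1 - x\<^sup>2) - 6 * max 0 (1 - x\<^sup>2) ^ 2"

lemma bump_deriv: "DERIV bump x :> bump' x"
proof -
  have "DERIV (\<lambda>x. max 0 (1 - x\<^sup>2) ^ 3) x :> real 3 * max 0 (1 - x\<^sup>2) ^ (3 - 1) * (- (2 * x))"
    by (rule DERIV_chain2[OF DERIV_pos_part_power]) (auto intro!: derivative_eq_intros)
  then show ?thesis by (simp add: bump_def[abs_def] bump'_def algebra_simps)
qed

lemma bump'_deriv: "DERIV bump' x :> bump'' x"
proof -
  have "DERIV (\<lambda>x. max 0 (1 - x\<^sup>2) ^ 2) x :> real 2 * max 0 (1 - x\<^sup>2) ^ (2 - 1) * (- (2 * x))"
    by (rule DERIV_chain2[OF DERIV_pos_part_power]) (auto intro!: derivative_eq_intros)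
  from DERIV_mult[OF DERIV_cmult[OF DERIV_ident, of "- 6"] this]
  have "((\<lambda>x. - 6 * x * max 0 (1 - x\<^sup>2) ^ 2) has_real_derivative
      - 6 * 1 * max 0 (1 - x\<^sup>2) ^ 2 + real 2 * max 0 (1 - x\<^sup>2) ^ (2 - 1) * (- (2 * x)) * (- 6 * x)) (at x)" by (simp only:)
  then show ?thesis by (simp add: bump'_def[abs_def] bump''_def algebra_simps power2_eq_square[of x])
qed

lemma bump''_cont: "continuous_on UNIV bump''"
  unfolding bump''_def[abs_def] by (intro continuous_intros)

lemma bump_cont: "continuous_on UNIV bump"
  unfolding bump_def[abs_def] by (intro continuous_intros)

lemma bump_bounds: "0 \<le> bump x" "bump x \<le> 1" "\<bar>bump' x\<bar> \<le> 6" "\<bar>bump'' x\<bar> \<le> 30"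
proof -
  define m where "m = max 0 (1 - x\<^sup>2)"
  have m: "0 \<le> m" "m \<le> 1" by (auto simp: m_def)
  show "0 \<le> bump x" by (simp add: bump_def)
  show "bump x \<le> 1" using m by (simp add: bump_def m_def[symmetric] power_le_one)
  have xm: "m = 0 \<or> x\<^sup>2 \<le> 1" by (auto simp: m_def max_def)
  then have xm': "m = 0 \<or> \<bar>x\<bar> \<le> 1" using abs_square_le_1 by blast
  have m2: "0 \<le> m\<^sup>2" "m\<^sup>2 \<le> 1" using m by (auto simp: power_le_one)
  show "\<bar>bump' x\<bar> \<le> 6"
    using xm' m2 by (auto simp: bump'_def m_def[symmetric] abs_mult mult_le_one)
  have "0 \<le> x\<^sup>2 * m" "x\<^sup>2 * m \<le> 1" using xm m by (auto simp: mult_le_one)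
  moreover have "bump'' x = 24 * (x\<^sup>2 * m) - 6 * m\<^sup>2" by (simp add: bump''_def m_def)
  ultimately show "\<bar>bump'' x\<bar> \<le> 30" using m2 by linarith
qed

lemma bump_outside: "1 \<le> \<bar>x\<bar> \<Longrightarrow> bump x = 0"
  using abs_le_square_iff[of 1 x] by (simp add: bump_def max_absorb1)

lemma bump_minus [simp]: "bump (- x) = bump x"
  by (simp add: bump_def)

lemma bump_integrable: "integrable lborel bump"
proof -
  have "integrable lborel (\<lambda>x. indicator {-1..1} x *\<^sub>R bump x)"
    by (rule borel_integrable_compact) (auto intro: continuous_on_subset[OF bump_cont])
  moreover have "(\<lambda>x. indicator {-1..1} x *\<^sub>R bump x) = bump"
  proof
    show "indicator {-1..1} x *\<^sub>R bump x = bump x" for x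
      using bump_outside[of x] by (cases "x \<in> {-1..1}") auto
  qed
  ultimately show ?thesis by simp
qed

definition bump_mass :: real where "bump_mass = (\<integral>x. bump x \<partial>lborel)"

lemma bump_mass_pos: "0 < bump_mass"
proof -
  have "bump_mass \<noteq> 0"
  proof
    assume "bump_mass = 0"
    then have "AE x in lborel. bump x = 0"
      using integral_nonneg_eq_0_iff_AE[OF bump_integrable] bump_bounds(1) by (simp add: bump_mass_def)
    then have "AE x\<in>{-1/2..1/2 :: real} in lborel. False"
    proof eventually_elim
      case (elim x)
      have "x\<^sup>2 < 1" if "x \<in> {-1/2..1/2}" using abs_square_less_1[of x] that by auto
      then show ?case using elim by (auto simp: bump_def max_def)
    qed
    then have "emeasure lborel {-1/2..1/2 :: real} = 0"
      by (subst (asm) AE_iff_measurable[OF _ refl]) (auto simp: Collect_conj_eq atLeastAtMost_def atLeast_def atMost_def)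
    moreover have "emeasure lborel {-1/2..1/2 :: real} = 1" by (subst emeasure_lborel_Icc) auto
    ultimately show False by simp
  qed
  moreover have "0 \<le> bump_mass" unfolding bump_mass_def by (rule Bochner_Integration.integral_nonneg) (simp add: bump_bounds)
  ultimately show ?thesis by simp
qed

text \<open>For \<open>N > 0\<close> a bump of total mass \<open>l\<close>, supported within
  distance \<open>1 / N\<close> of \<open>x0\<close>.\<close>

definition approx_delta :: "real \<Rightarrow> real \<Rightarrow> real \<Rightarrow> real \<Rightarrow> real" where
  "approx_delta l N x0 x = l / bump_mass * N * bump (N * (x - x0))"

lemma approx_delta_test_fun:
  assumes "0 \<le> l" "0 < N"
  shows "test_fun (approx_delta l N x0)"
  unfolding test_fun_def
proof (intro conjI)
  show "continuous_on UNIV (approx_delta l N x0)" unfolding approx_delta_def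
    by (intro continuous_intros continuous_on_compose2[OF bump_cont]) auto
  show "\<forall>y. 0 \<le> approx_delta l N x0 y"
    using assms bump_mass_pos bump_bounds(1) by (simp add: approx_delta_def)
  have "approx_delta l N x0 y = 0" if "\<bar>x0\<bar> + 1 / N < \<bar>y\<bar>" for y
  proof -
    have "1 / N \<le> \<bar>y - x0\<bar>" using that by linarith
    then have "1 \<le> \<bar>N * (y - x0)\<bar>" using assms(2) by (simp add: abs_mult divide_le_eq mult.commute)
    then show ?thesis by (simp add: approx_delta_def bump_outside)
  qed
  then show "\<exists>R. \<forall>y. R < \<bar>y\<bar> \<longrightarrow> approx_delta l N x0 y = 0" by blast
qed

lemma approx_delta_bounds:
  assumes "0 \<le> l" "0 < N"
  shows "0 \<le> approx_delta l N x0 x" "approx_delta l N x0 x \<le> l / bump_mass * N"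
    "1 / N \<le> \<bar>x - x0\<bar> \<Longrightarrow> approx_delta l N x0 x = 0"
proof -
  show "0 \<le> approx_delta l N x0 x" using assms bump_mass_pos bump_bounds(1) by (simp add: approx_delta_def)
  have "l / bump_mass * N * bump (N * (x - x0)) \<le> l / bump_mass * N * 1"
    by (rule mult_left_mono) (use assms bump_mass_pos bump_bounds in auto)
  then show "approx_delta l N x0 x \<le> l / bump_mass * N" by (simp add: approx_delta_def)
  assume "1 / N \<le> \<bar>x - x0\<bar>"
  then have "1 \<le> \<bar>N * (x - x0)\<bar>" using assms(2) by (simp add: abs_mult divide_le_eq mult.commute)
  then show "approx_delta l N x0 x = 0" by (simp add: approx_delta_def bump_outside)
qed

lemma approx_delta_strong_sol:
  assumes "0 \<le> l" "0 < N"
  shows "\<exists>u. strong_sol (approx_delta l N x0) u"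
proof -
  define k where "k = l / bump_mass * N"
  have k: "0 \<le> k" using assms bump_mass_pos by (simp add: k_def)
  have c: "DERIV (\<lambda>x. N * (x - x0)) x :> N" for x by (auto intro!: derivative_eq_intros)
  show ?thesis
  proof (rule strong_sol_exists)
    show "DERIV (approx_delta l N x0) x :> k * (bump' (N * (x - x0)) * N)" for x
      unfolding approx_delta_def[abs_def] k_def by (rule DERIV_cmult[OF DERIV_chain2[OF bump_deriv c]])
    show "DERIV (\<lambda>x. k * (bump' (N * (x - x0)) * N)) x :> k * (bump'' (N * (x - x0)) * N * N)" for x
      by (rule DERIV_cmult[OF DERIV_cmult_right[OF DERIV_chain2[OF bump'_deriv c]]])
    show "continuous_on UNIV (\<lambda>x. k * (bump'' (N * (x - x0)) * N * N))"
      by (intro continuous_intros continuous_on_compose2[OF bump''_cont]) auto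
    show "0 \<le> approx_delta l N x0 x" "approx_delta l N x0 x \<le> l / bump_mass * N" for x
      using approx_delta_bounds[OF assms] by auto
    show "\<bar>k * (bump' (N * (x - x0)) * N)\<bar> \<le> k * (6 * N)" for x
      unfolding abs_mult using k assms bump_bounds(3) by (intro mult_mono) auto
    show "\<bar>k * (bump'' (N * (x - x0)) * N * N)\<bar> \<le> k * (30 * N * N)" for x
      unfolding abs_mult using k assms bump_bounds(4) by (intro mult_mono) auto
  qed
qed

text \<open>One statement for the three symmetries in use: translations (\<open>c = 1\<close>), the
  reflection (\<open>c = -1\<close>, \<open>b = 0\<close>) and Brownian scaling
  (\<open>c = sqrt t\<close>, \<open>b = 0\<close>).\<close>

lemma strong_sol_affine:
  assumes u: "strong_sol \<phi> u" and c: "c \<noteq> 0"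
  shows "strong_sol (\<lambda>x. c\<^sup>2 * \<phi> (c * x + b)) (\<lambda>t x. c\<^sup>2 * u (c\<^sup>2 * t) (c * x + b))"
proof -
  obtain B p q where u: "u 0 = \<phi>" "\<And>t x. 0 \<le> u t x" "\<And>t x. u t x \<le> B"
     "continuous_on UNIV (\<lambda>(t, x). u t x)" "continuous_on UNIV (\<lambda>(t, x). p t x)" "continuous_on UNIV (\<lambda>(t, x). q t x)"
     "\<And>t x. DERIV (u t) x :> p t x" "\<And>t x. DERIV (p t) x :> q t x"
     "\<And>t x. 0 < t \<Longrightarrow> DERIV (\<lambda>r. u r x) t :> q t x / 2 - (u t x)\<^sup>2 / 2"
    using u unfolding strong_sol_def by blast
  have cont: "continuous_on UNIV (\<lambda>(t, x). k * f (c\<^sup>2 * t) (c * x + b))" if "continuous_on UNIV (\<lambda>(t, x). f t x)" for f and k :: real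
  proof -
    have "continuous_on UNIV (\<lambda>z :: real \<times> real. (\<lambda>(t, x). f t x) (c\<^sup>2 * fst z, c * snd z + b))"
      by (rule continuous_on_compose2[OF that]) (auto intro!: continuous_intros)
    then show ?thesis by (auto simp: case_prod_unfold intro!: continuous_intros)
  qed
  have l: "DERIV (\<lambda>x. c * x + b) x :> c" for x by (auto intro!: derivative_eq_intros)
  show ?thesis unfolding strong_sol_def
  proof (intro conjI)
    show "\<exists>B. \<forall>t x. c\<^sup>2 * u (c\<^sup>2 * t) (c * x + b) \<le> B"
      using u(3) by (intro exI[of _ "c\<^sup>2 * B"]) (simp add: mult_left_mono)
    show "\<exists>p q. continuous_on UNIV (\<lambda>(t, x). p t x) \<and> continuous_on UNIV (\<lambda>(t, x). q t x) \<and>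
        (\<forall>t x. DERIV (\<lambda>x. c\<^sup>2 * u (c\<^sup>2 * t) (c * x + b)) x :> p t x) \<and>
        (\<forall>t x. DERIV (p t) x :> q t x) \<and>
        (\<forall>t>0. \<forall>x. ((\<lambda>r. c\<^sup>2 * u (c\<^sup>2 * r) (c * x + b)) has_real_derivative
           q t x / 2 - (c\<^sup>2 * u (c\<^sup>2 * t) (c * x + b))\<^sup>2 / 2) (at t))"
    proof (rule exI[of _ "\<lambda>t x. c ^ 3 * p (c\<^sup>2 * t) (c * x + b)"], rule exI[of _ "\<lambda>t x. c ^ 4 * q (c\<^sup>2 * t) (c * x + b)"],
        intro conjI allI impI cont u(5,6))
      fix t x
      show "DERIV (\<lambda>x. c\<^sup>2 * u (c\<^sup>2 * t) (c * x + b)) x :> c ^ 3 * p (c\<^sup>2 * t) (c * x + b)"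
        using DERIV_cmult[OF DERIV_chain2[OF u(7) l], of "c\<^sup>2" "c\<^sup>2 * t" x] by (simp add: power2_eq_square power3_eq_cube mult_ac)
      show "DERIV (\<lambda>x. c ^ 3 * p (c\<^sup>2 * t) (c * x + b)) x :> c ^ 4 * q (c\<^sup>2 * t) (c * x + b)"
        using DERIV_cmult[OF DERIV_chain2[OF u(8) l], of "c ^ 3" "c\<^sup>2 * t" x] by (simp add: power3_eq_cube power4_eq_xxxx mult_ac)
      assume t: "0 < t"
      have "DERIV (\<lambda>r. c\<^sup>2 * r) t :> c\<^sup>2" by (auto intro!: derivative_eq_intros)
      moreover have "((\<lambda>r. u r (c * x + b)) has_real_derivative
          q (c\<^sup>2 * t) (c * x + b) / 2 - (u (c\<^sup>2 * t) (c * x + b))\<^sup>2 / 2) (at (c\<^sup>2 * t))"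
        using u(9)[of "c\<^sup>2 * t" "c * x + b"] t c by simp
      ultimately have "((\<lambda>r. u (c\<^sup>2 * r) (c * x + b)) has_real_derivative
           (q (c\<^sup>2 * t) (c * x + b) / 2 - (u (c\<^sup>2 * t) (c * x + b))\<^sup>2 / 2) * c\<^sup>2) (at t)"
        by (rule DERIV_chain2[rotated])
      from DERIV_cmult[OF this, of "c\<^sup>2"]
      have "((\<lambda>r. c\<^sup>2 * u (c\<^sup>2 * r) (c * x + b)) has_real_derivative
           c\<^sup>2 * ((q (c\<^sup>2 * t) (c * x + b) / 2 - (u (c\<^sup>2 * t) (c * x + b))\<^sup>2 / 2) * c\<^sup>2)) (at t)" .
      moreover have "c\<^sup>2 * ((q (c\<^sup>2 * t) (c * x + b) / 2 - (u (c\<^sup>2 * t) (c * x + b))\<^sup>2 / 2) * c\<^sup>2)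
         = c ^ 4 * q (c\<^sup>2 * t) (c * x + b) / 2 - (c\<^sup>2 * u (c\<^sup>2 * t) (c * x + b))\<^sup>2 / 2"
        by (simp add: power2_eq_square power4_eq_xxxx field_simps)
      ultimately show "((\<lambda>r. c\<^sup>2 * u (c\<^sup>2 * r) (c * x + b)) has_real_derivative
           c ^ 4 * q (c\<^sup>2 * t) (c * x + b) / 2 - (c\<^sup>2 * u (c\<^sup>2 * t) (c * x + b))\<^sup>2 / 2) (at t)" by simp
    qed
  qed (use u in \<open>auto intro!: cont\<close>)
qed

definition U :: "real \<Rightarrow> real \<Rightarrow> real \<Rightarrow> real \<Rightarrow> real" where
  "U l N = (SOME u. strong_sol (approx_delta l N 0) u)"

lemma U_strong_sol: "0 \<le> l \<Longrightarrow> 0 < N \<Longrightarrow> strong_sol (approx_delta l N 0) (U l N)"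
  unfolding U_def using someI_ex[OF approx_delta_strong_sol] by blast

lemma U_shift_strong_sol:
  assumes "0 \<le> l" "0 < N"
  shows "strong_sol (approx_delta l N x0) (\<lambda>t x. U l N t (x - x0))"
  using strong_sol_affine[OF U_strong_sol[OF assms], of 1 "- x0"] by (simp add: approx_delta_def[abs_def])

section \<open>Laplace functionals\<close>

locale sbm_laws =
  fixes Q :: "real measure \<Rightarrow> real \<Rightarrow> (real \<Rightarrow>\<^sub>C real) measure"
  assumes sbm: "\<And>X0 t. fin_meas X0 \<Longrightarrow> 0 < t \<Longrightarrow> is_sbm_law X0 t (Q X0 t)"
begin

lemma fin_meas_return: "fin_meas (return borel y)"
  unfolding fin_meas_def using prob_space_return[of y borel] by (simp add: prob_space_def)

lemma lawD:
  assumes "fin_meas X0" "0 < t"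
  shows "prob_space (Q X0 t)" "sets (Q X0 t) = sets borel" "AE f in Q X0 t. \<forall>y. 0 \<le> apply_bcontfun f y"
    "strong_sol \<phi> u \<Longrightarrow> test_fun \<phi> \<Longrightarrow>
      (\<integral>f. exp (- (\<integral>y. apply_bcontfun f y * \<phi> y \<partial>lborel)) \<partial>Q X0 t) = exp (- (\<integral>y. u t y \<partial>X0))"
  using sbm[OF assms] strong_sol_log_laplace_sol unfolding is_sbm_law_def by blast+

lemma strong_sol_slice: "strong_sol \<phi> u \<Longrightarrow> continuous_on UNIV (u t)"
proof -
  assume "strong_sol \<phi> u"
  then have "continuous_on UNIV (\<lambda>(t, x). u t x)" by (simp add: strong_sol_def)
  then have "continuous_on UNIV (\<lambda>x. (\<lambda>(t, x). u t x) (t, x))"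
    by (rule continuous_on_compose2) (auto intro!: continuous_intros)
  then show ?thesis by simp
qed

lemma law_return:
  assumes "strong_sol \<phi> u" "test_fun \<phi>" "0 < t"
  shows "(\<integral>f. exp (- (\<integral>y. apply_bcontfun f y * \<phi> y \<partial>lborel)) \<partial>Q (return borel x) t) = exp (- u t x)"
  using lawD(4)[OF fin_meas_return assms(3) assms(1,2), of x] strong_sol_slice[OF assms(1), of t]
  by (subst (asm) integral_return) (auto intro: borel_measurable_continuous_onI)

text \<open>Uniqueness is taken from the probabilistic side: both solutions represent the Laplace
  functional, at the same test function, of the one law started from the unit mass at
  \<open>x\<close>.\<close>

lemma strong_sol_unique:
  assumes "strong_sol \<phi> u" "strong_sol \<phi> v" "test_fun \<phi>" "0 < t"
  shows "u t x = v t x"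
  using law_return[OF assms(1,3,4), of x] law_return[OF assms(2,3,4), of x] by simp

lemma U_even:
  assumes "0 \<le> l" "0 < N" "0 < t"
  shows "U l N t (- x) = U l N t x"
proof -
  have "strong_sol (approx_delta l N 0) (\<lambda>t x. U l N t (- x))"
    using strong_sol_affine[OF U_strong_sol[OF assms(1,2)], of "-1" 0] by (simp add: approx_delta_def[abs_def])
  from strong_sol_unique[OF this U_strong_sol[OF assms(1,2)] approx_delta_test_fun[OF assms(1,2)] assms(3)]
  show ?thesis .
qed

text \<open>Scaling maps a bump of mass \<open>l\<close> and width \<open>1 / N\<close> to one of
  mass \<open>l * sqrt t\<close> and width \<open>1 / (N * sqrt t)\<close>. Large times thus amount
  to large Laplace parameters at time 1.\<close>

lemma U_scale:
  assumes "0 \<le> l" "0 < N" "0 < t"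
  shows "U l N t y = U (l * sqrt t) (N * sqrt t) 1 (y / sqrt t) / t"
proof -
  have s: "0 \<le> l * sqrt t" "0 < N * sqrt t" using assms by auto
  have sq: "sqrt t * (sqrt t * z) = t * z" for z using assms(3) by (simp flip: mult.assoc)
  have "strong_sol (approx_delta (l * sqrt t) (N * sqrt t) 0) (\<lambda>s x. t * U l N (t * s) (sqrt t * x))"
    using strong_sol_affine[OF U_strong_sol[OF assms(1,2)], of "sqrt t" 0] assms(3)
    by (simp add: approx_delta_def[abs_def] mult_ac sq)
  from strong_sol_unique[OF this U_strong_sol[OF s] approx_delta_test_fun[OF s] zero_less_one, of "y / sqrt t"]
  show ?thesis using assms(3) by (simp add: field_simps)
qed

end

section \<open>Point evaluation as a limit of test functions\<close>

lemma apply_bcontfun_measurable [measurable]: "(\<lambda>f :: real \<Rightarrow>\<^sub>C real. apply_bcontfun f y) \<in> borel_measurable borel"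
proof (rule borel_measurable_continuous_onI, rule continuous_onI)
  fix f :: "real \<Rightarrow>\<^sub>C real" and e :: real assume "0 < e"
  then show "\<exists>d>0. \<forall>g\<in>UNIV. dist g f < d \<longrightarrow> dist (apply_bcontfun g y) (apply_bcontfun f y) \<le> e"
    by (intro exI[of _ e]) (auto intro: order_trans[OF dist_bounded])
qed

lemma apply_bcontfun_continuous: "continuous_on UNIV (apply_bcontfun f)"
  using apply_bcontfun[of f] by (auto simp: bcontfun_def)

lemma apply_bcontfun_bound: "\<exists>B. \<forall>x. \<bar>apply_bcontfun (f :: real \<Rightarrow>\<^sub>C real) x\<bar> \<le> B"
  using apply_bcontfun[of f] by (auto simp: bcontfun_def bounded_iff)

lemma approx_delta_integrable: "integrable lborel (approx_delta l N x0)" if "0 < N"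
proof -
  have "integrable lborel (\<lambda>x. bump (- (N * x0) + N * x))"
    using bump_integrable that by (intro lborel_integrable_real_affine) auto
  then have "integrable lborel (\<lambda>x. l / bump_mass * N * bump (- (N * x0) + N * x))" by simp
  moreover have "(\<lambda>x. l / bump_mass * N * bump (- (N * x0) + N * x)) = approx_delta l N x0"
    by (auto simp: approx_delta_def fun_eq_iff algebra_simps)
  ultimately show ?thesis by simp
qed

lemma pairing_integrable:
  fixes f :: "real \<Rightarrow>\<^sub>C real"
  assumes "integrable lborel \<phi>"
  shows "integrable lborel (\<lambda>y. apply_bcontfun f y * \<phi> y)"
proof -
  obtain B where B: "\<And>x. \<bar>apply_bcontfun f x\<bar> \<le> B" using apply_bcontfun_bound by blast
  have [measurable]: "apply_bcontfun f \<in> borel_measurable borel"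
    by (rule borel_measurable_continuous_onI[OF apply_bcontfun_continuous])
  have [measurable]: "\<phi> \<in> borel_measurable borel" using assms by auto
  show ?thesis
  proof (rule Bochner_Integration.integrable_bound)
    show "integrable lborel (\<lambda>y. B * \<phi> y)" using assms by simp
    have "norm (apply_bcontfun f y * \<phi> y) \<le> norm (B * \<phi> y)" for y
      unfolding norm_mult by (rule mult_right_mono) (use B[of y] in auto)
    then show "AE y in lborel. norm (apply_bcontfun f y * \<phi> y) \<le> norm (B * \<phi> y)" by simp
  qed simp
qed

lemma pairing_measurable:
  assumes \<phi>: "integrable lborel \<phi>"
  shows "(\<lambda>f :: real \<Rightarrow>\<^sub>C real. \<integral>y. apply_bcontfun f y * \<phi> y \<partial>lborel) \<in> borel_measurable borel"
proof (rule borel_measurable_continuous_onI, rule continuous_onI)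
  fix f :: "real \<Rightarrow>\<^sub>C real" and e :: real assume e: "0 < e"
  define C where "C = (\<integral>y. \<bar>\<phi> y\<bar> \<partial>lborel)"
  have C: "0 \<le> C" unfolding C_def by (rule Bochner_Integration.integral_nonneg) simp
  have "dist (\<integral>y. apply_bcontfun g y * \<phi> y \<partial>lborel) (\<integral>y. apply_bcontfun f y * \<phi> y \<partial>lborel) \<le> e"
    if "dist g f < e / (C + 1)" for g
  proof -
    have "(\<integral>y. apply_bcontfun g y * \<phi> y \<partial>lborel) - (\<integral>y. apply_bcontfun f y * \<phi> y \<partial>lborel)
       = (\<integral>y. apply_bcontfun g y * \<phi> y - apply_bcontfun f y * \<phi> y \<partial>lborel)"
      using pairing_integrable[OF \<phi>] by simp
    moreover have "norm \<dots> \<le> (\<integral>y. dist g f * \<bar>\<phi> y\<bar> \<partial>lborel)"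
    proof (rule Bochner_Integration.integral_norm_bound_integral)
      show "integrable lborel (\<lambda>y. apply_bcontfun g y * \<phi> y - apply_bcontfun f y * \<phi> y)"
        using pairing_integrable[OF \<phi>] by simp
      show "integrable lborel (\<lambda>y. dist g f * \<bar>\<phi> y\<bar>)" using \<phi> by simp
      show "norm (apply_bcontfun g y * \<phi> y - apply_bcontfun f y * \<phi> y) \<le> dist g f * \<bar>\<phi> y\<bar>" for y
        unfolding left_diff_distrib[symmetric] norm_mult
        using dist_bounded[of g y f] by (auto simp: dist_real_def intro: mult_right_mono)
    qed
    ultimately have "dist (\<integral>y. apply_bcontfun g y * \<phi> y \<partial>lborel) (\<integral>y. apply_bcontfun f y * \<phi> y \<partial>lborel) \<le> dist g f * C"
      by (simp add: dist_real_def C_def)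
    also have "\<dots> \<le> e / (C + 1) * C" using that C by (intro mult_right_mono) auto
    also have "\<dots> \<le> e" using C e by (simp add: field_simps)
    finally show ?thesis .
  qed
  then show "\<exists>d>0. \<forall>g\<in>UNIV. dist g f < d \<longrightarrow> dist (\<integral>y. apply_bcontfun g y * \<phi> y \<partial>lborel) (\<integral>y. apply_bcontfun f y * \<phi> y \<partial>lborel) \<le> e"
    using e C by (intro exI[of _ "e / (C + 1)"]) auto
qed

text \<open>After rescaling, the bump is fixed and \<open>f\<close> is evaluated near
  \<open>y\<close>. All three parameters may move, because later compactness arguments vary mass,
  width and position at once.\<close>

lemma pairing_limit:
  fixes f :: "real \<Rightarrow>\<^sub>C real"
  assumes l: "lk \<longlonglongrightarrow> l" and N: "filterlim Nk at_top sequentially" "\<And>k. 0 < Nk k" and y: "yk \<longlonglongrightarrow> y"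
  shows "(\<lambda>k. \<integral>x. apply_bcontfun f x * approx_delta (lk k) (Nk k) (yk k) x \<partial>lborel) \<longlonglongrightarrow> l * apply_bcontfun f y"
proof -
  obtain B where B: "\<And>x. \<bar>apply_bcontfun f x\<bar> \<le> B" using apply_bcontfun_bound by blast
  have [measurable]: "bump \<in> borel_measurable borel" by (rule borel_measurable_continuous_onI[OF bump_cont])
  have fm: "(\<lambda>w. apply_bcontfun f (a + w * b)) \<in> borel_measurable borel" for a b
    by (rule borel_measurable_continuous_onI)
      (rule continuous_on_compose2[OF apply_bcontfun_continuous], auto intro!: continuous_intros)
  have eq: "(\<integral>x. apply_bcontfun f x * approx_delta (lk k) (Nk k) (yk k) x \<partial>lborel)
     = lk k / bump_mass * (\<integral>w. apply_bcontfun f (yk k + w * (1 / Nk k)) * bump w \<partial>lborel)" for k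
  proof -
    have "(\<integral>x. apply_bcontfun f x * approx_delta (lk k) (Nk k) (yk k) x \<partial>lborel)
      = \<bar>1 / Nk k\<bar> *\<^sub>R (\<integral>w. apply_bcontfun f (yk k + 1 / Nk k * w) * approx_delta (lk k) (Nk k) (yk k) (yk k + 1 / Nk k * w) \<partial>lborel)"
      by (rule lborel_integral_real_affine) (use N(2)[of k] in simp)
    also have "\<dots> = (\<integral>w. \<bar>1 / Nk k\<bar> * (apply_bcontfun f (yk k + 1 / Nk k * w) * approx_delta (lk k) (Nk k) (yk k) (yk k + 1 / Nk k * w)) \<partial>lborel)"
      by simp
    also have "\<dots> = (\<integral>w. lk k / bump_mass * (apply_bcontfun f (yk k + w * (1 / Nk k)) * bump w) \<partial>lborel)"
      using N(2)[of k] by (intro Bochner_Integration.integral_cong) (auto simp: approx_delta_def)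
    finally show ?thesis by simp
  qed
  have "(\<lambda>k. \<integral>w. apply_bcontfun f (yk k + w * (1 / Nk k)) * bump w \<partial>lborel) \<longlonglongrightarrow> (\<integral>w. apply_bcontfun f y * bump w \<partial>lborel)"
  proof (rule integral_dominated_convergence[where w = "\<lambda>w. B * bump w"])
    show "AE w in lborel. (\<lambda>k. apply_bcontfun f (yk k + w * (1 / Nk k)) * bump w) \<longlonglongrightarrow> apply_bcontfun f y * bump w"
    proof (rule AE_I2)
      fix w
      have "(\<lambda>k. 1 / Nk k) \<longlonglongrightarrow> 0"
        by (rule tendsto_divide_0[OF tendsto_const filterlim_at_top_imp_at_infinity[OF N(1)]])
      then have "(\<lambda>k. yk k + w * (1 / Nk k)) \<longlonglongrightarrow> y + w * 0" by (intro tendsto_intros y)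
      then have "(\<lambda>k. yk k + w * (1 / Nk k)) \<longlonglongrightarrow> y" by simp
      moreover have "isCont (apply_bcontfun f) y"
        using apply_bcontfun_continuous[of f] unfolding continuous_on_eq_continuous_at[OF open_UNIV] by blast
      ultimately have "(\<lambda>k. apply_bcontfun f (yk k + w * (1 / Nk k))) \<longlonglongrightarrow> apply_bcontfun f y"
        using isCont_tendsto_compose by blast
      then show "(\<lambda>k. apply_bcontfun f (yk k + w * (1 / Nk k)) * bump w) \<longlonglongrightarrow> apply_bcontfun f y * bump w"
        by (intro tendsto_intros)
    qed
    show "AE w in lborel. norm (apply_bcontfun f (yk k + w * (1 / Nk k)) * bump w) \<le> B * bump w" for k
      using B bump_bounds(1) by (auto simp: abs_mult intro!: mult_right_mono)
    show "(\<lambda>w. apply_bcontfun f (yk k + w * (1 / Nk k)) * bump w) \<in> borel_measurable lborel" for k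
      using fm[of "yk k" "1 / Nk k"] by measurable
  qed (use bump_integrable in auto)
  then have "(\<lambda>k. lk k / bump_mass * (\<integral>w. apply_bcontfun f (yk k + w * (1 / Nk k)) * bump w \<partial>lborel))
     \<longlonglongrightarrow> l / bump_mass * (\<integral>w. apply_bcontfun f y * bump w \<partial>lborel)"
    by (intro tendsto_intros l) (use bump_mass_pos in auto)
  then show ?thesis using bump_mass_pos by (simp add: eq bump_mass_def)
qed

context sbm_laws
begin

lemma law_measurable:
  assumes "fin_meas X0" "0 < t"
  shows "borel_measurable (Q X0 t) = borel_measurable borel"
  by (rule measurable_cong_sets) (use lawD(2)[OF assms] in auto)

lemma laplace_limit:
  assumes X: "fin_meas X0" "0 < t"
    and l: "lk \<longlonglongrightarrow> l" "\<And>k. 0 \<le> lk k" and N: "filterlim Nk at_top sequentially" "\<And>k. 0 < Nk k" and y: "yk \<longlonglongrightarrow> y"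
  shows "(\<lambda>k. \<integral>f. exp (- (\<integral>x. apply_bcontfun f x * approx_delta (lk k) (Nk k) (yk k) x \<partial>lborel)) \<partial>Q X0 t)
    \<longlonglongrightarrow> (\<integral>f. exp (- (l * apply_bcontfun f y)) \<partial>Q X0 t)"
proof (rule integral_dominated_convergence[where w = "\<lambda>_. 1"])
  interpret prob_space "Q X0 t" by (rule lawD(1)[OF X])
  show "(\<lambda>f. exp (- (l * apply_bcontfun f y))) \<in> borel_measurable (Q X0 t)"
    unfolding law_measurable[OF X] by measurable
  show "(\<lambda>f. exp (- (\<integral>x. apply_bcontfun f x * approx_delta (lk k) (Nk k) (yk k) x \<partial>lborel))) \<in> borel_measurable (Q X0 t)" for k
    unfolding law_measurable[OF X] using pairing_measurable[OF approx_delta_integrable[OF N(2)]] by measurable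
  show "integrable (Q X0 t) (\<lambda>_. 1 :: real)" by simp
  show "AE f in Q X0 t. (\<lambda>k. exp (- (\<integral>x. apply_bcontfun f x * approx_delta (lk k) (Nk k) (yk k) x \<partial>lborel)))
      \<longlonglongrightarrow> exp (- (l * apply_bcontfun f y))"
    by (intro AE_I2 tendsto_intros pairing_limit l N y)
  show "AE f in Q X0 t. norm (exp (- (\<integral>x. apply_bcontfun f x * approx_delta (lk k) (Nk k) (yk k) x \<partial>lborel))) \<le> 1" for k
    using lawD(3)[OF X]
  proof eventually_elim
    case (elim f)
    have "0 \<le> (\<integral>x. apply_bcontfun f x * approx_delta (lk k) (Nk k) (yk k) x \<partial>lborel)"
      using elim approx_delta_bounds(1)[OF l(2) N(2)] by (intro Bochner_Integration.integral_nonneg) auto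
    then show ?case by simp
  qed
qed

text \<open>The Laplace exponent of \<open>X(1,y)\<close> under a unit mass at 0. By translation and
  reflection it is also the exponent of \<open>X(1,0)\<close> under a unit mass at
  \<open>y\<close>.\<close>

definition Vp :: "real \<Rightarrow> real \<Rightarrow> real" where
  "Vp l y = - ln (\<integral>f. exp (- (l * apply_bcontfun f y)) \<partial>Q (return borel 0) 1)"

lemma exp_eval_integrable:
  assumes X: "fin_meas X0" "0 < t" and l: "0 \<le> l"
  shows "integrable (Q X0 t) (\<lambda>f. exp (- (l * apply_bcontfun f y)))"
proof -
  interpret prob_space "Q X0 t" by (rule lawD(1)[OF X])
  show ?thesis
  proof (rule integrable_const_bound[of _ 1])
    show "AE f in Q X0 t. norm (exp (- (l * apply_bcontfun f y))) \<le> 1"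
      using lawD(3)[OF X] by eventually_elim (use l in auto)
    show "(\<lambda>f. exp (- (l * apply_bcontfun f y))) \<in> borel_measurable (Q X0 t)"
      unfolding law_measurable[OF X] by measurable
  qed
qed

lemma exp_eval_pos:
  assumes X: "fin_meas X0" "0 < t" and l: "0 \<le> l"
  shows "0 < (\<integral>f. exp (- (l * apply_bcontfun f y)) \<partial>Q X0 t)"
proof -
  interpret prob_space "Q X0 t" by (rule lawD(1)[OF X])
  have "0 \<le> (\<integral>f. exp (- (l * apply_bcontfun f y)) \<partial>Q X0 t)" by (rule Bochner_Integration.integral_nonneg) simp
  moreover have "(\<integral>f. exp (- (l * apply_bcontfun f y)) \<partial>Q X0 t) \<noteq> 0"
  proof
    assume "(\<integral>f. exp (- (l * apply_bcontfun f y)) \<partial>Q X0 t) = 0"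
    then have "AE f in Q X0 t. exp (- (l * apply_bcontfun f y)) = 0"
      using integral_nonneg_eq_0_iff_AE[OF exp_eval_integrable[OF assms]] by simp
    then have "AE f in Q X0 t. False" by simp
    then show False by simp
  qed
  ultimately show ?thesis by (auto simp: less_le)
qed

lemma exp_Vp: "0 \<le> l \<Longrightarrow> (\<integral>f. exp (- (l * apply_bcontfun f y)) \<partial>Q (return borel 0) 1) = exp (- Vp l y)"
  unfolding Vp_def using exp_eval_pos[OF fin_meas_return[of 0] zero_less_one, where l = l and y = y] by simp

text \<open>Convergence along arbitrary sequences \<open>lk\<close>, \<open>Nk\<close>,
  \<open>yk\<close> stands in for locally uniform convergence. It is used with intermediate points
  that depend on the index and, through compactness of intervals, to start the barriers.\<close>

lemma U_limit:
  assumes l: "lk \<longlonglongrightarrow> l" "\<And>k. 0 \<le> lk k" and N: "filterlim Nk at_top sequentially" "\<And>k. 0 < Nk k" and y: "yk \<longlonglongrightarrow> y"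
  shows "(\<lambda>k. U (lk k) (Nk k) 1 (yk k)) \<longlonglongrightarrow> Vp l y"
proof -
  have l0: "0 \<le> l" using LIMSEQ_le_const[OF l(1)] l(2) by blast
  have "(\<integral>f. exp (- (\<integral>x. apply_bcontfun f x * approx_delta (lk k) (Nk k) (yk k) x \<partial>lborel)) \<partial>Q (return borel 0) 1)
      = exp (- U (lk k) (Nk k) 1 (yk k))" for k
    using law_return[OF U_shift_strong_sol[OF l(2)[of k] N(2)[of k]] approx_delta_test_fun[OF l(2)[of k] N(2)[of k]] zero_less_one, where x = 0 and x0 = "yk k"]
      U_even[OF l(2)[of k] N(2)[of k] zero_less_one, of "yk k"] by simp
  with laplace_limit[OF fin_meas_return zero_less_one assms, of 0]
  have "(\<lambda>k. exp (- U (lk k) (Nk k) 1 (yk k))) \<longlonglongrightarrow> exp (- Vp l y)"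
    by (simp add: exp_Vp[OF l0])
  from tendsto_minus[OF tendsto_ln[OF this]] show ?thesis by simp
qed

lemma U_limit_time:
  assumes l: "0 \<le> l" and N: "filterlim Nk at_top sequentially" "\<And>k. 0 < Nk k"
    and t: "tk \<longlonglongrightarrow> t" "0 < t" "\<And>k. 0 < tk k" and y: "yk \<longlonglongrightarrow> y"
  shows "(\<lambda>k. U l (Nk k) (tk k) (yk k)) \<longlonglongrightarrow> Vp (l * sqrt t) (y / sqrt t) / t"
proof -
  have "(\<lambda>k. U (l * sqrt (tk k)) (Nk k * sqrt (tk k)) 1 (yk k / sqrt (tk k))) \<longlonglongrightarrow> Vp (l * sqrt t) (y / sqrt t)"
  proof (rule U_limit)
    show "filterlim (\<lambda>k. Nk k * sqrt (tk k)) at_top sequentially"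
      by (rule filterlim_at_top_mult_tendsto_pos[OF tendsto_real_sqrt[OF t(1)] _ N(1)]) (use t in auto)
  qed (use l N t in \<open>auto intro!: tendsto_intros y mult_nonneg_nonneg less_imp_le[OF t(3)]\<close>)
  then have "(\<lambda>k. U (l * sqrt (tk k)) (Nk k * sqrt (tk k)) 1 (yk k / sqrt (tk k)) / tk k) \<longlonglongrightarrow> Vp (l * sqrt t) (y / sqrt t) / t"
    by (intro tendsto_intros t) (use t in auto)
  then show ?thesis using U_scale[OF l N(2) t(3)] by simp
qed

lemma Vp_continuous:
  assumes l: "lk \<longlonglongrightarrow> l" "\<And>k. 0 \<le> lk k" and y: "yk \<longlonglongrightarrow> y"
  shows "(\<lambda>k. Vp (lk k) (yk k)) \<longlonglongrightarrow> Vp l y"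
proof -
  have l0: "0 \<le> l" using LIMSEQ_le_const[OF l(1)] l(2) by blast
  let ?Q = "Q (return borel 0) 1"
  note X = fin_meas_return[of 0] zero_less_one
  interpret prob_space ?Q by (rule lawD(1)[OF X])
  have "(\<lambda>k. \<integral>f. exp (- (lk k * apply_bcontfun f (yk k))) \<partial>?Q) \<longlonglongrightarrow> (\<integral>f. exp (- (l * apply_bcontfun f y)) \<partial>?Q)"
  proof (rule integral_dominated_convergence[where w = "\<lambda>_. 1"])
    show "(\<lambda>f. exp (- (l * apply_bcontfun f y))) \<in> borel_measurable ?Q"
      "(\<lambda>f. exp (- (lk k * apply_bcontfun f (yk k)))) \<in> borel_measurable ?Q" for k
      unfolding law_measurable[OF X] by measurable
    show "AE f in ?Q. norm (exp (- (lk k * apply_bcontfun f (yk k)))) \<le> 1" for k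
      using lawD(3)[OF X] by eventually_elim (use l in auto)
    have "isCont (apply_bcontfun f) y" for f :: "real \<Rightarrow>\<^sub>C real"
      using apply_bcontfun_continuous[of f] unfolding continuous_on_eq_continuous_at[OF open_UNIV] by blast
    then show "AE f in ?Q. (\<lambda>k. exp (- (lk k * apply_bcontfun f (yk k)))) \<longlonglongrightarrow> exp (- (l * apply_bcontfun f y))"
      by (intro AE_I2 tendsto_intros l isCont_tendsto_compose[OF _ y])
  qed simp
  then have "(\<lambda>k. exp (- Vp (lk k) (yk k))) \<longlonglongrightarrow> exp (- Vp l y)"
    by (simp add: exp_Vp l0 l)
  from tendsto_minus[OF tendsto_ln[OF this]] show ?thesis by simp
qed

lemma Vp_continuous_on: "0 \<le> l \<Longrightarrow> continuous_on UNIV (Vp l)"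
  by (rule continuous_on_sequentiallyI) (rule Vp_continuous, auto)

lemma Vp_mono: "0 \<le> l \<Longrightarrow> l \<le> l' \<Longrightarrow> Vp l y \<le> Vp l' y"
proof -
  assume l: "0 \<le> l" "l \<le> l'"
  note X = fin_meas_return[of 0] zero_less_one
  have "exp (- Vp l' y) \<le> exp (- Vp l y)"
    unfolding exp_Vp[symmetric, OF l(1)] exp_Vp[symmetric, OF order_trans[OF l]]
  proof (rule integral_mono_AE[OF exp_eval_integrable[OF X] exp_eval_integrable[OF X]])
    show "AE f in Q (return borel 0) 1. exp (- (l' * apply_bcontfun f y)) \<le> exp (- (l * apply_bcontfun f y))"
      using lawD(3)[OF X] by eventually_elim (use l in \<open>auto intro: mult_right_mono\<close>)
  qed (use l in auto)
  then show ?thesis by simp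
qed

lemma Vp_nonneg: "0 \<le> l \<Longrightarrow> 0 \<le> Vp l y"
  using Vp_mono[of 0 l y] prob_space.prob_space[OF lawD(1)[OF fin_meas_return zero_less_one, of 0]]
  by (simp add: Vp_def)

end

section \<open>Comparison with self-similar barriers\<close>

lemma strong_solD:
  assumes "strong_sol \<phi> u"
  obtains p q B where "u 0 = \<phi>" "\<And>t x. 0 \<le> u t x" "\<And>t x. u t x \<le> B" "continuous_on UNIV (\<lambda>(t, x). u t x)"
     "continuous_on UNIV (\<lambda>(t, x). p t x)" "continuous_on UNIV (\<lambda>(t, x). q t x)"
     "\<And>t x. DERIV (u t) x :> p t x" "\<And>t x. DERIV (p t) x :> q t x"
     "\<And>t x. 0 < t \<Longrightarrow> DERIV (\<lambda>r. u r x) t :> q t x / 2 - (u t x)\<^sup>2 / 2"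
  using assms unfolding strong_sol_def by blast

abbreviation heat_super :: "(real \<Rightarrow> real) \<Rightarrow> (real \<Rightarrow> real) \<Rightarrow> real \<Rightarrow> real \<Rightarrow> real \<Rightarrow> bool" where
  "heat_super g h t x c \<equiv> \<exists>Gt G1 G2 e. DERIV g t :> Gt \<and> e > 0 \<and>
     (\<forall>y. \<bar>y - x\<bar> < e \<longrightarrow> DERIV h y :> G1 y) \<and> DERIV G1 x :> G2 \<and> G2 / 2 - c \<le> Gt"

abbreviation heat_sub :: "(real \<Rightarrow> real) \<Rightarrow> (real \<Rightarrow> real) \<Rightarrow> real \<Rightarrow> real \<Rightarrow> real \<Rightarrow> bool" where
  "heat_sub g h t x c \<equiv> \<exists>Gt G1 G2 e. DERIV g t :> Gt \<and> e > 0 \<and>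
     (\<forall>y. \<bar>y - x\<bar> < e \<longrightarrow> DERIV h y :> G1 y) \<and> DERIV G1 x :> G2 \<and> Gt \<le> G2 / 2 - c"

text \<open>The inequality for \<open>G\<close> carries the square of \<open>u\<close> and not that
  of \<open>G\<close>. This is exactly what the equation for the difference \<open>u - G\<close>
  requires, and it admits barriers that become negative.\<close>

lemma strong_sol_le_barrier:
  assumes u: "strong_sol \<phi> u" and t0: "0 \<le> t0"
    and cont: "continuous_on ({t0..} \<times> UNIV) (\<lambda>(t, x). G t x)" and K: "\<And>t x. t0 \<le> t \<Longrightarrow> K \<le> G t x"
    and init: "\<And>x. u t0 x \<le> G t0 x"
    and super: "\<And>t x. t0 < t \<Longrightarrow> G t x < u t x \<Longrightarrow>
      heat_super (\<lambda>r. G r x) (G t) t x ((u t x)\<^sup>2 / 2)"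
    and t: "t0 \<le> t"
  shows "u t x \<le> G t x"
proof -
  obtain p q B where U: "\<And>t x. u t x \<le> B" "continuous_on UNIV (\<lambda>(t, x). u t x)"
     "\<And>t x. DERIV (u t) x :> p t x" "\<And>t x. DERIV (p t) x :> q t x"
     "\<And>t x. 0 < t \<Longrightarrow> DERIV (\<lambda>r. u r x) t :> q t x / 2 - (u t x)\<^sup>2 / 2"
    using strong_solD[OF u] by metis
  have "u t x - G t x \<le> 0"
  proof (rule heat_max_principle[where z = "\<lambda>t x. u t x - G t x" and ?t0.0 = t0 and B = "B - K"])
    show "continuous_on ({t0..} \<times> UNIV) (\<lambda>(t, x). u t x - G t x)"
      using cont continuous_on_subset[OF U(2), of "{t0..} \<times> UNIV"]
      by (auto simp: case_prod_unfold intro!: continuous_intros)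
    show "u t x - G t x \<le> B - K" if "t0 \<le> t" for t x using U(1)[of t x] K[OF that, of x] by linarith
    show "u t0 x - G t0 x \<le> 0" for x using init[of x] by simp
    fix t x assume tx: "t0 < t" "0 < u t x - G t x"
    then obtain Gt G1 G2 e where G: "DERIV (\<lambda>r. G r x) t :> Gt" "e > 0"
        "\<And>y. \<bar>y - x\<bar> < e \<Longrightarrow> DERIV (G t) y :> G1 y"
        "DERIV G1 x :> G2" "G2 / 2 - (u t x)\<^sup>2 / 2 \<le> Gt"
      using super[of t x] by auto
    show "\<exists>zt z1 z2 e. DERIV (\<lambda>r. u r x - G r x) t :> zt \<and> e > 0 \<and>
        (\<forall>y. \<bar>y - x\<bar> < e \<longrightarrow> DERIV (\<lambda>x. u t x - G t x) y :> z1 y) \<and>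
        DERIV z1 x :> z2 \<and> zt \<le> z2 / 2"
    proof (intro exI conjI allI impI)
      show "DERIV (\<lambda>r. u r x - G r x) t :> q t x / 2 - (u t x)\<^sup>2 / 2 - Gt"
        using tx(1) t0 by (intro DERIV_diff U(5) G(1)) simp
      show "DERIV (\<lambda>x. u t x - G t x) y :> p t y - G1 y" if "\<bar>y - x\<bar> < e" for y
        by (intro DERIV_diff U(3) G(3) that)
      show "DERIV (\<lambda>y. p t y - G1 y) x :> q t x - G2"
        by (intro DERIV_diff U(4) G(4))
      show "q t x / 2 - (u t x)\<^sup>2 / 2 - Gt \<le> (q t x - G2) / 2" using G(5) by simp
    qed (rule G(2))
  qed (use t in auto)
  then show ?thesis by simp
qed

text \<open>Only points with \<open>u < G\<close> are inspected, where \<open>0 \<le> u\<close>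
  gives \<open>u^2 \<le> G^2\<close>; so the square of the barrier itself may be used, and elsewhere
  the barrier may be negative.\<close>

lemma strong_sol_ge_barrier:
  assumes u: "strong_sol \<phi> u" and t0: "0 \<le> t0"
    and cont: "continuous_on ({t0..} \<times> UNIV) (\<lambda>(t, x). G t x)" and K: "\<And>t x. t0 \<le> t \<Longrightarrow> G t x \<le> K"
    and init: "\<And>x. G t0 x \<le> u t0 x"
    and sub: "\<And>t x. t0 < t \<Longrightarrow> u t x < G t x \<Longrightarrow>
      heat_sub (\<lambda>r. G r x) (G t) t x ((G t x)\<^sup>2 / 2)"
    and t: "t0 \<le> t"
  shows "G t x \<le> u t x"
proof -
  obtain p q where U: "\<And>t x. 0 \<le> u t x" "continuous_on UNIV (\<lambda>(t, x). u t x)"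
     "\<And>t x. DERIV (u t) x :> p t x" "\<And>t x. DERIV (p t) x :> q t x"
     "\<And>t x. 0 < t \<Longrightarrow> DERIV (\<lambda>r. u r x) t :> q t x / 2 - (u t x)\<^sup>2 / 2"
    using strong_solD[OF u] by metis
  have "G t x - u t x \<le> 0"
  proof (rule heat_max_principle[where z = "\<lambda>t x. G t x - u t x" and ?t0.0 = t0 and B = K])
    show "continuous_on ({t0..} \<times> UNIV) (\<lambda>(t, x). G t x - u t x)"
      using cont continuous_on_subset[OF U(2), of "{t0..} \<times> UNIV"]
      by (auto simp: case_prod_unfold intro!: continuous_intros)
    show "G t x - u t x \<le> K" if "t0 \<le> t" for t x using U(1)[of t x] K[OF that, of x] by linarith
    show "G t0 x - u t0 x \<le> 0" for x using init[of x] by simp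
    fix t x assume tx: "t0 < t" "0 < G t x - u t x"
    then obtain Gt G1 G2 e where G: "DERIV (\<lambda>r. G r x) t :> Gt" "e > 0"
        "\<And>y. \<bar>y - x\<bar> < e \<Longrightarrow> DERIV (G t) y :> G1 y"
        "DERIV G1 x :> G2" "Gt \<le> G2 / 2 - (G t x)\<^sup>2 / 2"
      using sub[of t x] by auto
    show "\<exists>zt z1 z2 e. DERIV (\<lambda>r. G r x - u r x) t :> zt \<and> e > 0 \<and>
        (\<forall>y. \<bar>y - x\<bar> < e \<longrightarrow> DERIV (\<lambda>x. G t x - u t x) y :> z1 y) \<and>
        DERIV z1 x :> z2 \<and> zt \<le> z2 / 2"
    proof (intro exI conjI allI impI)
      show "DERIV (\<lambda>r. G r x - u r x) t :> Gt - (q t x / 2 - (u t x)\<^sup>2 / 2)"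
        using tx(1) t0 by (intro DERIV_diff U(5) G(1)) simp
      show "DERIV (\<lambda>x. G t x - u t x) y :> G1 y - p t y" if "\<bar>y - x\<bar> < e" for y
        by (intro DERIV_diff U(3) G(3) that)
      show "DERIV (\<lambda>y. G1 y - p t y) x :> G2 - q t x"
        by (intro DERIV_diff U(4) G(4))
      have "(u t x)\<^sup>2 \<le> (G t x)\<^sup>2" using tx(2) U(1)[of t x] by (intro power_mono) auto
      then show "Gt - (q t x / 2 - (u t x)\<^sup>2 / 2) \<le> (G2 - q t x) / 2" using G(5) by (simp add: field_simps)
    qed (rule G(2))
  qed (use t in auto)
  then show ?thesis by simp
qed

lemma le_barrierI:
  assumes "DERIV g t :> Gt" "(0::real) < e" "\<And>y. \<bar>y - x\<bar> < e \<Longrightarrow> DERIV h y :> G1 y"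
    "DERIV G1 x :> G2" "G2 / 2 - c \<le> Gt"
  shows "heat_super g h t x c"
  using assms by blast

lemma ge_barrierI:
  assumes "DERIV g t :> Gt" "(0::real) < e" "\<And>y. \<bar>y - x\<bar> < e \<Longrightarrow> DERIV h y :> G1 y"
    "DERIV G1 x :> G2" "Gt \<le> G2 / 2 - c"
  shows "heat_sub g h t x c"
  using assms by blast

text \<open>Functions invariant under parabolic scaling up to a power of \<open>t\<close>. Each
  space derivative raises the rate by 1/2 and each time derivative by 1, so a parabolic equation
  turns into an ordinary one for the profile.\<close>

definition selfsim :: "real \<Rightarrow> (real \<Rightarrow> real) \<Rightarrow> real \<Rightarrow> real \<Rightarrow> real" where
  "selfsim \<alpha> \<Psi> t x = t powr (- \<alpha>) * \<Psi> (x / sqrt t)"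

lemma selfsim_1: "0 < t \<Longrightarrow> selfsim 1 \<Psi> t x = \<Psi> (x / sqrt t) / t"
  by (simp add: selfsim_def powr_minus field_simps)

lemma selfsim_dx:
  assumes t: "0 < t" and d: "DERIV \<Psi> (x / sqrt t) :> \<Psi>1 (x / sqrt t)"
  shows "DERIV (selfsim \<alpha> \<Psi> t) x :> selfsim (\<alpha> + 1 / 2) \<Psi>1 t x"
proof -
  have "DERIV (\<lambda>x. x / sqrt t) x :> 1 / sqrt t"
    using DERIV_cdivide[OF DERIV_ident, of "sqrt t" x] by simp
  from DERIV_cmult[OF DERIV_chain2[OF d this], of "t powr (- \<alpha>)"]
  have "DERIV (selfsim \<alpha> \<Psi> t) x :> t powr (- \<alpha>) * (\<Psi>1 (x / sqrt t) * (1 / sqrt t))"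
    by (simp add: selfsim_def[abs_def])
  moreover have "t powr (- (\<alpha> + 1 / 2)) = t powr (- \<alpha>) * (1 / sqrt t)"
    using t powr_add[of t "- \<alpha>" "- (1 / 2)"] by (simp add: powr_half_sqrt powr_minus_divide)
  ultimately show ?thesis by (simp add: selfsim_def mult_ac)
qed

lemma selfsim_dt:
  assumes t: "0 < t" and d: "DERIV \<Psi> (x / sqrt t) :> \<Psi>1 (x / sqrt t)"
  shows "((\<lambda>t. selfsim \<alpha> \<Psi> t x) has_real_derivative
     - selfsim (\<alpha> + 1) (\<lambda>z. \<alpha> * \<Psi> z + z * \<Psi>1 z / 2) t x) (at t)"
proof -
  have "DERIV (\<lambda>t. x / sqrt t) t :> x * (- (inverse (sqrt t) * (inverse (sqrt t) / 2) * inverse (sqrt t)))"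
    unfolding divide_inverse[of x]
    by (rule DERIV_cmult[OF DERIV_inverse'[OF DERIV_real_sqrt[OF t]]]) (use t in simp)
  moreover have "x * (- (inverse (sqrt t) * (inverse (sqrt t) / 2) * inverse (sqrt t))) = - (x / sqrt t / (2 * t))"
    using t by (simp add: field_simps)
  ultimately have D: "DERIV (\<lambda>t. x / sqrt t) t :> - (x / sqrt t / (2 * t))"
    by (simp only:)
  have "DERIV (\<lambda>t. t powr (- \<alpha>)) t :> - \<alpha> * t powr (- \<alpha> - 1)"
    by (rule has_real_derivative_powr[OF t])
  from DERIV_mult[OF this DERIV_chain2[OF d D]]
  have "((\<lambda>t. selfsim \<alpha> \<Psi> t x) has_real_derivative
     - \<alpha> * t powr (- \<alpha> - 1) * \<Psi> (x / sqrt t) + \<Psi>1 (x / sqrt t) * - (x / sqrt t / (2 * t)) * t powr (- \<alpha>)) (at t)"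
    by (simp add: selfsim_def)
  moreover have "t powr (- \<alpha>) = t * t powr (- \<alpha> - 1)"
    using t powr_add[of t 1 "- \<alpha> - 1"] by simp
  ultimately have D: "((\<lambda>t. selfsim \<alpha> \<Psi> t x) has_real_derivative
     - \<alpha> * t powr (- \<alpha> - 1) * \<Psi> (x / sqrt t) + \<Psi>1 (x / sqrt t) * - (x / sqrt t / (2 * t)) * (t * t powr (- \<alpha> - 1))) (at t)"
    by simp
  have "- \<alpha> * t powr (- \<alpha> - 1) * \<Psi> (x / sqrt t) + \<Psi>1 (x / sqrt t) * - (x / sqrt t / (2 * t)) * (t * t powr (- \<alpha> - 1))
      = - (t powr (- \<alpha> - 1) * (\<alpha> * \<Psi> (x / sqrt t) + (x / sqrt t) * \<Psi>1 (x / sqrt t) / 2))"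
    using t by (simp add: field_simps)
  moreover have "- (\<alpha> + 1) = - \<alpha> - 1" by simp
  ultimately show ?thesis using D unfolding selfsim_def by (simp only:)
qed

lemma selfsim_continuous:
  assumes "continuous_on UNIV \<Psi>" "0 < t0"
  shows "continuous_on ({t0..} \<times> UNIV) (\<lambda>(t, x). selfsim \<alpha> \<Psi> t x)"
  unfolding selfsim_def case_prod_unfold
  by (intro continuous_intros continuous_on_compose2[OF assms(1)]) (use assms(2) in auto)

text \<open>The barrier is the spatially constant solution with initial value
  \<open>M\<close>.\<close>

lemma strong_sol_le_inverse:
  assumes u: "strong_sol \<phi> u" and M: "\<And>x. \<phi> x \<le> M" "0 < M" and t: "0 \<le> t"
  shows "u t x \<le> 2 / (t + 2 / M)"
proof (rule strong_sol_le_barrier[OF u order_refl, where G = "\<lambda>t x. 2 / (t + 2 / M)" and K = 0])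
  have pos: "0 < t + 2 / M" if "0 \<le> t" for t using that M(2) by (simp add: add_nonneg_pos)
  show "continuous_on ({0..} \<times> UNIV) (\<lambda>(t, x :: real). 2 / (t + 2 / M))"
    unfolding case_prod_unfold by (intro continuous_intros) (use pos in fastforce)
  show "0 \<le> 2 / (t + 2 / M)" if "0 \<le> t" for t using pos[OF that] by simp
  show "u 0 x \<le> 2 / (0 + 2 / M)" for x
    using M u by (simp add: strong_sol_def)
  fix t x assume t: "0 < t" and less: "2 / (t + 2 / M) < u t x"
  show "heat_super (\<lambda>r. 2 / (r + 2 / M)) (\<lambda>x. 2 / (t + 2 / M)) t x ((u t x)\<^sup>2 / 2)"
  proof (rule le_barrierI[where ?G1.0 = "\<lambda>_. 0" and e = 1])
    show "DERIV (\<lambda>r. 2 / (r + 2 / M)) t :> - (2 / (t + 2 / M)\<^sup>2)"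
      using pos[of t] t by (auto intro!: derivative_eq_intros simp: power2_eq_square field_simps)
    have "(2 / (t + 2 / M))\<^sup>2 \<le> (u t x)\<^sup>2"
      using less pos[of t] t by (intro power_mono) auto
    then show "0 / 2 - (u t x)\<^sup>2 / 2 \<le> - (2 / (t + 2 / M)\<^sup>2)" by (simp add: power_divide)
  qed auto
qed (rule t)

text \<open>For \<open>z > 1\<close> this is a multiple of the derivative of the Gaussian, so that
  \<open>selfsim 1 gauss_barrier\<close> solves the heat equation there.\<close>
definition gauss_barrier :: "real \<Rightarrow> real" where
  "gauss_barrier z = (if \<bar>z\<bar> \<le> 1 then 2 else 2 * \<bar>z\<bar> * exp ((1 - z\<^sup>2) / 2))"

lemma gauss_barrier_continuous: "continuous_on UNIV gauss_barrier"
proof -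
  have eq: "gauss_barrier = (\<lambda>z. 2 * max 1 \<bar>z\<bar> * exp ((1 - (max 1 \<bar>z\<bar>)\<^sup>2) / 2))"
    by (auto simp: gauss_barrier_def max_def fun_eq_iff)
  show ?thesis unfolding eq by (intro continuous_intros) auto
qed

lemma gauss_barrier_pos: "0 < gauss_barrier z"
  by (auto simp: gauss_barrier_def)

definition "gauss_barrier1 z = 2 * sgn z * (1 - z\<^sup>2) * exp ((1 - z\<^sup>2) / 2)" for z :: real
definition "gauss_barrier2 z = 2 * sgn z * (z ^ 3 - 3 * z) * exp ((1 - z\<^sup>2) / 2)" for z :: real

lemma gauss_barrier_deriv:
  assumes "1 < \<bar>z\<bar>"
  shows "DERIV gauss_barrier z :> gauss_barrier1 z"
    "DERIV gauss_barrier1 z :> gauss_barrier2 z"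
proof -
  define s where "s = sgn z"
  define S where "S = {w. 1 < s * w}"
  have S: "open S" unfolding S_def by (intro open_Collect_less continuous_intros)
  have z: "z \<in> S" using assms by (auto simp: S_def s_def sgn_if abs_if split: if_splits)
  have w: "sgn w = s \<and> 1 < \<bar>w\<bar> \<and> \<bar>w\<bar> = s * w" if "w \<in> S" for w
    using that assms by (auto simp: S_def s_def sgn_if abs_if split: if_splits)
  have 1: "DERIV (\<lambda>w. 2 * (s * w) * exp ((1 - w\<^sup>2) / 2)) z :> gauss_barrier1 z"
    unfolding gauss_barrier1_def s_def
    by (auto intro!: derivative_eq_intros simp: algebra_simps power2_eq_square)
  have "\<forall>\<^sub>F w in nhds z. gauss_barrier w = 2 * (s * w) * exp ((1 - w\<^sup>2) / 2)"
    using eventually_nhds_in_open[OF S z]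
  proof (rule eventually_mono)
    show "gauss_barrier w = 2 * (s * w) * exp ((1 - w\<^sup>2) / 2)" if "w \<in> S" for w
      unfolding gauss_barrier_def using w[OF that] by auto
  qed
  from DERIV_cong_ev[OF refl this refl, THEN iffD2, OF 1]
  show "DERIV gauss_barrier z :> gauss_barrier1 z" .
  have 2: "DERIV (\<lambda>w. 2 * s * (1 - w\<^sup>2) * exp ((1 - w\<^sup>2) / 2)) z :> gauss_barrier2 z"
    unfolding gauss_barrier2_def s_def
    by (auto intro!: derivative_eq_intros simp: algebra_simps power2_eq_square power3_eq_cube)
  have "\<forall>\<^sub>F w in nhds z. gauss_barrier1 w = 2 * s * (1 - w\<^sup>2) * exp ((1 - w\<^sup>2) / 2)"
    using eventually_nhds_in_open[OF S z]
  proof (rule eventually_mono)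
    show "gauss_barrier1 w = 2 * s * (1 - w\<^sup>2) * exp ((1 - w\<^sup>2) / 2)" if "w \<in> S" for w
      unfolding gauss_barrier1_def using w[OF that] by auto
  qed
  from DERIV_cong_ev[OF refl this refl, THEN iffD2, OF 2]
  show "DERIV gauss_barrier1 z :> gauss_barrier2 z" .
qed

lemma gauss_barrier_heat:
  "1 < \<bar>z\<bar> \<Longrightarrow> - (1 * gauss_barrier z + z * gauss_barrier1 z / 2) = gauss_barrier2 z / 2"
  by (cases "0 < z") (auto simp: gauss_barrier_def gauss_barrier1_def gauss_barrier2_def abs_if field_simps power2_eq_square power3_eq_cube)

lemma U_bounded: 
  assumes "0 \<le> l" "0 < N" "0 < t"
  shows "0 \<le> U l N t x" "U l N t x \<le> 2 / t"
proof -
  show "0 \<le> U l N t x" using U_strong_sol[OF assms(1,2)] by (simp add: strong_sol_def)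
  define M where "M = l / bump_mass * N + 1"
  have M: "0 < M" "approx_delta l N 0 y \<le> M" for y
    using approx_delta_bounds[OF assms(1,2), of 0 y] by (auto simp: M_def)
  have "U l N t x \<le> 2 / (t + 2 / M)"
    by (rule strong_sol_le_inverse[OF U_strong_sol[OF assms(1,2)] M(2) M(1)]) (use assms in auto)
  also have "\<dots> \<le> 2 / t" using M(1) assms(3) by (intro divide_left_mono mult_pos_pos) (auto intro: add_pos_nonneg)
  finally show "U l N t x \<le> 2 / t" .
qed

text \<open>Starting the barrier at time \<open>1 / N^2\<close> places the support of the bump in
  its flat part. There the spatially constant solution already gives the bound, so the differential
  inequality is needed only where the barrier is smooth and solves the heat equation. The bound
  contains \<open>l\<close> only through the size required of \<open>N\<close>, so it becomes
  uniform in \<open>l\<close>.\<close>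

lemma U_le_gauss_barrier:
  assumes l: "0 \<le> l" and N: "0 < N" "l / bump_mass \<le> 2 * N" and t: "0 \<le> t"
  shows "U l N t x \<le> selfsim 1 gauss_barrier (t + 1 / N\<^sup>2) x"
proof -
  define \<epsilon> where "\<epsilon> = 1 / N\<^sup>2"
  have \<epsilon>: "0 < \<epsilon>" using N by (simp add: \<epsilon>_def)
  note u = U_strong_sol[OF l N(1)]
  have "approx_delta l N 0 y \<le> 2 * N\<^sup>2" for y
  proof -
    have "approx_delta l N 0 y \<le> l / bump_mass * N" by (rule approx_delta_bounds[OF l N(1)])
    also have "\<dots> \<le> 2 * N * N" by (rule mult_right_mono[OF N(2)]) (use N in simp)
    finally show ?thesis by (simp add: power2_eq_square)
  qed
  from strong_sol_le_inverse[OF u this] N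
  have inv: "U l N t x \<le> 2 / (t + \<epsilon>)" if "0 \<le> t" for t x using that by (simp add: \<epsilon>_def)
  have inner: "U l N t x \<le> selfsim 1 gauss_barrier (t + \<epsilon>) x" if "0 \<le> t" "\<bar>x / sqrt (t + \<epsilon>)\<bar> \<le> 1" for t x
    using inv[OF that(1), of x] that \<epsilon> by (simp add: selfsim_1 gauss_barrier_def)
  have "U l N t x \<le> (\<lambda>t x. selfsim 1 gauss_barrier (t + \<epsilon>) x) t x"
  proof (rule strong_sol_le_barrier[OF u order_refl, where K = 0])
    have "continuous_on ({0..} \<times> UNIV) (\<lambda>q :: real \<times> real. (\<lambda>(t, x). selfsim 1 gauss_barrier t x) (fst q + \<epsilon>, snd q))"
      by (rule continuous_on_compose2[OF selfsim_continuous[OF gauss_barrier_continuous \<epsilon>]])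
        (auto intro!: continuous_intros)
    then show "continuous_on ({0..} \<times> UNIV) (\<lambda>(t, x). selfsim 1 gauss_barrier (t + \<epsilon>) x)"
      by (simp add: case_prod_unfold)
    show "0 \<le> selfsim 1 gauss_barrier (t + \<epsilon>) x" for t x
      using gauss_barrier_pos by (simp add: selfsim_def less_imp_le)
    show "U l N 0 x \<le> selfsim 1 gauss_barrier (0 + \<epsilon>) x" for x
    proof (cases "\<bar>x / sqrt (0 + \<epsilon>)\<bar> \<le> 1")
      case False
      then have "1 / N \<le> \<bar>x - 0\<bar>" using N by (simp add: \<epsilon>_def real_sqrt_divide abs_mult field_simps)
      then have "U l N 0 x = 0" using u approx_delta_bounds(3)[OF l N(1)] by (simp add: strong_sol_def)
      then show ?thesis using gauss_barrier_pos by (simp add: selfsim_def less_imp_le)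
    qed (use inner in blast)
    fix t x assume t: "0 < t" and less: "selfsim 1 gauss_barrier (t + \<epsilon>) x < U l N t x"
    define \<tau> where "\<tau> = t + \<epsilon>"
    have \<tau>: "0 < \<tau>" using t \<epsilon> by (simp add: \<tau>_def)
    have z: "1 < \<bar>x / sqrt \<tau>\<bar>" using inner[of t x] less t by (fastforce simp: \<tau>_def)
    have z': "sqrt \<tau> < \<bar>x\<bar>" using z \<tau> by (simp add: less_divide_eq)
    have z'': "1 < \<bar>y / sqrt \<tau>\<bar>" if "\<bar>y - x\<bar> < \<bar>x\<bar> - sqrt \<tau>" for y
      using that \<tau> by (simp add: less_divide_eq)
    show "heat_super (\<lambda>r. selfsim 1 gauss_barrier (r + \<epsilon>) x) (selfsim 1 gauss_barrier (t + \<epsilon>)) t x ((U l N t x)\<^sup>2 / 2)"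
      unfolding \<tau>_def[symmetric]
    proof (rule le_barrierI[where e = "\<bar>x\<bar> - sqrt \<tau>"])
      show "((\<lambda>r. selfsim 1 gauss_barrier (r + \<epsilon>) x) has_real_derivative
        - selfsim (1 + 1) (\<lambda>z. 1 * gauss_barrier z + z * gauss_barrier1 z / 2) \<tau> x) (at t)"
        using selfsim_dt[where \<Psi> = gauss_barrier and ?\<Psi>1.0 = gauss_barrier1 and \<alpha> = 1, OF \<tau> gauss_barrier_deriv(1)[OF z]]
        unfolding \<tau>_def by (rule DERIV_shift[THEN iffD1])
      show "DERIV (selfsim 1 gauss_barrier \<tau>) y :> selfsim (1 + 1 / 2) gauss_barrier1 \<tau> y"
        if "\<bar>y - x\<bar> < \<bar>x\<bar> - sqrt \<tau>" for y
        by (rule selfsim_dx[where \<Psi> = gauss_barrier and ?\<Psi>1.0 = gauss_barrier1, OF \<tau> gauss_barrier_deriv(1)[OF z''[OF that]]])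
      show "DERIV (selfsim (1 + 1 / 2) gauss_barrier1 \<tau>) x :> selfsim (1 + 1 / 2 + 1 / 2) gauss_barrier2 \<tau> x"
        by (rule selfsim_dx[where \<Psi> = gauss_barrier1 and ?\<Psi>1.0 = gauss_barrier2, OF \<tau> gauss_barrier_deriv(2)[OF z]])
      have "selfsim (1 + 1 / 2 + 1 / 2) gauss_barrier2 \<tau> x / 2
         = - selfsim (1 + 1) (\<lambda>z. 1 * gauss_barrier z + z * gauss_barrier1 z / 2) \<tau> x"
      proof -
        have "selfsim (1 + 1 / 2 + 1 / 2) gauss_barrier2 \<tau> x / 2 = \<tau> powr (- (1 + 1)) * (gauss_barrier2 (x / sqrt \<tau>) / 2)"
          by (simp add: selfsim_def)
        also have "gauss_barrier2 (x / sqrt \<tau>) / 2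
            = - (1 * gauss_barrier (x / sqrt \<tau>) + x / sqrt \<tau> * gauss_barrier1 (x / sqrt \<tau>) / 2)"
          by (rule gauss_barrier_heat[OF z, symmetric])
        finally show ?thesis unfolding selfsim_def by (simp only: mult_minus_right)
      qed
      then show "selfsim (1 + 1 / 2 + 1 / 2) gauss_barrier2 \<tau> x / 2 - (U l N t x)\<^sup>2 / 2
         \<le> - selfsim (1 + 1) (\<lambda>z. 1 * gauss_barrier z + z * gauss_barrier1 z / 2) \<tau> x"
        by simp
    qed (use z' in simp)
  qed (rule t)
  then show ?thesis by (simp add: \<epsilon>_def)
qed

section \<open>From the log-Laplace equation to the equation of F\<close>

lemma antideriv_dominated:
  assumes c: "\<And>k. continuous_on UNIV (h k)" and b: "\<And>k y. \<bar>y\<bar> \<le> \<bar>z\<bar> \<Longrightarrow> \<bar>h k y\<bar> \<le> B"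
    and l: "\<And>y. (\<lambda>k. h k y) \<longlonglongrightarrow> g y"
  shows "(\<lambda>k. antideriv (h k) z) \<longlonglongrightarrow> antideriv g z"
proof (cases "0 \<le> z")
  case True
  have "(\<lambda>k. integral {0..z} (h k)) \<longlonglongrightarrow> integral {0..z} g"
  proof (rule dominated_convergence(2))
    show "h k integrable_on {0..z}" for k
      by (intro integrable_continuous_real continuous_on_subset[OF c]) auto
    show "(\<lambda>_. B) integrable_on {0..z}" by (intro integrable_continuous_real continuous_intros)
    show "norm (h k x) \<le> B" if "x \<in> {0..z}" for k x using b[of x k] that by auto
  qed (use l in auto)
  then show ?thesis using True by (simp add: antideriv_def)
next
  case False
  have "(\<lambda>k. integral {z..0} (h k)) \<longlonglongrightarrow> integral {z..0} g"
  proof (rule dominated_convergence(2))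
    show "h k integrable_on {z..0}" for k
      by (intro integrable_continuous_real continuous_on_subset[OF c]) auto
    show "(\<lambda>_. B) integrable_on {z..0}" by (intro integrable_continuous_real continuous_intros)
    show "norm (h k x) \<le> B" if "x \<in> {z..0}" for k x using b[of x k] that by auto
  qed (use l in auto)
  then show ?thesis using False by (auto simp: antideriv_def intro!: tendsto_intros)
qed

text \<open>Meant for pointwise limits, whose continuity is still unknown; the integrability of
  \<open>g\<close> comes from dominated convergence, and an indefinite integral is continuous in any
  case.\<close>

lemma antideriv_continuous_bounded_limit:
  assumes c: "\<And>k. continuous_on UNIV (h k)" and b: "\<And>R. \<exists>B. \<forall>k y. \<bar>y\<bar> \<le> R \<longrightarrow> \<bar>h k y\<bar> \<le> B"
    and l: "\<And>y. (\<lambda>k. h k y) \<longlonglongrightarrow> g y"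
  shows "continuous_on UNIV (antideriv g)"
proof -
  have "isCont (antideriv g) x" for x
  proof -
    define R where "R = \<bar>x\<bar> + 1"
    obtain B where B: "\<And>k y. \<bar>y\<bar> \<le> R \<Longrightarrow> \<bar>h k y\<bar> \<le> B" using b by blast
    have i: "g integrable_on {-R..R}"
    proof (rule dominated_convergence(1))
      show "h k integrable_on {-R..R}" for k
        by (intro integrable_continuous_real continuous_on_subset[OF c]) auto
      show "(\<lambda>_. B) integrable_on {-R..R}" by (intro integrable_continuous_real continuous_intros)
      show "norm (h k x) \<le> B" if "x \<in> {-R..R}" for k x using B[of x k] that by auto
    qed (use l in auto)
    have "continuous_on {-R..R} (\<lambda>x. integral {-R..x} g - integral {-R..0} g)"
      by (intro continuous_intros indefinite_integral_continuous_1 i)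
    then have "continuous_on {-R..R} (antideriv g)"
    proof (rule continuous_on_eq)
      show "integral {-R..x} g - integral {-R..0} g = antideriv g x" if "x \<in> {-R..R}" for x
        by (rule antideriv_alt[OF i, symmetric]) (use that in auto)
    qed
    then show ?thesis by (rule continuous_on_interior) (auto simp: R_def)
  qed
  then show ?thesis by (simp add: continuous_at_imp_continuous_on)
qed

text \<open>The equation for \<open>w = e\<^sup>\<sigma> u(e\<^sup>\<sigma>, e\<^sup>\<sigma>\<^sup>/\<^sup>2 y)\<close>, integrated twice in y from 0 and once in \<sigma> from 0 to 1.\<close>
lemma selfsim_integral_identity:
  assumes u: "strong_sol \<phi> u" and even: "\<And>t x. 0 < t \<Longrightarrow> u t (- x) = u t x"
  defines "w \<equiv> \<lambda>\<sigma> y. exp \<sigma> * u (exp \<sigma>) (exp (\<sigma> / 2) * y)"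
  shows "\<exists>\<xi>. 0 < \<xi> \<and> \<xi> < 1 \<and>
     2 * (antideriv (\<lambda>y. (z - y) * w 1 y) z - antideriv (\<lambda>y. (z - y) * w 0 y) z)
      = w \<xi> z - w \<xi> 0 + antideriv (\<lambda>y. z * w \<xi> y - (z - y) * (w \<xi> y)\<^sup>2) z"
proof -
  obtain p q where U: "continuous_on UNIV (\<lambda>(t, x). u t x)"
     "continuous_on UNIV (\<lambda>(t, x). p t x)" "continuous_on UNIV (\<lambda>(t, x). q t x)"
     "\<And>t x. DERIV (u t) x :> p t x" "\<And>t x. DERIV (p t) x :> q t x"
     "\<And>t x. 0 < t \<Longrightarrow> DERIV (\<lambda>r. u r x) t :> q t x / 2 - (u t x)\<^sup>2 / 2"
    using strong_solD[OF u] by metis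
  define w1 where "w1 \<sigma> y = exp \<sigma> * exp (\<sigma> / 2) * p (exp \<sigma>) (exp (\<sigma> / 2) * y)" for \<sigma> y
  define w2 where "w2 \<sigma> y = exp \<sigma> * exp \<sigma> * q (exp \<sigma>) (exp (\<sigma> / 2) * y)" for \<sigma> y
  have ee: "exp (\<sigma> / 2) * exp (\<sigma> / 2) = exp \<sigma>" for \<sigma> :: real by (simp add: exp_add[symmetric])
  have cont: "continuous_on UNIV (\<lambda>r :: real \<times> real. f (exp (fst r)) (exp (fst r / 2) * snd r))"
    if "continuous_on UNIV (\<lambda>(t, x). f t x)" for f :: "real \<Rightarrow> real \<Rightarrow> real"
  proof -
    have "continuous_on UNIV (\<lambda>r :: real \<times> real. (\<lambda>(t, x). f t x) (exp (fst r), exp (fst r / 2) * snd r))"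
      by (rule continuous_on_compose2[OF that]) (auto intro!: continuous_intros)
    then show ?thesis by simp
  qed
  have cw: "continuous_on UNIV (\<lambda>r. w (fst r) (snd r))" "continuous_on UNIV (\<lambda>r. w1 (fst r) (snd r))"
    "continuous_on UNIV (\<lambda>r. w2 (fst r) (snd r))"
  proof -
    have e: "continuous_on UNIV (\<lambda>r :: real \<times> real. exp (fst r))" "continuous_on UNIV (\<lambda>r :: real \<times> real. exp (fst r / 2))"
      by (intro continuous_intros; simp)+
    show "continuous_on UNIV (\<lambda>r. w (fst r) (snd r))" unfolding w_def
      by (rule continuous_on_mult[OF e(1) cont[OF U(1)]])
    show "continuous_on UNIV (\<lambda>r. w1 (fst r) (snd r))" unfolding w1_def
      by (rule continuous_on_mult[OF continuous_on_mult[OF e] cont[OF U(2)]])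
    show "continuous_on UNIV (\<lambda>r. w2 (fst r) (snd r))" unfolding w2_def
      by (rule continuous_on_mult[OF continuous_on_mult[OF e(1) e(1)] cont[OF U(3)]])
  qed
  have sl: "continuous_on UNIV (f \<sigma>)" if "continuous_on UNIV (\<lambda>r :: real \<times> real. f (fst r) (snd r))"
    for f :: "real \<Rightarrow> real \<Rightarrow> real" and \<sigma>
  proof -
    have "continuous_on UNIV (\<lambda>y. (\<lambda>r :: real \<times> real. f (fst r) (snd r)) (\<sigma>, y))"
      by (rule continuous_on_compose2[OF that]) (auto intro!: continuous_intros)
    then show ?thesis by simp
  qed
  note cws = sl[OF cw(1)] sl[OF cw(2)] sl[OF cw(3)]
  have lin: "DERIV (\<lambda>y. exp (\<sigma> / 2) * y) y :> exp (\<sigma> / 2)" for \<sigma> y :: real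
    by (auto intro!: derivative_eq_intros)
  have d1: "DERIV (w \<sigma>) y :> w1 \<sigma> y" for \<sigma> y
    using DERIV_cmult[OF DERIV_chain2[OF U(4) lin], of "exp \<sigma>" "exp \<sigma>" \<sigma> y] by (simp add: w_def w1_def mult_ac)
  have d2: "DERIV (w1 \<sigma>) y :> w2 \<sigma> y" for \<sigma> y
  proof -
    have "DERIV (w1 \<sigma>) y :> exp \<sigma> * exp (\<sigma> / 2) * (q (exp \<sigma>) (exp (\<sigma> / 2) * y) * exp (\<sigma> / 2))"
      unfolding w1_def by (rule DERIV_cmult[OF DERIV_chain2[OF U(5) lin]])
    moreover have "exp \<sigma> * exp (\<sigma> / 2) * (X * exp (\<sigma> / 2)) = exp \<sigma> * (exp (\<sigma> / 2) * exp (\<sigma> / 2)) * X" for X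
      by (simp only: mult_ac)
    ultimately show ?thesis unfolding w2_def by (simp only: ee)
  qed
  define h where "h \<sigma> y = w2 \<sigma> y / 2 + y * w1 \<sigma> y / 2 + w \<sigma> y - (w \<sigma> y)\<^sup>2 / 2" for \<sigma> y
  have ch: "continuous_on UNIV (\<lambda>r. h (fst r) (snd r))"
    unfolding h_def by (intro continuous_intros cw) auto
  have dt: "DERIV (\<lambda>\<sigma>. w \<sigma> y) \<sigma> :> h \<sigma> y" for \<sigma> y
  proof -
    have a: "((\<lambda>\<sigma>. u (exp \<sigma>) (exp (\<sigma> / 2) * y)) has_real_derivative
      (q (exp \<sigma>) (exp (\<sigma> / 2) * y) / 2 - (u (exp \<sigma>) (exp (\<sigma> / 2) * y))\<^sup>2 / 2) * exp \<sigma>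
      + p (exp \<sigma>) (exp (\<sigma> / 2) * y) * (exp (\<sigma> / 2) * y / 2)) (at \<sigma>)"
    proof (rule DERIV_two_variables[where a = exp and b = "\<lambda>\<sigma>. exp (\<sigma> / 2) * y" and f = u and fy = p])
      show "((\<lambda>t. u t (exp (\<sigma> / 2) * y)) has_real_derivative
          q (exp \<sigma>) (exp (\<sigma> / 2) * y) / 2 - (u (exp \<sigma>) (exp (\<sigma> / 2) * y))\<^sup>2 / 2) (at (exp \<sigma>))"
        by (rule U(6)) simp
      show "continuous (at (exp \<sigma>, exp (\<sigma> / 2) * y)) (\<lambda>(x, y). p x y)"
        using U(2) unfolding continuous_on_eq_continuous_at[OF open_UNIV] by blast
      show "DERIV (\<lambda>\<sigma>. exp (\<sigma> / 2) * y) \<sigma> :> exp (\<sigma> / 2) * y / 2"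
        by (auto intro!: derivative_eq_intros)
    qed (auto intro: U(4))
    have "DERIV (\<lambda>\<sigma>. w \<sigma> y) \<sigma> :> exp \<sigma> * u (exp \<sigma>) (exp (\<sigma> / 2) * y) +
      ((q (exp \<sigma>) (exp (\<sigma> / 2) * y) / 2 - (u (exp \<sigma>) (exp (\<sigma> / 2) * y))\<^sup>2 / 2) * exp \<sigma>
      + p (exp \<sigma>) (exp (\<sigma> / 2) * y) * (exp (\<sigma> / 2) * y / 2)) * exp \<sigma>"
      unfolding w_def by (rule DERIV_mult[OF DERIV_exp a])
    moreover have "exp \<sigma> * u (exp \<sigma>) (exp (\<sigma> / 2) * y) +
      ((q (exp \<sigma>) (exp (\<sigma> / 2) * y) / 2 - (u (exp \<sigma>) (exp (\<sigma> / 2) * y))\<^sup>2 / 2) * exp \<sigma>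
      + p (exp \<sigma>) (exp (\<sigma> / 2) * y) * (exp (\<sigma> / 2) * y / 2)) * exp \<sigma> = h \<sigma> y"
      unfolding h_def w_def w1_def w2_def by (simp add: algebra_simps power2_eq_square)
    ultimately show ?thesis by simp
  qed
  \<comment> \<open>The weight \<open>z - y\<close> is Cauchy's formula for the twice repeated
    integral; integration by parts then moves all derivatives off \<open>w\<close>.\<close>
  define L where "L \<sigma> = antideriv (\<lambda>y. (z - y) * w \<sigma> y) z" for \<sigma>
  have dL: "DERIV L \<sigma> :> antideriv (\<lambda>y. (z - y) * h \<sigma> y) z" for \<sigma>
    unfolding L_def
  proof (rule antideriv_param_has_derivative)
    show "continuous_on UNIV (\<lambda>(\<sigma>, y). (z - y) * w \<sigma> y)" "continuous_on UNIV (\<lambda>(\<sigma>, y). (z - y) * h \<sigma> y)"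
      unfolding case_prod_unfold by (intro continuous_intros cw ch)+
    show "DERIV (\<lambda>\<sigma>. (z - y) * w \<sigma> y) \<sigma> :> (z - y) * h \<sigma> y" for \<sigma> y
      by (rule DERIV_cmult[OF dt])
  qed
  \<comment> \<open>Evenness removes the boundary term \<open>z * w1 \<sigma> 0\<close>, the only
    place where a derivative would survive.\<close>
  have w10: "w1 \<sigma> 0 = 0" for \<sigma>
  proof -
    have "w \<sigma> (- y) = w \<sigma> y" for y unfolding w_def using even[of "exp \<sigma>" "exp (\<sigma> / 2) * y"] by simp
    then have a: "DERIV (\<lambda>y. w \<sigma> (- y)) 0 :> w1 \<sigma> 0" using d1[of \<sigma> 0] by simp
    have b: "DERIV (\<lambda>y. w \<sigma> (- y)) 0 :> w1 \<sigma> (- 0) * - 1"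
      by (rule DERIV_chain2[OF d1]) (auto intro!: derivative_eq_intros)
    show ?thesis using DERIV_unique[OF a b] by simp
  qed
  have rhs: "2 * antideriv (\<lambda>y. (z - y) * h \<sigma> y) z
     = w \<sigma> z - w \<sigma> 0 + antideriv (\<lambda>y. z * w \<sigma> y - (z - y) * (w \<sigma> y)\<^sup>2) z" for \<sigma>
  proof -
    define g where "g y = z * w \<sigma> y - (z - y) * (w \<sigma> y)\<^sup>2" for y
    have cg: "continuous_on UNIV g" unfolding g_def by (intro continuous_on_diff continuous_on_mult continuous_on_power continuous_on_const continuous_on_id cws(1))
    define H where "H y = ((z - y) * w1 \<sigma> y + w \<sigma> y + (z - y) * y * w \<sigma> y + antideriv g y) / 2" for y
    have "antideriv (\<lambda>y. (z - y) * h \<sigma> y) z = H z - H 0"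
    proof (rule antideriv_unique)
      show "continuous_on UNIV (\<lambda>y. (z - y) * h \<sigma> y)" by (intro continuous_on_diff continuous_on_mult continuous_on_const continuous_on_id sl[OF ch])
      fix y
      have "DERIV H y :> ((- 1 * w1 \<sigma> y + w2 \<sigma> y * (z - y)) + w1 \<sigma> y
          + ((- 1 * y + 1 * (z - y)) * w \<sigma> y + w1 \<sigma> y * ((z - y) * y)) + g y) / 2"
      proof -
        have zy: "DERIV (\<lambda>y. z - y) y :> - 1" by (auto intro!: derivative_eq_intros)
        show ?thesis unfolding H_def
          by (rule DERIV_cdivide[OF DERIV_add[OF DERIV_add[OF DERIV_add[OF DERIV_mult[OF zy d2] d1]
              DERIV_mult[OF DERIV_mult[OF zy DERIV_ident] d1]] antideriv_has_derivative[OF cg]]])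
      qed
      moreover have "((- 1 * w1 \<sigma> y + w2 \<sigma> y * (z - y)) + w1 \<sigma> y
          + ((- 1 * y + 1 * (z - y)) * w \<sigma> y + w1 \<sigma> y * ((z - y) * y)) + g y) / 2 = (z - y) * h \<sigma> y"
        unfolding g_def h_def by (simp add: algebra_simps add_divide_distrib diff_divide_distrib power2_eq_square)
      ultimately show "DERIV H y :> (z - y) * h \<sigma> y" by simp
    qed
    then show ?thesis using w10 by (simp add: H_def g_def[abs_def] field_simps)
  qed
  \<comment> \<open>The mean value theorem replaces the integral over \<open>\<sigma>\<close> by the
    value at one unknown point, so that only limits of functions of \<open>y\<close> have to be
    taken afterwards.\<close>
  have "\<exists>\<xi>>0. \<xi> < 1 \<and> L 1 - L 0 = (1 - 0) * antideriv (\<lambda>y. (z - y) * h \<xi> y) z"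
    by (rule MVT2) (use dL in auto)
  then obtain \<xi> where \<xi>: "0 < \<xi>" "\<xi> < 1" "L 1 - L 0 = antideriv (\<lambda>y. (z - y) * h \<xi> y) z" by auto
  show ?thesis
    by (intro exI[of _ \<xi>] conjI \<xi>(1,2)) (use rhs[of \<xi>] \<xi>(3) in \<open>simp add: L_def\<close>)
qed

context sbm_laws
begin

text \<open>Agrees with \<open>sbmF Q\<close> by \<open>sbmF_eq\<close>. Here the unit mass stays at
  0 and the evaluation point moves, so that a single law is involved.\<close>

definition F :: "real \<Rightarrow> real" where
  "F y = - ln (measure (Q (return borel 0) 1) {f. apply_bcontfun f y = 0})"

lemma law_space: "fin_meas X0 \<Longrightarrow> 0 < t \<Longrightarrow> space (Q X0 t) = UNIV"
  using sets_eq_imp_space_eq[OF lawD(2)] by simp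

abbreviation "small x a \<equiv> {f :: real \<Rightarrow>\<^sub>C real. 0 < apply_bcontfun f x \<and> apply_bcontfun f x \<le> a}"

lemma eval_sets:
  assumes "fin_meas X0" "0 < t"
  shows "{f. apply_bcontfun f x = 0} \<in> sets (Q X0 t)" "{f. 0 < apply_bcontfun f x} \<in> sets (Q X0 t)"
    "small x a \<in> sets (Q X0 t)"
  unfolding lawD(2)[OF assms] by (measurable; fail)+

lemma zero_limit:
  assumes X: "fin_meas X0" "0 < t" and l: "filterlim lk at_top sequentially" "\<And>k :: nat. 0 \<le> lk k"
  shows "(\<lambda>k. \<integral>f. exp (- (lk k * apply_bcontfun f x)) \<partial>Q X0 t) \<longlonglongrightarrow> measure (Q X0 t) {f. apply_bcontfun f x = 0}"
proof -
  interpret prob_space "Q X0 t" by (rule lawD(1)[OF X])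
  have "(\<lambda>k. \<integral>f. exp (- (lk k * apply_bcontfun f x)) \<partial>Q X0 t) \<longlonglongrightarrow> (\<integral>f. indicator {f. apply_bcontfun f x = 0} f \<partial>Q X0 t)"
  proof (rule integral_dominated_convergence[where w = "\<lambda>_. 1"])
    show "indicat_real {f. apply_bcontfun f x = 0} \<in> borel_measurable (Q X0 t)"
      using eval_sets(1)[OF X] by simp
    show "(\<lambda>f. exp (- (lk k * apply_bcontfun f x))) \<in> borel_measurable (Q X0 t)" for k
      unfolding law_measurable[OF X] by measurable
    show "AE f in Q X0 t. norm (exp (- (lk k * apply_bcontfun f x))) \<le> 1" for k
      using lawD(3)[OF X] by eventually_elim (use l in auto)
    show "AE f in Q X0 t. (\<lambda>k. exp (- (lk k * apply_bcontfun f x))) \<longlonglongrightarrow> indicat_real {f. apply_bcontfun f x = 0} f"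
      using lawD(3)[OF X]
    proof eventually_elim
      case (elim f)
      show ?case
      proof (cases "apply_bcontfun f x = 0")
        case False
        then have "0 < apply_bcontfun f x" using elim by (simp add: less_le)
        then have "filterlim (\<lambda>k. lk k * apply_bcontfun f x) at_top sequentially"
          using filterlim_at_top_mult_tendsto_pos[OF tendsto_const _ l(1)] by blast
        then have "(\<lambda>k. exp (- (lk k * apply_bcontfun f x))) \<longlonglongrightarrow> 0"
          by (intro filterlim_compose[OF exp_at_bot]) (simp add: filterlim_uminus_at_bot)
        moreover have "indicat_real {f. apply_bcontfun f x = 0} f = 0" using False by simp
        ultimately show ?thesis by (simp only:)
      next
        case True
        have "(\<lambda>k. exp (- (lk k * apply_bcontfun f x))) = (\<lambda>k. 1)" using True by simp
        moreover have "indicat_real {f. apply_bcontfun f x = 0} f = 1" using True by simp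
        ultimately show ?thesis by (simp only: tendsto_const)
      qed
    qed
  qed simp
  moreover have "(\<integral>f. indicator {f. apply_bcontfun f x = 0} f \<partial>Q X0 t) = measure (Q X0 t) {f. apply_bcontfun f x = 0}"
    using eval_sets(1)[OF X] law_space[OF X] by simp
  ultimately show ?thesis by simp
qed

lemma Vp_le_gauss_barrier:
  assumes "0 \<le> l"
  shows "Vp l y \<le> gauss_barrier y"
proof -
  define c where "c = l / bump_mass + 1"
  have c: "0 < c" using assms bump_mass_pos by (simp add: c_def add_nonneg_pos)
  define Nk where "Nk k = c + real k" for k
  have N: "filterlim Nk at_top sequentially" "\<And>k. 0 < Nk k"
    unfolding Nk_def using c by (auto intro!: filterlim_tendsto_add_at_top[OF tendsto_const] filterlim_real_sequentially simp: add_pos_nonneg)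
  have lim: "(\<lambda>k. U l (Nk k) 1 y) \<longlonglongrightarrow> Vp l y"
    by (rule U_limit) (use assms N in auto)
  have le: "U l (Nk k) 1 y \<le> selfsim 1 gauss_barrier (1 + 1 / (Nk k)\<^sup>2) y" for k
  proof (rule U_le_gauss_barrier[OF assms N(2)])
    have "l / bump_mass \<le> c" by (simp add: c_def)
    then show "l / bump_mass \<le> 2 * Nk k" using c unfolding Nk_def by simp
  qed simp
  have "(\<lambda>k. 1 + 1 / (Nk k)\<^sup>2) \<longlonglongrightarrow> 1 + 0"
    by (intro tendsto_intros tendsto_divide_0[OF tendsto_const] filterlim_at_top_imp_at_infinity filterlim_pow_at_top N) simp
  then have "(\<lambda>k. (1 + 1 / (Nk k)\<^sup>2, y)) \<longlonglongrightarrow> (1, y)" by (intro tendsto_Pair) auto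
  moreover have "isCont (\<lambda>(t, x). selfsim 1 gauss_barrier t x) (1, y)"
    using selfsim_continuous[OF gauss_barrier_continuous, of "1 / 2" 1]
    by (rule continuous_on_interior) (auto simp: interior_Times)
  ultimately have "(\<lambda>k. selfsim 1 gauss_barrier (1 + 1 / (Nk k)\<^sup>2) y) \<longlonglongrightarrow> selfsim 1 gauss_barrier 1 y"
    using isCont_tendsto_compose by fastforce
  from LIMSEQ_le[OF lim this] le show ?thesis by (auto simp: selfsim_1)
qed

text \<open>Keeps the logarithm in \<open>F\<close> away from its default value at 0. The bound on
  the exponents is free of \<open>l\<close> and therefore survives the limit.\<close>

lemma zero_prob_pos: "0 < measure (Q (return borel 0) 1) {f. apply_bcontfun f y = 0}"
proof -
  have lim: "(\<lambda>n. exp (- Vp (real n) y)) \<longlonglongrightarrow> measure (Q (return borel 0) 1) {f. apply_bcontfun f y = 0}"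
    using zero_limit[OF fin_meas_return[of 0] zero_less_one filterlim_real_sequentially, of y] by (simp add: exp_Vp)
  have le: "exp (- gauss_barrier y) \<le> exp (- Vp (real n) y)" for n
    using Vp_le_gauss_barrier[of "real n" y] by simp
  have "exp (- gauss_barrier y) \<le> measure (Q (return borel 0) 1) {f. apply_bcontfun f y = 0}"
    by (rule LIMSEQ_le_const[OF lim]) (use le in blast)
  then show ?thesis using exp_gt_zero[of "- gauss_barrier y"] by linarith
qed

lemma Vp_tendsto_F:
  assumes "filterlim lk at_top sequentially" "\<And>k :: nat. 0 \<le> lk k"
  shows "(\<lambda>k. Vp (lk k) y) \<longlonglongrightarrow> F y"
  using tendsto_minus[OF tendsto_ln[OF zero_limit[OF fin_meas_return[of 0] zero_less_one assms, of y]]] zero_prob_pos[of y]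
  by (simp add: exp_Vp assms(2) F_def)

lemma Vp_le_F: "0 \<le> l \<Longrightarrow> Vp l y \<le> F y"
proof -
  assume l: "0 \<le> l"
  have "(\<lambda>k. Vp (l + real k) y) \<longlonglongrightarrow> F y"
    by (rule Vp_tendsto_F)
      (use l in \<open>auto intro!: filterlim_tendsto_add_at_top[OF tendsto_const] filterlim_real_sequentially\<close>)
  then show ?thesis by (rule LIMSEQ_le_const) (use l in \<open>auto intro!: Vp_mono\<close>)
qed

lemma F_le_gauss_barrier: "F y \<le> gauss_barrier y"
proof (rule LIMSEQ_le_const2[OF Vp_tendsto_F[OF filterlim_real_sequentially]])
  show "\<exists>N. \<forall>n\<ge>N. Vp (real n) y \<le> gauss_barrier y"
    using Vp_le_gauss_barrier[OF of_nat_0_le_iff] by blast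
qed simp

lemma gauss_barrier_le_2: "gauss_barrier y \<le> 2"
proof (cases "\<bar>y\<bar> \<le> 1")
  case False
  have "ln \<bar>y\<bar> \<le> \<bar>y\<bar> - 1" using False by (intro ln_le_minus_one) auto
  also have "\<dots> \<le> (y\<^sup>2 - 1) / 2"
    using False zero_le_power2[of "\<bar>y\<bar> - 1"] by (simp add: power2_eq_square algebra_simps)
  finally have "exp (ln \<bar>y\<bar>) \<le> exp ((y\<^sup>2 - 1) / 2)" by simp
  then have "\<bar>y\<bar> \<le> exp ((y\<^sup>2 - 1) / 2)" using False by simp
  then have "\<bar>y\<bar> * exp ((1 - y\<^sup>2) / 2) \<le> exp ((y\<^sup>2 - 1) / 2) * exp ((1 - y\<^sup>2) / 2)"
    by (rule mult_right_mono) simp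
  also have "\<dots> = 1" by (simp add: exp_add[symmetric] field_simps)
  finally show ?thesis using False by (simp add: gauss_barrier_def)
qed (simp add: gauss_barrier_def)

lemma F_bounds: "0 \<le> F y" "F y \<le> 2"
  using Vp_le_F[of 0 y] Vp_nonneg[of 0 y] F_le_gauss_barrier[of y] gauss_barrier_le_2[of y] by linarith+

lemma Vp_bounds:
  assumes "0 \<le> l"
  shows "Vp l y \<le> 2" "\<bar>Vp l y\<bar> \<le> 2"
  using Vp_le_F[OF assms, of y] F_bounds(2)[of y] Vp_nonneg[OF assms, of y] by linarith+

lemma Vp_even: "0 \<le> l \<Longrightarrow> Vp l (- y) = Vp l y"
proof -
  assume l: "0 \<le> l"
  have N: "filterlim (\<lambda>k. 1 + real k) at_top sequentially"
    by (auto intro!: filterlim_tendsto_add_at_top[OF tendsto_const] filterlim_real_sequentially)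
  have "(\<lambda>k. U l (1 + real k) 1 y) \<longlonglongrightarrow> Vp l y" "(\<lambda>k. U l (1 + real k) 1 (- y)) \<longlonglongrightarrow> Vp l (- y)"
    by (rule U_limit; use l N in \<open>auto simp: add_pos_nonneg\<close>)+
  moreover have "U l (1 + real k) 1 (- y) = U l (1 + real k) 1 y" for k
    by (rule U_even) (use l in \<open>auto simp: add_pos_nonneg\<close>)
  ultimately show ?thesis using LIMSEQ_unique by auto
qed

lemma F_even: "F (- y) = F y"
proof -
  have "(\<lambda>k. Vp (real k) (- y)) \<longlonglongrightarrow> F (- y)" "(\<lambda>k. Vp (real k) y) \<longlonglongrightarrow> F y"
    by (rule Vp_tendsto_F[OF filterlim_real_sequentially], simp)+
  then show ?thesis unfolding Vp_even[OF of_nat_0_le_iff] by (rule LIMSEQ_unique)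
qed

lemma F_measurable [measurable]: "F \<in> borel_measurable borel"
proof (rule borel_measurable_LIMSEQ_real)
  show "(\<lambda>k. Vp (real k) y) \<longlonglongrightarrow> F y" for y by (rule Vp_tendsto_F[OF filterlim_real_sequentially]) simp
  show "Vp (real k) \<in> borel_measurable borel" for k
    by (rule borel_measurable_continuous_onI[OF Vp_continuous_on]) simp
qed

end

lemma antideriv_split:
  assumes v: "continuous_on UNIV (v :: real \<Rightarrow> real)"
  shows "antideriv (\<lambda>y. z * v y - (z - y) * (v y)\<^sup>2) z
    = z * antideriv v z - z * antideriv (\<lambda>y. (v y)\<^sup>2) z + antideriv (\<lambda>y. y * (v y)\<^sup>2) z"
proof -
  have c: "continuous_on UNIV (\<lambda>y. (v y)\<^sup>2)" "continuous_on UNIV (\<lambda>y. y * (v y)\<^sup>2)"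
    by (intro continuous_on_power continuous_on_mult continuous_on_id v)+
  define H where "H x = z * antideriv v x - z * antideriv (\<lambda>y. (v y)\<^sup>2) x + antideriv (\<lambda>y. y * (v y)\<^sup>2) x" for x
  have "antideriv (\<lambda>y. z * v y - (z - y) * (v y)\<^sup>2) z = H z - H 0"
  proof (rule antideriv_unique)
    show "continuous_on UNIV (\<lambda>y. z * v y - (z - y) * (v y)\<^sup>2)"
      by (intro continuous_on_power continuous_on_diff continuous_on_mult continuous_on_id continuous_on_const v)
    have "DERIV H y :> z * v y - z * (v y)\<^sup>2 + y * (v y)\<^sup>2" for y
      unfolding H_def
      by (rule DERIV_add[OF DERIV_diff[OF DERIV_cmult[OF antideriv_has_derivative[OF v]]
          DERIV_cmult[OF antideriv_has_derivative[OF c(1)]]] antideriv_has_derivative[OF c(2)]])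
    then show "DERIV H y :> z * v y - (z - y) * (v y)\<^sup>2" for y
      by (simp add: algebra_simps)
  qed
  then show ?thesis by (simp add: H_def)
qed

text \<open>Uniqueness for second-order equations, in both directions from \<open>z\<close>: it is
  applied to the sum of the squares of a function and of its derivative.\<close>

lemma gronwall_zero:
  fixes E :: "real \<Rightarrow> real"
  assumes d: "\<And>x. DERIV E x :> E' x" and b: "\<And>x. \<bar>x\<bar> \<le> R \<Longrightarrow> \<bar>E' x\<bar> \<le> C * E x"
    and E: "\<And>x. 0 \<le> E x" "E z = 0" and zx: "\<bar>z\<bar> \<le> R" "\<bar>x\<bar> \<le> R"
  shows "E x = 0"
proof (cases "z \<le> x")
  case True
  have "E x * exp (- C * x) \<le> E z * exp (- C * z)"
  proof (rule DERIV_nonpos_imp_nonincreasing[OF True])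
    fix y assume y: "z \<le> y" "y \<le> x"
    have "DERIV (\<lambda>y. E y * exp (- C * y)) y :> (E' y - C * E y) * exp (- C * y)"
      by (auto intro!: derivative_eq_intros d simp: algebra_simps)
    moreover have "(E' y - C * E y) * exp (- C * y) \<le> 0"
    proof -
      have "\<bar>y\<bar> \<le> R" using y zx by linarith
      then show ?thesis using b[of y] by (intro mult_nonpos_nonneg) (auto simp: abs_le_iff)
    qed
    ultimately show "\<exists>w. DERIV (\<lambda>y. E y * exp (- C * y)) y :> w \<and> w \<le> 0" by blast
  qed
  then show ?thesis using E(1)[of x] by (simp add: E(2) mult_le_0_iff)
next
  case False
  then have xz: "x \<le> z" by simp
  have "E x * exp (C * x) \<le> E z * exp (C * z)"
  proof (rule DERIV_nonneg_imp_nondecreasing[OF xz])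
    fix y assume y: "x \<le> y" "y \<le> z"
    have "DERIV (\<lambda>y. E y * exp (C * y)) y :> (E' y + C * E y) * exp (C * y)"
      by (auto intro!: derivative_eq_intros d simp: algebra_simps)
    moreover have "(E' y + C * E y) * exp (C * y) \<ge> 0"
    proof -
      have "\<bar>y\<bar> \<le> R" using y zx by linarith
      then show ?thesis using b[of y] by (intro mult_nonneg_nonneg) (auto simp: abs_le_iff)
    qed
    ultimately show "\<exists>w. DERIV (\<lambda>y. E y * exp (C * y)) y :> w \<and> w \<ge> 0" by blast
  qed
  then show ?thesis using E(1)[of x] by (simp add: E(2) mult_le_0_iff)
qed

context sbm_laws
begin

text \<open>In self-similar variables \<open>\<sigma>\<close> becomes the factor
  \<open>exp (\<sigma> / 2)\<close> of the Laplace parameter at time 1. The intermediate points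
  depend on \<open>N\<close>, hence the convergent subsequence; its limit may be an endpoint of
  \<open>[0,1]\<close>.\<close>

lemma Vp_integral_identity:
  assumes l: "0 < l"
  shows "\<exists>\<xi>. 0 \<le> \<xi> \<and> \<xi> \<le> 1 \<and>
     2 * (antideriv (\<lambda>y. (z - y) * Vp (l * exp (1 / 2)) y) z - antideriv (\<lambda>y. (z - y) * Vp l y) z)
      = Vp (l * exp (\<xi> / 2)) z - Vp (l * exp (\<xi> / 2)) 0
        + antideriv (\<lambda>y. z * Vp (l * exp (\<xi> / 2)) y - (z - y) * (Vp (l * exp (\<xi> / 2)) y)\<^sup>2) z"
proof -
  define W where "W k \<sigma> y = U (l * exp (\<sigma> / 2)) ((1 + real k) * exp (\<sigma> / 2)) 1 y" for k :: nat and \<sigma> y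
  have pos: "0 \<le> l * exp (\<sigma> / 2)" "0 < (1 + real k) * exp (\<sigma> / 2)" for \<sigma> and k :: nat
    using l by (auto simp: add_pos_nonneg)
  have Wc: "continuous_on UNIV (W k \<sigma>)" for k \<sigma>
    unfolding W_def by (rule strong_sol_slice[OF U_strong_sol[OF pos]])
  have Wb: "\<bar>W k \<sigma> y\<bar> \<le> 2" for k \<sigma> y
    using U_bounded[OF pos zero_less_one, of \<sigma> k \<sigma> y] by (simp add: W_def)
  have Wl: "(\<lambda>k. W (r k) (\<sigma> k) y) \<longlonglongrightarrow> Vp (l * exp (s / 2)) y" if "strict_mono r" "\<sigma> \<longlonglongrightarrow> s" for r \<sigma> s y
    unfolding W_def
  proof (rule U_limit)
    show e: "(\<lambda>k. l * exp (\<sigma> k / 2)) \<longlonglongrightarrow> l * exp (s / 2)" by (intro tendsto_intros that) simp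
    have "filterlim (\<lambda>k. 1 + real (r k)) at_top sequentially"
      by (intro filterlim_tendsto_add_at_top[OF tendsto_const] filterlim_compose[OF filterlim_real_sequentially] filterlim_subseq that)
    moreover have "(\<lambda>k. exp (\<sigma> k / 2)) \<longlonglongrightarrow> exp (s / 2)" by (intro tendsto_intros that) simp
    ultimately show "filterlim (\<lambda>k. (1 + real (r k)) * exp (\<sigma> k / 2)) at_top sequentially"
      using filterlim_at_top_mult_tendsto_pos[of "\<lambda>k. exp (\<sigma> k / 2)" "exp (s / 2)" sequentially "\<lambda>k. 1 + real (r k)"] by simp
  qed (use pos in auto)
  have ex: "\<exists>\<xi>. 0 < \<xi> \<and> \<xi> < 1 \<and>
     2 * (antideriv (\<lambda>y. (z - y) * W k 1 y) z - antideriv (\<lambda>y. (z - y) * W k 0 y) z)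
      = W k \<xi> z - W k \<xi> 0 + antideriv (\<lambda>y. z * W k \<xi> y - (z - y) * (W k \<xi> y)\<^sup>2) z" for k
  proof -
    have k: "0 \<le> l" "0 < 1 + real k" using l by auto
    have ee: "sqrt (exp \<sigma>) = exp (\<sigma> / 2)" for \<sigma>
      by (rule real_sqrt_unique) (simp_all add: power2_eq_square exp_add[symmetric])
    have weq: "exp \<sigma> * U l (1 + real k) (exp \<sigma>) (exp (\<sigma> / 2) * y) = W k \<sigma> y" for \<sigma> y
      using U_scale[OF k, of "exp \<sigma>" "exp (\<sigma> / 2) * y"] by (simp add: W_def ee)
    show ?thesis
      using selfsim_integral_identity[OF U_strong_sol[OF k] U_even[OF k], of z] unfolding weq .
  qed
  define S where "S k \<xi> \<longleftrightarrow> 0 < \<xi> \<and> \<xi> < 1 \<and>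
     2 * (antideriv (\<lambda>y. (z - y) * W k 1 y) z - antideriv (\<lambda>y. (z - y) * W k 0 y) z)
      = W k \<xi> z - W k \<xi> 0 + antideriv (\<lambda>y. z * W k \<xi> y - (z - y) * (W k \<xi> y)\<^sup>2) z" for k \<xi>
  have "\<forall>k. \<exists>\<xi>. S k \<xi>" unfolding S_def using ex by (rule allI)
  then obtain \<xi> where "\<forall>k. S k (\<xi> k)" using choice[of S] by blast
  then have \<xi>: "\<And>k. 0 < \<xi> k" "\<And>k. \<xi> k < 1" "\<And>k.
     2 * (antideriv (\<lambda>y. (z - y) * W k 1 y) z - antideriv (\<lambda>y. (z - y) * W k 0 y) z)
      = W k (\<xi> k) z - W k (\<xi> k) 0 + antideriv (\<lambda>y. z * W k (\<xi> k) y - (z - y) * (W k (\<xi> k) y)\<^sup>2) z"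
    unfolding S_def by blast+
  have "\<forall>k. \<xi> k \<in> {0..1}" using \<xi>(1,2) by (auto simp: less_imp_le)
  then obtain s r where s: "s \<in> {0..1}" "strict_mono (r :: nat \<Rightarrow> nat)" "(\<lambda>k. \<xi> (r k)) \<longlonglongrightarrow> s"
  proof -
    have "\<exists>s\<in>{0..1}. \<exists>r. strict_mono (r :: nat \<Rightarrow> nat) \<and> (\<xi> \<circ> r) \<longlonglongrightarrow> s"
      using compact_Icc[of "0 :: real" 1] \<open>\<forall>k. \<xi> k \<in> {0..1}\<close> unfolding compact_def by blast
    then show ?thesis using that by (auto simp: comp_def)
  qed
  have L1: "(\<lambda>k. antideriv (\<lambda>y. (z - y) * W (r k) a y) z) \<longlonglongrightarrow> antideriv (\<lambda>y. (z - y) * Vp (l * exp (a / 2)) y) z" for a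
  proof (rule antideriv_dominated)
    show "continuous_on UNIV (\<lambda>y. (z - y) * W (r k) a y)" for k
      by (intro continuous_on_diff continuous_on_mult continuous_on_id continuous_on_const Wc)
    show "\<bar>(z - y) * W (r k) a y\<bar> \<le> (2 * \<bar>z\<bar>) * 2" if "\<bar>y\<bar> \<le> \<bar>z\<bar>" for k y
      unfolding abs_mult using that Wb by (intro mult_mono) auto
    show "(\<lambda>k. (z - y) * W (r k) a y) \<longlonglongrightarrow> (z - y) * Vp (l * exp (a / 2)) y" for y
      by (intro tendsto_mult tendsto_const Wl s(2))
  qed
  have L2: "(\<lambda>k. antideriv (\<lambda>y. z * W (r k) (\<xi> (r k)) y - (z - y) * (W (r k) (\<xi> (r k)) y)\<^sup>2) z)
     \<longlonglongrightarrow> antideriv (\<lambda>y. z * Vp (l * exp (s / 2)) y - (z - y) * (Vp (l * exp (s / 2)) y)\<^sup>2) z"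
  proof (rule antideriv_dominated)
    show "continuous_on UNIV (\<lambda>y. z * W (r k) (\<xi> (r k)) y - (z - y) * (W (r k) (\<xi> (r k)) y)\<^sup>2)" for k
      by (intro continuous_on_power continuous_on_diff continuous_on_mult continuous_on_id continuous_on_const Wc)
    show "\<bar>z * W (r k) (\<xi> (r k)) y - (z - y) * (W (r k) (\<xi> (r k)) y)\<^sup>2\<bar> \<le> \<bar>z\<bar> * 2 + (2 * \<bar>z\<bar>) * 2\<^sup>2" if "\<bar>y\<bar> \<le> \<bar>z\<bar>" for k y
    proof (rule order_trans[OF abs_triangle_ineq4 add_mono])
      show "\<bar>z * W (r k) (\<xi> (r k)) y\<bar> \<le> \<bar>z\<bar> * 2"
        unfolding abs_mult using Wb by (intro mult_left_mono) auto
      show "\<bar>(z - y) * (W (r k) (\<xi> (r k)) y)\<^sup>2\<bar> \<le> (2 * \<bar>z\<bar>) * 2\<^sup>2"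
        unfolding abs_mult power_abs using that Wb by (intro mult_mono power_mono) auto
    qed
    show "(\<lambda>k. z * W (r k) (\<xi> (r k)) y - (z - y) * (W (r k) (\<xi> (r k)) y)\<^sup>2)
       \<longlonglongrightarrow> z * Vp (l * exp (s / 2)) y - (z - y) * (Vp (l * exp (s / 2)) y)\<^sup>2" for y
      by (intro tendsto_diff tendsto_power tendsto_mult tendsto_const Wl s)
  qed
  have "(\<lambda>k. 2 * (antideriv (\<lambda>y. (z - y) * W (r k) 1 y) z - antideriv (\<lambda>y. (z - y) * W (r k) 0 y) z))
     \<longlonglongrightarrow> 2 * (antideriv (\<lambda>y. (z - y) * Vp (l * exp (1 / 2)) y) z - antideriv (\<lambda>y. (z - y) * Vp (l * exp (0 / 2)) y) z)"
    by (intro tendsto_mult tendsto_diff tendsto_const L1)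
  moreover have "(\<lambda>k. W (r k) (\<xi> (r k)) z - W (r k) (\<xi> (r k)) 0 + antideriv (\<lambda>y. z * W (r k) (\<xi> (r k)) y - (z - y) * (W (r k) (\<xi> (r k)) y)\<^sup>2) z)
     \<longlonglongrightarrow> Vp (l * exp (s / 2)) z - Vp (l * exp (s / 2)) 0
        + antideriv (\<lambda>y. z * Vp (l * exp (s / 2)) y - (z - y) * (Vp (l * exp (s / 2)) y)\<^sup>2) z"
    by (intro tendsto_add tendsto_diff Wl s L2)
  ultimately have "2 * (antideriv (\<lambda>y. (z - y) * Vp (l * exp (1 / 2)) y) z - antideriv (\<lambda>y. (z - y) * Vp (l * exp (0 / 2)) y) z)
     = Vp (l * exp (s / 2)) z - Vp (l * exp (s / 2)) 0
        + antideriv (\<lambda>y. z * Vp (l * exp (s / 2)) y - (z - y) * (Vp (l * exp (s / 2)) y)\<^sup>2) z"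
    unfolding \<xi>(3) by (rule LIMSEQ_unique)
  then show ?thesis using s(1) by (intro exI[of _ s]) simp
qed

abbreviation "A1 \<equiv> antideriv F"
abbreviation "A2 \<equiv> antideriv (\<lambda>y. (F y)\<^sup>2)"
abbreviation "A3 \<equiv> antideriv (\<lambda>y. y * (F y)\<^sup>2)"

text \<open>As \<open>l\<close> tends to infinity, both terms on the left of the identity for
  \<open>Vp\<close> have the same limit and cancel: \<open>F\<close> is stationary in self-similar
  variables. Dominated convergence with the bound 2 is enough, and no derivative has to be
  controlled.\<close>

lemma F_integral_equation: "F z = F 0 - z * A1 z + z * A2 z - A3 z"
proof -
  define S where "S k \<xi> \<longleftrightarrow> 0 \<le> \<xi> \<and> \<xi> \<le> 1 \<and>
     2 * (antideriv (\<lambda>y. (z - y) * Vp ((1 + real k) * exp (1 / 2)) y) z - antideriv (\<lambda>y. (z - y) * Vp (1 + real k) y) z)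
      = Vp ((1 + real k) * exp (\<xi> / 2)) z - Vp ((1 + real k) * exp (\<xi> / 2)) 0
        + antideriv (\<lambda>y. z * Vp ((1 + real k) * exp (\<xi> / 2)) y - (z - y) * (Vp ((1 + real k) * exp (\<xi> / 2)) y)\<^sup>2) z" for k \<xi>
  have "\<exists>\<xi>. S k \<xi>" for k unfolding S_def by (rule Vp_integral_identity) simp
  then obtain \<xi> where "\<forall>k. S k (\<xi> k)" using choice[of S] by blast
  then have \<xi>: "\<And>k :: nat. 0 \<le> \<xi> k" "\<And>k. \<xi> k \<le> 1"
     "\<And>k. 2 * (antideriv (\<lambda>y. (z - y) * Vp ((1 + real k) * exp (1 / 2)) y) z - antideriv (\<lambda>y. (z - y) * Vp (1 + real k) y) z)
      = Vp ((1 + real k) * exp (\<xi> k / 2)) z - Vp ((1 + real k) * exp (\<xi> k / 2)) 0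
        + antideriv (\<lambda>y. z * Vp ((1 + real k) * exp (\<xi> k / 2)) y - (z - y) * (Vp ((1 + real k) * exp (\<xi> k / 2)) y)\<^sup>2) z"
    unfolding S_def by blast+
  define l where "l k = (1 + real k) * exp (\<xi> k / 2)" for k
  have l0: "0 \<le> l k" for k by (simp add: l_def)
  have t0: "filterlim (\<lambda>k. 1 + real k) at_top sequentially"
    by (intro filterlim_tendsto_add_at_top[OF tendsto_const] filterlim_real_sequentially)
  have t1: "filterlim (\<lambda>k. (1 + real k) * exp (1 / 2)) at_top sequentially"
    by (rule filterlim_at_top_mult_tendsto_pos[OF tendsto_const _ t0]) simp
  have t2: "filterlim l at_top sequentially"
  proof (rule filterlim_at_top_mono[OF t0])
    show "\<forall>\<^sub>F k in sequentially. 1 + real k \<le> l k"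
      using \<xi>(1) by (intro always_eventually allI) (simp add: l_def mult_le_cancel_left1)
  qed
  have lim: "(\<lambda>k. Vp (m k) y) \<longlonglongrightarrow> F y" if "filterlim m at_top sequentially" "\<And>k. 0 \<le> m k" for m y
    by (rule Vp_tendsto_F[OF that])
  have dom: "(\<lambda>k. antideriv (\<lambda>y. a y * (Vp (m k) y) ^ n) z) \<longlonglongrightarrow> antideriv (\<lambda>y. a y * (F y) ^ n) z"
    if "filterlim m at_top sequentially" "\<And>k. 0 \<le> m k" "continuous_on UNIV a" "\<And>y. \<bar>y\<bar> \<le> \<bar>z\<bar> \<Longrightarrow> \<bar>a y\<bar> \<le> B" for m a n B
  proof (rule antideriv_dominated)
    show "continuous_on UNIV (\<lambda>y. a y * (Vp (m k) y) ^ n)" for k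
      by (intro continuous_on_mult continuous_on_power that(3) Vp_continuous_on that(2))
    show "\<bar>a y * (Vp (m k) y) ^ n\<bar> \<le> \<bar>B\<bar> * 2 ^ n" if "\<bar>y\<bar> \<le> \<bar>z\<bar>" for k y
      unfolding abs_mult power_abs
      using \<open>\<And>y. \<bar>y\<bar> \<le> \<bar>z\<bar> \<Longrightarrow> \<bar>a y\<bar> \<le> B\<close>[OF that] Vp_bounds(2)[OF \<open>\<And>k. 0 \<le> m k\<close>[of k], of y]
      by (intro mult_mono power_mono) auto
    show "(\<lambda>k. a y * (Vp (m k) y) ^ n) \<longlonglongrightarrow> a y * (F y) ^ n" for y
      by (intro tendsto_mult tendsto_const tendsto_power lim that)
  qed
  have zb: "\<bar>z - y\<bar> \<le> 2 * \<bar>z\<bar>" "\<bar>y\<bar> \<le> \<bar>z\<bar>" if "\<bar>y\<bar> \<le> \<bar>z\<bar>" for y using that by auto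
  have cz: "continuous_on UNIV (\<lambda>y. z - y)" by (intro continuous_intros)
  have "(\<lambda>k. 2 * (antideriv (\<lambda>y. (z - y) * (Vp ((1 + real k) * exp (1 / 2)) y) ^ 1) z - antideriv (\<lambda>y. (z - y) * (Vp (1 + real k) y) ^ 1) z))
     \<longlonglongrightarrow> 2 * (antideriv (\<lambda>y. (z - y) * (F y) ^ 1) z - antideriv (\<lambda>y. (z - y) * (F y) ^ 1) z)"
    by (intro tendsto_mult tendsto_diff tendsto_const dom[OF t1 _ cz zb(1)] dom[OF t0 _ cz zb(1)]) auto
  then have l1: "(\<lambda>k. 2 * (antideriv (\<lambda>y. (z - y) * Vp ((1 + real k) * exp (1 / 2)) y) z - antideriv (\<lambda>y. (z - y) * Vp (1 + real k) y) z)) \<longlonglongrightarrow> 0"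
    by simp
  have "(\<lambda>k. Vp (l k) z - Vp (l k) 0 + (z * antideriv (\<lambda>y. 1 * (Vp (l k) y) ^ 1) z - z * antideriv (\<lambda>y. 1 * (Vp (l k) y) ^ 2) z + antideriv (\<lambda>y. y * (Vp (l k) y) ^ 2) z))
    \<longlonglongrightarrow> F z - F 0 + (z * antideriv (\<lambda>y. 1 * (F y) ^ 1) z - z * antideriv (\<lambda>y. 1 * (F y) ^ 2) z + antideriv (\<lambda>y. y * (F y) ^ 2) z)"
    by (intro tendsto_add tendsto_mult tendsto_diff tendsto_const lim[OF t2 l0]
        dom[OF t2 l0 continuous_on_const, of _ 1] dom[OF t2 l0 continuous_on_id zb(2)]) auto
  then have l2: "(\<lambda>k. Vp (l k) z - Vp (l k) 0 + antideriv (\<lambda>y. z * Vp (l k) y - (z - y) * (Vp (l k) y)\<^sup>2) z)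
    \<longlonglongrightarrow> F z - F 0 + (z * A1 z - z * A2 z + A3 z)"
    by (simp add: antideriv_split[OF Vp_continuous_on[OF l0]])
  have "F z - F 0 + (z * A1 z - z * A2 z + A3 z) = 0"
    using LIMSEQ_unique[OF l2 l1[unfolded \<xi>(3) l_def[symmetric]]] .
  then show ?thesis by linarith
qed

lemma F_eq_integral: "(\<lambda>z. F 0 - z * A1 z + z * A2 z - A3 z) = F"
  by (rule ext) (rule F_integral_equation[symmetric])

text \<open>A bootstrap: as a limit of continuous functions \<open>F\<close> is only measurable at
  first, but its integral equation expresses it through primitives of locally bounded
  functions.\<close>

lemma F_continuous: "continuous_on UNIV F"
proof -
  have ac: "continuous_on UNIV (antideriv (\<lambda>y. a y * (F y) ^ n))" if a: "continuous_on UNIV a" for a and n :: nat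
  proof (rule antideriv_continuous_bounded_limit[where h = "\<lambda>k y. a y * (Vp (real k) y) ^ n"])
    show "continuous_on UNIV (\<lambda>y. a y * (Vp (real k) y) ^ n)" for k
      by (intro continuous_on_mult continuous_on_power a Vp_continuous_on) simp
    show "(\<lambda>k. a y * (Vp (real k) y) ^ n) \<longlonglongrightarrow> a y * (F y) ^ n" for y
      by (intro tendsto_mult tendsto_const tendsto_power Vp_tendsto_F filterlim_real_sequentially) simp
    fix R :: real
    have "compact (a ` {-R..R})"
      using a by (intro compact_continuous_image) (auto intro: continuous_on_subset)
    then have "bounded (a ` {-R..R})" by (rule compact_imp_bounded)
    then obtain B where B: "\<forall>y\<in>a ` {-R..R}. norm y \<le> B" unfolding bounded_iff by blast
    have "\<bar>a y * (Vp (real k) y) ^ n\<bar> \<le> \<bar>B\<bar> * 2 ^ n" if "\<bar>y\<bar> \<le> R" for k y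
    proof -
      have "y \<in> {-R..R}" using that by auto
      then have "\<bar>a y\<bar> \<le> B" using B by force
      then show ?thesis unfolding abs_mult power_abs
        using Vp_bounds(2)[OF of_nat_0_le_iff, of k y] by (intro mult_mono power_mono) auto
    qed
    then show "\<exists>B. \<forall>k y. \<bar>y\<bar> \<le> R \<longrightarrow> \<bar>a y * (Vp (real k) y) ^ n\<bar> \<le> B" by blast
  qed
  have "continuous_on UNIV A1" "continuous_on UNIV A2" "continuous_on UNIV A3"
    using ac[OF continuous_on_const, of 1 1] ac[OF continuous_on_const, of 1 2] ac[OF continuous_on_id, of 2] by auto
  then have "continuous_on UNIV (\<lambda>z. F 0 - z * A1 z + z * A2 z - A3 z)"
    by (intro continuous_on_diff continuous_on_add continuous_on_mult continuous_on_const continuous_on_id)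
  then show ?thesis by (simp only: F_eq_integral)
qed

definition F1 :: "real \<Rightarrow> real" where "F1 z = A2 z - A1 z - z * F z"

lemma F_ode: "DERIV F z :> F1 z"
  "DERIV F1 z :> (F z)\<^sup>2 - 2 * F z - z * F1 z"
proof -
  have c: "continuous_on UNIV (\<lambda>y. (F y)\<^sup>2)" "continuous_on UNIV (\<lambda>y. y * (F y)\<^sup>2)"
    by (intro continuous_on_power continuous_on_mult continuous_on_id F_continuous)+
  note d = antideriv_has_derivative[OF F_continuous] antideriv_has_derivative[OF c(1)] antideriv_has_derivative[OF c(2)]
  show F: "DERIV F z :> F1 z" for z
  proof -
    have "((\<lambda>z. F 0 - z * A1 z + z * A2 z - A3 z) has_real_derivative
        0 - (1 * A1 z + F z * z) + (1 * A2 z + (F z)\<^sup>2 * z) - z * (F z)\<^sup>2) (at z)"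
      by (rule DERIV_diff[OF DERIV_add[OF DERIV_diff[OF DERIV_const DERIV_mult[OF DERIV_ident d(1)]] DERIV_mult[OF DERIV_ident d(2)]] d(3)])
    moreover have "0 - (1 * A1 z + F z * z) + (1 * A2 z + (F z)\<^sup>2 * z) - z * (F z)\<^sup>2 = F1 z"
      by (simp add: F1_def algebra_simps)
    ultimately show ?thesis by (simp only: F_eq_integral)
  qed
  have "DERIV F1 z :> (F z)\<^sup>2 - F z - (1 * F z + F1 z * z)"
    unfolding F1_def[abs_def] by (rule DERIV_diff[OF DERIV_diff[OF d(2) d(1)] DERIV_mult[OF DERIV_ident F, unfolded F1_def]])
  then show "DERIV F1 z :> (F z)\<^sup>2 - 2 * F z - z * F1 z" by (simp add: algebra_simps)
qed

lemma F1_0: "F1 0 = 0" by (simp add: F1_def)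

text \<open>If \<open>F\<close> vanished, \<open>X(1,y)\<close> would be zero almost surely at every
  rational \<open>y\<close>, hence for all \<open>y\<close> at once by continuity of the density,
  and \<open>U\<close> would vanish at time 1 for all parameters. Scaling carries this to all
  positive times, against continuity at time 0, where \<open>U 1 1\<close> equals
  \<open>1 / bump_mass\<close> at the origin.\<close>

lemma F_nonzero: "\<exists>y. F y \<noteq> 0"
proof (rule ccontr)
  assume "\<not> ?thesis"
  then have F0: "F y = 0" for y by blast
  note X = fin_meas_return[of 0] zero_less_one
  interpret prob_space "Q (return borel 0) 1" by (rule lawD(1)[OF X])
  have "prob {f. apply_bcontfun f y = 0} = 1" for y
    using F0[of y] zero_prob_pos[of y] by (simp add: F_def)
  then have "AE f in Q (return borel 0) 1. f \<in> {f. apply_bcontfun f y = 0}" for y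
    by (rule AE_prob_1)
  then have "AE f in Q (return borel 0) 1. \<forall>y\<in>\<rat>. apply_bcontfun f y = 0"
    by (subst AE_ball_countable[OF countable_rat]) auto
  then have ae: "AE f in Q (return borel 0) 1. \<forall>y. apply_bcontfun f y = 0"
  proof eventually_elim
    case (elim f)
    show ?case
    proof
      fix y
      show "apply_bcontfun f y = 0"
        by (rule continuous_constant_on_closure[of \<rat>])
          (use elim apply_bcontfun_continuous[of f] in \<open>auto simp: Rats_closure_real\<close>)
    qed
  qed
  have U1: "U l N 1 y = 0" if "0 \<le> l" "0 < N" for l N y
  proof -
    have "(\<integral>f. exp (- (\<integral>x. apply_bcontfun f x * approx_delta l N (- y) x \<partial>lborel)) \<partial>Q (return borel 0) 1) = (\<integral>f. 1 \<partial>Q (return borel 0) 1)"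
    proof (rule integral_cong_AE)
      show "(\<lambda>f. exp (- (\<integral>x. apply_bcontfun f x * approx_delta l N (- y) x \<partial>lborel))) \<in> borel_measurable (Q (return borel 0) 1)"
        unfolding law_measurable[OF X] using pairing_measurable[OF approx_delta_integrable[OF that(2)]] by measurable
      show "AE f in Q (return borel 0) 1. exp (- (\<integral>x. apply_bcontfun f x * approx_delta l N (- y) x \<partial>lborel)) = 1"
        using ae by eventually_elim simp
    qed simp
    then show ?thesis
      using law_return[OF U_shift_strong_sol[OF that] approx_delta_test_fun[OF that] zero_less_one, where x = 0 and x0 = "- y"] prob_space
      by simp
  qed
  have U0: "U 1 1 t 0 = 0" if "0 < t" for t
    using U_scale[of 1 1 t 0] U1[of "1 * sqrt t" "1 * sqrt t" "0 / sqrt t"] that by simp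
  have "continuous_on UNIV (\<lambda>t. (\<lambda>(t, x). U 1 1 t x) (t, 0))"
    by (rule continuous_on_compose2[OF conjunct1[OF conjunct2[OF conjunct2[OF conjunct2[OF U_strong_sol[of 1 1, unfolded strong_sol_def]]]]]])
      (auto intro!: continuous_intros)
  then have "isCont (\<lambda>t. U 1 1 t 0) 0" by (simp add: continuous_on_eq_continuous_at)
  moreover have "(\<lambda>k. 1 / (1 + real k)) \<longlonglongrightarrow> 0"
    by (rule tendsto_divide_0[OF tendsto_const filterlim_at_top_imp_at_infinity])
      (intro filterlim_tendsto_add_at_top[OF tendsto_const] filterlim_real_sequentially)
  ultimately have "(\<lambda>k. U 1 1 (1 / (1 + real k)) 0) \<longlonglongrightarrow> U 1 1 0 0"
    by (rule isCont_tendsto_compose)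
  then have "(\<lambda>k :: nat. 0) \<longlonglongrightarrow> U 1 1 0 0" using U0 by (simp add: add_pos_nonneg)
  then have "U 1 1 0 0 = 0" by (rule LIMSEQ_unique) (rule tendsto_const)
  moreover have "U 1 1 0 0 = 1 / bump_mass"
    using U_strong_sol[of 1 1] by (simp add: strong_sol_def approx_delta_def bump_def)
  ultimately show False using bump_mass_pos by simp
qed

text \<open>A zero of the nonnegative \<open>F\<close> is a minimum, hence a double zero, and
  uniqueness for the equation would spread it over the whole line.\<close>

lemma F_pos: "0 < F z"
proof (rule ccontr)
  assume "\<not> 0 < F z"
  then have z: "F z = 0" using F_bounds(1)[of z] by simp
  then have z1: "F1 z = 0"
    using DERIV_local_min[OF F_ode(1), of 1 z] F_bounds(1) by simp
  define E where "E x = (F x)\<^sup>2 + (F1 x)\<^sup>2" for x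
  define E' where "E' x = 2 * F1 x * (F x * (F x - 1)) - 2 * x * (F1 x)\<^sup>2" for x
  have d: "DERIV E x :> E' x" for x
    unfolding E_def[abs_def] E'_def
    by (auto intro!: derivative_eq_intros F_ode simp: algebra_simps power2_eq_square)
  have "F y = 0" for y
  proof -
    define R where "R = max \<bar>z\<bar> \<bar>y\<bar>"
    have "E y = 0"
    proof (rule gronwall_zero[where R = R and C = "1 + 2 * R" and z = z, OF d])
      fix x assume x: "\<bar>x\<bar> \<le> R"
      have "\<bar>F x - 1\<bar> \<le> 1" using F_bounds[of x] by auto
      then have "\<bar>F1 x\<bar> * (\<bar>F x\<bar> * \<bar>F x - 1\<bar>) \<le> \<bar>F1 x\<bar> * (\<bar>F x\<bar> * 1)"
        by (intro mult_left_mono) auto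
      moreover have "2 * (\<bar>F1 x\<bar> * \<bar>F x\<bar>) \<le> E x"
        using zero_le_power2[of "\<bar>F1 x\<bar> - \<bar>F x\<bar>"] by (simp add: E_def power2_diff)
      ultimately have 1: "\<bar>2 * F1 x * (F x * (F x - 1))\<bar> \<le> E x" by (simp add: abs_mult)
      have "\<bar>x\<bar> * (F1 x)\<^sup>2 \<le> R * E x"
        using x by (intro mult_mono) (auto simp: E_def)
      then have 2: "\<bar>2 * x * (F1 x)\<^sup>2\<bar> \<le> 2 * R * E x" by (simp add: abs_mult)
      have "\<bar>E' x\<bar> \<le> \<bar>2 * F1 x * (F x * (F x - 1))\<bar> + \<bar>2 * x * (F1 x)\<^sup>2\<bar>"
        unfolding E'_def by (rule abs_triangle_ineq4)
      also have "\<dots> \<le> E x + 2 * R * E x" by (rule add_mono[OF 1 2])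
      finally show "\<bar>E' x\<bar> \<le> (1 + 2 * R) * E x" by (simp add: algebra_simps)
    qed (auto simp: E_def z z1 R_def)
    then show ?thesis by (simp add: E_def sum_power2_eq_zero_iff)
  qed
  then show False using F_nonzero by blast
qed

text \<open>The Laplace functional is already exponential in the initial measure, so only the limit
  in \<open>N\<close> under the integral is left, with \<open>2 / t\<close> as dominating
  constant.\<close>

lemma laplace_formula:
  assumes X: "fin_meas X0" "0 < t" and l: "0 \<le> l"
  shows "(\<integral>f. exp (- (l * apply_bcontfun f x)) \<partial>Q X0 t) = exp (- (\<integral>y. Vp (l * sqrt t) ((y - x) / sqrt t) / t \<partial>X0))"
    and "integrable X0 (\<lambda>y. Vp (l * sqrt t) ((y - x) / sqrt t) / t)"
proof -
  interpret finite_measure X0 using X(1) by (simp add: fin_meas_def)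
  have sX: "borel_measurable X0 = borel_measurable borel"
    using X(1) by (intro measurable_cong_sets) (auto simp: fin_meas_def)
  have N: "filterlim (\<lambda>k. 1 + real k) at_top sequentially" "\<And>k. 0 < 1 + real k"
    by (auto intro!: filterlim_tendsto_add_at_top[OF tendsto_const] filterlim_real_sequentially simp: add_pos_nonneg)
  have "(\<lambda>k. \<integral>f. exp (- (\<integral>w. apply_bcontfun f w * approx_delta l (1 + real k) x w \<partial>lborel)) \<partial>Q X0 t) \<longlonglongrightarrow> (\<integral>f. exp (- (l * apply_bcontfun f x)) \<partial>Q X0 t)"
    by (rule laplace_limit[OF X tendsto_const l N tendsto_const])
  moreover have "(\<integral>f. exp (- (\<integral>w. apply_bcontfun f w * approx_delta l (1 + real k) x w \<partial>lborel)) \<partial>Q X0 t)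
      = exp (- (\<integral>y. U l (1 + real k) t (y - x) \<partial>X0))" for k
    by (rule lawD(4)[OF X U_shift_strong_sol[OF l N(2)] approx_delta_test_fun[OF l N(2)]])
  ultimately have 1: "(\<lambda>k. exp (- (\<integral>y. U l (1 + real k) t (y - x) \<partial>X0))) \<longlonglongrightarrow> (\<integral>f. exp (- (l * apply_bcontfun f x)) \<partial>Q X0 t)"
    by simp
  have Vm: "(\<lambda>y. Vp (l * sqrt t) ((y - x) / sqrt t) / t) \<in> borel_measurable X0"
    unfolding sX
    by (rule borel_measurable_continuous_onI, intro continuous_on_divide continuous_on_compose2[OF Vp_continuous_on] continuous_intros)
      (use X(2) l in auto)
  have Um: "(\<lambda>y. U l (1 + real k) t (y - x)) \<in> borel_measurable X0" for k
    unfolding sX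
    by (rule borel_measurable_continuous_onI, rule continuous_on_compose2[OF strong_sol_slice[OF U_strong_sol[OF l N(2)]]])
      (auto intro!: continuous_intros)
  have lim: "(\<lambda>k. U l (1 + real k) t (y - x)) \<longlonglongrightarrow> Vp (l * sqrt t) ((y - x) / sqrt t) / t" for y
    by (rule U_limit_time[OF l N tendsto_const X(2) X(2) tendsto_const])
  have Ub: "\<bar>U l (1 + real k) t (y - x)\<bar> \<le> 2 / t" for k y
    using U_bounded[OF l N(2) X(2), of k "y - x"] by simp
  have "(\<lambda>k. \<integral>y. U l (1 + real k) t (y - x) \<partial>X0) \<longlonglongrightarrow> (\<integral>y. Vp (l * sqrt t) ((y - x) / sqrt t) / t \<partial>X0)"
    by (rule integral_dominated_convergence[OF Vm Um, of "\<lambda>_. 2 / t"]) (use lim Ub in auto)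
  then have "(\<lambda>k. exp (- (\<integral>y. U l (1 + real k) t (y - x) \<partial>X0))) \<longlonglongrightarrow> exp (- (\<integral>y. Vp (l * sqrt t) ((y - x) / sqrt t) / t \<partial>X0))"
    by (intro tendsto_intros)
  from LIMSEQ_unique[OF 1 this]
  show "(\<integral>f. exp (- (l * apply_bcontfun f x)) \<partial>Q X0 t) = exp (- (\<integral>y. Vp (l * sqrt t) ((y - x) / sqrt t) / t \<partial>X0))" .
  show "integrable X0 (\<lambda>y. Vp (l * sqrt t) ((y - x) / sqrt t) / t)"
    by (rule integrable_const_bound[OF _ Vm, of "2 / t"])
      (use Vp_bounds(2)[of "l * sqrt t"] X(2) l in \<open>auto simp: abs_divide divide_right_mono\<close>)
qed

lemma zero_formula:
  assumes X: "fin_meas X0" "0 < t"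
  shows "measure (Q X0 t) {f. apply_bcontfun f x = 0} = exp (- (\<integral>y. F ((y - x) / sqrt t) / t \<partial>X0))"
    and "integrable X0 (\<lambda>y. F ((y - x) / sqrt t) / t)"
proof -
  interpret finite_measure X0 using X(1) by (simp add: fin_meas_def)
  have sX: "borel_measurable X0 = borel_measurable borel"
    using X(1) by (intro measurable_cong_sets) (auto simp: fin_meas_def)
  have Fm: "(\<lambda>y. F ((y - x) / sqrt t) / t) \<in> borel_measurable X0"
    unfolding sX
    by (rule borel_measurable_continuous_onI, intro continuous_on_divide continuous_on_compose2[OF F_continuous] continuous_intros)
      (use X(2) in auto)
  have "(\<lambda>k. \<integral>y. Vp (real k * sqrt t) ((y - x) / sqrt t) / t \<partial>X0) \<longlonglongrightarrow> (\<integral>y. F ((y - x) / sqrt t) / t \<partial>X0)"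
  proof (rule integral_dominated_convergence[OF Fm, of _ "\<lambda>_. 2 / t"])
    show "(\<lambda>y. Vp (real k * sqrt t) ((y - x) / sqrt t) / t) \<in> borel_measurable X0" for k
      using laplace_formula(2)[OF X, of "real k" x] by auto
    have "filterlim (\<lambda>k. real k * sqrt t) at_top sequentially"
      by (rule filterlim_at_top_mult_tendsto_pos[OF tendsto_const _ filterlim_real_sequentially]) (use X(2) in simp)
    then show "AE y in X0. (\<lambda>k. Vp (real k * sqrt t) ((y - x) / sqrt t) / t) \<longlonglongrightarrow> F ((y - x) / sqrt t) / t"
      by (intro AE_I2 tendsto_divide tendsto_const Vp_tendsto_F) (use X(2) in auto)
    show "AE y in X0. norm (Vp (real k * sqrt t) ((y - x) / sqrt t) / t) \<le> 2 / t" for k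
      using Vp_bounds(2)[of "real k * sqrt t"] X(2) by (auto simp: abs_divide divide_right_mono)
  qed simp
  then have "(\<lambda>k. exp (- (\<integral>y. Vp (real k * sqrt t) ((y - x) / sqrt t) / t \<partial>X0))) \<longlonglongrightarrow> exp (- (\<integral>y. F ((y - x) / sqrt t) / t \<partial>X0))"
    by (intro tendsto_intros)
  moreover have "(\<lambda>k. exp (- (\<integral>y. Vp (real k * sqrt t) ((y - x) / sqrt t) / t \<partial>X0))) \<longlonglongrightarrow> measure (Q X0 t) {f. apply_bcontfun f x = 0}"
    using zero_limit[OF X filterlim_real_sequentially, of x] by (simp add: laplace_formula(1)[OF X])
  ultimately show "measure (Q X0 t) {f. apply_bcontfun f x = 0} = exp (- (\<integral>y. F ((y - x) / sqrt t) / t \<partial>X0))"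
    using LIMSEQ_unique by blast
  show "integrable X0 (\<lambda>y. F ((y - x) / sqrt t) / t)"
    by (rule integrable_const_bound[OF _ Fm, of "2 / t"])
      (use F_bounds X(2) in \<open>auto simp: divide_right_mono\<close>)
qed

lemma sbmF_eq: "sbmF Q = F"
proof
  fix x
  have "(\<integral>y. F ((y - 0) / sqrt 1) / 1 \<partial>return borel x) = F x"
    by (subst integral_return) (auto intro: F_measurable)
  then show "sbmF Q x = F x"
    unfolding sbmF_def using zero_formula(1)[OF fin_meas_return[of x] zero_less_one, of 0] by simp
qed

end

section \<open>The profile and its ground state\<close>

lemma antideriv_bound_abs:
  assumes h: "continuous_on UNIV h" and w: "\<And>s. DERIV W s :> w s"
    and le: "\<And>s. \<bar>s\<bar> \<le> \<bar>x\<bar> \<Longrightarrow> \<bar>h s\<bar> \<le> w \<bar>s\<bar>"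
  shows "\<bar>antideriv h x\<bar> \<le> \<bar>W \<bar>x\<bar> - W 0\<bar>"
proof (cases "0 \<le> x")
  case True
  have "\<bar>antideriv h x\<bar> \<le> \<bar>W x - W 0\<bar>"
  proof (rule antideriv_bound[OF h w])
    show "\<bar>h s\<bar> \<le> w s" if "min 0 x \<le> s" "s \<le> max 0 x" for s
      using le[of s] that True by auto
  qed
  then show ?thesis using True by simp
next
  case False
  have w': "DERIV (\<lambda>s. - W (- s)) s :> w (- s)" for s
  proof -
    have "DERIV (\<lambda>s. W (- s)) s :> w (- s) * - 1"
      by (rule DERIV_chain2[OF w]) (auto intro!: derivative_eq_intros)
    from DERIV_minus[OF this] show ?thesis by simp
  qed
  have "\<bar>antideriv h x\<bar> \<le> \<bar>- W (- x) - - W (- 0)\<bar>"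
  proof (rule antideriv_bound[OF h w'])
    show "\<bar>h s\<bar> \<le> w (- s)" if "min 0 x \<le> s" "s \<le> max 0 x" for s
      using le[of s] that False by (auto simp: min_def max_def split: if_splits)
  qed
  then show ?thesis using False by simp
qed

lemma antideriv_diff:
  assumes "continuous_on UNIV h" "continuous_on UNIV k"
  shows "antideriv h x - antideriv k x = antideriv (\<lambda>s. h s - k s) x"
proof -
  have "antideriv (\<lambda>s. h s - k s) x = (antideriv h x - antideriv k x) - (antideriv h 0 - antideriv k 0)"
    by (rule antideriv_unique) (intro continuous_on_diff DERIV_diff antideriv_has_derivative assms)+
  then show ?thesis by simp
qed

lemma antideriv_parity:
  assumes c: "continuous_on UNIV h" and h: "\<And>s. h (- s) = \<sigma> * h s"
  shows "antideriv h (- x) = - \<sigma> * antideriv h x"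
proof -
  have "antideriv h (- x) = (\<lambda>x. antideriv h (- x)) x" by simp
  have d: "DERIV (\<lambda>x. antideriv h (- x)) s :> - (h (- s))" for s
  proof -
    have "DERIV (\<lambda>x. antideriv h (- x)) s :> h (- s) * - 1"
      by (rule DERIV_chain2[OF antideriv_has_derivative[OF c]]) (auto intro!: derivative_eq_intros)
    then show ?thesis by simp
  qed
  have d': "DERIV (\<lambda>x. antideriv h (- x) + \<sigma> * antideriv h x) s :> - (h (- s)) + \<sigma> * h s" for s
    by (rule DERIV_add[OF d DERIV_cmult[OF antideriv_has_derivative[OF c]]])
  have "DERIV (\<lambda>x. antideriv h (- x) + \<sigma> * antideriv h x) s :> 0" for s
    using d'[of s] by (simp add: h)
  then have "antideriv h (- x) + \<sigma> * antideriv h x = antideriv h (- 0) + \<sigma> * antideriv h 0"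
    using DERIV_isconst_all[of "\<lambda>x. antideriv h (- x) + \<sigma> * antideriv h x"] by blast
  then show ?thesis by simp
qed

text \<open>The spectral analysis is purely analytic and rests on these properties of
  \<open>F\<close> alone. The bound 2 is itself a constant solution of the equation.\<close>

locale profile =
  fixes F F1 :: "real \<Rightarrow> real"
  assumes F_d: "\<And>z. DERIV F z :> F1 z"
    and F1_d: "\<And>z. DERIV F1 z :> (F z)\<^sup>2 - 2 * F z - z * F1 z"
    and F1_zero: "F1 0 = 0" and F_evn: "\<And>z. F (- z) = F z"
    and F_gt0: "\<And>z. 0 < F z" and F_le2: "\<And>z. F z \<le> 2"
    and F_tail: "\<And>z. 1 \<le> \<bar>z\<bar> \<Longrightarrow> F z \<le> 2 * \<bar>z\<bar> * exp ((1 - z\<^sup>2) / 2)"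
begin

section \<open>The shooting family\<close>

lemma F_cont: "continuous_on UNIV F"
  using F_d by (meson DERIV_continuous_on has_field_derivative_at_within)

text \<open>The solutions of \<open>y'' = x y' + 2 (F - \<mu>) y\<close>, y(0) = 1, y'(0) = 0, as functions of \<mu> and x.\<close>

definition shoot_inner :: "(real \<Rightarrow> real \<Rightarrow> real) \<Rightarrow> real \<Rightarrow> real \<Rightarrow> real" where
  "shoot_inner Y \<mu> = antideriv (\<lambda>w. 2 * (F w - \<mu>) * gw w * Y \<mu> w)"

text \<open>The equation in divergence form, \<open>(gw * y')' = 2 * (F - \<mu>) * gw * y\<close>,
  integrated twice with the initial conditions built in.\<close>

definition shoot_step :: "(real \<Rightarrow> real \<Rightarrow> real) \<Rightarrow> real \<Rightarrow> real \<Rightarrow> real" where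
  "shoot_step Y \<mu> x = 1 + antideriv (\<lambda>v. exp (v\<^sup>2 / 2) * shoot_inner Y \<mu> v) x"

lemma slice2: "continuous_on UNIV (\<lambda>(\<mu>, x). Y \<mu> x) \<Longrightarrow> continuous_on UNIV (Y \<mu>)" for Y :: "real \<Rightarrow> real \<Rightarrow> real"
proof -
  assume c: "continuous_on UNIV (\<lambda>(\<mu>, x). Y \<mu> x)"
  have "continuous_on UNIV (\<lambda>x. (\<lambda>(\<mu>, x). Y \<mu> x) (\<mu>, x))"
    by (rule continuous_on_compose2[OF c]) (auto intro!: continuous_intros)
  then show ?thesis by simp
qed

lemma inner_integrand_cont:
  assumes c: "continuous_on UNIV (\<lambda>(\<mu>, x). Y \<mu> x)"
  shows "continuous_on UNIV (\<lambda>(\<mu>, w). 2 * (F w - \<mu>) * gw w * Y \<mu> w)"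
proof -
  have "continuous_on UNIV (\<lambda>q :: real \<times> real. F (snd q))"
    by (rule continuous_on_compose2[OF F_cont]) (auto intro!: continuous_intros)
  then show ?thesis using c unfolding case_prod_unfold by (intro continuous_intros) auto
qed

lemma shoot_inner_cont:
  assumes c: "continuous_on UNIV (\<lambda>(\<mu>, x). Y \<mu> x)"
  shows "continuous_on UNIV (\<lambda>(\<mu>, x). shoot_inner Y \<mu> x)"
  unfolding shoot_inner_def by (rule continuous_on_antideriv2[OF inner_integrand_cont[OF c]])

lemma outer_integrand_cont:
  assumes c: "continuous_on UNIV (\<lambda>(\<mu>, x). Y \<mu> x)"
  shows "continuous_on UNIV (\<lambda>(\<mu>, v). exp (v\<^sup>2 / 2) * shoot_inner Y \<mu> v)"
  using shoot_inner_cont[OF c] unfolding case_prod_unfold by (intro continuous_intros) auto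

lemma shoot_step_cont:
  assumes c: "continuous_on UNIV (\<lambda>(\<mu>, x). Y \<mu> x)"
  shows "continuous_on UNIV (\<lambda>(\<mu>, x). shoot_step Y \<mu> x)"
proof -
  have "continuous_on UNIV (\<lambda>(\<mu>, x). antideriv (\<lambda>v. exp (v\<^sup>2 / 2) * shoot_inner Y \<mu> v) x)"
    by (rule continuous_on_antideriv2[OF outer_integrand_cont[OF c]])
  then show ?thesis unfolding shoot_step_def case_prod_unfold by (intro continuous_intros)
qed

lemma integrand_slices:
  assumes c: "continuous_on UNIV (\<lambda>(\<mu>, x). Y \<mu> x)"
  shows "continuous_on UNIV (\<lambda>w. 2 * (F w - \<mu>) * gw w * Y \<mu> w)"
    "continuous_on UNIV (\<lambda>v. exp (v\<^sup>2 / 2) * shoot_inner Y \<mu> v)"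
  using slice2[OF inner_integrand_cont[OF c], of \<mu>] slice2[OF outer_integrand_cont[OF c], of \<mu>] by (simp_all only:)

text \<open>The rate of the Gaussian weight in which one step contracts by 1/2; for this it has to
  exceed the bound \<open>4 + 2 * \<bar>\<mu>\<bar>\<close> on
  \<open>2 * \<bar>F - \<mu>\<bar>\<close>.\<close>

definition "rate \<mu> = 5 + 2 * \<bar>\<mu>\<bar>" for \<mu> :: real

lemma shoot_step_contraction:
  assumes c: "continuous_on UNIV (\<lambda>(\<mu>, x). Y \<mu> x)" "continuous_on UNIV (\<lambda>(\<mu>, x). Z \<mu> x)"
    and b: "\<And>x. \<bar>Y \<mu> x - Z \<mu> x\<bar> \<le> c0 * exp (rate \<mu> * x\<^sup>2)" and c0: "0 \<le> c0"
  shows "\<bar>shoot_step Y \<mu> x - shoot_step Z \<mu> x\<bar> \<le> c0 / 2 * exp (rate \<mu> * x\<^sup>2)"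
proof -
  define \<kappa> where "\<kappa> = rate \<mu>"
  define m where "m = 4 + 2 * \<bar>\<mu>\<bar>"
  have m: "0 < m" "m \<le> \<kappa>" "1 / 2 \<le> \<kappa>" "0 < \<kappa>" by (auto simp: m_def \<kappa>_def rate_def)
  note ic = integrand_slices(1)[OF c(1), of \<mu>] integrand_slices(1)[OF c(2), of \<mu>]
  note oc = integrand_slices(2)[OF c(1), of \<mu>] integrand_slices(2)[OF c(2), of \<mu>]
  have inn: "\<bar>shoot_inner Y \<mu> v - shoot_inner Z \<mu> v\<bar> \<le> c0 * m * \<bar>v\<bar> * exp ((\<kappa> - 1 / 2) * v\<^sup>2)" for v
  proof -
    have "shoot_inner Y \<mu> v - shoot_inner Z \<mu> v = antideriv (\<lambda>w. 2 * (F w - \<mu>) * gw w * Y \<mu> w - 2 * (F w - \<mu>) * gw w * Z \<mu> w) v"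
      unfolding shoot_inner_def by (rule antideriv_diff[OF ic])
    also have "\<bar>\<dots>\<bar> \<le> \<bar>c0 * m * (\<bar>v\<bar> * exp ((\<kappa> - 1 / 2) * \<bar>v\<bar>\<^sup>2)) - c0 * m * (0 * exp ((\<kappa> - 1 / 2) * 0\<^sup>2))\<bar>"
    proof (rule antideriv_bound_abs[OF continuous_on_diff[OF ic]])
      fix s :: real
      show "((\<lambda>s. c0 * m * (s * exp ((\<kappa> - 1 / 2) * s\<^sup>2))) has_real_derivative
          c0 * m * ((1 + 2 * (\<kappa> - 1 / 2) * s\<^sup>2) * exp ((\<kappa> - 1 / 2) * s\<^sup>2))) (at s)"
        by (auto intro!: derivative_eq_intros simp: algebra_simps power2_eq_square)
    next
      fix s
      have "\<bar>2 * (F s - \<mu>)\<bar> \<le> m" using F_gt0[of s] F_le2[of s] by (simp add: m_def abs_if split: if_splits)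
      then have "\<bar>2 * (F s - \<mu>)\<bar> * gw s * \<bar>Y \<mu> s - Z \<mu> s\<bar> \<le> m * gw s * (c0 * exp (\<kappa> * s\<^sup>2))"
        using b[of s] m c0 by (intro mult_mono) (auto simp: \<kappa>_def)
      also have "\<dots> = c0 * m * (1 * exp ((\<kappa> - 1 / 2) * s\<^sup>2))"
        by (simp add: exp_add[symmetric] algebra_simps)
      also have "\<dots> \<le> c0 * m * ((1 + 2 * (\<kappa> - 1 / 2) * s\<^sup>2) * exp ((\<kappa> - 1 / 2) * s\<^sup>2))"
        using m c0 by (intro mult_left_mono mult_right_mono) auto
      finally have fin: "\<bar>2 * (F s - \<mu>)\<bar> * gw s * \<bar>Y \<mu> s - Z \<mu> s\<bar>
        \<le> c0 * m * ((1 + 2 * (\<kappa> - 1 / 2) * s\<^sup>2) * exp ((\<kappa> - 1 / 2) * s\<^sup>2))" .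
      show "\<bar>2 * (F s - \<mu>) * gw s * Y \<mu> s - 2 * (F s - \<mu>) * gw s * Z \<mu> s\<bar>
         \<le> c0 * m * ((1 + 2 * (\<kappa> - 1 / 2) * \<bar>s\<bar>\<^sup>2) * exp ((\<kappa> - 1 / 2) * \<bar>s\<bar>\<^sup>2))"
        unfolding right_diff_distrib[symmetric, of "2 * (F s - \<mu>) * gw s"] abs_mult[of "2 * (F s - \<mu>) * gw s"]
          abs_mult[of "2 * (F s - \<mu>)"] power2_abs abs_exp_cancel by (rule fin)
    qed
    also have "\<dots> = c0 * m * \<bar>v\<bar> * exp ((\<kappa> - 1 / 2) * v\<^sup>2)" using m c0 by (simp add: abs_mult)
    finally show ?thesis .
  qed
  have "shoot_step Y \<mu> x - shoot_step Z \<mu> x = antideriv (\<lambda>v. exp (v\<^sup>2 / 2) * shoot_inner Y \<mu> v - exp (v\<^sup>2 / 2) * shoot_inner Z \<mu> v) x"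
    unfolding shoot_step_def using antideriv_diff[OF oc, of x] by simp
  also have "\<bar>\<dots>\<bar> \<le> \<bar>c0 * m / (2 * \<kappa>) * exp (\<kappa> * \<bar>x\<bar>\<^sup>2) - c0 * m / (2 * \<kappa>) * exp (\<kappa> * 0\<^sup>2)\<bar>"
  proof (rule antideriv_bound_abs[OF continuous_on_diff[OF oc]])
    fix s :: real
    show "DERIV (\<lambda>s. c0 * m / (2 * \<kappa>) * exp (\<kappa> * s\<^sup>2)) s :> c0 * m * s * exp (\<kappa> * s\<^sup>2)"
      using m by (auto intro!: derivative_eq_intros simp: field_simps)
  next
    fix s
    have "exp (s\<^sup>2 / 2) * \<bar>shoot_inner Y \<mu> s - shoot_inner Z \<mu> s\<bar> \<le> exp (s\<^sup>2 / 2) * (c0 * m * \<bar>s\<bar> * exp ((\<kappa> - 1 / 2) * s\<^sup>2))"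
      by (rule mult_left_mono[OF inn]) simp
    also have "\<dots> = c0 * m * \<bar>s\<bar> * exp (\<kappa> * s\<^sup>2)"
      by (simp add: exp_add[symmetric] algebra_simps)
    finally show "\<bar>exp (s\<^sup>2 / 2) * shoot_inner Y \<mu> s - exp (s\<^sup>2 / 2) * shoot_inner Z \<mu> s\<bar> \<le> c0 * m * \<bar>s\<bar> * exp (\<kappa> * \<bar>s\<bar>\<^sup>2)"
      unfolding right_diff_distrib[symmetric] abs_mult power2_abs abs_exp_cancel .
  qed
  also have "\<dots> = c0 * m / (2 * \<kappa>) * (exp (\<kappa> * x\<^sup>2) - 1)"
  proof -
    have "0 \<le> c0 * m / (2 * \<kappa>) * (exp (\<kappa> * x\<^sup>2) - 1)" using c0 m by (intro mult_nonneg_nonneg) auto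
    then show ?thesis by (simp add: right_diff_distrib)
  qed
  also have "\<dots> \<le> c0 * m / (2 * \<kappa>) * exp (\<kappa> * x\<^sup>2)"
    using c0 m by (intro mult_left_mono) auto
  also have "\<dots> \<le> c0 / 2 * exp (\<kappa> * x\<^sup>2)"
  proof (rule mult_right_mono)
    have "c0 * m \<le> c0 * \<kappa>" using c0 m by (intro mult_left_mono) auto
    then show "c0 * m / (2 * \<kappa>) \<le> c0 / 2" using m by (simp add: field_simps)
  qed simp
  finally show ?thesis by (simp add: \<kappa>_def)
qed

primrec shoot_iter :: "nat \<Rightarrow> real \<Rightarrow> real \<Rightarrow> real" where
  "shoot_iter 0 = (\<lambda>_ _. 0)"
| "shoot_iter (Suc k) = shoot_step (shoot_iter k)"

lemma shoot_step_0: "shoot_step (\<lambda>_ _. 0) \<mu> x = 1"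
proof -
  have z: "antideriv (\<lambda>_. 0) x = 0" for x
    using antideriv_unique[of "\<lambda>_. 0" "\<lambda>_. 0" x] by simp
  show ?thesis by (simp add: shoot_step_def shoot_inner_def z)
qed

lemma shoot_iter_cont: "continuous_on UNIV (\<lambda>(\<mu>, x). shoot_iter k \<mu> x)"
proof (induction k)
  case (Suc k)
  show ?case using shoot_step_cont[OF Suc.IH] by simp
qed (simp add: case_prod_unfold)

lemma shoot_iter_step_bound: "\<bar>shoot_iter (Suc k) \<mu> x - shoot_iter k \<mu> x\<bar> \<le> 1 * (1 / 2) ^ k * exp (rate \<mu> * x\<^sup>2)"
proof (induction k arbitrary: x)
  case 0
  have "0 \<le> rate \<mu> * x\<^sup>2" by (simp add: rate_def)
  then show ?case by (simp add: shoot_step_0)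
next
  case (Suc k)
  have "\<bar>shoot_step (shoot_iter (Suc k)) \<mu> x - shoot_step (shoot_iter k) \<mu> x\<bar> \<le> 1 * (1 / 2) ^ k / 2 * exp (rate \<mu> * x\<^sup>2)"
    by (rule shoot_step_contraction[OF shoot_iter_cont shoot_iter_cont Suc.IH]) simp
  then show ?case by simp
qed

text \<open>Solved for all \<open>\<mu>\<close> at once, because the choice of the critical
  parameter relies on joint continuity in \<open>\<mu>\<close> and \<open>x\<close>. Evenness is
  inherited from the iterates.\<close>

lemma ex_shooting:
  "\<exists>Y. continuous_on UNIV (\<lambda>(\<mu>, x). Y \<mu> x) \<and> (\<forall>\<mu> x. shoot_step Y \<mu> x = Y \<mu> x) \<and> (\<forall>\<mu> x. Y \<mu> (- x) = Y \<mu> x)"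
proof -
  have "\<bar>shoot_iter (Suc k) (fst q) (snd q) - shoot_iter k (fst q) (snd q)\<bar> \<le> 1 * (1 / 2) ^ k * exp (rate (fst q) * (snd q)\<^sup>2)" for k q
    by (rule shoot_iter_step_bound)
  from weighted_limit[of "\<lambda>k q. shoot_iter k (fst q) (snd q)" 1 "1 / 2" "\<lambda>q. exp (rate (fst q) * (snd q)\<^sup>2)", OF this]
  obtain Y' where Y': "\<And>k q. \<bar>Y' q - shoot_iter k (fst q) (snd q)\<bar> \<le> 1 / (1 - 1 / 2) * (1 / 2) ^ k * exp (rate (fst q) * (snd q)\<^sup>2)"
    by auto
  define Y where "Y \<mu> x = Y' (\<mu>, x)" for \<mu> x
  have Y: "\<bar>Y \<mu> x - shoot_iter k \<mu> x\<bar> \<le> 2 * (1 / 2) ^ k * exp (rate \<mu> * x\<^sup>2)" for k \<mu> x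
    using Y'[of "(\<mu>, x)" k] by (simp add: Y_def)
  have "continuous_on UNIV Y'"
  proof (rule weighted_limit_continuous[OF Y'])
    show "continuous_on UNIV (\<lambda>q. exp (rate (fst q) * (snd q)\<^sup>2))" unfolding rate_def by (intro continuous_intros)
    show "continuous_on UNIV (\<lambda>q. shoot_iter k (fst q) (snd q))" for k
      using shoot_iter_cont[of k] by (simp add: case_prod_unfold)
  qed auto
  then have Yc: "continuous_on UNIV (\<lambda>(\<mu>, x). Y \<mu> x)" by (simp add: Y_def case_prod_unfold)
  have lim: "(\<lambda>k. shoot_iter k \<mu> x) \<longlonglongrightarrow> Y \<mu> x" for \<mu> x
    by (rule weighted_limit_tendsto[where F = "\<lambda>x. Y \<mu> x" and f = "\<lambda>k x. shoot_iter k \<mu> x" and C = 2 and r = "1 / 2" and W = "\<lambda>x. exp (rate \<mu> * x\<^sup>2)"])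
      (use Y in auto)
  have fp: "shoot_step Y \<mu> x = Y \<mu> x" for \<mu> x
  proof -
    have "\<bar>shoot_step Y \<mu> x - shoot_iter (Suc k) \<mu> x\<bar> \<le> 1 * (1 / 2) ^ k * exp (rate \<mu> * x\<^sup>2)" for k x
    proof -
      have "\<bar>shoot_step Y \<mu> x - shoot_step (shoot_iter k) \<mu> x\<bar> \<le> 2 * (1 / 2) ^ k / 2 * exp (rate \<mu> * x\<^sup>2)"
        by (rule shoot_step_contraction[OF Yc shoot_iter_cont Y]) simp
      then show ?thesis by simp
    qed
    then have "(\<lambda>k. shoot_iter (Suc k) \<mu> x) \<longlonglongrightarrow> shoot_step Y \<mu> x"
      by (intro weighted_limit_tendsto[where F = "\<lambda>x. shoot_step Y \<mu> x" and f = "\<lambda>k x. shoot_iter (Suc k) \<mu> x" and C = 1 and r = "1 / 2" and W = "\<lambda>x. exp (rate \<mu> * x\<^sup>2)"]) auto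
    then show ?thesis using LIMSEQ_Suc[OF lim[of \<mu> x]] by (rule LIMSEQ_unique)
  qed
  have "shoot_iter k \<mu> (- x) = shoot_iter k \<mu> x" for k \<mu> x
  proof (induction k arbitrary: x)
    case (Suc k)
    have "shoot_inner (shoot_iter k) \<mu> (- v) = - 1 * shoot_inner (shoot_iter k) \<mu> v" for v
      unfolding shoot_inner_def
      by (rule antideriv_parity[OF integrand_slices(1)[OF shoot_iter_cont], where \<sigma> = 1])
        (simp add: F_evn Suc.IH)
    then have "antideriv (\<lambda>v. exp (v\<^sup>2 / 2) * shoot_inner (shoot_iter k) \<mu> v) (- x) = - (- 1) * antideriv (\<lambda>v. exp (v\<^sup>2 / 2) * shoot_inner (shoot_iter k) \<mu> v) x"
      by (intro antideriv_parity integrand_slices(2)[OF shoot_iter_cont]) simp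
    then show ?case by (simp add: shoot_step_def)
  qed simp
  then have "Y \<mu> (- x) = Y \<mu> x" for \<mu> x
    using LIMSEQ_unique[OF lim[of \<mu> "- x"], of "Y \<mu> x"] lim[of \<mu> x] by simp
  then show ?thesis using Yc fp by blast
qed

definition Y :: "real \<Rightarrow> real \<Rightarrow> real" where
  "Y = (SOME Y. continuous_on UNIV (\<lambda>(\<mu>, x). Y \<mu> x) \<and> (\<forall>\<mu> x. shoot_step Y \<mu> x = Y \<mu> x) \<and> (\<forall>\<mu> x. Y \<mu> (- x) = Y \<mu> x))"

lemma Y_props: "continuous_on UNIV (\<lambda>(\<mu>, x). Y \<mu> x)" "shoot_step Y \<mu> x = Y \<mu> x" "Y \<mu> (- x) = Y \<mu> x"
  using someI_ex[OF ex_shooting] unfolding Y_def[symmetric] by blast+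

definition Y1 :: "real \<Rightarrow> real \<Rightarrow> real" where
  "Y1 \<mu> x = exp (x\<^sup>2 / 2) * shoot_inner Y \<mu> x"

lemma Y1_cont: "continuous_on UNIV (\<lambda>(\<mu>, x). Y1 \<mu> x)"
  unfolding Y1_def by (rule outer_integrand_cont[OF Y_props(1)])

lemma Y_d: "DERIV (Y \<mu>) x :> Y1 \<mu> x"
proof -
  have "DERIV (shoot_step Y \<mu>) x :> 0 + exp (x\<^sup>2 / 2) * shoot_inner Y \<mu> x"
    unfolding shoot_step_def[abs_def]
    by (rule DERIV_add[OF DERIV_const antideriv_has_derivative[OF integrand_slices(2)[OF Y_props(1), of \<mu>]]])
  moreover have "shoot_step Y \<mu> = Y \<mu>" using Y_props(2) by blast
  ultimately show ?thesis by (simp add: Y1_def)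
qed

lemma Y1_d: "DERIV (Y1 \<mu>) x :> x * Y1 \<mu> x + 2 * (F x - \<mu>) * Y \<mu> x"
proof -
  have i: "DERIV (shoot_inner Y \<mu>) x :> 2 * (F x - \<mu>) * gw x * Y \<mu> x"
    unfolding shoot_inner_def by (rule antideriv_has_derivative[OF integrand_slices(1)[OF Y_props(1), of \<mu>]])
  have e: "DERIV (\<lambda>x. exp (x\<^sup>2 / 2)) x :> x * exp (x\<^sup>2 / 2)"
    by (auto intro!: derivative_eq_intros)
  have D: "DERIV (Y1 \<mu>) x :> x * exp (x\<^sup>2 / 2) * shoot_inner Y \<mu> x + 2 * (F x - \<mu>) * gw x * Y \<mu> x * exp (x\<^sup>2 / 2)"
    unfolding Y1_def[abs_def] by (rule DERIV_mult[OF e i])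
  have ee: "gw x * exp (x\<^sup>2 / 2) = 1" by (simp add: exp_add[symmetric])
  have eq: "2 * (F x - \<mu>) * gw x * Y \<mu> x * exp (x\<^sup>2 / 2)
      = 2 * (F x - \<mu>) * Y \<mu> x * (gw x * exp (x\<^sup>2 / 2))" by (simp only: mult_ac)
  show ?thesis using D unfolding eq ee by (simp only: Y1_def mult.assoc mult_1_right)
qed

lemma Y_0: "Y \<mu> 0 = 1" "Y1 \<mu> 0 = 0"
  using Y_props(2)[of \<mu> 0] by (simp_all add: shoot_step_def Y1_def shoot_inner_def)

text \<open>A double zero would propagate to the origin, where the solution is 1.\<close>

lemma Y_no_double_zero: "Y \<mu> x = 0 \<Longrightarrow> Y1 \<mu> x \<noteq> 0"
proof
  assume 0: "Y \<mu> x = 0" "Y1 \<mu> x = 0"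
  define E where "E x = (Y \<mu> x)\<^sup>2 + (Y1 \<mu> x)\<^sup>2" for x
  define E' where "E' x = 2 * Y \<mu> x * Y1 \<mu> x + 2 * Y1 \<mu> x * (x * Y1 \<mu> x + 2 * (F x - \<mu>) * Y \<mu> x)" for x
  define R where "R = \<bar>x\<bar>"
  define m where "m = 4 + 2 * \<bar>\<mu>\<bar>"
  have "E 0 = 0"
  proof (rule gronwall_zero[where E = E and x = 0 and E' = E' and R = R and C = "1 + 2 * R + m" and z = x])
    show "DERIV E s :> E' s" for s
      unfolding E_def[abs_def] E'_def
      by (auto intro!: derivative_eq_intros Y_d Y1_d simp: algebra_simps power2_eq_square)
    fix s assume s: "\<bar>s\<bar> \<le> R"
    have p: "2 * (\<bar>Y \<mu> s\<bar> * \<bar>Y1 \<mu> s\<bar>) \<le> E s"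
      using zero_le_power2[of "\<bar>Y \<mu> s\<bar> - \<bar>Y1 \<mu> s\<bar>"] by (simp add: E_def power2_diff)
    have 1: "\<bar>2 * Y \<mu> s * Y1 \<mu> s\<bar> \<le> E s" using p by (simp add: abs_mult)
    have "\<bar>s\<bar> * (Y1 \<mu> s)\<^sup>2 \<le> R * E s" using s by (intro mult_mono) (auto simp: E_def)
    then have 2: "\<bar>2 * Y1 \<mu> s * (s * Y1 \<mu> s)\<bar> \<le> 2 * R * E s" by (simp add: abs_mult power2_eq_square mult_ac)
    have "\<bar>2 * (F s - \<mu>)\<bar> \<le> m" using F_gt0[of s] F_le2[of s] by (simp add: m_def abs_if split: if_splits)
    then have "\<bar>2 * (F s - \<mu>)\<bar> * (2 * (\<bar>Y \<mu> s\<bar> * \<bar>Y1 \<mu> s\<bar>)) \<le> m * E s"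
      using p by (intro mult_mono) (auto simp: m_def)
    then have 3: "\<bar>2 * Y1 \<mu> s * (2 * (F s - \<mu>) * Y \<mu> s)\<bar> \<le> m * E s" by (simp add: abs_mult mult_ac)
    have "E' s = 2 * Y \<mu> s * Y1 \<mu> s + (2 * Y1 \<mu> s * (s * Y1 \<mu> s) + 2 * Y1 \<mu> s * (2 * (F s - \<mu>) * Y \<mu> s))"
      by (simp add: E'_def algebra_simps)
    also have "\<bar>\<dots>\<bar> \<le> E s + (2 * R * E s + m * E s)"
      by (rule order_trans[OF abs_triangle_ineq add_mono[OF 1 order_trans[OF abs_triangle_ineq add_mono[OF 2 3]]]])
    finally show "\<bar>E' s\<bar> \<le> (1 + 2 * R + m) * E s" by (simp add: algebra_simps)
  qed (auto simp: E_def 0 R_def)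
  then show False by (simp add: E_def Y_0)
qed

end

section \<open>Explicit solutions and Sturm comparison\<close>

lemma nondecreasing_from_derivative:
  fixes h :: "real \<Rightarrow> real"
  assumes "a \<le> b" "\<And>x. a \<le> x \<Longrightarrow> x \<le> b \<Longrightarrow> DERIV h x :> h' x"
    and "\<And>x. a < x \<Longrightarrow> x < b \<Longrightarrow> 0 \<le> h' x"
  shows "h a \<le> h b"
proof (cases "a = b")
  case False
  then have ab: "a < b" using assms(1) by simp
  show ?thesis
  proof (rule DERIV_nonneg_imp_increasing_open[OF assms(1)])
    show "\<exists>y. DERIV h x :> y \<and> 0 \<le> y" if "a < x" "x < b" for x
      using assms(2,3)[of x] that by (intro exI[of _ "h' x"]) auto
    show "continuous_on {a..b} h"
      using assms(2) by (intro DERIV_atLeastAtMost_imp_continuous_on) auto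
  qed
qed simp

lemma exp_half_square_ge: "x ^ 4 / 8 \<le> exp (x\<^sup>2 / 2)" for x :: real
proof -
  have "1 + x\<^sup>2 / 2 + (x\<^sup>2 / 2)\<^sup>2 / 2 \<le> exp (x\<^sup>2 / 2)" by (rule exp_lower_Taylor_quadratic) simp
  moreover have "(x\<^sup>2 / 2)\<^sup>2 / 2 = x ^ 4 / 8" by (simp add: power2_eq_square power4_eq_xxxx)
  ultimately show ?thesis using zero_le_power2[of x] by linarith
qed

context profile
begin

definition f :: "real \<Rightarrow> real" where "f z = F z * exp (z\<^sup>2 / 2)"
text \<open>The origin of this solution is translation invariance: the space derivative of the
  self-similar solution solves the linearised equation and has decay rate 3/2, which corresponds to
  the parameter 1.\<close>

definition k :: "real \<Rightarrow> real" where "k z = - F1 z * exp (z\<^sup>2 / 2)"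
definition f1 :: "real \<Rightarrow> real" where "f1 z = z * f z - k z"
definition k1 :: "real \<Rightarrow> real" where "k1 z = (2 - F z) * f z"

lemma exp_sq_d: "DERIV (\<lambda>z. exp (z\<^sup>2 / 2)) z :> z * exp (z\<^sup>2 / 2)" for z :: real
  by (auto intro!: derivative_eq_intros)

lemma exp_nsq_d: "DERIV (\<lambda>z. gw z) z :> - z * gw z" for z :: real
  by (auto intro!: derivative_eq_intros)

lemma exp_sq_inverse: "gw z * exp (z\<^sup>2 / 2) = 1" for z :: real
  by (simp add: exp_add[symmetric])

lemma f_d: "DERIV f z :> f1 z"
proof -
  have "DERIV f z :> F1 z * exp (z\<^sup>2 / 2) + z * exp (z\<^sup>2 / 2) * F z"
    unfolding f_def[abs_def] by (rule DERIV_mult[OF F_d exp_sq_d])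
  moreover have "F1 z * exp (z\<^sup>2 / 2) + z * exp (z\<^sup>2 / 2) * F z = f1 z"
    by (simp add: f1_def f_def k_def algebra_simps)
  ultimately show ?thesis by simp
qed

lemma k_d: "DERIV k z :> k1 z"
proof -
  have "DERIV k z :> - ((F z)\<^sup>2 - 2 * F z - z * F1 z) * exp (z\<^sup>2 / 2) + z * exp (z\<^sup>2 / 2) * - F1 z"
    unfolding k_def[abs_def] by (rule DERIV_mult[OF DERIV_minus[OF F1_d] exp_sq_d])
  moreover have "- ((F z)\<^sup>2 - 2 * F z - z * F1 z) * exp (z\<^sup>2 / 2) + z * exp (z\<^sup>2 / 2) * - F1 z = k1 z"
    by (simp add: k1_def f_def algebra_simps power2_eq_square)
  ultimately show ?thesis by simp
qed

lemma f1_d: "DERIV f1 z :> z * f1 z + (F z - 1) * f z"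
proof -
  have "DERIV f1 z :> 1 * f z + f1 z * z - k1 z"
    unfolding f1_def[abs_def] by (rule DERIV_diff[OF DERIV_mult[OF DERIV_ident f_d, unfolded f1_def] k_d])
  moreover have "1 * f z + f1 z * z - k1 z = z * f1 z + (F z - 1) * f z"
    by (simp add: k1_def algebra_simps)
  ultimately show ?thesis by (simp only:)
qed

lemma k1_d: "DERIV k1 z :> z * k1 z + 2 * (F z - 1) * k z"
proof -
  have "DERIV k1 z :> (0 - F1 z) * f z + f1 z * (2 - F z)"
    unfolding k1_def[abs_def] by (rule DERIV_mult[OF DERIV_diff[OF DERIV_const F_d] f_d])
  moreover have "F1 z * f z = - F z * k z" by (simp add: f_def k_def)
  then have "(0 - F1 z) * f z + f1 z * (2 - F z) = z * k1 z + 2 * (F z - 1) * k z"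
    by (simp add: k1_def f1_def algebra_simps)
  ultimately show ?thesis by simp
qed

lemma k_0 [simp]: "k 0 = 0" by (simp add: k_def F1_zero)
lemma f1_0 [simp]: "f1 0 = 0" by (simp add: f1_def)
lemma f_pos: "0 < f z" using F_gt0[of z] by (simp add: f_def)

text \<open>Touching the constant solution 2 would make \<open>F\<close> equal to it everywhere,
  which the Gaussian tail excludes at the point 3.\<close>

lemma F_lt2: "F z < 2"
proof (rule ccontr)
  assume "\<not> F z < 2"
  then have z: "F z = 2" using F_le2[of z] by simp
  then have z1: "F1 z = 0"
    using DERIV_local_max[OF F_d, of 1 z] F_le2 by simp
  define E where "E x = (F x - 2)\<^sup>2 + (F1 x)\<^sup>2" for x
  define E' where "E' x = 2 * F1 x * ((F x - 2) * (1 + F x)) - 2 * x * (F1 x)\<^sup>2" for x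
  define R where "R = max \<bar>z\<bar> 3"
  have "E 3 = 0"
  proof (rule gronwall_zero[where E = E and E' = E' and R = R and C = "3 + 2 * R" and z = z and x = 3])
    show "DERIV E x :> E' x" for x
    proof -
      have "DERIV E x :> 2 * (F x - 2) * F1 x + 2 * F1 x * ((F x)\<^sup>2 - 2 * F x - x * F1 x)"
        unfolding E_def[abs_def] by (auto intro!: derivative_eq_intros F_d F1_d)
      moreover have "2 * (F x - 2) * F1 x + 2 * F1 x * ((F x)\<^sup>2 - 2 * F x - x * F1 x) = E' x"
        by (simp add: E'_def algebra_simps power2_eq_square)
      ultimately show ?thesis by simp
    qed
    fix x assume x: "\<bar>x\<bar> \<le> R"
    have "\<bar>1 + F x\<bar> \<le> 3" using F_gt0[of x] F_le2[of x] by simp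
    then have "2 * (\<bar>F1 x\<bar> * \<bar>F x - 2\<bar>) * \<bar>1 + F x\<bar> \<le> 2 * (\<bar>F1 x\<bar> * \<bar>F x - 2\<bar>) * 3"
      by (intro mult_left_mono) auto
    moreover have "2 * (\<bar>F1 x\<bar> * \<bar>F x - 2\<bar>) \<le> E x"
      using zero_le_power2[of "\<bar>F1 x\<bar> - \<bar>F x - 2\<bar>"] by (simp add: E_def power2_diff)
    moreover have "\<bar>2 * F1 x * ((F x - 2) * (1 + F x))\<bar> = 2 * (\<bar>F1 x\<bar> * \<bar>F x - 2\<bar>) * \<bar>1 + F x\<bar>"
      by (simp add: abs_mult)
    ultimately have 1: "\<bar>2 * F1 x * ((F x - 2) * (1 + F x))\<bar> \<le> 3 * E x" by linarith
    have "\<bar>x\<bar> * (F1 x)\<^sup>2 \<le> R * E x"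
      using x by (intro mult_mono) (auto simp: E_def)
    then have 2: "\<bar>2 * x * (F1 x)\<^sup>2\<bar> \<le> 2 * R * E x" by (simp add: abs_mult)
    have "\<bar>E' x\<bar> \<le> 3 * E x + 2 * R * E x"
      unfolding E'_def by (rule order_trans[OF abs_triangle_ineq4 add_mono[OF 1 2]])
    then show "\<bar>E' x\<bar> \<le> (3 + 2 * R) * E x" by (simp add: algebra_simps)
  qed (auto simp: E_def z z1 R_def)
  then have "F 3 = 2" by (simp add: E_def sum_power2_eq_zero_iff)
  moreover have "F 3 \<le> 6 * exp (- 4)" using F_tail[of 3] by simp
  moreover have "exp (- 4 :: real) \<le> 1 / 5"
  proof -
    have "5 \<le> exp (4 :: real)" using exp_ge_add_one_self[of 4] by simp
    then show ?thesis by (simp add: exp_minus inverse_eq_divide field_simps)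
  qed
  ultimately show False by simp
qed

lemma f_le: "f z \<le> 4 * max 1 \<bar>z\<bar>"
proof (cases "1 \<le> \<bar>z\<bar>")
  case True
  have "exp (1 / 2 :: real) \<le> 2"
  proof (rule power2_le_imp_le)
    show "(exp (1 / 2 :: real))\<^sup>2 \<le> 2\<^sup>2" using exp_le by (simp add: power2_eq_square exp_add[symmetric])
  qed simp
  have "f z \<le> 2 * \<bar>z\<bar> * exp ((1 - z\<^sup>2) / 2) * exp (z\<^sup>2 / 2)"
    unfolding f_def by (rule mult_right_mono[OF F_tail[OF True]]) simp
  also have "\<dots> = 2 * \<bar>z\<bar> * exp (1 / 2)" by (simp add: exp_add[symmetric] field_simps)
  also have "\<dots> \<le> 2 * \<bar>z\<bar> * 2" by (rule mult_left_mono[OF \<open>exp (1 / 2) \<le> 2\<close>]) simp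
  finally show ?thesis using True by (simp add: max_absorb2)
next
  case False
  have "z\<^sup>2 / 2 \<le> 1 / 2" using False abs_square_le_1[of z] by simp
  then have "exp (z\<^sup>2 / 2) \<le> exp (1 / 2)" by simp
  also have "exp (1 / 2 :: real) \<le> 2"
  proof (rule power2_le_imp_le)
    show "(exp (1 / 2 :: real))\<^sup>2 \<le> 2\<^sup>2" using exp_le by (simp add: power2_eq_square exp_add[symmetric])
  qed simp
  finally have "F z * exp (z\<^sup>2 / 2) \<le> 2 * 2"
    using F_gt0[of z] F_le2[of z] by (intro mult_mono) auto
  then show ?thesis using False by (simp add: f_def max_absorb1)
qed

lemma k1_pos: "0 < k1 z"
  unfolding k1_def using F_lt2[of z] f_pos[of z] by simp

lemma k_nonneg: "0 \<le> x \<Longrightarrow> 0 \<le> k x"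
  using nondecreasing_from_derivative[of 0 x k k1, OF _ k_d less_imp_le[OF k1_pos]] by simp

lemma k_pos: "0 < x \<Longrightarrow> 0 < k x"
proof -
  assume "0 < x"
  then have "k 0 < k x" by (rule DERIV_pos_imp_increasing) (use k_d k1_pos in blast)
  then show ?thesis by simp
qed

text \<open>The derivative \<open>(2 - F) * f\<close> is at most \<open>2 * f\<close>, and
  \<open>f\<close> has a linear bound.\<close>

lemma k_le: "1 \<le> x \<Longrightarrow> k x \<le> 12 * x\<^sup>2"
proof -
  assume x: "1 \<le> x"
  have "8 * 0 + 4 * 0\<^sup>2 - k 0 \<le> 8 * x + 4 * x\<^sup>2 - k x"
  proof (rule nondecreasing_from_derivative[where h = "\<lambda>x. 8 * x + 4 * x\<^sup>2 - k x" and h' = "\<lambda>y. 8 + 8 * y - k1 y"])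
    show "DERIV (\<lambda>x. 8 * x + 4 * x\<^sup>2 - k x) y :> 8 + 8 * y - k1 y" for y
      by (auto intro!: derivative_eq_intros k_d)
    show "0 \<le> 8 + 8 * y - k1 y" if "0 < y" "y < x" for y
    proof -
      have "k1 y \<le> 2 * (4 * max 1 \<bar>y\<bar>)"
        unfolding k1_def using F_gt0[of y] F_lt2[of y] f_pos[of y] f_le[of y] by (intro mult_mono) auto
      also have "\<dots> \<le> 8 + 8 * y" using that by (simp add: max_def)
      finally show ?thesis by simp
    qed
  qed (use x in auto)
  then have "k x \<le> 8 * x + 4 * x\<^sup>2" by simp
  also have "\<dots> \<le> 12 * x\<^sup>2" using x self_le_power[of x 2] by simp
  finally show ?thesis .
qed

text \<open>The Wronskian of \<open>Y \<mu>\<close> and \<open>f\<close>; the weight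
  \<open>gw\<close> makes the first-order terms of both equations cancel in its derivative.\<close>

definition wr :: "real \<Rightarrow> real \<Rightarrow> real" where
  "wr \<mu> x = gw x * (Y1 \<mu> x * f x - Y \<mu> x * f1 x)"

lemma wr_d: "DERIV (wr \<mu>) x :> gw x * (Y \<mu> x * f x * (F x + 1 - 2 * \<mu>))"
proof -
  have "DERIV (wr \<mu>) x :> - x * gw x * (Y1 \<mu> x * f x - Y \<mu> x * f1 x)
     + (((x * Y1 \<mu> x + 2 * (F x - \<mu>) * Y \<mu> x) * f x + f1 x * Y1 \<mu> x) - (Y1 \<mu> x * f1 x + (x * f1 x + (F x - 1) * f x) * Y \<mu> x)) * gw x"
    unfolding wr_def[abs_def]
    by (rule DERIV_mult[OF exp_nsq_d DERIV_diff[OF DERIV_mult[OF Y1_d f_d] DERIV_mult[OF Y_d f1_d]]])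
  moreover have "- x * gw x * (Y1 \<mu> x * f x - Y \<mu> x * f1 x)
     + (((x * Y1 \<mu> x + 2 * (F x - \<mu>) * Y \<mu> x) * f x + f1 x * Y1 \<mu> x) - (Y1 \<mu> x * f1 x + (x * f1 x + (F x - 1) * f x) * Y \<mu> x)) * gw x
    = gw x * (Y \<mu> x * f x * (F x + 1 - 2 * \<mu>))"
    by (simp add: algebra_simps)
  ultimately show ?thesis by simp
qed

lemma Y_cont: "continuous_on UNIV (Y \<mu>)" and Y1_cont': "continuous_on UNIV (Y1 \<mu>)"
  using slice2[OF Y_props(1)] slice2[OF Y1_cont] by blast+

text \<open>Sturm comparison with the positive solution \<open>f\<close>: for these
  \<open>\<mu>\<close> the Wronskian does not decrease from its value 0 as long as
  \<open>Y \<mu>\<close> is positive, so \<open>Y \<mu> / f\<close> is nondecreasing and cannot come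
  down to 0.\<close>

lemma Y_pos_le_half:
  assumes \<mu>: "\<mu> \<le> 1 / 2" and x: "0 \<le> x"
  shows "0 < Y \<mu> x"
proof (rule stay_positive[of 0 "Y \<mu>"])
  show "continuous_on {0..} (Y \<mu>)" by (rule continuous_on_subset[OF Y_cont]) simp
  show "0 < Y \<mu> 0" by (simp add: Y_0)
  fix b assume b: "0 < b" and pos: "\<And>x. 0 \<le> x \<Longrightarrow> x < b \<Longrightarrow> 0 < Y \<mu> x"
  have wr: "0 \<le> wr \<mu> x" if "0 \<le> x" "x \<le> b" for x
  proof -
    have "wr \<mu> 0 \<le> wr \<mu> x"
    proof (rule nondecreasing_from_derivative[OF that(1) wr_d])
      show "0 \<le> gw y * (Y \<mu> y * f y * (F y + 1 - 2 * \<mu>))" if "0 < y" "y < x" for y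
        using pos[of y] that \<open>x \<le> b\<close> f_pos[of y] F_gt0[of y] \<mu> by (intro mult_nonneg_nonneg) auto
    qed
    then show ?thesis by (simp add: wr_def Y_0)
  qed
  have "Y \<mu> 0 / f 0 \<le> Y \<mu> b / f b"
  proof (rule nondecreasing_from_derivative[where h = "\<lambda>x. Y \<mu> x / f x" and h' = "\<lambda>x. (Y1 \<mu> x * f x - Y \<mu> x * f1 x) / (f x * f x)"])
    show "DERIV (\<lambda>x. Y \<mu> x / f x) x :> (Y1 \<mu> x * f x - Y \<mu> x * f1 x) / (f x * f x)" for x
      using f_pos[of x] by (intro DERIV_divide Y_d f_d) simp
    show "0 \<le> (Y1 \<mu> x * f x - Y \<mu> x * f1 x) / (f x * f x)" if "0 < x" "x < b" for x
      using wr[of x] that by (simp add: wr_def zero_le_mult_iff)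
  qed (use b in simp)
  then have "Y \<mu> 0 / f 0 \<le> Y \<mu> b / f b" .
  moreover have "0 < Y \<mu> 0 / f 0" using f_pos[of 0] by (simp add: Y_0)
  ultimately have "0 < Y \<mu> b / f b" by (rule less_le_trans[rotated])
  then show "0 < Y \<mu> b" using f_pos[of b] by (simp add: zero_less_divide_iff)
qed (rule x)

text \<open>\<open>k\<close> solves the equation for \<open>\<mu> = 1\<close>, so its weighted
  Wronskian with \<open>Y 1\<close> is constant and
  \<open>(Y 1 / k)' = - k1 0 * exp (x^2 / 2) / k^2\<close>. As \<open>k\<close> grows at most
  quadratically, this slope is at most a negative constant for \<open>x \<ge> 1\<close>, and the
  quotient would eventually be negative.\<close>

lemma Y_one_zero: "\<exists>x>0. Y 1 x \<le> 0"
proof (rule ccontr)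
  assume "\<not> ?thesis"
  then have pos: "0 < Y 1 x" if "0 < x" for x using that by (meson not_less)
  define wk where "wk x = gw x * (k x * Y1 1 x - Y 1 x * k1 x)" for x
  have "DERIV wk x :> - x * gw x * (k x * Y1 1 x - Y 1 x * k1 x)
     + ((k1 x * Y1 1 x + (x * Y1 1 x + 2 * (F x - 1) * Y 1 x) * k x) - (Y1 1 x * k1 x + (x * k1 x + 2 * (F x - 1) * k x) * Y 1 x)) * gw x" for x
    unfolding wk_def[abs_def]
    by (rule DERIV_mult[OF exp_nsq_d DERIV_diff[OF DERIV_mult[OF k_d Y1_d] DERIV_mult[OF Y_d k1_d]]])
  moreover have "- x * gw x * (k x * Y1 1 x - Y 1 x * k1 x)
     + ((k1 x * Y1 1 x + (x * Y1 1 x + 2 * (F x - 1) * Y 1 x) * k x) - (Y1 1 x * k1 x + (x * k1 x + 2 * (F x - 1) * k x) * Y 1 x)) * gw x = 0" for x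
    by (simp add: algebra_simps)
  ultimately have "DERIV wk x :> 0" for x by metis
  then have wk: "wk x = wk 0" for x using DERIV_isconst_all by blast
  define c where "c = k1 0"
  have c: "0 < c" unfolding c_def by (rule k1_pos)
  have wkc: "wk x = - c" for x using wk[of x] by (simp add: wk_def c_def Y_0)
  have kd: "k x * Y1 1 x - Y 1 x * k1 x = - c * exp (x\<^sup>2 / 2)" for x
  proof -
    have "exp (x\<^sup>2 / 2) * wk x = (gw x * exp (x\<^sup>2 / 2)) * (k x * Y1 1 x - Y 1 x * k1 x)"
      by (simp add: wk_def mult_ac)
    then show ?thesis by (simp only: exp_sq_inverse wkc mult_1) (simp add: mult.commute)
  qed
  \<comment> \<open>1152 is 144 times 8: the square of the 12 in the bound on \<open>k\<close>,
    against \<open>exp (x^2 / 2) \<ge> x^4 / 8\<close>.\<close>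
  define d where "d = c / 1152"
  have d: "0 < d" using c by (simp add: d_def)
  have bound: "Y 1 b / k b \<le> Y 1 1 / k 1 - d * (b - 1)" if b: "1 \<le> b" for b
  proof -
    have "- (Y 1 1 / k 1) - d * 1 \<le> - (Y 1 b / k b) - d * b"
    proof (rule nondecreasing_from_derivative[where h = "\<lambda>x. - (Y 1 x / k x) - d * x" and
        h' = "\<lambda>x. - ((Y1 1 x * k x - Y 1 x * k1 x) / (k x * k x)) - d", OF b])
      fix x :: real assume x: "1 \<le> x" "x \<le> b"
      have "DERIV (\<lambda>x. Y 1 x / k x) x :> (Y1 1 x * k x - Y 1 x * k1 x) / (k x * k x)"
        using k_pos[of x] x by (intro DERIV_divide Y_d k_d) simp
      then show "DERIV (\<lambda>x. - (Y 1 x / k x) - d * x) x :> - ((Y1 1 x * k x - Y 1 x * k1 x) / (k x * k x)) - d"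
        using DERIV_diff[OF DERIV_minus DERIV_cmult[OF DERIV_ident, of d]] by simp
    next
      fix x :: real assume x: "1 < x" "x < b"
      have kx: "0 < k x" using k_pos[of x] x by simp
      have "k x * k x \<le> (12 * x\<^sup>2) * (12 * x\<^sup>2)" using k_le[of x] x kx by (intro mult_mono) auto
      also have "\<dots> = 1152 * (x ^ 4 / 8)" by (simp add: power2_eq_square power4_eq_xxxx)
      also have "\<dots> \<le> 1152 * exp (x\<^sup>2 / 2)" by (intro mult_left_mono exp_half_square_ge) simp
      finally have "d * (k x * k x) \<le> d * (1152 * exp (x\<^sup>2 / 2))" using d by (intro mult_left_mono) auto
      then have "d * (k x * k x) \<le> c * exp (x\<^sup>2 / 2)" by (simp add: d_def)
      then have "d \<le> c * exp (x\<^sup>2 / 2) / (k x * k x)" using kx by (simp add: pos_le_divide_eq)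
      then show "0 \<le> - ((Y1 1 x * k x - Y 1 x * k1 x) / (k x * k x)) - d"
        using kd[of x] by (simp add: mult.commute)
    qed
    then show ?thesis by (simp add: algebra_simps)
  qed
  define b where "b = 2 + Y 1 1 / k 1 / d"
  have Yk: "0 < Y 1 1 / k 1" using pos[of 1] k_pos[of 1] by simp
  then have "0 < Y 1 1 / k 1 / d" using d by (rule divide_pos_pos)
  then have b1: "1 \<le> b" by (simp add: b_def)
  have "d * (b - 1) = d + Y 1 1 / k 1" using d by (simp add: b_def field_simps)
  then have "Y 1 b / k b < 0" using bound[OF b1] d by linarith
  moreover have "0 < Y 1 b / k b" using pos[of b] k_pos[of b] b1 by simp
  ultimately show False by simp
qed

text \<open>Beyond \<open>X\<close> the region \<open>Y > 0\<close>, \<open>x * Y' > c * Y\<close>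
  cannot be left. Inserting the slope bound and \<open>F > 0\<close> into the derivative of
  \<open>x * Y' - c * Y\<close> leaves at least
  \<open>(x^2 * (c - 2 * \<mu>) - c * (c - 1)) * Y / x\<close>, which is nonnegative by the size of
  \<open>X\<close>.\<close>

lemma trap:
  assumes c: "1 \<le> c" "c \<le> 2" "2 * \<mu> < c" and X: "1 \<le> X" "c * (c - 1) \<le> X\<^sup>2 * (c - 2 * \<mu>)" "0 \<le> \<mu>"
    and Y0: "0 < Y \<mu> X" "c * Y \<mu> X < X * Y1 \<mu> X" and x: "X \<le> x"
  shows "0 < Y \<mu> x"
proof -
  define Z where "Z x = x * Y1 \<mu> x - c * Y \<mu> x" for x
  define h where "h x = min (Y \<mu> x) (Z x)" for x
  have dZ: "DERIV Z x :> (1 * Y1 \<mu> x + (x * Y1 \<mu> x + 2 * (F x - \<mu>) * Y \<mu> x) * x) - c * Y1 \<mu> x" for x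
    unfolding Z_def[abs_def] by (rule DERIV_diff[OF DERIV_mult[OF DERIV_ident Y1_d] DERIV_cmult[OF Y_d]])
  have "0 < h x"
  proof (rule stay_positive[of X h])
    show "continuous_on {X..} h" unfolding h_def Z_def
      by (intro continuous_intros continuous_on_subset[OF Y_cont] continuous_on_subset[OF Y1_cont']) auto
    show "0 < h X" using Y0 by (simp add: h_def Z_def)
    fix b assume b: "X < b" and pos: "\<And>x. X \<le> x \<Longrightarrow> x < b \<Longrightarrow> 0 < h x"
    have Y1p: "c * Y \<mu> x / x < Y1 \<mu> x" "0 < Y \<mu> x" if "X \<le> x" "x < b" for x
      using pos[OF that] that X(1) by (auto simp: h_def Z_def pos_divide_less_eq mult.commute)
    have "Y \<mu> X \<le> Y \<mu> b"
    proof (rule nondecreasing_from_derivative[OF _ Y_d])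
      show "0 \<le> Y1 \<mu> x" if "X < x" "x < b" for x
      proof -
        have "0 \<le> c * Y \<mu> x / x" using Y1p(2)[of x] that c(1) X(1) by simp
        then show ?thesis using Y1p(1)[of x] that by simp
      qed
    qed (use b in simp)
    moreover have "Z X \<le> Z b"
    proof (rule nondecreasing_from_derivative[OF _ dZ])
      fix x assume x: "X < x" "x < b"
      then have x1: "1 < x" "0 < x" using X(1) by auto
      have y: "c * Y \<mu> x / x < Y1 \<mu> x" "0 < Y \<mu> x" using Y1p[of x] x by auto
      have "1 \<le> x * x" using x1 by (smt (verit) mult_less_cancel_left1)
      then have "0 \<le> x * x + 1 - c" using c by simp
      then have "(x * x + 1 - c) * (c * Y \<mu> x / x) \<le> (x * x + 1 - c) * Y1 \<mu> x"
        using y by (intro mult_left_mono) auto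
      moreover have "- \<mu> * (2 * Y \<mu> x * x) \<le> (F x - \<mu>) * (2 * Y \<mu> x * x)"
        using F_gt0[of x] y x1 by (intro mult_right_mono) auto
      moreover have "0 \<le> (x * x + 1 - c) * (c * Y \<mu> x / x) - \<mu> * (2 * Y \<mu> x * x)"
      proof -
        have "X * X \<le> x * x" using x X(1) by (intro mult_mono) auto
        then have "X\<^sup>2 * (c - 2 * \<mu>) \<le> x * x * (c - 2 * \<mu>)"
          using c(3) by (intro mult_right_mono) (auto simp: power2_eq_square)
        then have "0 \<le> (x * x * (c - 2 * \<mu>) - c * (c - 1)) * (Y \<mu> x / x)"
          using X(2) y x1 by (intro mult_nonneg_nonneg) auto
        also have "\<dots> = (x * x + 1 - c) * (c * Y \<mu> x / x) - \<mu> * (2 * Y \<mu> x * x)"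
          using x1 by (simp add: field_simps)
        finally show ?thesis .
      qed
      ultimately have "0 \<le> (x * x + 1 - c) * Y1 \<mu> x + (F x - \<mu>) * (2 * Y \<mu> x * x)" by linarith
      also have "\<dots> = (1 * Y1 \<mu> x + (x * Y1 \<mu> x + 2 * (F x - \<mu>) * Y \<mu> x) * x) - c * Y1 \<mu> x"
        by (simp add: algebra_simps)
      finally show "0 \<le> (1 * Y1 \<mu> x + (x * Y1 \<mu> x + 2 * (F x - \<mu>) * Y \<mu> x) * x) - c * Y1 \<mu> x" .
    qed (use b in simp)
    ultimately show "0 < h b" using Y0 by (simp add: h_def Z_def)
  qed (rule x)
  then show ?thesis by (simp add: h_def)
qed

section \<open>The critical parameter and the growth of its solution\<close>

lemma Y_tendsto:
  assumes "(m \<longlongrightarrow> \<mu>) G" "(x \<longlongrightarrow> l) G"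
  shows "((\<lambda>j. Y (m j) (x j)) \<longlongrightarrow> Y \<mu> l) G" and "((\<lambda>j. Y1 (m j) (x j)) \<longlongrightarrow> Y1 \<mu> l) G"
proof -
  have p: "((\<lambda>j. (m j, x j)) \<longlongrightarrow> (\<mu>, l)) G" by (rule tendsto_Pair[OF assms])
  show "((\<lambda>j. Y (m j) (x j)) \<longlongrightarrow> Y \<mu> l) G"
    using continuous_on_tendsto_compose[OF Y_props(1) p] by simp
  show "((\<lambda>j. Y1 (m j) (x j)) \<longlongrightarrow> Y1 \<mu> l) G"
    using continuous_on_tendsto_compose[OF Y1_cont p] by simp
qed

definition ms :: real where "ms = Inf {\<mu>. \<exists>x>0. Y \<mu> x \<le> 0}"

lemma ms_lower: "\<exists>x>0. Y \<mu> x \<le> 0 \<Longrightarrow> ms \<le> \<mu>"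
proof -
  assume a: "\<exists>x>0. Y \<mu> x \<le> 0"
  have "bdd_below {\<mu>. \<exists>x>0. Y \<mu> x \<le> 0}"
  proof (rule bdd_belowI[of _ "1 / 2"])
    fix \<mu> assume "\<mu> \<in> {\<mu>. \<exists>x>0. Y \<mu> x \<le> 0}"
    then obtain x where "0 < x" "Y \<mu> x \<le> 0" by blast
    then show "1 / 2 \<le> \<mu>" using Y_pos_le_half[of \<mu> x] by (cases "\<mu> \<le> 1 / 2") auto
  qed
  then show ?thesis unfolding ms_def using a by (intro cInf_lower) auto
qed

lemma ms_ge_half: "1 / 2 \<le> ms"
  unfolding ms_def
proof (rule cInf_greatest)
  show "{\<mu>. \<exists>x>0. Y \<mu> x \<le> 0} \<noteq> {}" using Y_one_zero by blast
  fix \<mu> assume "\<mu> \<in> {\<mu>. \<exists>x>0. Y \<mu> x \<le> 0}"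
  then obtain x where "0 < x" "Y \<mu> x \<le> 0" by blast
  then show "1 / 2 \<le> \<mu>" using Y_pos_le_half[of \<mu> x] by (cases "\<mu> \<le> 1 / 2") auto
qed

lemma ms_approx: "\<exists>m :: nat \<Rightarrow> real. m \<longlonglongrightarrow> ms \<and> (\<forall>j. \<exists>x>0. Y (m j) x \<le> 0)"
proof -
  have "\<exists>\<mu>. \<mu> < ms + 1 / real (Suc j) \<and> (\<exists>x>0. Y \<mu> x \<le> 0)" for j
  proof -
    have "Inf {\<mu>. \<exists>x>0. Y \<mu> x \<le> 0} < ms + 1 / real (Suc j)" by (simp add: ms_def)
    then obtain \<mu> where "\<mu> \<in> {\<mu>. \<exists>x>0. Y \<mu> x \<le> 0}" "\<mu> < ms + 1 / real (Suc j)"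
      using cInf_lessD[of "{\<mu>. \<exists>x>0. Y \<mu> x \<le> 0}" "ms + 1 / real (Suc j)"] Y_one_zero by blast
    then show ?thesis by blast
  qed
  then obtain m where m: "\<And>j. m j < ms + 1 / real (Suc j)" "\<And>j. \<exists>x>0. Y (m j) x \<le> 0" by metis
  have "m \<longlonglongrightarrow> ms"
  proof (rule tendsto_sandwich)
    show "\<forall>\<^sub>F j in sequentially. ms \<le> m j" using ms_lower[OF m(2)] by (intro always_eventually allI)
    show "\<forall>\<^sub>F j in sequentially. m j \<le> ms + 1 / real (Suc j)" using less_imp_le[OF m(1)] by (intro always_eventually allI)
    show "(\<lambda>j. ms + 1 / real (Suc j)) \<longlonglongrightarrow> ms"
      using tendsto_add[OF tendsto_const[of ms] LIMSEQ_Suc[OF lim_1_over_n]] by simp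
  qed simp
  then show ?thesis using m(2) by blast
qed

abbreviation "psi \<equiv> Y ms"
abbreviation "psi1 \<equiv> Y1 ms"

text \<open>For parameters below \<open>ms\<close> there is no zero, by the choice of
  \<open>ms\<close>, and \<open>psi\<close> is the limit of these positive solutions.\<close>

lemma psi_nonneg: "0 < x \<Longrightarrow> 0 \<le> psi x"
proof (rule ccontr)
  assume x: "0 < x" and "\<not> 0 \<le> psi x"
  then have "psi x < 0" by simp
  moreover have "((\<lambda>j. Y (ms - 1 / real (Suc j)) x) \<longlongrightarrow> psi x) sequentially"
    using tendsto_diff[OF tendsto_const[of ms] LIMSEQ_Suc[OF lim_1_over_n]]
    by (intro Y_tendsto tendsto_const) simp
  ultimately have "eventually (\<lambda>j. Y (ms - 1 / real (Suc j)) x < 0) sequentially"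
    by (rule order_tendstoD(2)[rotated])
  then obtain j where "Y (ms - 1 / real (Suc j)) x < 0" using eventually_sequentially by auto
  then have "ms \<le> ms - 1 / real (Suc j)" using x by (intro ms_lower exI[of _ x]) auto
  moreover have "0 < 1 / real (Suc j)" by simp
  ultimately show False by linarith
qed

text \<open>A first zero would be simple: a positive slope there makes \<open>psi\<close> negative
  just before it, a negative slope just after it.\<close>

lemma psi_pos_nonneg: "0 \<le> x \<Longrightarrow> 0 < psi x"
proof (rule stay_positive[of 0 psi])
  show "continuous_on {0..} psi" by (rule continuous_on_subset[OF Y_cont]) simp
  show "0 < psi 0" by (simp add: Y_0)
  fix b assume b: "0 < b" and pos: "\<And>x. 0 \<le> x \<Longrightarrow> x < b \<Longrightarrow> 0 < psi x"
  show "0 < psi b"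
  proof (rule ccontr)
    assume "\<not> 0 < psi b"
    then have b0: "psi b = 0" using psi_nonneg[OF b] by simp
    then have "psi1 b \<noteq> 0" by (rule Y_no_double_zero)
    then consider "0 < psi1 b" | "psi1 b < 0" by linarith
    then show False
    proof cases
      case 1
      from DERIV_pos_inc_left[OF Y_d 1] obtain d where
        d: "0 < d" "\<forall>h>0. h < d \<longrightarrow> psi (b - h) < psi b" by blast
      then have "psi (b - min b d / 2) < 0" using b b0 by auto
      moreover have "0 < psi (b - min b d / 2)" using b d by (intro pos) auto
      ultimately show False by simp
    next
      case 2
      from DERIV_neg_dec_right[OF Y_d 2] obtain d where
        d: "0 < d" "\<forall>h>0. h < d \<longrightarrow> psi (b + h) < psi b" by blast
      then have "psi (b + d / 2) < 0" using b0 by auto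
      then show False using psi_nonneg[of "b + d / 2"] b d by simp
    qed
  qed
qed

lemma psi_pos: "0 < psi x"
  using psi_pos_nonneg[of "\<bar>x\<bar>"] Y_props(3)[of ms x] by (cases "0 \<le> x") (auto simp: abs_if)

lemma ms_less_1: "ms < 1"
proof -
  have "ms \<le> 1" using ms_lower[OF Y_one_zero] .
  moreover have "ms \<noteq> 1"
  proof
    assume "ms = 1"
    then obtain x where "psi x \<le> 0" using Y_one_zero by auto
    then show False using psi_pos[of x] by simp
  qed
  ultimately show ?thesis by simp
qed

text \<open>If \<open>x \<psi>' > (1 + ms) \<psi>\<close> at some large x, then by \<open>trap\<close> the solutions for \<mu> slightly above
  \<open>ms\<close> are positive beyond x, so that their zeros accumulate at a zero of \<open>\<psi>\<close>.\<close>

lemma psi_slope_upper: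
  assumes X: "1 \<le> X" "4 \<le> X\<^sup>2 * (1 - ms)"
  shows "X * psi1 X \<le> (1 + ms) * psi X"
proof (rule ccontr)
  assume "\<not> ?thesis"
  then have Z0: "0 < X * psi1 X - (1 + ms) * psi X" by simp
  obtain m :: "nat \<Rightarrow> real" where m: "m \<longlonglongrightarrow> ms" "\<And>j. \<exists>x>0. Y (m j) x \<le> 0" using ms_approx by blast
  have "(\<lambda>j. X * Y1 (m j) X - (1 + ms) * Y (m j) X) \<longlonglongrightarrow> X * psi1 X - (1 + ms) * psi X"
    by (intro tendsto_intros Y_tendsto m(1) tendsto_const)
  then have 1: "\<forall>\<^sub>F j in sequentially. 0 < X * Y1 (m j) X - (1 + ms) * Y (m j) X"
    using Z0 by (rule order_tendstoD(1))
  have "(\<lambda>j. Y (m j) X) \<longlonglongrightarrow> psi X" by (intro Y_tendsto m(1) tendsto_const)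
  then have 2: "\<forall>\<^sub>F j in sequentially. 0 < Y (m j) X" using psi_pos by (rule order_tendstoD(1))
  have 3: "\<forall>\<^sub>F j in sequentially. m j < ms + (1 - ms) / 4"
    using m(1) by (rule order_tendstoD(2)) (use ms_less_1 in simp)
  have "\<forall>\<^sub>F j in sequentially. \<exists>x. 0 \<le> x \<and> x \<le> X \<and> Y (m j) x \<le> 0"
    using 1 2 3
  proof eventually_elim
    case (elim j)
    obtain x where x: "0 < x" "Y (m j) x \<le> 0" using m(2) by blast
    have "0 \<le> m j" using ms_lower[OF m(2), of j] ms_ge_half by simp
    \<comment> \<open>The size condition of \<open>trap\<close> for \<open>c = 1 + ms\<close>: the
      left-hand side is at most 2, and \<open>c - 2 * \<mu>\<close> is at least
      \<open>(1 - ms) / 2\<close> as soon as \<open>\<mu> < ms + (1 - ms) / 4\<close>.\<close>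
    have "(1 + ms) * ((1 + ms) - 1) \<le> 2 * 1" using ms_less_1 ms_ge_half by (intro mult_mono) auto
    also have "\<dots> \<le> X\<^sup>2 * ((1 - ms) / 2)" using X(2) by simp
    also have "\<dots> \<le> X\<^sup>2 * ((1 + ms) - 2 * m j)" using elim(3) by (intro mult_left_mono) (auto simp: field_simps)
    finally have t: "(1 + ms) * ((1 + ms) - 1) \<le> X\<^sup>2 * ((1 + ms) - 2 * m j)" .
    have mj: "2 * m j < 1 + ms" using elim(3) ms_less_1 by (simp add: field_simps)
    have "\<not> X \<le> x"
    proof
      assume "X \<le> x"
      have "0 < Y (m j) x"
        by (rule trap[of "1 + ms" "m j" X x])
          (use t X elim(1,2) mj \<open>0 \<le> m j\<close> ms_less_1 ms_ge_half \<open>X \<le> x\<close> in auto)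
      then show False using x by simp
    qed
    then show ?case using x by (intro exI[of _ x]) auto
  qed
  then obtain n where "\<And>j. n \<le> j \<Longrightarrow> \<exists>x. 0 \<le> x \<and> x \<le> X \<and> Y (m j) x \<le> 0"
    unfolding eventually_sequentially by blast
  then have "\<forall>j. \<exists>x. 0 \<le> x \<and> x \<le> X \<and> Y (m (j + n)) x \<le> 0" by simp
  then obtain xs where xs: "\<And>j. 0 \<le> xs j" "\<And>j. xs j \<le> X" "\<And>j. Y (m (j + n)) (xs j) \<le> 0" by metis
  have "seq_compact {0..X}" using compact_Icc by (rule compact_imp_seq_compact)
  moreover have "\<forall>j. xs j \<in> {0..X}" using xs by simp
  ultimately obtain l r where lr: "l \<in> {0..X}" "strict_mono r" "(xs \<circ> r) \<longlonglongrightarrow> l"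
    by (rule seq_compactE)
  have "(\<lambda>j. m (r j + n)) \<longlonglongrightarrow> ms"
    using LIMSEQ_subseq_LIMSEQ[OF LIMSEQ_ignore_initial_segment[OF m(1), of n] lr(2)] by (simp add: o_def)
  then have "(\<lambda>j. Y (m (r j + n)) ((xs \<circ> r) j)) \<longlonglongrightarrow> psi l" by (rule Y_tendsto(1)[OF _ lr(3)])
  then have "psi l \<le> 0" by (rule LIMSEQ_le_const2) (use xs(3) in auto)
  then show False using psi_pos[of l] by simp
qed

text \<open>Bounds on the logarithmic slope \<open>z * y' / y\<close> integrate to power bounds;
  dividing by \<open>y\<close> is avoided through the monotonicity of
  \<open>y z * z powr (- c)\<close>.\<close>

lemma powr_slope:
  fixes y :: "real \<Rightarrow> real"
  assumes y: "\<And>x. DERIV y x :> y' x" and X: "0 < X" "X \<le> x"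
  shows "(\<And>z. X \<le> z \<Longrightarrow> z * y' z \<le> c * y z) \<Longrightarrow> y x \<le> y X * X powr (- c) * x powr c"
    and "(\<And>z. X \<le> z \<Longrightarrow> c * y z \<le> z * y' z) \<Longrightarrow> y X * X powr (- c) * x powr c \<le> y x"
proof -
  have d: "DERIV (\<lambda>z. s * (y z * z powr (- c))) z :> s * ((z * y' z - c * y z) * z powr (- c - 1))"
    if "0 < z" for z s
  proof -
    have "DERIV (\<lambda>z. s * (y z * z powr (- c))) z :> s * (y' z * z powr (- c) + - c * z powr (- c - 1) * y z)"
      by (rule DERIV_cmult[OF DERIV_mult[OF y has_real_derivative_powr[OF that]]])
    moreover have "z powr (- c) = z * z powr (- c - 1)" using that by (simp add: powr_mult_base)
    then have "y' z * z powr (- c) + - c * z powr (- c - 1) * y z = (z * y' z - c * y z) * z powr (- c - 1)"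
      by (simp add: algebra_simps)
    ultimately show ?thesis by simp
  qed
  have i: "x powr (- c) * x powr c = 1" using X by (simp add: powr_add[symmetric])
  show "y x \<le> y X * X powr (- c) * x powr c" if le: "\<And>z. X \<le> z \<Longrightarrow> z * y' z \<le> c * y z"
  proof -
    have "- 1 * (y X * X powr (- c)) \<le> - 1 * (y x * x powr (- c))"
    proof (rule nondecreasing_from_derivative[OF X(2) d[of _ "- 1"]])
      show "0 \<le> - 1 * ((z * y' z - c * y z) * z powr (- c - 1))" if "X < z" for z
        using mult_nonneg_nonneg[of "c * y z - z * y' z" "z powr (- c - 1)"] le[of z] that by (simp add: algebra_simps)
    qed (use X in auto)
    then have "(y x * x powr (- c)) * x powr c \<le> (y X * X powr (- c)) * x powr c" by (intro mult_right_mono) auto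
    moreover have "(y x * x powr (- c)) * x powr c = y x" by (simp only: mult.assoc i mult_1_right)
    ultimately show ?thesis by simp
  qed
  show "y X * X powr (- c) * x powr c \<le> y x" if le: "\<And>z. X \<le> z \<Longrightarrow> c * y z \<le> z * y' z"
  proof -
    have "1 * (y X * X powr (- c)) \<le> 1 * (y x * x powr (- c))"
    proof (rule nondecreasing_from_derivative[OF X(2) d[of _ 1]])
      show "0 \<le> 1 * ((z * y' z - c * y z) * z powr (- c - 1))" if "X < z" for z
        using mult_nonneg_nonneg[of "z * y' z - c * y z" "z powr (- c - 1)"] le[of z] that by simp
    qed (use X in auto)
    then have "(y X * X powr (- c)) * x powr c \<le> (y x * x powr (- c)) * x powr c" by (intro mult_right_mono) auto
    moreover have "(y x * x powr (- c)) * x powr c = y x" by (simp only: mult.assoc i mult_1_right)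
    ultimately show ?thesis by simp
  qed
qed

lemma psi_upper_powr: "\<exists>C>0. \<forall>\<^sub>F x in at_top. psi x \<le> C * x powr (1 + ms)"
proof -
  define X where "X = max 1 (4 / (1 - ms))"
  have X: "1 \<le> X" "4 / (1 - ms) \<le> X" by (auto simp: X_def)
  have large: "1 \<le> z" "4 \<le> z\<^sup>2 * (1 - ms)" if "X \<le> z" for z
  proof -
    show z: "1 \<le> z" using X that by simp
    have "4 / (1 - ms) \<le> z" using X that by simp
    also have "z \<le> z\<^sup>2" using z by (simp add: power2_eq_square)
    finally show "4 \<le> z\<^sup>2 * (1 - ms)" using ms_less_1 by (simp add: pos_divide_le_eq)
  qed
  have "\<forall>\<^sub>F x in at_top. psi x \<le> (psi X * X powr (- (1 + ms))) * x powr (1 + ms)"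
    using eventually_ge_at_top[of X]
  proof eventually_elim
    case (elim x)
    show ?case
      by (rule powr_slope(1)[OF Y_d _ elim psi_slope_upper]) (use less_le_trans[OF zero_less_one X(1)] large in auto)
  qed
  moreover have "0 < psi X * X powr (- (1 + ms))" using psi_pos[of X] X by simp
  ultimately show ?thesis by blast
qed

lemma psi_little_square: "0 < \<epsilon> \<Longrightarrow> \<forall>\<^sub>F x in at_top. psi x \<le> \<epsilon> * x\<^sup>2"
proof -
  assume e: "0 < \<epsilon>"
  obtain C where C: "0 < C" "\<forall>\<^sub>F x in at_top. psi x \<le> C * x powr (1 + ms)" using psi_upper_powr by blast
  have "((\<lambda>x. x powr (ms - 1)) \<longlongrightarrow> 0) at_top" by (rule tendsto_neg_powr) (use ms_less_1 in \<open>auto intro: filterlim_ident\<close>)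
  then have "\<forall>\<^sub>F x in at_top. x powr (ms - 1) < \<epsilon> / C" by (rule order_tendstoD(2)) (use e C in simp)
  then show ?thesis using C(2) eventually_gt_at_top[of 0]
  proof eventually_elim
    case (elim x)
    have "x powr (1 + ms) = x powr ((ms - 1) + 2)" by (simp add: add.commute)
    also have "\<dots> = x powr (ms - 1) * x powr 2" by (rule powr_add)
    also have "x powr 2 = x\<^sup>2" using elim by (simp add: powr_numeral)
    finally have "x powr (1 + ms) = x powr (ms - 1) * x\<^sup>2" .
    then have "C * x powr (1 + ms) = (C * x powr (ms - 1)) * x\<^sup>2" by simp
    also have "\<dots> \<le> \<epsilon> * x\<^sup>2" using elim(1) C(1) by (intro mult_right_mono) (auto simp: pos_less_divide_eq mult.commute)
    finally show ?case using elim(2) by simp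
  qed
qed

text \<open>At \<open>ms = 1 / 2\<close> the Wronskian with \<open>f\<close> would have the strictly
  positive derivative \<open>gw * psi * f * F\<close> and stay above its value at 1. The slope bound
  on \<open>psi\<close> and the quadratic bounds on \<open>psi\<close> and \<open>k\<close> keep it
  below \<open>12 * x^4 * gw x\<close>, which tends to 0.\<close>

lemma half_less_ms: "1 / 2 < ms"
proof (rule ccontr)
  assume "\<not> 1 / 2 < ms"
  then have half: "ms = 1 / 2" using ms_ge_half by simp
  define w' where "w' x = gw x * (psi x * f x * (F x + 1 - 2 * ms))" for x
  have w'_pos: "0 < w' x" for x
    unfolding w'_def using F_gt0[of x] ms_less_1 by (intro mult_pos_pos psi_pos f_pos) (simp_all add: half)
  have mono: "wr ms x < wr ms y" if "x < y" for x y
    by (rule DERIV_pos_imp_increasing[OF that]) (use wr_d[of ms] w'_pos in \<open>unfold w'_def, blast\<close>)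
  have w1: "0 < wr ms 1" using mono[of 0 1] by (simp add: wr_def Y_0)
  have "((\<lambda>x :: real. 12 * (x ^ 4 * gw x)) \<longlongrightarrow> 0) at_top" by real_asymp
  then have small: "\<forall>\<^sub>F x in at_top. 12 * (x ^ 4 * gw x) < wr ms 1" using w1 by (rule order_tendstoD(2))
  have "\<forall>\<^sub>F x in at_top. psi x \<le> 1 * x\<^sup>2" by (rule psi_little_square) simp
  then have "\<forall>\<^sub>F x :: real in at_top. False" using small eventually_ge_at_top[of "3 :: real"]
  proof eventually_elim
    case (elim x)
    have x: "0 < x" "1 \<le> x" using elim by auto
    have x9: "3 * 3 \<le> x\<^sup>2" unfolding power2_eq_square using elim by (intro mult_mono) auto
    have "x * psi1 x \<le> (1 + ms) * psi x" by (rule psi_slope_upper) (use x9 x in \<open>simp_all add: half\<close>)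
    also have "\<dots> \<le> x\<^sup>2 * psi x" using x9 half psi_pos[of x] by (intro mult_right_mono) auto
    finally have "x * psi1 x \<le> x * (x * psi x)" by (simp add: power2_eq_square)
    then have "psi1 x \<le> x * psi x" using x by simp
    then have "psi1 x * f x \<le> (x * psi x) * f x" using f_pos[of x] by (intro mult_right_mono) auto
    then have "psi1 x * f x - psi x * f1 x \<le> psi x * k x" by (simp add: f1_def algebra_simps)
    also have "\<dots> \<le> x\<^sup>2 * (12 * x\<^sup>2)" using elim k_le[of x] x psi_pos[of x] k_nonneg[of x] by (intro mult_mono) auto
    finally have "gw x * (psi1 x * f x - psi x * f1 x) \<le> gw x * (x\<^sup>2 * (12 * x\<^sup>2))"
      by (intro mult_left_mono) auto
    also have "\<dots> = 12 * (x ^ 4 * gw x)" by (simp add: power2_eq_square power4_eq_xxxx)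
    also have "\<dots> < wr ms 1" by (rule elim)
    finally have "wr ms x < wr ms 1" by (simp add: wr_def)
    moreover have "wr ms 1 < wr ms x" using elim by (intro mono) simp
    ultimately show False by simp
  qed
  then show False by simp
qed

lemma F_tendsto_0: "(F \<longlongrightarrow> 0) at_top"
proof (rule tendsto_sandwich)
  show "\<forall>\<^sub>F x in at_top. 0 \<le> F x" using less_imp_le[OF F_gt0] by (intro always_eventually allI)
  show "\<forall>\<^sub>F x in at_top. F x \<le> 2 * \<bar>x\<bar> * exp ((1 - x\<^sup>2) / 2)"
    using eventually_ge_at_top[of 1]
  proof eventually_elim
    case (elim x)
    then show ?case by (intro F_tail) simp
  qed
  show "((\<lambda>x :: real. 2 * \<bar>x\<bar> * exp ((1 - x\<^sup>2) / 2)) \<longlongrightarrow> 0) at_top" by real_asymp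
qed simp

text \<open>Where \<open>F < ms\<close> the product \<open>gw * psi1\<close> decreases. Once
  negative it stays below a negative constant, and so does \<open>psi1\<close> because
  \<open>gw \<le> 1\<close>; then \<open>psi\<close> could not remain positive.\<close>

lemma psi1_nonneg: "\<forall>\<^sub>F x in at_top. 0 \<le> psi1 x"
proof -
  have "\<forall>\<^sub>F x in at_top. F x < ms" by (rule order_tendstoD(2)[OF F_tendsto_0]) (use half_less_ms in simp)
  then obtain X where X: "\<And>x. X \<le> x \<Longrightarrow> F x < ms" unfolding eventually_at_top_linorder by blast
  have "0 \<le> psi1 x" if x: "X \<le> x" for x
  proof (rule ccontr)
    assume "\<not> 0 \<le> psi1 x"
    then have neg: "psi1 x < 0" by simp
    define E where "E z = - (gw z * psi1 z)" for z
    have Ed: "DERIV E z :> 2 * (ms - F z) * psi z * gw z" for z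
    proof -
      have "DERIV E z :> - (- z * gw z * psi1 z + (z * psi1 z + 2 * (F z - ms) * psi z) * gw z)"
        unfolding E_def[abs_def] by (rule DERIV_minus[OF DERIV_mult[OF exp_nsq_d Y1_d]])
      moreover have "- (- z * gw z * psi1 z + (z * psi1 z + 2 * (F z - ms) * psi z) * gw z)
        = 2 * (ms - F z) * psi z * gw z" by (simp add: algebra_simps)
      ultimately show ?thesis by simp
    qed
    define a where "a = E x"
    have a: "0 < a" unfolding a_def E_def using neg by (simp add: mult_pos_neg)
    have psi1: "psi1 z \<le> - a" if z: "x \<le> z" for z
    proof -
      have "E x \<le> E z"
      proof (rule nondecreasing_from_derivative[OF z Ed])
        show "0 \<le> 2 * (ms - F w) * psi w * gw w" if "x < w" "w < z" for w
          using X[of w] psi_pos[of w] that x by (intro mult_nonneg_nonneg) auto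
      qed
      then have "a \<le> gw z * (- psi1 z)" by (simp add: a_def E_def)
      moreover have "0 \<le> - psi1 z"
      proof (rule ccontr)
        assume "\<not> 0 \<le> - psi1 z"
        then have "gw z * (- psi1 z) \<le> 0" by (intro mult_nonneg_nonpos) auto
        then show False using \<open>a \<le> gw z * (- psi1 z)\<close> a by simp
      qed
      then have "gw z * (- psi1 z) \<le> 1 * (- psi1 z)" by (intro mult_right_mono) auto
      ultimately show ?thesis by simp
    qed
    \<comment> \<open>The point at which the line of slope \<open>- a\<close> through
      \<open>(x, psi x)\<close> reaches 0.\<close>
    define z where "z = x + psi x / a"
    have z: "x \<le> z" using psi_pos[of x] a by (simp add: z_def)
    have "- a * x - psi x \<le> - a * z - psi z"
    proof (rule nondecreasing_from_derivative[where h = "\<lambda>z. - a * z - psi z" and h' = "\<lambda>z. - a * 1 - psi1 z", OF z])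
      show "DERIV (\<lambda>z. - a * z - psi z) y :> - a * 1 - psi1 y" for y
        by (intro DERIV_diff DERIV_cmult DERIV_ident Y_d)
    qed (use psi1 in auto)
    moreover have "a * z = a * x + psi x" using a by (simp add: z_def distrib_left)
    ultimately have "psi z \<le> 0" by simp
    then show False using psi_pos[of z] by simp
  qed
  then show ?thesis unfolding eventually_at_top_linorder by blast
qed

text \<open>The exponent \<open>1 / 2 + ms\<close> lies strictly between 1, which makes the growth
  superlinear, and \<open>2 * ms\<close>, which makes \<open>gw * (c * psi - x * psi1)\<close>
  nondecreasing once \<open>F\<close> is small. A positive value would persist, while the quadratic
  bound on \<open>psi\<close> bounds the expression by a quantity tending to 0.\<close>

lemma psi_slope_lower: "\<forall>\<^sub>F x in at_top. (1 / 2 + ms) * psi x \<le> x * psi1 x"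
proof -
  define c where "c = 1 / 2 + ms"
  have c: "1 < c" "c < 2 * ms" "c \<le> 2" using half_less_ms ms_less_1 by (auto simp: c_def)
  have "\<forall>\<^sub>F x in at_top. F x < (2 * ms - c) / 2" by (rule order_tendstoD(2)[OF F_tendsto_0]) (use c in simp)
  then have "\<forall>\<^sub>F x in at_top. F x < (2 * ms - c) / 2 \<and> 0 \<le> psi1 x \<and> 1 \<le> x \<and> psi x \<le> 1 * x\<^sup>2"
    by (intro eventually_conj psi1_nonneg eventually_ge_at_top psi_little_square) auto
  then obtain X where X: "\<And>x. X \<le> x \<Longrightarrow> F x < (2 * ms - c) / 2 \<and> 0 \<le> psi1 x \<and> 1 \<le> x \<and> psi x \<le> 1 * x\<^sup>2"
    unfolding eventually_at_top_linorder by blast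
  define Z where "Z x = gw x * (c * psi x - x * psi1 x)" for x
  define Z' where "Z' x = gw x * ((c - 1) * psi1 x + (2 * ms - c - 2 * F x) * (x * psi x))" for x
  have dZ: "DERIV Z x :> Z' x" for x
  proof -
    have "DERIV Z x :> - x * gw x * (c * psi x - x * psi1 x)
       + (c * psi1 x - (1 * psi1 x + (x * psi1 x + 2 * (F x - ms) * psi x) * x)) * gw x"
      unfolding Z_def[abs_def]
      by (rule DERIV_mult[OF exp_nsq_d DERIV_diff[OF DERIV_cmult[OF Y_d] DERIV_mult[OF DERIV_ident Y1_d]]])
    moreover have "- x * gw x * (c * psi x - x * psi1 x)
       + (c * psi1 x - (1 * psi1 x + (x * psi1 x + 2 * (F x - ms) * psi x) * x)) * gw x = Z' x"
      by (simp add: Z'_def algebra_simps)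
    ultimately show ?thesis by simp
  qed
  have "c * psi x \<le> x * psi1 x" if x: "X \<le> x" for x
  proof (rule ccontr)
    assume "\<not> ?thesis"
    then have a: "0 < Z x" by (simp add: Z_def)
    have "Z x \<le> 2 * (y\<^sup>2 * gw y)" if y: "x \<le> y" for y
    proof -
      have "Z x \<le> Z y"
      proof (rule nondecreasing_from_derivative[OF y dZ])
        show "0 \<le> Z' w" if "x < w" "w < y" for w
          unfolding Z'_def using X[of w] that x c psi_pos[of w]
          by (intro mult_nonneg_nonneg add_nonneg_nonneg) auto
      qed
      also have "Z y \<le> gw y * (2 * y\<^sup>2)"
      proof -
        have "0 \<le> y * psi1 y" using X[of y] x y by auto
        moreover have "c * psi y \<le> 2 * y\<^sup>2" using c X[of y] x y psi_pos[of y] by (intro mult_mono) auto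
        ultimately show ?thesis unfolding Z_def by (intro mult_left_mono) auto
      qed
      finally show ?thesis by (simp add: mult_ac)
    qed
    then have "\<forall>\<^sub>F y in at_top. Z x \<le> 2 * (y\<^sup>2 * gw y)"
      unfolding eventually_at_top_linorder by blast
    moreover have "((\<lambda>y :: real. 2 * (y\<^sup>2 * gw y)) \<longlongrightarrow> 0) at_top" by real_asymp
    then have "\<forall>\<^sub>F y in at_top. 2 * (y\<^sup>2 * gw y) < Z x" using a by (rule order_tendstoD(2))
    ultimately have "\<forall>\<^sub>F y :: real in at_top. False" by eventually_elim simp
    then show False by simp
  qed
  then show ?thesis unfolding eventually_at_top_linorder c_def by blast
qed

lemma psi_superlinear: "\<forall>\<^sub>F x in at_top. M * x \<le> psi x"
proof -
  obtain X where X: "\<And>x. X \<le> x \<Longrightarrow> (1 / 2 + ms) * psi x \<le> x * psi1 x"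
    using psi_slope_lower unfolding eventually_at_top_linorder by blast
  define X' where "X' = max 1 X"
  define a where "a = psi X' * X' powr (- (1 / 2 + ms))"
  have a: "0 < a" unfolding a_def using psi_pos[of X'] by (auto simp: X'_def)
  have "filterlim (\<lambda>x :: real. x powr (ms - 1 / 2)) at_top at_top"
    using half_less_ms by (intro real_powr_at_top) simp
  then have "\<forall>\<^sub>F x in at_top. M / a \<le> x powr (ms - 1 / 2)" by (simp add: filterlim_at_top)
  then show ?thesis using eventually_ge_at_top[of X']
  proof eventually_elim
    case (elim x)
    have x: "0 < x" using elim by (simp add: X'_def)
    have "M * x \<le> (a * x powr (ms - 1 / 2)) * x"
      using elim(1) a x by (intro mult_right_mono) (auto simp: pos_divide_le_eq mult.commute)
    also have "\<dots> = a * x powr (1 / 2 + ms)"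
    proof -
      have "x powr (1 / 2 + ms) = x powr ((ms - 1 / 2) + 1)" by (simp add: add.commute)
      also have "\<dots> = x powr (ms - 1 / 2) * x powr 1" by (rule powr_add)
      finally show ?thesis using x by simp
    qed
    also have "\<dots> \<le> psi x" unfolding a_def
      by (rule powr_slope(2)[OF Y_d _ elim(2) X]) (auto simp: X'_def)
    finally show ?case .
  qed
qed

lemma even_extend:
  assumes "\<forall>\<^sub>F x in at_top. P (x :: real)"
  shows "\<exists>X\<ge>1. \<forall>x. X \<le> \<bar>x\<bar> \<longrightarrow> P \<bar>x\<bar>"
proof -
  obtain X where "\<And>x. X \<le> x \<Longrightarrow> P x" using assms unfolding eventually_at_top_linorder by blast
  then show ?thesis by (intro exI[of _ "max 1 X"]) auto
qed

lemma psi_abs: "psi \<bar>x\<bar> = psi x"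
  using Y_props(3)[of ms x] by (simp add: abs_if)

lemma psi_lower: "\<exists>m>0. \<forall>x. m \<le> psi x"
proof -
  obtain X where X: "1 \<le> X" "\<And>x. X \<le> \<bar>x\<bar> \<Longrightarrow> 1 * \<bar>x\<bar> \<le> psi \<bar>x\<bar>"
    using even_extend[OF psi_superlinear[of 1]] by blast
  obtain z where z: "\<And>x. x \<in> {-X..X} \<Longrightarrow> psi z \<le> psi x"
    using continuous_attains_inf[OF compact_Icc _ continuous_on_subset[OF Y_cont], of "-X" X ms] X(1) by fastforce
  show ?thesis
  proof (intro exI[of _ "min 1 (psi z)"] conjI allI)
    show "0 < min 1 (psi z)" using psi_pos by simp
    show "min 1 (psi z) \<le> psi x" for x
    proof (cases "X \<le> \<bar>x\<bar>")
      case True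
      then show ?thesis using X(1) X(2)[of x] by (simp add: psi_abs)
    next
      case False
      then have "- X \<le> x \<and> x \<le> X" by linarith
      then show ?thesis using z[of x] by (simp add: min_le_iff_disj)
    qed
  qed
qed

lemma psi_upper: "\<exists>C>0. \<forall>x. psi x \<le> C * (1 + x\<^sup>2)"
proof -
  obtain X where X: "1 \<le> X" "\<And>x. X \<le> \<bar>x\<bar> \<Longrightarrow> psi \<bar>x\<bar> \<le> 1 * \<bar>x\<bar>\<^sup>2"
    using even_extend[OF psi_little_square[of 1]] by auto
  obtain z where z: "\<And>x. x \<in> {-X..X} \<Longrightarrow> psi x \<le> psi z"
    using continuous_attains_sup[OF compact_Icc _ continuous_on_subset[OF Y_cont], of "-X" X ms] X(1) by fastforce
  show ?thesis
  proof (intro exI[of _ "1 + psi z"] conjI allI)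
    show "0 < 1 + psi z" using psi_pos[of z] by simp
    show "psi x \<le> (1 + psi z) * (1 + x\<^sup>2)" for x
    proof -
      have "psi x \<le> psi z + x\<^sup>2"
      proof (cases "X \<le> \<bar>x\<bar>")
        case True
        then show ?thesis using X(2)[of x] psi_pos[of z] by (simp add: psi_abs)
      next
        case False
        then have "- X \<le> x \<and> x \<le> X" by linarith
        then have "psi x \<le> psi z" using z[of x] by simp
        then show ?thesis using zero_le_power2[of x] by linarith
      qed
      also have "\<dots> \<le> (1 + psi z) * (1 + x\<^sup>2)"
        using psi_pos[of z] mult_nonneg_nonneg[of "psi z" "x\<^sup>2"] by (simp add: algebra_simps)
      finally show ?thesis .
    qed
  qed
qed

text \<open>For \<open>lam < ms\<close> the weighted Wronskian of \<open>h\<close> and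
  \<open>psi\<close> increases while \<open>h\<close> is positive, and eventually exceeds some
  \<open>a > 0\<close>. Since \<open>psi\<close> is at most quadratic, \<open>h / psi\<close> then
  grows at least like a multiple of \<open>exp (x^2 / 4)\<close>, the square of which the normal
  density just compensates.\<close>

lemma low_eigen_growth:
  assumes h: "\<And>x. DERIV h x :> h1 x"
    and h1: "\<And>x. DERIV h1 x :> x * h1 x + 2 * (F x - lam) * h x"
    and lam: "lam < ms" and x0: "0 < h x0" "0 \<le> h1 x0 * psi x0 - h x0 * psi1 x0"
  shows "\<exists>b>0. \<forall>\<^sub>F x in at_top. b \<le> (h x)\<^sup>2 * gw x"
proof -
  define w where "w x = gw x * (h1 x * psi x - h x * psi1 x)" for x
  define w' where "w' x = 2 * (ms - lam) * (gw x * (h x * psi x))" for x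
  have dw: "DERIV w x :> w' x" for x
  proof -
    have "DERIV w x :> - x * gw x * (h1 x * psi x - h x * psi1 x)
       + (((x * h1 x + 2 * (F x - lam) * h x) * psi x + psi1 x * h1 x)
         - (h1 x * psi1 x + (x * psi1 x + 2 * (F x - ms) * psi x) * h x)) * gw x"
      unfolding w_def[abs_def]
      by (rule DERIV_mult[OF exp_nsq_d DERIV_diff[OF DERIV_mult[OF h1 Y_d] DERIV_mult[OF h Y1_d]]])
    moreover have "- x * gw x * (h1 x * psi x - h x * psi1 x)
       + (((x * h1 x + 2 * (F x - lam) * h x) * psi x + psi1 x * h1 x)
         - (h1 x * psi1 x + (x * psi1 x + 2 * (F x - ms) * psi x) * h x)) * gw x = w' x"
      by (simp add: w'_def algebra_simps)
    ultimately show ?thesis by simp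
  qed
  define q where "q x = h x / psi x" for x
  define q' where "q' x = (h1 x * psi x - h x * psi1 x) / (psi x * psi x)" for x
  have dq: "DERIV q x :> q' x" for x
    unfolding q_def[abs_def] q'_def using psi_pos[of x] by (intro DERIV_divide h Y_d) simp
  have q'_eq: "q' x = w x * exp (x\<^sup>2 / 2) / (psi x)\<^sup>2" for x
  proof -
    have "w x * exp (x\<^sup>2 / 2) = (gw x * exp (x\<^sup>2 / 2)) * (h1 x * psi x - h x * psi1 x)"
      by (simp add: w_def mult_ac)
    then have "w x * exp (x\<^sup>2 / 2) = h1 x * psi x - h x * psi1 x" by (simp only: exp_sq_inverse mult_1)
    then show ?thesis by (simp add: q'_def power2_eq_square)
  qed
  have hp: "0 < h x" if "x0 \<le> x" for x
  proof (rule stay_positive[of x0 h])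
    show "continuous_on {x0..} h" using h by (meson DERIV_continuous_on has_field_derivative_at_within)
    show "0 < h x0" by (rule x0)
    fix b assume b: "x0 < b" and pos: "\<And>x. x0 \<le> x \<Longrightarrow> x < b \<Longrightarrow> 0 < h x"
    have w0: "0 \<le> w y" if y: "x0 \<le> y" "y \<le> b" for y
    proof -
      have "w x0 \<le> w y"
      proof (rule nondecreasing_from_derivative[OF y(1) dw])
        show "0 \<le> w' z" if "x0 < z" "z < y" for z
          unfolding w'_def using pos[of z] psi_pos[of z] that y lam by (intro mult_nonneg_nonneg) auto
      qed
      moreover have "0 \<le> w x0" unfolding w_def using x0 by (intro mult_nonneg_nonneg) auto
      ultimately show ?thesis by simp
    qed
    have "q x0 \<le> q b"
    proof (rule nondecreasing_from_derivative[OF _ dq])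
      show "0 \<le> q' z" if "x0 < z" "z < b" for z
        unfolding q'_eq using w0[of z] that by (intro divide_nonneg_nonneg mult_nonneg_nonneg) auto
    qed (use b in simp)
    moreover have "0 < q x0" unfolding q_def using x0 psi_pos by (intro divide_pos_pos)
    ultimately have "0 < h b / psi b" unfolding q_def by (rule less_le_trans[rotated])
    then show "0 < h b" using psi_pos[of b] by (simp add: zero_less_divide_iff)
  qed (rule that)
  have w'p: "0 < w' x" if "x0 \<le> x" for x
    unfolding w'_def using hp[OF that] psi_pos[of x] lam by (intro mult_pos_pos) auto
  define a where "a = w (x0 + 1)"
  have "w x0 < a" unfolding a_def
  proof (rule DERIV_pos_imp_increasing[where f = w])
    show "\<exists>y. DERIV w x :> y \<and> 0 < y" if "x0 \<le> x" for x
      using dw w'p[OF that] by blast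
  qed simp
  moreover have "0 \<le> w x0" unfolding w_def using x0 by (intro mult_nonneg_nonneg) auto
  ultimately have a: "0 < a" by simp
  have wa: "a \<le> w x" if "x0 + 1 \<le> x" for x
    unfolding a_def
  proof (rule nondecreasing_from_derivative[OF that dw])
    show "0 \<le> w' z" if "x0 + 1 < z" for z using w'p[of z] that by simp
  qed
  have "\<forall>\<^sub>F x :: real in at_top. x ^ 5 \<le> exp (x\<^sup>2 / 4)" by real_asymp
  moreover have "\<forall>\<^sub>F x in at_top. psi x \<le> 1 * x\<^sup>2" by (rule psi_little_square) simp
  ultimately have "\<forall>\<^sub>F x in at_top. x ^ 5 \<le> exp (x\<^sup>2 / 4) \<and> psi x \<le> 1 * x\<^sup>2 \<and> max 1 (x0 + 1) \<le> x"
    by (intro eventually_conj eventually_ge_at_top)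
  then obtain X where X: "\<And>x. X \<le> x \<Longrightarrow> x ^ 5 \<le> exp (x\<^sup>2 / 4) \<and> psi x \<le> 1 * x\<^sup>2 \<and> max 1 (x0 + 1) \<le> x"
    unfolding eventually_at_top_linorder by blast
  define r where "r x = q x - 2 * a * exp (x\<^sup>2 / 4)" for x
  have dr: "DERIV r x :> q' x - 2 * a * (x / 2 * exp (x\<^sup>2 / 4))" for x
  proof -
    have "DERIV (\<lambda>x. exp (x\<^sup>2 / 4)) x :> x / 2 * exp (x\<^sup>2 / 4)"
      by (auto intro!: derivative_eq_intros)
    then show ?thesis unfolding r_def[abs_def] by (intro DERIV_diff dq DERIV_cmult)
  qed
  have rX: "r X \<le> r x" if x: "X \<le> x" for x
  proof (rule nondecreasing_from_derivative[OF x dr])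
    fix z assume z: "X < z" "z < x"
    then have z': "z ^ 5 \<le> exp (z\<^sup>2 / 4)" "psi z \<le> z\<^sup>2" "1 \<le> z" "x0 + 1 \<le> z" using X[of z] by auto
    have "(psi z)\<^sup>2 \<le> (z\<^sup>2)\<^sup>2" using z' psi_pos[of z] by (intro power_mono) auto
    \<comment> \<open>Here the fifth power in the choice of \<open>X\<close> originates: one factor
      \<open>exp (z^2 / 4)\<close> is spent on it and the other is kept.\<close>
    then have "z * (psi z)\<^sup>2 \<le> z * (z\<^sup>2)\<^sup>2" using z' by (intro mult_left_mono) auto
    also have "\<dots> = z ^ 5" by (simp add: power_mult[symmetric] power_Suc[symmetric] del: power_Suc)
    also note z'(1)
    finally have "(a * exp (z\<^sup>2 / 4)) * (z * (psi z)\<^sup>2) \<le> (a * exp (z\<^sup>2 / 4)) * exp (z\<^sup>2 / 4)"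
      using a by (intro mult_left_mono) auto
    also have "\<dots> = a * exp (z\<^sup>2 / 2)" by (simp add: exp_add[symmetric] mult.assoc)
    also have "\<dots> \<le> w z * exp (z\<^sup>2 / 2)" using wa[OF z'(4)] by (intro mult_right_mono) auto
    finally have "(a * exp (z\<^sup>2 / 4) * z) * (psi z)\<^sup>2 \<le> w z * exp (z\<^sup>2 / 2)" by (simp add: mult_ac)
    then have "a * exp (z\<^sup>2 / 4) * z \<le> q' z"
      unfolding q'_eq using psi_pos[of z] by (simp add: pos_le_divide_eq)
    then show "0 \<le> q' z - 2 * a * (z / 2 * exp (z\<^sup>2 / 4))" by (simp add: mult_ac)
  qed
  have "filterlim (\<lambda>x :: real. exp (x\<^sup>2 / 4)) at_top at_top" by real_asymp
  then have "\<forall>\<^sub>F x in at_top. - r X / a \<le> exp (x\<^sup>2 / 4)" by (simp add: filterlim_at_top)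
  moreover have "\<forall>\<^sub>F x in at_top. 1 * x \<le> psi x" by (rule psi_superlinear)
  ultimately have "\<forall>\<^sub>F x in at_top. a\<^sup>2 \<le> (h x)\<^sup>2 * gw x"
    using eventually_ge_at_top[of "max 1 X"]
  proof eventually_elim
    case (elim x)
    have "- r X \<le> a * exp (x\<^sup>2 / 4)" using mult_left_mono[OF elim(1), of a] a by simp
    moreover have "r X \<le> r x" using elim by (intro rX) simp
    ultimately have "a * exp (x\<^sup>2 / 4) \<le> q x" by (simp add: r_def)
    also have "q x * 1 \<le> q x * psi x"
      using elim X[of x] hp[of x] psi_pos[of x] by (intro mult_left_mono) (auto simp: q_def)
    then have "q x \<le> h x" using psi_pos[of x] by (simp add: q_def)
    finally have "(a * exp (x\<^sup>2 / 4))\<^sup>2 \<le> (h x)\<^sup>2" using a by (intro power_mono) auto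
    then have "(a * exp (x\<^sup>2 / 4))\<^sup>2 * gw x \<le> (h x)\<^sup>2 * gw x"
      by (rule mult_right_mono) simp
    moreover have "(a * exp (x\<^sup>2 / 4))\<^sup>2 * gw x = a\<^sup>2 * (exp (x\<^sup>2 / 4) * exp (x\<^sup>2 / 4) * gw x)"
      by (simp add: power2_eq_square)
    moreover have "exp (x\<^sup>2 / 4) * exp (x\<^sup>2 / 4) * gw x = 1" by (simp add: exp_add[symmetric])
    ultimately show ?case by (simp only: mult_1_right)
  qed
  then show ?thesis using a by (intro exI[of _ "a\<^sup>2"]) simp
qed

lemma not_integrable_bounded_below:
  assumes b: "0 < b" "\<forall>\<^sub>F x in at_top. b \<le> g x" and g: "\<And>x. 0 \<le> g x"
  shows "\<not> integrable lborel (g :: real \<Rightarrow> real)"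
proof
  assume i: "integrable lborel g"
  obtain X where X: "\<And>x. X \<le> x \<Longrightarrow> b \<le> g x" using b(2) unfolding eventually_at_top_linorder by blast
  \<comment> \<open>Chosen so that \<open>b * T\<close> exceeds the integral by
    \<open>b\<close>.\<close>
  define T where "T = 1 + integral\<^sup>L lborel g / b"
  have T: "0 \<le> T" using Bochner_Integration.integral_nonneg[of lborel g] g b(1) by (simp add: T_def)
  have "b * T = (\<integral>x. b * indicat_real {X..X + T} x \<partial>lborel)" using T by simp
  also have "\<dots> \<le> integral\<^sup>L lborel g"
  proof (rule Bochner_Integration.integral_mono[OF _ i])
    show "integrable lborel (\<lambda>x. b * indicat_real {X..X + T} x)"
      by (intro integrable_mult_right integrable_real_indicator) (auto simp: emeasure_lborel_Icc_eq)
    show "b * indicat_real {X..X + T} x \<le> g x" for x using X[of x] g[of x] by (auto simp: indicator_def)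
  qed
  finally have "b * T \<le> integral\<^sup>L lborel g" .
  moreover have "b * T = b + integral\<^sup>L lborel g" using b(1) by (simp add: T_def distrib_left)
  ultimately show False using b(1) by simp
qed

lemma psi1_odd: "psi1 (- x) = - psi1 x"
proof -
  have "DERIV (\<lambda>x. psi (- x)) x :> psi1 (- x) * - 1"
    by (rule DERIV_chain2[OF Y_d]) (auto intro!: derivative_eq_intros)
  moreover have "(\<lambda>x. psi (- x)) = psi" using Y_props(3) by blast
  ultimately have "DERIV psi x :> psi1 (- x) * - 1" by simp
  from DERIV_unique[OF this Y_d] show ?thesis by simp
qed

lemma psi_LF_eigen: "LF_eigen F ms psi"
  unfolding LF_eigen_def
proof (intro conjI allI)
  have d1: "deriv psi = psi1" using DERIV_imp_deriv[OF Y_d] by blast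
  have d2: "deriv psi1 = (\<lambda>x. x * psi1 x + 2 * (F x - ms) * psi x)" using DERIV_imp_deriv[OF Y1_d] by blast
  show "psi differentiable (at x)" for x unfolding real_differentiable_def using Y_d by blast
  show "deriv psi differentiable (at x)" for x unfolding d1 unfolding real_differentiable_def using Y1_d by blast
  show "continuous_on UNIV (deriv (deriv psi))" unfolding d1 d2
    by (intro continuous_intros F_cont Y_cont Y1_cont')
  show "\<exists>x. psi x \<noteq> 0" using psi_pos[of 0] by (intro exI[of _ 0]) simp
  show "deriv (deriv psi) x / 2 - x / 2 * deriv psi x - F x * psi x = - ms * psi x" for x
    unfolding d1 d2 by (simp add: field_simps)
  obtain C where C: "0 < C" "\<And>x. psi x \<le> C * (1 + x\<^sup>2)" using psi_upper by blast
  show "integrable lborel (\<lambda>x. (psi x)\<^sup>2 * std_normal_density x)"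
  proof (rule Bochner_Integration.integrable_bound)
    show "integrable lborel (\<lambda>x. C\<^sup>2 * (std_normal_density x * x ^ 0 + (2 * (std_normal_density x * x ^ 2) + std_normal_density x * x ^ 4)))"
      by (intro integrable_mult_right Bochner_Integration.integrable_add integrable_std_normal_moment)
    have "psi \<in> borel_measurable borel" using Y_cont by (rule borel_measurable_continuous_onI)
    then show "(\<lambda>x. (psi x)\<^sup>2 * std_normal_density x) \<in> borel_measurable lborel" by measurable
    show "AE x in lborel. norm ((psi x)\<^sup>2 * std_normal_density x)
      \<le> norm (C\<^sup>2 * (std_normal_density x * x ^ 0 + (2 * (std_normal_density x * x ^ 2) + std_normal_density x * x ^ 4)))"
    proof (intro AE_I2)
      fix x
      have "(psi x)\<^sup>2 \<le> (C * (1 + x\<^sup>2))\<^sup>2" using C(2)[of x] psi_pos[of x] by (intro power_mono) auto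
      then have "(psi x)\<^sup>2 * std_normal_density x \<le> (C * (1 + x\<^sup>2))\<^sup>2 * std_normal_density x"
        by (intro mult_right_mono) auto
      also have "\<dots> = C\<^sup>2 * (std_normal_density x * x ^ 0 + (2 * (std_normal_density x * x ^ 2) + std_normal_density x * x ^ 4))"
        by (simp add: power2_eq_square power4_eq_xxxx algebra_simps)
      finally show "norm ((psi x)\<^sup>2 * std_normal_density x)
        \<le> norm (C\<^sup>2 * (std_normal_density x * x ^ 0 + (2 * (std_normal_density x * x ^ 2) + std_normal_density x * x ^ 4)))"
        by (simp add: abs_mult)
    qed
  qed
qed

text \<open>An eigenfunction comes with neither sign nor parity. The sign \<open>s\<close> makes it
  positive at a point, and the reflection \<open>\<tau>\<close> makes the Wronskian nonnegative
  there, as reflecting flips the Wronskian with the even function \<open>psi\<close>. The resulting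
  growth contradicts square integrability.\<close>

lemma LF_eigen_ge:
  assumes e: "LF_eigen F lam h"
  shows "ms \<le> lam"
proof (rule ccontr)
  assume "\<not> ms \<le> lam"
  then have lam: "lam < ms" by simp
  define h1 where "h1 = deriv h"
  have dh: "DERIV h x :> h1 x" for x
    using e unfolding LF_eigen_def h1_def by (simp add: DERIV_deriv_iff_real_differentiable)
  have dh1: "DERIV h1 x :> x * h1 x + 2 * (F x - lam) * h x" for x
  proof -
    have "DERIV h1 x :> deriv h1 x"
      using e unfolding LF_eigen_def h1_def by (simp add: DERIV_deriv_iff_real_differentiable)
    moreover have "deriv h1 x / 2 - x / 2 * h1 x - F x * h x = - lam * h x"
      using e unfolding LF_eigen_def h1_def by blast
    then have "deriv h1 x = x * h1 x + 2 * (F x - lam) * h x" by (simp add: field_simps)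
    ultimately show ?thesis by simp
  qed
  have int: "integrable lborel (\<lambda>x. (h x)\<^sup>2 * std_normal_density x)" using e by (simp add: LF_eigen_def)
  obtain x0 where x0: "h x0 \<noteq> 0" using e by (auto simp: LF_eigen_def)
  define s where "s = sgn (h x0)"
  have s: "s * s = 1" "0 < s * h x0" using x0 by (auto simp: s_def sgn_mult_abs sgn_real_def)
  define \<tau> :: real where "\<tau> = (if 0 \<le> s * (h1 x0 * psi x0 - h x0 * psi1 x0) then 1 else - 1)"
  have \<tau>: "\<tau> * \<tau> = 1" "\<tau> = 1 \<or> \<tau> = - 1" by (auto simp: \<tau>_def)
  define H where "H x = s * h (\<tau> * x)" for x
  define H1 where "H1 x = s * (h1 (\<tau> * x) * \<tau>)" for x
  have m: "DERIV (\<lambda>x. \<tau> * x) x :> \<tau>" for x by (auto intro!: derivative_eq_intros)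
  have dH: "DERIV H x :> H1 x" for x
    unfolding H_def[abs_def] H1_def by (intro DERIV_cmult DERIV_chain2[OF dh m])
  have dH1: "DERIV H1 x :> x * H1 x + 2 * (F x - lam) * H x" for x
  proof -
    have "DERIV H1 x :> s * ((\<tau> * x * h1 (\<tau> * x) + 2 * (F (\<tau> * x) - lam) * h (\<tau> * x)) * \<tau> * \<tau>)"
      unfolding H1_def[abs_def] by (intro DERIV_cmult DERIV_cmult_right DERIV_chain2[OF dh1 m])
    moreover have "F (\<tau> * x) = F x" using \<tau>(2) F_evn[of x] by auto
    moreover have "s * ((\<tau> * x * h1 (\<tau> * x) + 2 * (F x - lam) * h (\<tau> * x)) * \<tau> * \<tau>)
      = (\<tau> * \<tau>) * (x * (s * (h1 (\<tau> * x) * \<tau>)) + 2 * (F x - lam) * (s * h (\<tau> * x)))"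
      by (simp add: algebra_simps)
    ultimately show ?thesis by (simp add: \<tau>(1) H_def H1_def)
  qed
  have "0 < H (\<tau> * x0)" using s(2) \<tau>(1) by (simp add: H_def mult.assoc[symmetric])
  moreover have "0 \<le> H1 (\<tau> * x0) * psi (\<tau> * x0) - H (\<tau> * x0) * psi1 (\<tau> * x0)"
  proof (cases "0 \<le> s * (h1 x0 * psi x0 - h x0 * psi1 x0)")
    case True
    then have "\<tau> = 1" by (simp add: \<tau>_def)
    then show ?thesis using True by (simp add: H_def H1_def algebra_simps)
  next
    case False
    then have "\<tau> = - 1" by (simp add: \<tau>_def)
    then show ?thesis using False by (simp add: H_def H1_def algebra_simps Y_props(3) psi1_odd)
  qed
  ultimately obtain b where b: "0 < b" "\<forall>\<^sub>F x in at_top. b \<le> (H x)\<^sup>2 * gw x"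
    using low_eigen_growth[OF dH dH1 lam] by blast
  have HH: "(h (\<tau> * x))\<^sup>2 * std_normal_density (\<tau> * x) = 1 / sqrt (2 * pi) * ((H x)\<^sup>2 * gw x)" for x
  proof -
    have "(\<tau> * x)\<^sup>2 = x\<^sup>2" using \<tau>(2) by auto
    moreover have "(H x)\<^sup>2 = (s * s) * (h (\<tau> * x))\<^sup>2" by (simp add: H_def power2_eq_square)
    ultimately show ?thesis by (simp add: s(1) std_normal_density_def)
  qed
  have "integrable lborel (\<lambda>x. (h (0 + \<tau> * x))\<^sup>2 * std_normal_density (0 + \<tau> * x))"
    by (rule lborel_integrable_real_affine[OF int]) (use \<tau>(2) in auto)
  then have "integrable lborel (\<lambda>x. 1 / sqrt (2 * pi) * ((H x)\<^sup>2 * gw x))"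
    by (simp only: add_0 HH)
  moreover have "\<not> integrable lborel (\<lambda>x. 1 / sqrt (2 * pi) * ((H x)\<^sup>2 * gw x))"
  proof (rule not_integrable_bounded_below)
    show "0 < 1 / sqrt (2 * pi) * b" using b(1) by simp
    show "\<forall>\<^sub>F x in at_top. 1 / sqrt (2 * pi) * b \<le> 1 / sqrt (2 * pi) * ((H x)\<^sup>2 * gw x)"
      using b(2)
    proof eventually_elim
      case (elim x)
      then show ?case by (rule mult_left_mono) simp
    qed
  qed simp
  ultimately show False by simp
qed

lemma lambda0_eq: "lambda0 F = ms"
  unfolding lambda0_def
proof (rule cInf_eq_minimum)
  show "ms \<in> {lam. \<exists>h. LF_eigen F lam h}" using psi_LF_eigen by blast
  show "\<And>lam. lam \<in> {lam. \<exists>h. LF_eigen F lam h} \<Longrightarrow> ms \<le> lam" using LF_eigen_ge by blast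
qed

end

section \<open>The gap between F and the Laplace exponents\<close>

text \<open>Uniformity from convergence along moving points: infinitely many failures would yield
  bad points with a convergent subsequence, along which the limit is positive by assumption.\<close>

lemma eventually_positive_on_interval:
  fixes D :: "nat \<Rightarrow> real \<Rightarrow> real"
  assumes lim: "\<And>r x l. strict_mono r \<Longrightarrow> x \<longlonglongrightarrow> l \<Longrightarrow> \<exists>c>0. (\<lambda>k. D (r k) (x k)) \<longlonglongrightarrow> c"
  shows "\<forall>\<^sub>F k in sequentially. \<forall>x\<in>{-R..R}. 0 < D k x"
proof (rule ccontr)
  assume "\<not> ?thesis"
  then have "infinite {k. \<not> (\<forall>x\<in>{-R..R}. 0 < D k x)}"
    unfolding cofinite_eq_sequentially[symmetric] eventually_cofinite by simp
  then obtain s :: "nat \<Rightarrow> nat" where s: "strict_mono s" "\<And>k. s k \<in> {k. \<not> (\<forall>x\<in>{-R..R}. 0 < D k x)}"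
    using infinite_enumerate by blast
  have "\<forall>k. \<exists>x. x \<in> {-R..R} \<and> D (s k) x \<le> 0"
  proof
    fix k
    show "\<exists>x. x \<in> {-R..R} \<and> D (s k) x \<le> 0" using s(2)[of k] by (auto simp: not_less)
  qed
  from choice[OF this] obtain x where x: "\<forall>k. x k \<in> {-R..R} \<and> D (s k) (x k) \<le> 0" by blast
  have "seq_compact {-R..R}" using compact_Icc by (rule compact_imp_seq_compact)
  moreover have "\<forall>k. x k \<in> {-R..R}" using x by blast
  ultimately obtain l r where lr: "l \<in> {-R..R}" "strict_mono r" "(x \<circ> r) \<longlonglongrightarrow> l"
    by (rule seq_compactE)
  obtain c where c: "0 < c" "(\<lambda>k. D ((s \<circ> r) k) ((x \<circ> r) k)) \<longlonglongrightarrow> c"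
    using lim[OF strict_mono_o[OF s(1) lr(2)] lr(3)] by blast
  have "c \<le> 0" by (rule LIMSEQ_le_const2[OF c(2)]) (use x in auto)
  then show False using c(1) by simp
qed

text \<open>\<open>R\<close> is the defect of the profile: the self-similar function satisfies the
  heat equation up to the source \<open>- R\<close>, taken with rate
  \<open>\<alpha> + 1\<close>.\<close>

lemma selfsim_heat:
  assumes t: "0 < t" and d: "\<And>z. DERIV \<Psi> z :> \<Psi>1 z" "\<And>z. DERIV \<Psi>1 z :> \<Psi>2 z"
    and R: "\<And>z. \<Psi>2 z / 2 + z * \<Psi>1 z / 2 + \<alpha> * \<Psi> z = R z"
  shows "((\<lambda>t. selfsim \<alpha> \<Psi> t x) has_real_derivative
      selfsim (\<alpha> + 1) \<Psi>2 t x / 2 - selfsim (\<alpha> + 1) R t x) (at t)"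
    and "DERIV (selfsim \<alpha> \<Psi> t) x :> selfsim (\<alpha> + 1 / 2) \<Psi>1 t x"
    and "DERIV (selfsim (\<alpha> + 1 / 2) \<Psi>1 t) x :> selfsim (\<alpha> + 1) \<Psi>2 t x"
proof -
  show "DERIV (selfsim \<alpha> \<Psi> t) x :> selfsim (\<alpha> + 1 / 2) \<Psi>1 t x"
    by (rule selfsim_dx[where \<Psi> = \<Psi> and ?\<Psi>1.0 = \<Psi>1, OF t d(1)])
  have "DERIV (selfsim (\<alpha> + 1 / 2) \<Psi>1 t) x :> selfsim (\<alpha> + 1 / 2 + 1 / 2) \<Psi>2 t x"
    by (rule selfsim_dx[where \<Psi> = \<Psi>1 and ?\<Psi>1.0 = \<Psi>2, OF t d(2)])
  moreover have "\<alpha> + 1 / 2 + 1 / 2 = \<alpha> + 1" by simp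
  ultimately show "DERIV (selfsim (\<alpha> + 1 / 2) \<Psi>1 t) x :> selfsim (\<alpha> + 1) \<Psi>2 t x" by (simp only:)
  have "((\<lambda>t. selfsim \<alpha> \<Psi> t x) has_real_derivative
     - selfsim (\<alpha> + 1) (\<lambda>z. \<alpha> * \<Psi> z + z * \<Psi>1 z / 2) t x) (at t)"
    by (rule selfsim_dt[where \<Psi> = \<Psi> and ?\<Psi>1.0 = \<Psi>1, OF t d(1)])
  moreover have "- selfsim (\<alpha> + 1) (\<lambda>z. \<alpha> * \<Psi> z + z * \<Psi>1 z / 2) t x = selfsim (\<alpha> + 1) \<Psi>2 t x / 2 - selfsim (\<alpha> + 1) R t x"
    by (simp add: selfsim_def R[symmetric] algebra_simps)
  ultimately show "((\<lambda>t. selfsim \<alpha> \<Psi> t x) has_real_derivative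
      selfsim (\<alpha> + 1) \<Psi>2 t x / 2 - selfsim (\<alpha> + 1) R t x) (at t)" by simp
qed

lemma selfsim_mult: "0 < t \<Longrightarrow> selfsim (\<alpha> + \<beta>) (\<lambda>z. f z * g z) t x = selfsim \<alpha> f t x * selfsim \<beta> g t x"
  using powr_add[of t "- \<alpha>" "- \<beta>"] by (simp add: selfsim_def mult_ac)

context sbm_laws
begin

sublocale gs: profile F F1
proof
  show "F z \<le> 2 * \<bar>z\<bar> * exp ((1 - z\<^sup>2) / 2)" if "1 \<le> \<bar>z\<bar>" for z
  proof (cases "\<bar>z\<bar> = 1")
    case True
    then have "z\<^sup>2 = 1" using power2_abs[of z] by simp
    then show ?thesis using F_bounds(2)[of z] True by simp
  next
    case False
    then show ?thesis using F_le_gauss_barrier[of z] that by (simp add: gauss_barrier_def)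
  qed
qed (use F_ode F1_0 F_even F_pos F_bounds in auto)

abbreviation "ms \<equiv> gs.ms"
abbreviation "psi \<equiv> gs.Y gs.ms"
abbreviation "psi1 \<equiv> gs.Y1 gs.ms"
definition "\<beta> = ms - 1 / 2"

lemma \<beta>: "0 < \<beta>" "\<beta> < 1 / 2"
  using gs.half_less_ms gs.ms_less_1 by (simp_all add: \<beta>_def)

text \<open>The Gaussian factor passes from the Ornstein-Uhlenbeck operator to its formal adjoint
  with respect to Lebesgue measure, which is the operator arising in self-similar variables.\<close>

definition "Psi z = gw z * psi z"
definition "Psi1 z = gw z * (psi1 z - z * psi z)"
definition "Psi2 z = gw z * ((2 * F z - 2 * ms - 1 + z\<^sup>2) * psi z - z * psi1 z)"

section \<open>Self-similar solutions of the nonlinear and the linearised equation\<close>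

lemma Psi_d: "DERIV Psi z :> Psi1 z"
proof -
  have "DERIV Psi z :> - z * gw z * psi z + psi1 z * gw z"
    unfolding Psi_def[abs_def] by (rule DERIV_mult[OF gs.exp_nsq_d gs.Y_d])
  moreover have "- z * gw z * psi z + psi1 z * gw z = Psi1 z"
    by (simp add: Psi1_def algebra_simps)
  ultimately show ?thesis by simp
qed

lemma Psi1_d: "DERIV Psi1 z :> Psi2 z"
proof -
  have "DERIV Psi1 z :> - z * gw z * (psi1 z - z * psi z)
     + ((z * psi1 z + 2 * (F z - ms) * psi z) - (1 * psi z + psi1 z * z)) * gw z"
    unfolding Psi1_def[abs_def]
    by (rule DERIV_mult[OF gs.exp_nsq_d DERIV_diff[OF gs.Y1_d DERIV_mult[OF DERIV_ident gs.Y_d]]])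
  moreover have "- z * gw z * (psi1 z - z * psi z)
     + ((z * psi1 z + 2 * (F z - ms) * psi z) - (1 * psi z + psi1 z * z)) * gw z = Psi2 z"
    by (simp add: Psi2_def algebra_simps power2_eq_square)
  ultimately show ?thesis by simp
qed

lemma Psi_eq: "Psi2 z / 2 + z * Psi1 z / 2 + (1 + \<beta>) * Psi z = F z * Psi z"
  by (simp add: Psi2_def Psi1_def Psi_def \<beta>_def power2_eq_square field_simps)

lemma Psi_pos: "0 < Psi z"
  unfolding Psi_def using gs.psi_pos by simp

lemma Psi_cont: "continuous_on UNIV Psi"
  using Psi_d by (meson DERIV_continuous_on has_field_derivative_at_within)

lemma Psi_bounded: "\<exists>B>0. \<forall>z. Psi z \<le> B"
proof -
  obtain C where C: "0 < C" "\<And>x. psi x \<le> C * (1 + x\<^sup>2)" using gs.psi_upper by blast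
  have "Psi z \<le> 2 * C" for z
  proof -
    have "1 + z\<^sup>2 / 2 \<le> exp (z\<^sup>2 / 2)" by (rule exp_ge_add_one_self)
    then have "C * (1 + z\<^sup>2) \<le> C * (2 * exp (z\<^sup>2 / 2))" using C(1) by (intro mult_left_mono) (linarith, simp)
    then have "gw z * psi z \<le> gw z * (C * (2 * exp (z\<^sup>2 / 2)))"
      using C(2)[of z] by (intro mult_left_mono) auto
    also have "\<dots> = 2 * C * (gw z * exp (z\<^sup>2 / 2))" by simp
    also have "\<dots> = 2 * C" by (simp only: gs.exp_sq_inverse mult_1_right)
    finally show ?thesis by (simp add: Psi_def)
  qed
  then show ?thesis using C(1) by (intro exI[of _ "2 * C"]) simp
qed

lemma F_le_Psi_outside: "0 < \<epsilon> \<Longrightarrow> \<exists>R\<ge>1. \<forall>z. R \<le> \<bar>z\<bar> \<longrightarrow> F z \<le> \<epsilon> * Psi z"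
proof -
  assume e: "0 < \<epsilon>"
  obtain R where R: "1 \<le> R" "\<And>z. R \<le> \<bar>z\<bar> \<Longrightarrow> 4 / \<epsilon> * \<bar>z\<bar> \<le> psi \<bar>z\<bar>"
    using gs.even_extend[OF gs.psi_superlinear[of "4 / \<epsilon>"]] by blast
  have "F z \<le> \<epsilon> * Psi z" if z: "R \<le> \<bar>z\<bar>" for z
  proof -
    have "gs.f z \<le> 4 * \<bar>z\<bar>" using gs.f_le[of z] z R(1) by (simp add: max_absorb2)
    also have "\<dots> = \<epsilon> * (4 / \<epsilon> * \<bar>z\<bar>)" using e by simp
    also have "\<dots> \<le> \<epsilon> * psi z" using R(2)[OF z] e by (intro mult_left_mono) (simp_all only: gs.psi_abs)
    finally have le: "gw z * gs.f z \<le> gw z * (\<epsilon> * psi z)" by (rule mult_left_mono) simp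
    have "gw z * gs.f z = F z * (gw z * exp (z\<^sup>2 / 2))" by (simp add: gs.f_def)
    then have "gw z * gs.f z = F z" by (simp only: gs.exp_sq_inverse mult_1_right)
    then have "F z \<le> gw z * (\<epsilon> * psi z)" using le by (simp only:)
    then show ?thesis by (simp add: Psi_def mult_ac)
  qed
  then show ?thesis using R(1) by blast
qed

lemma Vi_d:
  assumes "0 < t"
  shows "((\<lambda>t. selfsim 1 F t x) has_real_derivative
      selfsim 2 (\<lambda>z. (F z)\<^sup>2 - 2 * F z - z * F1 z) t x / 2 - (selfsim 1 F t x)\<^sup>2 / 2) (at t)"
    and "DERIV (selfsim 1 F t) x :> selfsim (3 / 2) F1 t x"
    and "DERIV (selfsim (3 / 2) F1 t) x :> selfsim 2 (\<lambda>z. (F z)\<^sup>2 - 2 * F z - z * F1 z) t x"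
proof -
  have R: "((F z)\<^sup>2 - 2 * F z - z * F1 z) / 2 + z * F1 z / 2 + 1 * F z = F z * (F z / 2)" for z
    by (simp add: field_simps power2_eq_square)
  note h = selfsim_heat[where \<Psi> = F and ?\<Psi>1.0 = F1 and ?\<Psi>2.0 = "\<lambda>z. (F z)\<^sup>2 - 2 * F z - z * F1 z"
    and R = "\<lambda>z. F z * (F z / 2)" and \<alpha> = 1, OF assms F_ode R]
  have "selfsim (1 + 1) (\<lambda>z. F z * (F z / 2)) t x = selfsim 1 F t x * selfsim 1 (\<lambda>z. F z / 2) t x"
    by (rule selfsim_mult[OF assms])
  also have "\<dots> = (selfsim 1 F t x)\<^sup>2 / 2" by (simp add: selfsim_def power2_eq_square)
  finally have e: "selfsim (1 + 1) (\<lambda>z. F z * (F z / 2)) t x = (selfsim 1 F t x)\<^sup>2 / 2" .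
  show "((\<lambda>t. selfsim 1 F t x) has_real_derivative
      selfsim 2 (\<lambda>z. (F z)\<^sup>2 - 2 * F z - z * F1 z) t x / 2 - (selfsim 1 F t x)\<^sup>2 / 2) (at t)"
    using h(1)[of x] unfolding e by simp
  show "DERIV (selfsim 1 F t) x :> selfsim (3 / 2) F1 t x" using h(2)[of x] by simp
  show "DERIV (selfsim (3 / 2) F1 t) x :> selfsim 2 (\<lambda>z. (F z)\<^sup>2 - 2 * F z - z * F1 z) t x"
    using h(3)[of x] by simp
qed

lemma A_d:
  assumes "0 < t"
  shows "((\<lambda>t. selfsim (1 + \<beta>) Psi t x) has_real_derivative
      selfsim (2 + \<beta>) Psi2 t x / 2 - selfsim 1 F t x * selfsim (1 + \<beta>) Psi t x) (at t)"
    and "DERIV (selfsim (1 + \<beta>) Psi t) x :> selfsim (3 / 2 + \<beta>) Psi1 t x"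
    and "DERIV (selfsim (3 / 2 + \<beta>) Psi1 t) x :> selfsim (2 + \<beta>) Psi2 t x"
proof -
  note h = selfsim_heat[where \<Psi> = Psi and ?\<Psi>1.0 = Psi1 and ?\<Psi>2.0 = Psi2
    and R = "\<lambda>z. F z * Psi z" and \<alpha> = "1 + \<beta>", OF assms Psi_d Psi1_d Psi_eq]
  have e: "1 + \<beta> + 1 = 1 + (1 + \<beta>)" "1 + \<beta> + 1 / 2 = 3 / 2 + \<beta>" by simp_all
  have e': "1 + (1 + \<beta>) = 2 + \<beta>" by simp
  show "((\<lambda>t. selfsim (1 + \<beta>) Psi t x) has_real_derivative
      selfsim (2 + \<beta>) Psi2 t x / 2 - selfsim 1 F t x * selfsim (1 + \<beta>) Psi t x) (at t)"
    using h(1)[of x] unfolding e selfsim_mult[OF assms] unfolding e' .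
  show "DERIV (selfsim (1 + \<beta>) Psi t) x :> selfsim (3 / 2 + \<beta>) Psi1 t x"
    using h(2)[of x] unfolding e .
  show "DERIV (selfsim (3 / 2 + \<beta>) Psi1 t) x :> selfsim (2 + \<beta>) Psi2 t x"
    using h(3)[of x] unfolding e e' .
qed

text \<open>Dini's argument: \<open>Vp\<close> increases with its parameter to a continuous limit,
  so the convergence is uniform on compact intervals.\<close>

lemma Vp_reaches_F:
  assumes e: "0 < \<epsilon>"
  shows "\<exists>l>0. \<forall>z\<in>{-R..R}. F z - \<epsilon> * Psi z < Vp l z"
proof -
  have "\<forall>\<^sub>F k in sequentially. \<forall>z\<in>{-R..R}. 0 < Vp (real k) z - (F z - \<epsilon> * Psi z)"
  proof (rule ccontr)
    assume "\<not> ?thesis"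
    then have "infinite {k. \<not> (\<forall>z\<in>{-R..R}. 0 < Vp (real k) z - (F z - \<epsilon> * Psi z))}"
      unfolding cofinite_eq_sequentially[symmetric] eventually_cofinite by simp
    then have inf: "\<And>m. \<exists>k>m. \<not> (\<forall>z\<in>{-R..R}. 0 < Vp (real k) z - (F z - \<epsilon> * Psi z))"
      unfolding infinite_nat_iff_unbounded by blast
    have "\<forall>m. \<exists>z. z \<in> {-R..R} \<and> Vp (real m) z \<le> F z - \<epsilon> * Psi z"
    proof
      fix m
      obtain k z where "m < k" "z \<in> {-R..R}" "Vp (real k) z \<le> F z - \<epsilon> * Psi z"
        using inf[of m] by (auto simp: not_less)
      moreover have "Vp (real m) z \<le> Vp (real k) z" using \<open>m < k\<close> by (intro Vp_mono) auto
      ultimately show "\<exists>z. z \<in> {-R..R} \<and> Vp (real m) z \<le> F z - \<epsilon> * Psi z" by (intro exI[of _ z]) simp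
    qed
    from choice[OF this] obtain x where x: "\<forall>m. x m \<in> {-R..R} \<and> Vp (real m) (x m) \<le> F (x m) - \<epsilon> * Psi (x m)" by blast
    have "seq_compact {-R..R}" using compact_Icc by (rule compact_imp_seq_compact)
    moreover have "\<forall>k. x k \<in> {-R..R}" using x by blast
    ultimately obtain l r where lr: "l \<in> {-R..R}" "strict_mono r" "(x \<circ> r) \<longlonglongrightarrow> l"
      by (rule seq_compactE)
    have cF: "continuous_on UNIV (\<lambda>z. F z - \<epsilon> * Psi z)" by (intro continuous_intros F_continuous Psi_cont)
    have rhs: "(\<lambda>k. F ((x \<circ> r) k) - \<epsilon> * Psi ((x \<circ> r) k)) \<longlonglongrightarrow> F l - \<epsilon> * Psi l"
      by (rule continuous_on_tendsto_compose[OF cF lr(3)]) auto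
    have "Vp (real j) l \<le> F l - \<epsilon> * Psi l" for j
    proof (rule LIMSEQ_le[OF Vp_continuous[OF tendsto_const _ lr(3), of "real j"] rhs])
      show "\<exists>N. \<forall>n\<ge>N. Vp (real j) ((x \<circ> r) n) \<le> F ((x \<circ> r) n) - \<epsilon> * Psi ((x \<circ> r) n)"
      proof (intro exI[of _ j] allI impI)
        fix n assume "j \<le> n"
        then have "j \<le> r n" using seq_suble[OF lr(2), of n] by simp
        then have "Vp (real j) (x (r n)) \<le> Vp (real (r n)) (x (r n))" by (intro Vp_mono) auto
        also have "\<dots> \<le> F (x (r n)) - \<epsilon> * Psi (x (r n))" using x by blast
        finally show "Vp (real j) ((x \<circ> r) n) \<le> F ((x \<circ> r) n) - \<epsilon> * Psi ((x \<circ> r) n)" by simp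
      qed
    qed simp
    moreover have "(\<lambda>j. Vp (real j) l) \<longlonglongrightarrow> F l"
      by (rule Vp_tendsto_F) (auto intro: filterlim_real_sequentially)
    ultimately have "F l \<le> F l - \<epsilon> * Psi l" by (intro LIMSEQ_le_const2) auto
    then show False using mult_pos_pos[OF e Psi_pos[of l]] by simp
  qed
  then obtain n where n: "\<And>k z. n \<le> k \<Longrightarrow> z \<in> {-R..R} \<Longrightarrow> 0 < Vp (real k) z - (F z - \<epsilon> * Psi z)"
    unfolding eventually_sequentially by blast
  show ?thesis
  proof (intro exI[of _ "real (Suc n)"] conjI ballI)
    show "F z - \<epsilon> * Psi z < Vp (real (Suc n)) z" if "z \<in> {-R..R}" for z using n[of "Suc n" z] that by simp
  qed simp
qed

section \<open>Upper bound for the gap by a subsolution\<close>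

lemma filterlim_real_Suc: "filterlim (\<lambda>k. real (Suc k)) at_top sequentially"
  by (rule filterlim_compose[OF filterlim_real_sequentially filterlim_Suc])

text \<open>The subsolution is \<open>V - m(t) * A\<close>, with \<open>V\<close> and
  \<open>A\<close> the self-similar functions of \<open>F\<close> and \<open>Psi\<close>. The linear
  terms cancel, and the increasing coefficient has to pay for the quadratic one:
  \<open>m' * A\<close> must exceed \<open>m^2 * A^2 / 2\<close>. At time 1 the subsolution lies
  below \<open>U\<close> because \<open>Vp\<close> is close to \<open>F\<close> on an interval and
  \<open>\<epsilon> * Psi\<close> exceeds \<open>F\<close> outside.\<close>

lemma gap_upper_large:
  "\<exists>C>0. \<exists>l>0. \<forall>\<sigma>\<ge>l. \<forall>z. F z - Vp \<sigma> z \<le> C * \<sigma> powr (- 2 * \<beta>)"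
proof -
  obtain B where B: "0 < B" "\<And>z. Psi z \<le> B" using Psi_bounded by blast
  \<comment> \<open>Makes \<open>(2 * \<epsilon>)^2 * B = 2 * \<epsilon> * \<beta>\<close>, which is
    the inequality \<open>m^2 * A \<le> 2 * m'\<close> for the coefficient \<open>m\<close>
    below.\<close>
  define \<epsilon> where "\<epsilon> = \<beta> / (2 * B)"
  have e: "0 < \<epsilon>" using \<beta> B by (simp add: \<epsilon>_def)
  obtain R where R: "1 \<le> R" "\<And>z. R \<le> \<bar>z\<bar> \<Longrightarrow> F z \<le> \<epsilon> * Psi z" using F_le_Psi_outside[OF e] by blast
  obtain l where l: "0 < l" "\<And>z. z \<in> {-R..R} \<Longrightarrow> F z - \<epsilon> / 2 * Psi z < Vp l z"
    using Vp_reaches_F[of "\<epsilon> / 2" R] e by auto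
  define N where "N k = real (Suc k)" for k
  have N: "filterlim N at_top sequentially" "\<And>k. 0 < N k"
    using filterlim_real_Suc by (simp_all add: N_def[abs_def])
  have "\<forall>\<^sub>F k in sequentially. \<forall>z\<in>{-R..R}. 0 < U l (N k) 1 (max (-R) (min R z)) - (F (max (-R) (min R z)) - \<epsilon> * Psi (max (-R) (min R z)))"
  proof (rule eventually_positive_on_interval)
    fix r :: "nat \<Rightarrow> nat" and x :: "nat \<Rightarrow> real" and z assume r: "strict_mono r" and x: "x \<longlonglongrightarrow> z"
    \<comment> \<open>Arguments are clamped to \<open>[-R, R]\<close>, since the positivity
      criterion asks for a positive limit along every convergent sequence, also one leaving the
      interval.\<close>
    define T where "T z = max (-R) (min R z)" for z
    have Tx: "(\<lambda>k. T (x k)) \<longlonglongrightarrow> T z" unfolding T_def by (intro tendsto_intros x)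
    have "T z \<in> {-R..R}" using R(1) by (auto simp: T_def)
    then have "F (T z) - \<epsilon> / 2 * Psi (T z) < Vp l (T z)" by (rule l(2))
    moreover have "0 < \<epsilon> / 2 * Psi (T z)" using e Psi_pos by simp
    ultimately have pos: "0 < Vp l (T z) - (F (T z) - \<epsilon> * Psi (T z))" by simp
    have "filterlim (\<lambda>k. N (r k)) at_top sequentially"
      by (rule filterlim_compose[OF N(1) filterlim_subseq[OF r]])
    then have Ul: "(\<lambda>k. U l (N (r k)) 1 (T (x k))) \<longlonglongrightarrow> Vp l (T z)"
      using l(1) N(2) Tx by (intro U_limit) auto
    have "continuous_on UNIV (\<lambda>z. F z - \<epsilon> * Psi z)" by (intro continuous_intros F_continuous Psi_cont)
    from continuous_on_tendsto_compose[OF this Tx]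
    have "(\<lambda>k. F (T (x k)) - \<epsilon> * Psi (T (x k))) \<longlonglongrightarrow> F (T z) - \<epsilon> * Psi (T z)" by simp
    from tendsto_diff[OF Ul this]
    show "\<exists>c>0. (\<lambda>k. U l (N (r k)) 1 (max (-R) (min R (x k))) - (F (max (-R) (min R (x k))) - \<epsilon> * Psi (max (-R) (min R (x k))))) \<longlonglongrightarrow> c"
      unfolding T_def[symmetric] using pos by blast
  qed
  then have init: "\<forall>\<^sub>F k in sequentially. \<forall>z. F z - \<epsilon> * Psi z \<le> U l (N k) 1 z"
  proof eventually_elim
    case (elim k)
    show ?case
    proof
      fix z
      show "F z - \<epsilon> * Psi z \<le> U l (N k) 1 z"
      proof (cases "\<bar>z\<bar> \<le> R")
        case True
        then have "max (-R) (min R z) = z" "z \<in> {-R..R}" by (auto simp: abs_le_iff)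
        then show ?thesis using elim by fastforce
      next
        case False
        then have "F z \<le> \<epsilon> * Psi z" by (intro R) simp
        moreover have "0 \<le> U l (N k) 1 z" using l(1) N(2) by (intro U_bounded) auto
        ultimately show ?thesis by simp
      qed
    qed
  qed
  \<comment> \<open>Increases from \<open>\<epsilon>\<close> towards \<open>2 * \<epsilon>\<close>,
    so it stays bounded, while its derivative decays like \<open>t powr (- 1 - \<beta>)\<close>, the
    same rate as the bound on \<open>A\<close>.\<close>
  define m where "m t = \<epsilon> * (2 - t powr (- \<beta>))" for t
  have powr_le: "t powr (- \<beta>) \<le> 1" if "1 \<le> t" for t
    using powr_mono2'[of "- \<beta>" 1 t] that \<beta> by simp
  have m: "0 \<le> m t" "m t \<le> 2 * \<epsilon>" if "1 \<le> t" for t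
    using powr_le[OF that] e by (auto simp: m_def mult_le_cancel_left1)
  define G where "G t x = selfsim 1 F t x - m t * selfsim (1 + \<beta>) Psi t x" for t x
  have barrier: "\<forall>\<^sub>F k in sequentially. \<forall>t\<ge>1. \<forall>x. G t x \<le> U l (N k) t x"
    using init
  proof eventually_elim
    case (elim k)
    show ?case
    proof (intro allI impI)
      fix t x :: real assume t: "1 \<le> t"
      show "G t x \<le> U l (N k) t x"
      proof (rule strong_sol_ge_barrier[OF U_strong_sol[OF less_imp_le[OF l(1)] N(2)], where G = G and K = 2 and ?t0.0 = 1])
        have "continuous_on ({1..} \<times> UNIV) (\<lambda>q :: real \<times> real. m (fst q))"
          unfolding m_def by (intro continuous_intros) auto
        then show "continuous_on ({1..} \<times> UNIV) (\<lambda>(t, x). G t x)"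
          using selfsim_continuous[OF F_continuous, of 1 1] selfsim_continuous[OF Psi_cont, of 1 "1 + \<beta>"]
          unfolding G_def case_prod_unfold by (intro continuous_on_diff continuous_on_mult) auto
        show "G t x \<le> 2" if t: "1 \<le> t" for t x
        proof -
          have "selfsim 1 F t x \<le> 1 * 2" unfolding selfsim_def
            using t F_bounds[of "x / sqrt t"] by (intro mult_mono) (auto simp: powr_minus_divide)
          moreover have "0 \<le> m t * selfsim (1 + \<beta>) Psi t x"
            using m[OF t] Psi_pos[of "x / sqrt t"] by (simp add: selfsim_def)
          ultimately show ?thesis by (simp add: G_def)
        qed
        show "G 1 x \<le> U l (N k) 1 x" for x using elim by (simp add: G_def m_def selfsim_def)
        fix t x :: real assume t: "1 < t"
        then have t0: "0 < t" and t1: "1 \<le> t" by auto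
        define m' where "m' = \<epsilon> * (0 - - \<beta> * t powr (- \<beta> - 1))"
        have dm: "DERIV m t :> m'"
          unfolding m_def[abs_def] m'_def
          by (intro DERIV_cmult DERIV_diff DERIV_const has_real_derivative_powr t0)
        define V where "V = selfsim 1 F t x"
        define A where "A = selfsim (1 + \<beta>) Psi t x"
        define V2 where "V2 = selfsim 2 (\<lambda>z. (F z)\<^sup>2 - 2 * F z - z * F1 z) t x"
        define A2 where "A2 = selfsim (2 + \<beta>) Psi2 t x"
        have dt: "DERIV (\<lambda>r. G r x) t :> (V2 / 2 - V\<^sup>2 / 2) - (m' * A + (A2 / 2 - V * A) * m t)"
          unfolding G_def V2_def V_def A2_def A_def
          by (rule DERIV_diff[OF Vi_d(1)[OF t0] DERIV_mult[OF dm A_d(1)[OF t0]]])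
        have dx: "DERIV (G t) y :> selfsim (3 / 2) F1 t y - m t * selfsim (3 / 2 + \<beta>) Psi1 t y" for y
          unfolding G_def[abs_def] by (rule DERIV_diff[OF Vi_d(2)[OF t0] DERIV_cmult[OF A_d(2)[OF t0]]])
        have dxx: "DERIV (\<lambda>y. selfsim (3 / 2) F1 t y - m t * selfsim (3 / 2 + \<beta>) Psi1 t y) x :> V2 - m t * A2"
          unfolding V2_def A2_def by (rule DERIV_diff[OF Vi_d(3)[OF t0] DERIV_cmult[OF A_d(3)[OF t0]]])
        have A0: "0 \<le> A" unfolding A_def using Psi_pos[of "x / sqrt t"] by (simp add: selfsim_def)
        have "(m t)\<^sup>2 * A \<le> (2 * \<epsilon>)\<^sup>2 * (t powr (- (1 + \<beta>)) * B)"
          unfolding A_def selfsim_def using m[OF t1] B(2)[of "x / sqrt t"] Psi_pos[of "x / sqrt t"]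
          by (intro mult_mono power_mono) auto
        also have "- (1 + \<beta>) = - \<beta> - 1" by simp
        also have "(2 * \<epsilon>)\<^sup>2 * (t powr (- \<beta> - 1) * B) = 2 * m'" using B(1)
          by (simp add: m'_def \<epsilon>_def power2_eq_square field_simps)
        finally have "(m t)\<^sup>2 * A * A \<le> 2 * m' * A" using A0 by (rule mult_right_mono)
        then have key: "(V2 / 2 - V\<^sup>2 / 2) - (m' * A + (A2 / 2 - V * A) * m t) \<le> (V2 - m t * A2) / 2 - (G t x)\<^sup>2 / 2"
          unfolding G_def V_def[symmetric] A_def[symmetric] by (simp add: power2_eq_square field_simps)
        show "heat_sub (\<lambda>r. G r x) (G t) t x ((G t x)\<^sup>2 / 2)"
          by (rule ge_barrierI[OF dt zero_less_one dx dxx key])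
      qed (use t in auto)
    qed
  qed
  have "F z - Vp \<sigma> z \<le> 2 * \<epsilon> * B * l powr (2 * \<beta>) * \<sigma> powr (- 2 * \<beta>)" if \<sigma>: "l \<le> \<sigma>" for \<sigma> z
  proof -
    \<comment> \<open>By scaling, parameter \<open>l\<close> at this time is parameter
      \<open>\<sigma>\<close> at time 1.\<close>
    define t where "t = (\<sigma> / l)\<^sup>2"
    have ratio: "1 \<le> \<sigma> / l" using \<sigma> l(1) by simp
    then have t: "1 \<le> t" unfolding t_def by (rule one_le_power)
    have st: "sqrt t = \<sigma> / l" unfolding t_def using \<sigma> l(1) by simp
    have "(\<lambda>k. U l (N k) t (sqrt t * z)) \<longlonglongrightarrow> Vp (l * sqrt t) (sqrt t * z / sqrt t) / t"
      using l(1) N t by (intro U_limit_time) auto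
    moreover have "l * sqrt t = \<sigma>" using st l(1) by simp
    moreover have "sqrt t * z / sqrt t = z" using t by simp
    ultimately have lim: "(\<lambda>k. U l (N k) t (sqrt t * z)) \<longlonglongrightarrow> Vp \<sigma> z / t" by simp
    have "G t (sqrt t * z) \<le> Vp \<sigma> z / t"
    proof (rule tendsto_lowerbound[OF lim])
      show "\<forall>\<^sub>F k in sequentially. G t (sqrt t * z) \<le> U l (N k) t (sqrt t * z)"
        using barrier by eventually_elim (use t in blast)
    qed simp
    moreover have "G t (sqrt t * z) = F z / t - m t * (t powr (- (1 + \<beta>)) * Psi z)"
      using t by (simp add: G_def selfsim_def powr_minus_divide)
    moreover have "m t * (t powr (- (1 + \<beta>)) * Psi z) \<le> (2 * \<epsilon>) * (t powr (- (1 + \<beta>)) * B)"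
      using m[OF t] B(2)[of z] Psi_pos[of z] by (intro mult_mono) auto
    ultimately have "F z / t - Vp \<sigma> z / t \<le> 2 * \<epsilon> * B * t powr (- (1 + \<beta>))" by (simp add: mult_ac)
    then have a: "t * (F z / t - Vp \<sigma> z / t) \<le> t * (2 * \<epsilon> * B * t powr (- (1 + \<beta>)))"
      using t by (intro mult_left_mono) auto
    have b: "t * (F z / t - Vp \<sigma> z / t) = F z - Vp \<sigma> z" using t by (simp add: field_simps)
    have "t * t powr (- (1 + \<beta>)) = t powr (- \<beta>)"
      using t powr_mult_base[of t "- (1 + \<beta>)"] by simp
    then have c: "t * (2 * \<epsilon> * B * t powr (- (1 + \<beta>))) = 2 * \<epsilon> * B * t powr (- \<beta>)" by (simp add: mult_ac)
    have d: "t powr (- \<beta>) = l powr (2 * \<beta>) * \<sigma> powr (- 2 * \<beta>)"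
    proof -
      have "t = (\<sigma> / l) powr 2" unfolding t_def using ratio by (simp add: powr_numeral)
      then have "t powr (- \<beta>) = (\<sigma> / l) powr (- 2 * \<beta>)" by (simp add: powr_powr)
      also have "\<dots> = \<sigma> powr (- 2 * \<beta>) / l powr (- 2 * \<beta>)" by (rule powr_divide)
      also have "\<dots> = l powr (2 * \<beta>) * \<sigma> powr (- 2 * \<beta>)" by (simp add: powr_minus_divide)
      finally show ?thesis .
    qed
    show ?thesis using a unfolding b c d by (simp only: mult.assoc)
  qed
  moreover have "0 < 2 * \<epsilon> * B * l powr (2 * \<beta>)" using e B(1) l(1) by simp
  ultimately show ?thesis using l(1) by blast
qed

lemma gap_upper: "\<exists>C>0. \<forall>\<sigma>>0. \<forall>z. F z - Vp \<sigma> z \<le> C * \<sigma> powr (- 2 * \<beta>)"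
proof -
  obtain C l where C: "0 < C" "0 < l" "\<And>\<sigma> z. l \<le> \<sigma> \<Longrightarrow> F z - Vp \<sigma> z \<le> C * \<sigma> powr (- 2 * \<beta>)"
    using gap_upper_large by blast
  \<comment> \<open>The second entry covers \<open>\<sigma> < l\<close>, where the trivial bound 2
    on the gap is used.\<close>
  define D where "D = max C (2 * l powr (2 * \<beta>))"
  have "F z - Vp \<sigma> z \<le> D * \<sigma> powr (- 2 * \<beta>)" if \<sigma>: "0 < \<sigma>" for \<sigma> z
  proof (cases "l \<le> \<sigma>")
    case True
    have "F z - Vp \<sigma> z \<le> C * \<sigma> powr (- 2 * \<beta>)" by (rule C(3)[OF True])
    also have "\<dots> \<le> D * \<sigma> powr (- 2 * \<beta>)" by (rule mult_right_mono) (auto simp: D_def)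
    finally show ?thesis .
  next
    case False
    have "F z - Vp \<sigma> z \<le> 2 * 1" using F_bounds(2)[of z] Vp_nonneg[of \<sigma> z] \<sigma> by simp
    also have "1 = l powr (2 * \<beta>) * l powr (- 2 * \<beta>)" using C(2) by (simp add: powr_add[symmetric])
    also have "2 * (l powr (2 * \<beta>) * l powr (- 2 * \<beta>)) \<le> 2 * (l powr (2 * \<beta>) * \<sigma> powr (- 2 * \<beta>))"
      using False \<sigma> \<beta> by (intro mult_left_mono powr_mono2') auto
    also have "\<dots> = 2 * l powr (2 * \<beta>) * \<sigma> powr (- 2 * \<beta>)" by simp
    also have "\<dots> \<le> D * \<sigma> powr (- 2 * \<beta>)" by (rule mult_right_mono) (auto simp: D_def)
    finally show ?thesis .
  qed
  moreover have "0 < D" using C(1) by (simp add: D_def)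
  ultimately show ?thesis by blast
qed

section \<open>Lower bound for the gap by a supersolution\<close>

lemma Vp_less_F:
  assumes l: "0 < l"
  shows "Vp l y < F y"
proof (rule ccontr)
  assume "\<not> Vp l y < F y"
  then have eq: "Vp l y = F y" using Vp_le_F[of l y] l by simp
  note X = fin_meas_return[of 0] zero_less_one[where ?'a = real]
  define P where "P = Q (return borel 0) 1"
  interpret P: prob_space P unfolding P_def by (rule lawD(1)[OF X])
  define Z where "Z = {f :: real \<Rightarrow>\<^sub>C real. apply_bcontfun f y = 0}"
  have Z: "Z \<in> sets P" unfolding Z_def P_def by (rule eval_sets(1)[OF X])
  have mZ: "measure P Z = exp (- F y)"
    using zero_prob_pos[of y] by (simp add: F_def P_def Z_def)
  have i1: "integrable P (\<lambda>f. exp (- (l * apply_bcontfun f y)))"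
    unfolding P_def using l by (intro exp_eval_integrable[OF X]) simp
  have i2: "integrable P (indicat_real Z)"
    using Z by (rule integrable_real_indicator) (simp add: P.emeasure_eq_measure)
  \<comment> \<open>The exponential dominates the indicator of \<open>X(1,y) = 0\<close>; equal
    expectations would make \<open>X(1,y)\<close> vanish almost surely, against
    \<open>F > 0\<close>.\<close>
  have "(\<integral>f. exp (- (l * apply_bcontfun f y)) - indicat_real Z f \<partial>P) = exp (- Vp l y) - measure P Z"
    using exp_Vp[of l y] l i1 i2 Z by (simp add: P_def)
  also have "\<dots> = 0" using mZ eq by simp
  finally have int0: "(\<integral>f. exp (- (l * apply_bcontfun f y)) - indicat_real Z f \<partial>P) = 0" .
  have i3: "integrable P (\<lambda>f. exp (- (l * apply_bcontfun f y)) - indicat_real Z f)"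
    by (rule Bochner_Integration.integrable_diff[OF i1 i2])
  have "AE f in P. 0 \<le> exp (- (l * apply_bcontfun f y)) - indicat_real Z f"
    by (rule AE_I2) (auto simp: Z_def indicator_def)
  from integral_nonneg_eq_0_iff_AE[OF i3 this] int0
  have "AE f in P. exp (- (l * apply_bcontfun f y)) - indicat_real Z f = 0" by blast
  then have "AE f in P. f \<in> Z"
  proof eventually_elim
    case (elim f)
    then show ?case by (cases "f \<in> Z") simp_all
  qed
  then have "measure P Z = 1" using Z by (simp add: P.prob_eq_1)
  then show False using mZ F_pos[of y] by simp
qed

text \<open>\<open>F\<close> itself serves as a barrier: it is bounded below by
  \<open>F z0 > 0\<close> on \<open>[-1,1]\<close>, so after the time shift its initial height over
  the bump is at least \<open>N^2 * F z0\<close>, while the bump has height at most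
  \<open>l / bump_mass * N\<close>. In contrast to the Gaussian barrier, the limit in
  \<open>N\<close> of this bound is sharp to leading order.\<close>

lemma U_le_Vi:
  assumes l: "0 \<le> l"
  shows "\<exists>N0>0. \<forall>N\<ge>N0. \<forall>t\<ge>0. \<forall>x. U l N t x \<le> selfsim 1 F (t + 1 / N\<^sup>2) x"
proof -
  obtain z0 where z0: "\<And>z. z \<in> {-1..1} \<Longrightarrow> F z0 \<le> F z"
    using continuous_attains_inf[OF compact_Icc _ continuous_on_subset[OF F_continuous], of "- 1" 1] by fastforce
  define N0 where "N0 = 1 + l / (bump_mass * F z0)"
  have N0: "1 \<le> N0" using l bump_mass_pos F_pos[of z0] by (simp add: N0_def)
  have "U l N t x \<le> selfsim 1 F (t + 1 / N\<^sup>2) x" if N: "N0 \<le> N" and t: "0 \<le> t" for N t x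
  proof -
    have Np: "0 < N" using N N0 by simp
    define \<epsilon> where "\<epsilon> = 1 / N\<^sup>2"
    have \<epsilon>: "0 < \<epsilon>" using Np by (simp add: \<epsilon>_def)
    note u = U_strong_sol[OF l Np]
    have "U l N t x \<le> (\<lambda>t x. selfsim 1 F (t + \<epsilon>) x) t x"
    proof (rule strong_sol_le_barrier[OF u order_refl, where K = 0])
      have "continuous_on ({0..} \<times> UNIV) (\<lambda>q :: real \<times> real. (\<lambda>(t, x). selfsim 1 F t x) (fst q + \<epsilon>, snd q))"
        by (rule continuous_on_compose2[OF selfsim_continuous[OF F_continuous \<epsilon>]])
          (auto intro!: continuous_intros)
      then show "continuous_on ({0..} \<times> UNIV) (\<lambda>(t, x). selfsim 1 F (t + \<epsilon>) x)"
        by (simp add: case_prod_unfold)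
      show nn: "0 \<le> selfsim 1 F (t + \<epsilon>) x" for t x
        using F_bounds by (simp add: selfsim_def)
      show "U l N 0 x \<le> selfsim 1 F (0 + \<epsilon>) x" for x
      proof (cases "1 / N \<le> \<bar>x - 0\<bar>")
        case True
        then have "U l N 0 x = 0" using u approx_delta_bounds(3)[OF l Np] by (simp add: strong_sol_def)
        then show ?thesis using nn[of 0 x] by simp
      next
        case False
        have s: "sqrt \<epsilon> = 1 / N" using Np by (simp add: \<epsilon>_def real_sqrt_divide)
        have "\<bar>x\<bar> * N < 1" using False Np by (simp add: field_simps)
        then have "\<bar>x * N\<bar> \<le> 1" using Np by (simp add: abs_mult)
        then have "x / sqrt \<epsilon> \<in> {-1..1}" using s by (simp add: abs_le_iff)
        then have F: "F z0 \<le> F (x / sqrt \<epsilon>)" by (rule z0)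
        have "U l N 0 x = approx_delta l N 0 x" using u by (simp add: strong_sol_def)
        also have "\<dots> \<le> l / bump_mass * N" by (rule approx_delta_bounds[OF l Np])
        also have "l / bump_mass = (l / (bump_mass * F z0)) * F z0" using F_pos[of z0] by simp
        also have "\<dots> \<le> N * F z0" using N F_pos[of z0] by (intro mult_right_mono) (auto simp: N0_def)
        also have "N * F z0 * N \<le> N * F (x / sqrt \<epsilon>) * N" using F Np by (intro mult_left_mono mult_right_mono) auto
        also have "\<dots> = selfsim 1 F (0 + \<epsilon>) x"
          using Np \<epsilon> by (simp add: selfsim_1 \<epsilon>_def power2_eq_square)
        finally show ?thesis using Np by simp
      qed
      fix t x assume t: "0 < t" and less: "selfsim 1 F (t + \<epsilon>) x < U l N t x"
      have \<tau>: "0 < t + \<epsilon>" using t \<epsilon> by simp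
      have "((\<lambda>r. selfsim 1 F (r + \<epsilon>) x) has_real_derivative
          selfsim 2 (\<lambda>z. (F z)\<^sup>2 - 2 * F z - z * F1 z) (t + \<epsilon>) x / 2 - (selfsim 1 F (t + \<epsilon>) x)\<^sup>2 / 2) (at t)"
        using Vi_d(1)[OF \<tau>, of x] by (rule DERIV_shift[THEN iffD1])
      moreover have "selfsim 2 (\<lambda>z. (F z)\<^sup>2 - 2 * F z - z * F1 z) (t + \<epsilon>) x / 2 - (U l N t x)\<^sup>2 / 2
        \<le> selfsim 2 (\<lambda>z. (F z)\<^sup>2 - 2 * F z - z * F1 z) (t + \<epsilon>) x / 2 - (selfsim 1 F (t + \<epsilon>) x)\<^sup>2 / 2"
        using power_mono[OF less_imp_le[OF less] nn, of 2] by simp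
      ultimately show "heat_super (\<lambda>r. selfsim 1 F (r + \<epsilon>) x) (selfsim 1 F (t + \<epsilon>)) t x ((U l N t x)\<^sup>2 / 2)"
        by (intro le_barrierI[OF _ zero_less_one Vi_d(2)[OF \<tau>] Vi_d(3)[OF \<tau>]])
    qed (rule t)
    then show ?thesis by (simp add: \<epsilon>_def)
  qed
  then show ?thesis using N0 by (intro exI[of _ N0]) auto
qed

text \<open>The second derivative of \<open>gw\<close> is \<open>(z^2 - 1) * gw z\<close>, the
  profile of a solution of the heat equation with rate 3/2. Replacing it by
  \<open>z^2 * gw z\<close> costs only the defect \<open>gw z\<close> at that rate.\<close>

definition "Phi \<delta> z = Psi z - \<delta> * (z\<^sup>2 * gw z)"
definition "Phi1 \<delta> z = Psi1 z - \<delta> * ((2 * z - z ^ 3) * gw z)"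
definition "Phi2 \<delta> z = Psi2 z - \<delta> * ((2 - 5 * z\<^sup>2 + z ^ 4) * gw z)"

lemma Phi_d: "DERIV (Phi \<delta>) z :> Phi1 \<delta> z"
proof -
  have "DERIV (\<lambda>z. z\<^sup>2) z :> 2 * z" by (auto intro!: derivative_eq_intros)
  from DERIV_diff[OF Psi_d DERIV_cmult[OF DERIV_mult[OF this gs.exp_nsq_d]]]
  have "DERIV (Phi \<delta>) z :> Psi1 z - \<delta> * (2 * z * gw z + - z * gw z * z\<^sup>2)"
    unfolding Phi_def[abs_def] .
  moreover have "Psi1 z - \<delta> * (2 * z * gw z + - z * gw z * z\<^sup>2) = Phi1 \<delta> z"
    by (simp add: Phi1_def algebra_simps power2_eq_square power3_eq_cube)
  ultimately show ?thesis by simp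
qed

lemma Phi1_d: "DERIV (Phi1 \<delta>) z :> Phi2 \<delta> z"
proof -
  have "DERIV (\<lambda>z. 2 * z - z ^ 3) z :> 2 - 3 * z\<^sup>2" by (auto intro!: derivative_eq_intros)
  from DERIV_diff[OF Psi1_d DERIV_cmult[OF DERIV_mult[OF this gs.exp_nsq_d]]]
  have "DERIV (Phi1 \<delta>) z :> Psi2 z - \<delta> * ((2 - 3 * z\<^sup>2) * gw z + - z * gw z * (2 * z - z ^ 3))"
    unfolding Phi1_def[abs_def] .
  moreover have "Psi2 z - \<delta> * ((2 - 3 * z\<^sup>2) * gw z + - z * gw z * (2 * z - z ^ 3)) = Phi2 \<delta> z"
    by (simp add: Phi2_def algebra_simps power2_eq_square power3_eq_cube power4_eq_xxxx)
  ultimately show ?thesis by simp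
qed

lemma Phi_eq:
  "Phi2 \<delta> z / 2 + z * Phi1 \<delta> z / 2 + (3 / 2) * Phi \<delta> z
    = F z * Psi z + ((1 / 2 - \<beta>) * Psi z - \<delta> * gw z)"
proof -
  have "Phi2 \<delta> z / 2 + z * Phi1 \<delta> z / 2 + (3 / 2) * Phi \<delta> z
    = (Psi2 z / 2 + z * Psi1 z / 2 + (1 + \<beta>) * Psi z) + ((1 / 2 - \<beta>) * Psi z - \<delta> * gw z)"
    by (simp add: Phi2_def Phi1_def Phi_def algebra_simps power2_eq_square power3_eq_cube power4_eq_xxxx add_divide_distrib diff_divide_distrib)
  then show ?thesis by (simp only: Psi_eq)
qed

lemma Phi_cont: "continuous_on UNIV (Phi \<delta>)"
  using Phi_d by (meson DERIV_continuous_on has_field_derivative_at_within)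

lemma Phi_le: "0 \<le> \<delta> \<Longrightarrow> Phi \<delta> z \<le> Psi z"
  by (simp add: Phi_def)

lemma B_d:
  assumes "0 < t"
  shows "((\<lambda>t. selfsim (3 / 2) (Phi \<delta>) t x) has_real_derivative
      selfsim (5 / 2) (Phi2 \<delta>) t x / 2
        - (selfsim 1 F t x * selfsim (3 / 2) Psi t x
          + selfsim (5 / 2) (\<lambda>z. (1 / 2 - \<beta>) * Psi z - \<delta> * gw z) t x)) (at t)"
    and "DERIV (selfsim (3 / 2) (Phi \<delta>) t) x :> selfsim 2 (Phi1 \<delta>) t x"
    and "DERIV (selfsim 2 (Phi1 \<delta>) t) x :> selfsim (5 / 2) (Phi2 \<delta>) t x"
proof -
  note h = selfsim_heat[where \<Psi> = "Phi \<delta>" and ?\<Psi>1.0 = "Phi1 \<delta>" and ?\<Psi>2.0 = "Phi2 \<delta>"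
    and R = "\<lambda>z. F z * Psi z + ((1 / 2 - \<beta>) * Psi z - \<delta> * gw z)" and \<alpha> = "3 / 2", OF assms Phi_d Phi1_d Phi_eq]
  have e: "3 / 2 + 1 = (5 / 2 :: real)" "3 / 2 + 1 / 2 = (2 :: real)" "1 + 3 / 2 = (5 / 2 :: real)" by simp_all
  have "selfsim (5 / 2) (\<lambda>z. F z * Psi z + ((1 / 2 - \<beta>) * Psi z - \<delta> * gw z)) t x
     = selfsim (5 / 2) (\<lambda>z. F z * Psi z) t x + selfsim (5 / 2) (\<lambda>z. (1 / 2 - \<beta>) * Psi z - \<delta> * gw z) t x"
    by (simp add: selfsim_def distrib_left)
  moreover have "selfsim (5 / 2) (\<lambda>z. F z * Psi z) t x = selfsim 1 F t x * selfsim (3 / 2) Psi t x"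
    using selfsim_mult[OF assms, of 1 "3 / 2" F Psi x] unfolding e .
  ultimately have R: "selfsim (5 / 2) (\<lambda>z. F z * Psi z + ((1 / 2 - \<beta>) * Psi z - \<delta> * gw z)) t x
     = selfsim 1 F t x * selfsim (3 / 2) Psi t x + selfsim (5 / 2) (\<lambda>z. (1 / 2 - \<beta>) * Psi z - \<delta> * gw z) t x"
    by (simp only:)
  show "((\<lambda>t. selfsim (3 / 2) (Phi \<delta>) t x) has_real_derivative
      selfsim (5 / 2) (Phi2 \<delta>) t x / 2
        - (selfsim 1 F t x * selfsim (3 / 2) Psi t x
          + selfsim (5 / 2) (\<lambda>z. (1 / 2 - \<beta>) * Psi z - \<delta> * gw z) t x)) (at t)"
    using h(1)[of x] unfolding e R .
  show "DERIV (selfsim (3 / 2) (Phi \<delta>) t) x :> selfsim 2 (Phi1 \<delta>) t x"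
    using h(2)[of x] unfolding e .
  show "DERIV (selfsim 2 (Phi1 \<delta>) t) x :> selfsim (5 / 2) (Phi2 \<delta>) t x"
    using h(3)[of x] unfolding e .
qed

text \<open>The correction \<open>Phi\<close>, with the faster rate 3/2, makes the perturbation of the self-similar
  solution nonpositive for large z at time 1.\<close>

lemma gap_lower_1:
  "\<exists>c>0. \<exists>\<delta>>0. \<forall>\<sigma>\<ge>1. \<forall>z. c * (\<sigma> powr (- 2 * \<beta>) * Psi z - \<delta> * \<sigma> powr (- 1) * (z\<^sup>2 * gw z)) \<le> F z - Vp \<sigma> z"
proof -
  obtain p where p: "0 < p" "\<And>x. p \<le> psi x" using gs.psi_lower by blast
  \<comment> \<open>With \<open>p\<close> a lower bound of \<open>psi\<close>, the part
    \<open>(1 / 2 - \<beta>) * Psi - \<delta> * gw\<close> of the defect of \<open>Phi\<close> is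
    nonnegative. That \<open>\<delta>\<close> is positive is due to
    \<open>\<beta> < 1 / 2\<close>.\<close>
  define \<delta> where "\<delta> = (1 / 2 - \<beta>) * p"
  have \<delta>: "0 < \<delta>" using \<beta> p by (simp add: \<delta>_def)
  have rem: "0 \<le> (1 / 2 - \<beta>) * Psi z - \<delta> * gw z" for z
  proof -
    have "(1 / 2 - \<beta>) * gw z * p \<le> (1 / 2 - \<beta>) * gw z * psi z"
      using p(2)[of z] \<beta> by (intro mult_left_mono) auto
    then show ?thesis by (simp add: Psi_def \<delta>_def mult_ac)
  qed
  obtain B where B: "0 < B" "\<And>z. Psi z \<le> B" using Psi_bounded by blast
  obtain R where R: "1 \<le> R" "\<And>z. R \<le> \<bar>z\<bar> \<Longrightarrow> psi \<bar>z\<bar> \<le> \<delta> / 2 * \<bar>z\<bar>\<^sup>2"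
    using gs.even_extend[OF gs.psi_little_square[of "\<delta> / 2"]] \<delta> by auto
  \<comment> \<open>The factor 1/2 in the choice of \<open>R\<close> lets the correction outweigh
    two copies of \<open>Psi\<close>: the one of rate \<open>1 + \<beta>\<close> and the one inside
    \<open>Phi\<close>.\<close>
  have outside: "Psi z + Phi \<delta> z \<le> 0" if z: "R \<le> \<bar>z\<bar>" for z
  proof -
    have "psi z \<le> \<delta> / 2 * z\<^sup>2" using R(2)[OF z] by (simp only: gs.psi_abs power2_abs)
    then have "gw z * psi z \<le> gw z * (\<delta> / 2 * z\<^sup>2)" by (rule mult_left_mono) simp
    then show ?thesis by (simp add: Phi_def Psi_def mult_ac)
  qed
  obtain z0 where z0: "z0 \<in> {-R..R}" "\<And>z. z \<in> {-R..R} \<Longrightarrow> F z0 - Vp 1 z0 \<le> F z - Vp 1 z"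
    using continuous_attains_inf[OF compact_Icc _ continuous_on_subset[of UNIV "\<lambda>z. F z - Vp 1 z"], of "-R" R]
      R(1) F_continuous Vp_continuous_on[of 1] by (fastforce intro: continuous_intros)
  define \<eta> where "\<eta> = (F z0 - Vp 1 z0) / 2"
  have \<eta>: "0 < \<eta>" using Vp_less_F[of 1 z0] by (simp add: \<eta>_def)
  define c where "c = \<eta> / (2 * B)"
  have c: "0 < c" using \<eta> B by (simp add: c_def)
  obtain N0 where N0: "0 < N0" "\<And>N t x. N0 \<le> N \<Longrightarrow> 0 \<le> t \<Longrightarrow> U 1 N t x \<le> selfsim 1 F (t + 1 / N\<^sup>2) x"
    using U_le_Vi[of 1] by auto
  define N where "N k = real (Suc k) + max 1 N0" for k
  have N: "\<And>k. 1 < N k" "\<And>k. N0 \<le> N k" by (auto simp: N_def)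
  have Ntop: "filterlim N at_top sequentially"
    unfolding N_def[abs_def] by (rule filterlim_at_top_mono[OF filterlim_real_Suc]) (auto intro: always_eventually)
  \<comment> \<open>The barrier runs ahead of \<open>U\<close> by \<open>1 / N^2\<close>; starting
    \<open>U\<close> at \<open>s k\<close> makes the barrier start at time 1 exactly, where its two
    powers of \<open>t\<close> coincide.\<close>
  define s where "s k = 1 - 1 / (N k)\<^sup>2" for k
  have s01: "0 < s k" "s k + 1 / (N k)\<^sup>2 = 1" for k
    using N(1)[of k] power_strict_mono[of 1 "N k" 2] by (auto simp: s_def)
  have N2: "(\<lambda>k. 1 / (N k)\<^sup>2) \<longlonglongrightarrow> 0"
  proof -
    have "filterlim (\<lambda>k. (N k)\<^sup>2) at_top sequentially" by (rule filterlim_pow_at_top[OF _ Ntop]) simp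
    from tendsto_divide_0[OF tendsto_const filterlim_at_top_imp_at_infinity[OF this]] show ?thesis .
  qed
  have slim: "s \<longlonglongrightarrow> 1" unfolding s_def[abs_def] using tendsto_diff[OF tendsto_const[of 1] N2] by simp
  have "\<forall>\<^sub>F k in sequentially. \<forall>z\<in>{-R..R}. 0 < (F (max (-R) (min R z)) - \<eta>) - U 1 (N k) (s k) (max (-R) (min R z))"
  proof (rule eventually_positive_on_interval)
    fix r :: "nat \<Rightarrow> nat" and x :: "nat \<Rightarrow> real" and z assume r: "strict_mono r" and x: "x \<longlonglongrightarrow> z"
    define T where "T z = max (-R) (min R z)" for z
    have Tx: "(\<lambda>k. T (x k)) \<longlonglongrightarrow> T z" unfolding T_def by (intro tendsto_intros x)
    have "T z \<in> {-R..R}" using R(1) by (auto simp: T_def)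
    then have "F z0 - Vp 1 z0 \<le> F (T z) - Vp 1 (T z)" by (rule z0(2))
    moreover have "F z0 - Vp 1 z0 = 2 * \<eta>" by (simp add: \<eta>_def)
    ultimately have pos: "0 < (F (T z) - \<eta>) - Vp 1 (T z)" using \<eta> by simp
    have "filterlim (\<lambda>k. N (r k)) at_top sequentially"
      by (rule filterlim_compose[OF Ntop filterlim_subseq[OF r]])
    then have "(\<lambda>k. U 1 (N (r k)) (s (r k)) (T (x k))) \<longlonglongrightarrow> Vp (1 * sqrt 1) (T z / sqrt 1) / 1"
      using N(1) s01 LIMSEQ_subseq_LIMSEQ[OF slim r] Tx
      by (intro U_limit_time) (auto simp: o_def intro: less_trans[OF zero_less_one])
    then have Ul: "(\<lambda>k. U 1 (N (r k)) (s (r k)) (T (x k))) \<longlonglongrightarrow> Vp 1 (T z)" by simp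
    have "(\<lambda>k. F (T (x k))) \<longlonglongrightarrow> F (T z)"
      using continuous_on_tendsto_compose[OF F_continuous Tx] by simp
    then have "(\<lambda>k. (F (T (x k)) - \<eta>) - U 1 (N (r k)) (s (r k)) (T (x k))) \<longlonglongrightarrow> (F (T z) - \<eta>) - Vp 1 (T z)"
      by (intro tendsto_diff tendsto_const Ul)
    then show "\<exists>c>0. (\<lambda>k. (F (max (-R) (min R (x k))) - \<eta>) - U 1 (N (r k)) (s (r k)) (max (-R) (min R (x k)))) \<longlonglongrightarrow> c"
      unfolding T_def[symmetric] using pos by blast
  qed
  then have init: "\<forall>\<^sub>F k in sequentially. \<forall>z. U 1 (N k) (s k) z \<le> F z - c * (Psi z + Phi \<delta> z)"
  proof eventually_elim
    case (elim k)
    show ?case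
    proof
      fix z
      show "U 1 (N k) (s k) z \<le> F z - c * (Psi z + Phi \<delta> z)"
      proof (cases "\<bar>z\<bar> \<le> R")
        case True
        then have "max (-R) (min R z) = z" "z \<in> {-R..R}" by (auto simp: abs_le_iff)
        then have "U 1 (N k) (s k) z \<le> F z - \<eta>" using elim by fastforce
        moreover have "c * (Psi z + Phi \<delta> z) \<le> c * (2 * B)"
          using Phi_le[of \<delta> z] B(2)[of z] \<delta> c by (intro mult_left_mono) auto
        moreover have "c * (2 * B) = \<eta>" using B(1) by (simp add: c_def)
        ultimately show ?thesis by linarith
      next
        case False
        then have "c * (Psi z + Phi \<delta> z) \<le> 0" using outside[of z] c by (intro mult_nonneg_nonpos) auto
        moreover have "U 1 (N k) (s k) z \<le> selfsim 1 F (s k + 1 / (N k)\<^sup>2) z"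
          using N(2) s01(1)[of k] by (intro N0) auto
        ultimately show ?thesis unfolding s01 by (simp add: selfsim_def)
      qed
    qed
  qed
  define H where "H t x = selfsim 1 F t x - c * (selfsim (1 + \<beta>) Psi t x + selfsim (3 / 2) (Phi \<delta>) t x)" for t x
  have Hcont: "continuous_on ({1..} \<times> UNIV) (\<lambda>(t, x). H t x)"
    using selfsim_continuous[OF F_continuous, of 1 1] selfsim_continuous[OF Psi_cont, of 1 "1 + \<beta>"]
      selfsim_continuous[OF Phi_cont[of \<delta>], of 1 "3 / 2"]
    unfolding H_def case_prod_unfold by (intro continuous_on_diff continuous_on_mult continuous_on_add continuous_on_const) auto
  have barrier: "\<forall>\<^sub>F k in sequentially. \<forall>t\<ge>1. \<forall>x. U 1 (N k) (t - 1 / (N k)\<^sup>2) x \<le> H t x"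
    using init
  proof eventually_elim
    case (elim k)
    define \<epsilon> where "\<epsilon> = 1 / (N k)\<^sup>2"
    have Np: "0 < N k" using N(1)[of k] by simp
    have \<epsilon>: "0 < \<epsilon>" using Np by (simp add: \<epsilon>_def)
    have s\<epsilon>: "s k = 1 - \<epsilon>" by (simp add: s_def \<epsilon>_def)
    show ?case
    proof (intro allI impI)
      fix t x :: real assume t: "1 \<le> t"
      have "U 1 (N k) (t - \<epsilon>) x \<le> (\<lambda>t x. H (t + \<epsilon>) x) (t - \<epsilon>) x"
      proof (rule strong_sol_le_barrier[OF U_strong_sol[OF zero_le_one Np], where K = "- (c * (2 * B))" and ?t0.0 = "s k"])
        have "continuous_on ({s k..} \<times> UNIV) (\<lambda>q :: real \<times> real. (\<lambda>(t, x). H t x) (fst q + \<epsilon>, snd q))"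
          by (rule continuous_on_compose2[OF Hcont]) (auto intro!: continuous_intros simp: s\<epsilon>)
        then show "continuous_on ({s k..} \<times> UNIV) (\<lambda>(t, x). H (t + \<epsilon>) x)" by (simp add: case_prod_unfold)
        show "- (c * (2 * B)) \<le> H (t + \<epsilon>) x" if t: "s k \<le> t" for t x
        proof -
          have t1: "1 \<le> t + \<epsilon>" using t by (simp add: s\<epsilon>)
          have bd: "selfsim \<alpha> Psi (t + \<epsilon>) x \<le> 1 * B" if "0 < \<alpha>" for \<alpha>
            unfolding selfsim_def using powr_mono2'[of "- \<alpha>" 1 "t + \<epsilon>"] t1 that B(2) Psi_pos
            by (intro mult_mono) (auto intro: less_imp_le)
          have "selfsim (3 / 2) (Phi \<delta>) (t + \<epsilon>) x \<le> selfsim (3 / 2) Psi (t + \<epsilon>) x"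
            unfolding selfsim_def using \<delta> by (intro mult_left_mono Phi_le) auto
          then have "c * (selfsim (1 + \<beta>) Psi (t + \<epsilon>) x + selfsim (3 / 2) (Phi \<delta>) (t + \<epsilon>) x) \<le> c * (2 * B)"
            using bd[of "1 + \<beta>"] bd[of "3 / 2"] \<beta> c by (intro mult_left_mono) auto
          moreover have "0 \<le> selfsim 1 F (t + \<epsilon>) x" using F_bounds by (simp add: selfsim_def)
          ultimately show ?thesis by (simp add: H_def)
        qed
        show "U 1 (N k) (s k) x \<le> H (s k + \<epsilon>) x" for x
          using elim by (simp add: H_def s\<epsilon> selfsim_def)
        fix t x assume t: "s k < t" and less: "H (t + \<epsilon>) x < U 1 (N k) t x"
        define \<tau> where "\<tau> = t + \<epsilon>"
        have \<tau>: "0 < \<tau>" using t by (simp add: \<tau>_def s\<epsilon>)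
        have tp: "0 \<le> t" using s01(1)[of k] t by simp
        define V where "V = selfsim 1 F \<tau> x"
        define A where "A = selfsim (1 + \<beta>) Psi \<tau> x"
        define A' where "A' = selfsim (3 / 2) Psi \<tau> x"
        define B where "B = selfsim (3 / 2) (Phi \<delta>) \<tau> x"
        define V2 where "V2 = selfsim 2 (\<lambda>z. (F z)\<^sup>2 - 2 * F z - z * F1 z) \<tau> x"
        define A2 where "A2 = selfsim (2 + \<beta>) Psi2 \<tau> x"
        define B2 where "B2 = selfsim (5 / 2) (Phi2 \<delta>) \<tau> x"
        define E where "E = selfsim (5 / 2) (\<lambda>z. (1 / 2 - \<beta>) * Psi z - \<delta> * gw z) \<tau> x"
        define u where "u = U 1 (N k) t x"
        have "DERIV (\<lambda>r. H r x) \<tau> :> (V2 / 2 - V\<^sup>2 / 2) - c * ((A2 / 2 - V * A) + (B2 / 2 - (V * A' + E)))"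
          unfolding H_def V2_def V_def A2_def A_def B2_def A'_def E_def
          by (rule DERIV_diff[OF Vi_d(1)[OF \<tau>] DERIV_cmult[OF DERIV_add[OF A_d(1)[OF \<tau>] B_d(1)[OF \<tau>]]]])
        then have dt: "DERIV (\<lambda>r. H (r + \<epsilon>) x) t :> (V2 / 2 - V\<^sup>2 / 2) - c * ((A2 / 2 - V * A) + (B2 / 2 - (V * A' + E)))"
          unfolding \<tau>_def by (rule DERIV_shift[THEN iffD1])
        have dx: "DERIV (H \<tau>) y :> selfsim (3 / 2) F1 \<tau> y - c * (selfsim (3 / 2 + \<beta>) Psi1 \<tau> y + selfsim 2 (Phi1 \<delta>) \<tau> y)" for y
          unfolding H_def[abs_def] by (rule DERIV_diff[OF Vi_d(2)[OF \<tau>] DERIV_cmult[OF DERIV_add[OF A_d(2)[OF \<tau>] B_d(2)[OF \<tau>]]]])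
        have dxx: "DERIV (\<lambda>y. selfsim (3 / 2) F1 \<tau> y - c * (selfsim (3 / 2 + \<beta>) Psi1 \<tau> y + selfsim 2 (Phi1 \<delta>) \<tau> y)) x :> V2 - c * (A2 + B2)"
          unfolding V2_def A2_def B2_def
          by (rule DERIV_diff[OF Vi_d(3)[OF \<tau>] DERIV_cmult[OF DERIV_add[OF A_d(3)[OF \<tau>] B_d(3)[OF \<tau>]]]])
        have V0: "0 \<le> V" unfolding V_def using F_bounds by (simp add: selfsim_def)
        have E0: "0 \<le> E" unfolding E_def selfsim_def using rem by simp
        have BA: "B \<le> A'" unfolding B_def A'_def selfsim_def using \<delta> by (intro mult_left_mono Phi_le) auto
        have uV: "u \<le> V" unfolding u_def V_def \<tau>_def \<epsilon>_def using N(2) tp by (intro N0) auto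
        \<comment> \<open>The identity \<open>V^2 - u^2 = 2 * V * (V - u) - (V - u)^2\<close>
          governs the rest: the last square is dropped, and where the comparison fails
          \<open>V - u\<close> is below \<open>c * (A + A')\<close>. The resulting
          \<open>2 * c * V * (A + A')\<close> is what the linear terms provide.\<close>
        have "V - c * (A + B) < u" using less unfolding \<tau>_def[symmetric] by (simp add: H_def V_def A_def B_def u_def)
        moreover have "c * (A + B) \<le> c * (A + A')" using BA c by (intro mult_left_mono) auto
        ultimately have "V - u \<le> c * (A + A')" by simp
        then have "(V - u) * V \<le> c * (A + A') * V" using V0 by (rule mult_right_mono)
        moreover have "0 \<le> (V - u) * (V - u)" by simp
        moreover have "0 \<le> c * E" using c E0 by simp
        ultimately have key: "(V2 - c * (A2 + B2)) / 2 - u\<^sup>2 / 2 \<le> (V2 / 2 - V\<^sup>2 / 2) - c * ((A2 / 2 - V * A) + (B2 / 2 - (V * A' + E)))"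
          by (simp add: power2_eq_square algebra_simps add_divide_distrib diff_divide_distrib)
        show "heat_super (\<lambda>r. H (r + \<epsilon>) x) (H (t + \<epsilon>)) t x ((U 1 (N k) t x)\<^sup>2 / 2)"
          unfolding \<tau>_def[symmetric] u_def[symmetric]
          by (rule le_barrierI[OF dt zero_less_one dx dxx key])
      qed (use t s01(1)[of k] s\<epsilon> in auto)
      then show "U 1 (N k) (t - 1 / (N k)\<^sup>2) x \<le> H t x" by (simp add: \<epsilon>_def)
    qed
  qed
  have "c * (\<sigma> powr (- 2 * \<beta>) * Psi z - \<delta> * \<sigma> powr (- 1) * (z\<^sup>2 * gw z)) \<le> F z - Vp \<sigma> z" if \<sigma>: "1 \<le> \<sigma>" for \<sigma> z
  proof -
    define t where "t = \<sigma>\<^sup>2"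
    have t: "1 \<le> t" unfolding t_def using \<sigma> by (rule one_le_power)
    have st: "sqrt t = \<sigma>" unfolding t_def using \<sigma> by simp
    have "(\<lambda>k. U 1 (N k) (t - 1 / (N k)\<^sup>2) (\<sigma> * z)) \<longlonglongrightarrow> Vp (1 * sqrt t) (\<sigma> * z / sqrt t) / t"
    proof (rule U_limit_time[OF zero_le_one Ntop])
      show "0 < N k" for k using N(1)[of k] by simp
      show "(\<lambda>k. t - 1 / (N k)\<^sup>2) \<longlonglongrightarrow> t" using tendsto_diff[OF tendsto_const[of t] N2] by simp
      show "0 < t - 1 / (N k)\<^sup>2" for k using s01[of k] t by simp
    qed (use t in auto)
    then have lim: "(\<lambda>k. U 1 (N k) (t - 1 / (N k)\<^sup>2) (\<sigma> * z)) \<longlonglongrightarrow> Vp \<sigma> z / t" using st \<sigma> by simp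
    have "Vp \<sigma> z / t \<le> H t (\<sigma> * z)"
    proof (rule tendsto_upperbound[OF lim])
      show "\<forall>\<^sub>F k in sequentially. U 1 (N k) (t - 1 / (N k)\<^sup>2) (\<sigma> * z) \<le> H t (\<sigma> * z)"
        using barrier by eventually_elim (use t in blast)
    qed simp
    moreover have "H t (\<sigma> * z) = F z / t - c * (t powr (- (1 + \<beta>)) * Psi z + t powr (- (3 / 2)) * Phi \<delta> z)"
      using t st \<sigma> by (simp add: H_def selfsim_def powr_minus_divide)
    ultimately have "c * (t powr (- (1 + \<beta>)) * Psi z + t powr (- (3 / 2)) * Phi \<delta> z) \<le> F z / t - Vp \<sigma> z / t" by simp
    then have a: "t * (c * (t powr (- (1 + \<beta>)) * Psi z + t powr (- (3 / 2)) * Phi \<delta> z)) \<le> t * (F z / t - Vp \<sigma> z / t)"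
      using t by (intro mult_left_mono) auto
    have b: "t * (F z / t - Vp \<sigma> z / t) = F z - Vp \<sigma> z" using t by (simp add: field_simps)
    have tl: "t powr a = \<sigma> powr (2 * a)" for a
      unfolding t_def using \<sigma> powr_powr[of \<sigma> 2 a] by (simp add: powr_numeral)
    have p1: "t * t powr (- (1 + \<beta>)) = \<sigma> powr (- 2 * \<beta>)"
      using t powr_mult_base[of t "- (1 + \<beta>)"] tl[of "- \<beta>"] by simp
    have p2: "t * t powr (- (3 / 2)) = \<sigma> powr (- 1)"
      using t powr_mult_base[of t "- (3 / 2)"] tl[of "- (1 / 2)"] by simp
    have "t * (c * (t powr (- (1 + \<beta>)) * Psi z + t powr (- (3 / 2)) * Phi \<delta> z))
       = c * ((t * t powr (- (1 + \<beta>))) * Psi z + (t * t powr (- (3 / 2))) * Phi \<delta> z)"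
      by (simp add: algebra_simps)
    also have "\<dots> = c * (\<sigma> powr (- 2 * \<beta>) * Psi z + \<sigma> powr (- 1) * Phi \<delta> z)" by (simp only: p1 p2)
    finally have e: "t * (c * (t powr (- (1 + \<beta>)) * Psi z + t powr (- (3 / 2)) * Phi \<delta> z))
       = c * (\<sigma> powr (- 2 * \<beta>) * Psi z + \<sigma> powr (- 1) * Phi \<delta> z)" .
    have "c * (\<sigma> powr (- 2 * \<beta>) * Psi z - \<delta> * \<sigma> powr (- 1) * (z\<^sup>2 * gw z))
      \<le> c * (\<sigma> powr (- 2 * \<beta>) * Psi z + \<sigma> powr (- 1) * Phi \<delta> z)"
    proof -
      have "0 \<le> \<sigma> powr (- 1) * Psi z" using Psi_pos[of z] by simp
      then have "\<sigma> powr (- 2 * \<beta>) * Psi z - \<delta> * \<sigma> powr (- 1) * (z\<^sup>2 * gw z)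
        \<le> \<sigma> powr (- 2 * \<beta>) * Psi z + \<sigma> powr (- 1) * Phi \<delta> z"
        by (simp add: Phi_def right_diff_distrib mult_ac)
      then show ?thesis using c by (intro mult_left_mono) auto
    qed
    then show ?thesis using a unfolding b e by (rule order_trans)
  qed
  then show ?thesis using c \<delta> by blast
qed

text \<open>For bounded \<open>z\<close> the correction is of order
  \<open>\<sigma> powr (- 1)\<close> and negligible against
  \<open>\<sigma> powr (- 2 * \<beta>)\<close> for large \<open>\<sigma>\<close>, because
  \<open>\<beta> < 1 / 2\<close>. For \<open>\<sigma>\<close> between 1 and \<open>L\<close> the gap
  is at least the one at \<open>L\<close>, by monotonicity.\<close>

lemma gap_lower: "\<exists>c>0. \<forall>\<sigma>\<ge>1. \<forall>z. \<bar>z\<bar> \<le> K \<longrightarrow> c * \<sigma> powr (- 2 * \<beta>) \<le> F z - Vp \<sigma> z"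
proof -
  obtain c \<delta> where c: "0 < c" "0 < \<delta>"
    "\<And>\<sigma> z. 1 \<le> \<sigma> \<Longrightarrow> c * (\<sigma> powr (- 2 * \<beta>) * Psi z - \<delta> * \<sigma> powr (- 1) * (z\<^sup>2 * gw z)) \<le> F z - Vp \<sigma> z"
    using gap_lower_1 by blast
  obtain p where p: "0 < p" "\<And>x. p \<le> psi x" using gs.psi_lower by blast
  have lim: "((\<lambda>\<sigma>. \<sigma> powr (2 * \<beta> - 1)) \<longlongrightarrow> 0) at_top" by (rule tendsto_neg_powr) (use \<beta> in \<open>auto intro: filterlim_ident\<close>)
  \<comment> \<open>The summand 1 keeps \<open>q\<close> positive also for \<open>K = 0\<close>, so
    that it can be divided by.\<close>
  define q where "q = \<delta> * K\<^sup>2 + 1"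
  have q: "0 < q" "\<delta> * K\<^sup>2 \<le> q" using c(2) by (auto simp: q_def intro: add_nonneg_pos)
  have "\<forall>\<^sub>F \<sigma> in at_top. \<sigma> powr (2 * \<beta> - 1) < p / 2 / q"
    by (rule order_tendstoD(2)[OF lim]) (use p q in simp)
  then obtain L0 where L0: "\<And>\<sigma>. L0 \<le> \<sigma> \<Longrightarrow> \<sigma> powr (2 * \<beta> - 1) < p / 2 / q"
    unfolding eventually_at_top_linorder by blast
  define L where "L = max 1 L0"
  define d where "d = c * gw K * (p / 2)"
  have d: "0 < d" using c p by (simp add: d_def)
  have large: "d * \<sigma> powr (- 2 * \<beta>) \<le> F z - Vp \<sigma> z" if \<sigma>: "L \<le> \<sigma>" and z: "\<bar>z\<bar> \<le> K" for \<sigma> z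
  proof -
    have l1: "1 \<le> \<sigma>" "L0 \<le> \<sigma>" using \<sigma> by (auto simp: L_def)
    have zK: "z\<^sup>2 \<le> K\<^sup>2" using z by (rule power2_le_iff_abs_le[THEN iffD2, rotated]) (use z in simp)
    have "q * \<sigma> powr (2 * \<beta> - 1) \<le> q * (p / 2 / q)"
      using L0[OF l1(2)] q(1) by (intro mult_left_mono) auto
    also have "\<dots> = p / 2" using q(1) by simp
    finally have "q * \<sigma> powr (2 * \<beta> - 1) \<le> p / 2" .
    moreover have "\<delta> * z\<^sup>2 * \<sigma> powr (2 * \<beta> - 1) \<le> q * \<sigma> powr (2 * \<beta> - 1)"
    proof (rule mult_right_mono)
      show "\<delta> * z\<^sup>2 \<le> q" by (rule order_trans[OF mult_left_mono[OF zK] q(2)]) (use c(2) in simp)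
    qed simp
    ultimately have 1: "\<delta> * z\<^sup>2 * \<sigma> powr (2 * \<beta> - 1) \<le> p / 2" by simp
    have split: "\<sigma> powr (- 1) = \<sigma> powr (- 2 * \<beta>) * \<sigma> powr (2 * \<beta> - 1)" using l1(1) by (simp add: powr_add[symmetric])
    have "gw K * (p / 2) \<le> gw z * (psi z - \<delta> * z\<^sup>2 * \<sigma> powr (2 * \<beta> - 1))"
      using zK 1 p(2)[of z] p(1) by (intro mult_mono) auto
    then have "(c * \<sigma> powr (- 2 * \<beta>)) * (gw K * (p / 2))
      \<le> (c * \<sigma> powr (- 2 * \<beta>)) * (gw z * (psi z - \<delta> * z\<^sup>2 * \<sigma> powr (2 * \<beta> - 1)))"
      using c(1) by (intro mult_left_mono) auto
    also have "\<dots> = c * (\<sigma> powr (- 2 * \<beta>) * Psi z - \<delta> * \<sigma> powr (- 1) * (z\<^sup>2 * gw z))"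
      unfolding split Psi_def by (simp add: algebra_simps)
    also note c(3)[OF l1(1)]
    finally show ?thesis by (simp add: d_def mult_ac)
  qed
  define e where "e = d * L powr (- 2 * \<beta>)"
  have L1: "1 \<le> L" by (simp add: L_def)
  have pl: "\<sigma> powr (- 2 * \<beta>) \<le> 1" if "1 \<le> \<sigma>" for \<sigma> using powr_mono2'[of "- 2 * \<beta>" 1 \<sigma>] that \<beta> by simp
  have "e * \<sigma> powr (- 2 * \<beta>) \<le> F z - Vp \<sigma> z" if \<sigma>: "1 \<le> \<sigma>" and z: "\<bar>z\<bar> \<le> K" for \<sigma> z
  proof (cases "L \<le> \<sigma>")
    case True
    have "e \<le> d * 1" unfolding e_def using d pl[OF L1] by (intro mult_left_mono) auto
    then have "e * \<sigma> powr (- 2 * \<beta>) \<le> d * \<sigma> powr (- 2 * \<beta>)" by (intro mult_right_mono) auto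
    also note large[OF True z]
    finally show ?thesis .
  next
    case False
    have "e * \<sigma> powr (- 2 * \<beta>) \<le> e * 1" using pl[OF \<sigma>] d by (intro mult_left_mono) (auto simp: e_def)
    also have "\<dots> \<le> F z - Vp L z" using large[OF order_refl z] by (simp add: e_def)
    also have "\<dots> \<le> F z - Vp \<sigma> z" using Vp_mono[of \<sigma> L z] \<sigma> False by simp
    finally show ?thesis .
  qed
  moreover have "0 < e" using d L1 by (simp add: e_def)
  ultimately show ?thesis by blast
qed

end

section \<open>Tail estimates\<close>

context sbm_laws
begin

text \<open>The logarithm of the ratio of \<open>E exp (- \<sigma> X(t,x))\<close> to
  \<open>P(X(t,x) = 0)\<close>.\<close>

definition "gap X0 t x \<sigma> = (\<integral>y. F ((y - x) / sqrt t) / t \<partial>X0) - (\<integral>y. Vp (\<sigma> * sqrt t) ((y - x) / sqrt t) / t \<partial>X0)"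

lemma fin_measD:
  assumes "fin_meas X0"
  shows "finite_measure X0" "space X0 = UNIV" "sets X0 = sets borel"
  using assms sets_eq_imp_space_eq[of X0 borel] by (auto simp: fin_meas_def)

lemma gap_eq:
  assumes X: "fin_meas X0" "0 < t" and \<sigma>: "0 \<le> \<sigma>"
  shows "gap X0 t x \<sigma> = (\<integral>y. (F ((y - x) / sqrt t) - Vp (\<sigma> * sqrt t) ((y - x) / sqrt t)) / t \<partial>X0)"
    and "integrable X0 (\<lambda>y. (F ((y - x) / sqrt t) - Vp (\<sigma> * sqrt t) ((y - x) / sqrt t)) / t)"
proof -
  note i = zero_formula(2)[OF X, of x] laplace_formula(2)[OF X \<sigma>, of x]
  have e: "(\<lambda>y. (F ((y - x) / sqrt t) - Vp (\<sigma> * sqrt t) ((y - x) / sqrt t)) / t)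
      = (\<lambda>y. F ((y - x) / sqrt t) / t - Vp (\<sigma> * sqrt t) ((y - x) / sqrt t) / t)"
    by (rule ext) (rule diff_divide_distrib)
  show "gap X0 t x \<sigma> = (\<integral>y. (F ((y - x) / sqrt t) - Vp (\<sigma> * sqrt t) ((y - x) / sqrt t)) / t \<partial>X0)"
    unfolding gap_def e by (rule Bochner_Integration.integral_diff[OF i, symmetric])
  show "integrable X0 (\<lambda>y. (F ((y - x) / sqrt t) - Vp (\<sigma> * sqrt t) ((y - x) / sqrt t)) / t)"
    unfolding e by (rule Bochner_Integration.integrable_diff[OF i])
qed

lemma gap_nonneg:
  assumes X: "fin_meas X0" "0 < t" and \<sigma>: "0 \<le> \<sigma>"
  shows "0 \<le> gap X0 t x \<sigma>"
  unfolding gap_eq(1)[OF assms]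
  using Vp_le_F[of "\<sigma> * sqrt t"] X \<sigma> by (intro Bochner_Integration.integral_nonneg) simp

lemma integral_F_le:
  assumes X: "fin_meas X0" "0 < t"
  shows "(\<integral>y. F ((y - x) / sqrt t) / t \<partial>X0) \<le> 2 * (measure X0 UNIV / t)"
proof -
  interpret finite_measure X0 by (rule fin_measD(1)[OF X(1)])
  have "(\<integral>y. F ((y - x) / sqrt t) / t \<partial>X0) \<le> (\<integral>y. 2 / t \<partial>X0)"
    using zero_formula(2)[OF X, of x] X(2) F_bounds(2)
    by (intro Bochner_Integration.integral_mono divide_right_mono) auto
  then show ?thesis by (simp add: fin_measD(2)[OF X(1)] mult.commute)
qed

lemma gap_le:
  assumes X: "fin_meas X0" "0 < t" and \<sigma>: "0 \<le> \<sigma>" and le: "\<And>z. F z - Vp (\<sigma> * sqrt t) z \<le> c"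
  shows "gap X0 t x \<sigma> \<le> c * (measure X0 UNIV / t)"
proof -
  interpret finite_measure X0 by (rule fin_measD(1)[OF X(1)])
  have "gap X0 t x \<sigma> \<le> (\<integral>y. c / t \<partial>X0)"
    unfolding gap_eq(1)[OF X \<sigma>] using gap_eq(2)[OF X \<sigma>, of x] X(2) le
    by (intro Bochner_Integration.integral_mono divide_right_mono) auto
  then show ?thesis by (simp add: fin_measD(2)[OF X(1)] mult.commute)
qed

lemma gap_ge:
  assumes X: "fin_meas X0" "0 < t" and \<sigma>: "0 \<le> \<sigma>" and c: "0 \<le> c"
    and ge: "\<And>z. \<bar>z\<bar> \<le> K \<Longrightarrow> c \<le> F z - Vp (\<sigma> * sqrt t) z"
  shows "c * (measure X0 {x - K * sqrt t .. x + K * sqrt t} / t) \<le> gap X0 t x \<sigma>"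
proof -
  interpret finite_measure X0 by (rule fin_measD(1)[OF X(1)])
  define J where "J = {x - K * sqrt t .. x + K * sqrt t}"
  have J: "J \<in> sets X0" using fin_measD(3)[OF X(1)] by (simp add: J_def)
  have "c / t * measure X0 J = (\<integral>y. c / t * indicat_real J y \<partial>X0)"
    using J fin_measD(2)[OF X(1)] by simp
  also have "\<dots> \<le> gap X0 t x \<sigma>"
    unfolding gap_eq(1)[OF X \<sigma>]
  proof (rule Bochner_Integration.integral_mono[OF _ gap_eq(2)[OF X \<sigma>, of x]])
    show "integrable X0 (\<lambda>y. c / t * indicat_real J y)"
      by (intro integrable_mult_right integrable_real_indicator J) (simp add: emeasure_eq_measure)
    show "c / t * indicat_real J y \<le> (F ((y - x) / sqrt t) - Vp (\<sigma> * sqrt t) ((y - x) / sqrt t)) / t" for y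
    proof (cases "y \<in> J")
      case True
      then have "\<bar>y - x\<bar> \<le> K * sqrt t" unfolding J_def atLeastAtMost_iff by linarith
      then have "\<bar>(y - x) / sqrt t\<bar> \<le> K" using X(2) by (simp add: abs_divide pos_divide_le_eq)
      then have "c / t \<le> (F ((y - x) / sqrt t) - Vp (\<sigma> * sqrt t) ((y - x) / sqrt t)) / t"
        using X(2) by (intro divide_right_mono ge) auto
      then show ?thesis using True by simp
    next
      case False
      have "0 \<le> (F ((y - x) / sqrt t) - Vp (\<sigma> * sqrt t) ((y - x) / sqrt t)) / t"
        using Vp_le_F[of "\<sigma> * sqrt t"] X \<sigma> by simp
      then show ?thesis using False by simp
    qed
  qed
  finally show ?thesis by (simp add: J_def)
qed

text \<open>The Laplace transform restricted to \<open>X(t,x) > 0\<close>, that is, without the atom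
  at 0.\<close>

definition "pos_laplace X0 t x \<sigma> = (\<integral>f. exp (- (\<sigma> * apply_bcontfun f x)) - indicat_real {f. apply_bcontfun f x = 0} f \<partial>Q X0 t)"

lemma pos_laplace:
  assumes X: "fin_meas X0" "0 < t" and \<sigma>: "0 \<le> \<sigma>"
  shows "pos_laplace X0 t x \<sigma> = exp (- (\<integral>y. F ((y - x) / sqrt t) / t \<partial>X0)) * (exp (gap X0 t x \<sigma>) - 1)"
    and "integrable (Q X0 t) (\<lambda>f. exp (- (\<sigma> * apply_bcontfun f x)) - indicat_real {f. apply_bcontfun f x = 0} f)"
proof -
  interpret prob_space "Q X0 t" by (rule lawD(1)[OF X])
  note Z = eval_sets(1)[OF X, of x]
  have i1: "integrable (Q X0 t) (\<lambda>f. exp (- (\<sigma> * apply_bcontfun f x)))" by (rule exp_eval_integrable[OF X \<sigma>])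
  have i2: "integrable (Q X0 t) (indicat_real {f. apply_bcontfun f x = 0})"
    using Z by (rule integrable_real_indicator) (simp add: emeasure_eq_measure)
  show "integrable (Q X0 t) (\<lambda>f. exp (- (\<sigma> * apply_bcontfun f x)) - indicat_real {f. apply_bcontfun f x = 0} f)"
    by (rule Bochner_Integration.integrable_diff[OF i1 i2])
  have "pos_laplace X0 t x \<sigma> = (\<integral>f. exp (- (\<sigma> * apply_bcontfun f x)) \<partial>Q X0 t) - (\<integral>f. indicat_real {f. apply_bcontfun f x = 0} f \<partial>Q X0 t)"
    unfolding pos_laplace_def by (rule Bochner_Integration.integral_diff[OF i1 i2])
  also have "(\<integral>f. indicat_real {f. apply_bcontfun f x = 0} f \<partial>Q X0 t) = exp (- (\<integral>y. F ((y - x) / sqrt t) / t \<partial>X0))"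
    using zero_formula(1)[OF X, of x] by (simp add: law_space[OF X])
  finally have "pos_laplace X0 t x \<sigma> = exp (- (\<integral>y. Vp (\<sigma> * sqrt t) ((y - x) / sqrt t) / t \<partial>X0)) - exp (- (\<integral>y. F ((y - x) / sqrt t) / t \<partial>X0))"
    by (simp only: laplace_formula(1)[OF X \<sigma>])
  then show "pos_laplace X0 t x \<sigma> = exp (- (\<integral>y. F ((y - x) / sqrt t) / t \<partial>X0)) * (exp (gap X0 t x \<sigma>) - 1)"
    by (simp add: gap_def right_diff_distrib exp_add[symmetric])
qed

text \<open>Writing \<open>exp (- I) * (exp g - 1)\<close> as
  \<open>exp (g - I) * (1 - exp (- g))\<close> and using \<open>g \<le> I\<close> gives a bound
  linear in \<open>g\<close> without any restriction on the total mass, as the first claim of the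
  theorem demands.\<close>

lemma pos_laplace_le:
  assumes X: "fin_meas X0" "0 < t" and \<sigma>: "0 \<le> \<sigma>"
  shows "pos_laplace X0 t x \<sigma> \<le> gap X0 t x \<sigma>"
proof -
  define I where "I = (\<integral>y. F ((y - x) / sqrt t) / t \<partial>X0)"
  define g where "g = gap X0 t x \<sigma>"
  have "0 \<le> (\<integral>y. Vp (\<sigma> * sqrt t) ((y - x) / sqrt t) / t \<partial>X0)"
    using Vp_nonneg[of "\<sigma> * sqrt t"] X \<sigma> by (intro Bochner_Integration.integral_nonneg) simp
  then have "g \<le> I" by (simp add: g_def I_def gap_def)
  have "exp (- I) * (exp g - 1) = exp (g - I) * (1 - exp (- g))"
    by (simp add: right_diff_distrib exp_add[symmetric] algebra_simps)
  also have "\<dots> \<le> 1 * g"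
    using \<open>g \<le> I\<close> exp_ge_add_one_self[of "- g"] gap_nonneg[OF assms, of x] by (intro mult_mono) (auto simp: g_def)
  finally show ?thesis by (simp add: pos_laplace(1)[OF assms] I_def g_def)
qed

lemma pos_laplace_ge:
  assumes X: "fin_meas X0" "0 < t" and \<sigma>: "0 \<le> \<sigma>"
  shows "exp (- (\<integral>y. F ((y - x) / sqrt t) / t \<partial>X0)) * gap X0 t x \<sigma> \<le> pos_laplace X0 t x \<sigma>"
  unfolding pos_laplace(1)[OF assms]
proof (rule mult_left_mono)
  show "gap X0 t x \<sigma> \<le> exp (gap X0 t x \<sigma>) - 1"
    using exp_ge_add_one_self[of "gap X0 t x \<sigma>"] by linarith
qed simp

lemma small_prob_eq:
  assumes X: "fin_meas X0" "0 < t"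
  shows "measure (Q X0 t) (small x a)
      = (\<integral>f. indicat_real (small x a) f \<partial>Q X0 t)"
    and "integrable (Q X0 t) (indicat_real (small x a))"
proof -
  interpret prob_space "Q X0 t" by (rule lawD(1)[OF X])
  show "measure (Q X0 t) (small x a)
      = (\<integral>f. indicat_real (small x a) f \<partial>Q X0 t)"
    by (simp add: law_space[OF X])
  show "integrable (Q X0 t) (indicat_real (small x a))"
    using eval_sets(3)[OF X] by (rule integrable_real_indicator) (simp add: emeasure_eq_measure)
qed

text \<open>Chebyshev with parameter \<open>1 / a\<close>: on \<open>0 < X \<le> a\<close> the
  exponential is at least \<open>exp (- 1)\<close>.\<close>

lemma small_prob_le:
  assumes X: "fin_meas X0" "0 < t" and a: "0 < a"
  shows "measure (Q X0 t) (small x a) \<le> exp 1 * pos_laplace X0 t x (1 / a)"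
proof -
  have \<sigma>: "0 \<le> 1 / a" using a by simp
  have "(\<integral>f. indicat_real (small x a) f \<partial>Q X0 t)
    \<le> (\<integral>f. exp 1 * (exp (- (1 / a * apply_bcontfun f x)) - indicat_real {f. apply_bcontfun f x = 0} f) \<partial>Q X0 t)"
  proof (rule integral_mono_AE[OF small_prob_eq(2)[OF X] integrable_mult_right[OF pos_laplace(2)[OF X \<sigma>]]])
    show "AE f in Q X0 t. indicat_real (small x a) f
      \<le> exp 1 * (exp (- (1 / a * apply_bcontfun f x)) - indicat_real {f. apply_bcontfun f x = 0} f)"
      using lawD(3)[OF X]
    proof eventually_elim
      case (elim f)
      define y where "y = apply_bcontfun f x"
      have y: "0 \<le> y" using elim by (simp add: y_def)
      have "1 \<le> exp 1 * exp (- (1 / a * y))" if "y \<le> a"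
      proof -
        have "0 \<le> 1 + - (1 / a * y)" using that a by (simp add: field_simps)
        then have "1 \<le> exp (1 + - (1 / a * y))" by simp
        then show ?thesis by (simp only: exp_add)
      qed
      then show ?case using y by (auto simp: indicator_def y_def[symmetric])
    qed
  qed
  also have "\<dots> = exp 1 * pos_laplace X0 t x (1 / a)" by (simp add: pos_laplace_def)
  finally show ?thesis by (simp only: small_prob_eq(1)[OF X])
qed

text \<open>Values above \<open>a\<close> are cut off by \<open>exp (- M * X / a) \<le> exp (- M /
  2) * exp (- M * X / (2 * a))\<close>. Their contribution is a small multiple of the same transform
  at half the parameter, which the upper bound controls.\<close>

lemma small_prob_ge:
  assumes X: "fin_meas X0" "0 < t" and a: "0 < a" and M: "0 < M"
  shows "pos_laplace X0 t x (M / a) - exp (- M / 2) * pos_laplace X0 t x (M / a / 2)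
    \<le> measure (Q X0 t) (small x a)"
proof -
  have \<sigma>: "0 \<le> M / a" "0 \<le> M / a / 2" using a M by simp_all
  define Z where "Z = indicat_real {f :: real \<Rightarrow>\<^sub>C real. apply_bcontfun f x = 0}"
  note i1 = pos_laplace(2)[OF X \<sigma>(1), of x, folded Z_def]
  note i2 = integrable_mult_right[OF pos_laplace(2)[OF X \<sigma>(2), of x, folded Z_def], of "exp (- M / 2)"]
  have "pos_laplace X0 t x (M / a) - exp (- M / 2) * pos_laplace X0 t x (M / a / 2)
    = (\<integral>f. (exp (- (M / a * apply_bcontfun f x)) - Z f) - exp (- M / 2) * (exp (- (M / a / 2 * apply_bcontfun f x)) - Z f) \<partial>Q X0 t)"
    unfolding pos_laplace_def Z_def[symmetric] Bochner_Integration.integral_diff[OF i1 i2] by simp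
  also have "\<dots> \<le> (\<integral>f. indicat_real (small x a) f \<partial>Q X0 t)"
  proof (rule integral_mono_AE[OF Bochner_Integration.integrable_diff[OF i1 i2] small_prob_eq(2)[OF X]])
    show "AE f in Q X0 t. (exp (- (M / a * apply_bcontfun f x)) - Z f) - exp (- M / 2) * (exp (- (M / a / 2 * apply_bcontfun f x)) - Z f)
      \<le> indicat_real (small x a) f"
      using lawD(3)[OF X]
    proof eventually_elim
      case (elim f)
      define y where "y = apply_bcontfun f x"
      have y: "0 \<le> y" using elim by (simp add: y_def)
      define e where "e = exp (- (M / a / 2 * y))"
      have e: "exp (- (M / a * y)) = e * e" "0 < e" by (simp_all add: e_def exp_add[symmetric])
      consider "y = 0" | "0 < y" "y \<le> a" | "a < y" using y by linarith
      then have "(exp (- (M / a * y)) - (if y = 0 then 1 else 0)) - exp (- M / 2) * (e - (if y = 0 then 1 else 0))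
        \<le> (if 0 < y \<and> y \<le> a then 1 else 0)"
      proof cases
        case 1
        then show ?thesis by (simp add: e_def)
      next
        case 2
        have "exp (- (M / a * y)) \<le> 1" using M a 2 by simp
        moreover have "0 \<le> exp (- M / 2) * e" using e by simp
        ultimately have "exp (- (M / a * y)) - exp (- M / 2) * e \<le> 1" by linarith
        then show ?thesis using 2 by simp
      next
        case 3
        have "M / 2 * 1 \<le> M / 2 * (y / a)" using M a 3 by (intro mult_left_mono) auto
        then have "e \<le> exp (- M / 2)" by (simp add: e_def)
        then have "e * e \<le> exp (- M / 2) * e" using e(2) by (intro mult_right_mono) auto
        then have "exp (- (M / a * y)) - exp (- M / 2) * e \<le> 0" unfolding e(1) by linarith
        then show ?thesis using 3 a by simp
      qed
      then show ?case by (simp add: Z_def indicator_def y_def e_def of_bool_def)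
    qed
  qed
  finally show ?thesis by (simp only: small_prob_eq(1)[OF X])
qed

lemma scale_powr:
  assumes "0 < M" "0 < a" "0 < t"
  shows "(M / a * sqrt t) powr (- 2 * \<beta>) / t = M powr (- 2 * \<beta>) * (t powr (- 1 - \<beta>) * a powr (2 * \<beta>))"
proof -
  have "(M / a * sqrt t) powr (- 2 * \<beta>) = M powr (- 2 * \<beta>) / a powr (- 2 * \<beta>) * (sqrt t) powr (- 2 * \<beta>)"
    using assms by (simp add: powr_mult powr_divide)
  also have "(sqrt t) powr (- 2 * \<beta>) = t powr (- \<beta>)"
    using assms powr_powr[of t "1 / 2" "- 2 * \<beta>"] by (simp add: powr_half_sqrt)
  also have "M powr (- 2 * \<beta>) / a powr (- 2 * \<beta>) = M powr (- 2 * \<beta>) * a powr (2 * \<beta>)"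
    by (simp add: powr_minus_divide)
  finally have "(M / a * sqrt t) powr (- 2 * \<beta>) / t = M powr (- 2 * \<beta>) * a powr (2 * \<beta>) * (t powr (- \<beta>) / t)" by simp
  also have "t powr (- \<beta>) / t = t powr (- 1 - \<beta>)"
    using assms powr_mult_base[of t "- 1 - \<beta>"] by (simp add: field_simps)
  finally show ?thesis by (simp add: mult_ac)
qed

lemma upper_tail:
  "\<exists>C>0. \<forall>X0 a t x. fin_meas X0 \<longrightarrow> 0 < a \<longrightarrow> 0 < t \<longrightarrow>
     measure (Q X0 t) (small x a)
       \<le> C * measure X0 UNIV * t powr (- 1 - \<beta>) * a powr (2 * \<beta>)"
proof -
  obtain C where C: "0 < C" "\<And>\<sigma> z. 0 < \<sigma> \<Longrightarrow> F z - Vp \<sigma> z \<le> C * \<sigma> powr (- 2 * \<beta>)"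
    using gap_upper by blast
  have "measure (Q X0 t) (small x a)
       \<le> exp 1 * C * measure X0 UNIV * t powr (- 1 - \<beta>) * a powr (2 * \<beta>)"
    if X: "fin_meas X0" "0 < t" and a: "0 < a" for X0 t x a
  proof -
    have \<sigma>: "0 \<le> 1 / a" "0 < 1 / a * sqrt t" using a X by simp_all
    have "pos_laplace X0 t x (1 / a) \<le> gap X0 t x (1 / a)" by (rule pos_laplace_le[OF X \<sigma>(1)])
    also have "\<dots> \<le> (C * (1 / a * sqrt t) powr (- 2 * \<beta>)) * (measure X0 UNIV / t)"
      by (rule gap_le[OF X \<sigma>(1) C(2)[OF \<sigma>(2)]])
    also have "\<dots> = C * measure X0 UNIV * ((1 / a * sqrt t) powr (- 2 * \<beta>) / t)" by simp
    also have "\<dots> = C * measure X0 UNIV * (t powr (- 1 - \<beta>) * a powr (2 * \<beta>))"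
      unfolding scale_powr[OF zero_less_one a X(2)] by simp
    finally have le: "exp 1 * pos_laplace X0 t x (1 / a) \<le> exp 1 * (C * measure X0 UNIV * (t powr (- 1 - \<beta>) * a powr (2 * \<beta>)))"
      by (rule mult_left_mono) simp
    show ?thesis using order_trans[OF small_prob_le[OF X a, of x] le] by (simp only: mult.assoc)
  qed
  moreover have "0 < exp 1 * C" using C(1) by simp
  ultimately show ?thesis by blast
qed

lemma lower_tail:
  assumes K: "1 \<le> K"
  shows "\<exists>c>0. \<forall>X0 t x a. fin_meas X0 \<longrightarrow> 0 < t \<longrightarrow> measure X0 UNIV \<le> K * t \<longrightarrow>
     K powr (- 2) * measure X0 UNIV \<le> measure X0 {x - K * sqrt t .. x + K * sqrt t} \<longrightarrow> 0 \<le> a \<longrightarrow> a \<le> sqrt t \<longrightarrow>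
     c * measure X0 UNIV * t powr (- 1 - \<beta>) * a powr (2 * \<beta>)
       \<le> measure (Q X0 t) (small x a)"
proof -
  obtain C where C: "0 < C" "\<And>\<sigma> z. 0 < \<sigma> \<Longrightarrow> F z - Vp \<sigma> z \<le> C * \<sigma> powr (- 2 * \<beta>)"
    using gap_upper by blast
  obtain c where c: "0 < c" "\<And>\<sigma> z. 1 \<le> \<sigma> \<Longrightarrow> \<bar>z\<bar> \<le> K \<Longrightarrow> c * \<sigma> powr (- 2 * \<beta>) \<le> F z - Vp \<sigma> z"
    using gap_lower[of K] by blast
  \<comment> \<open>\<open>exp (- 2 * K)\<close> bounds the probability of \<open>X(t,x) = 0\<close>
    from below, by \<open>F \<le> 2\<close> and total mass at most \<open>K * t\<close>;
    \<open>K powr (- 2)\<close> is the share of the mass near \<open>x\<close>.\<close>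
  define b where "b = exp (- 2 * K) * c * K powr (- 2)"
  have b: "0 < b" using c K by (simp add: b_def)
  define D where "D = C * (1 / 2) powr (- 2 * \<beta>)"
  have D: "0 < D" using C by (simp add: D_def)
  have "((\<lambda>M :: real. exp (- M / 2)) \<longlongrightarrow> 0) at_top" by real_asymp
  then have "\<forall>\<^sub>F M in at_top. exp (- M / 2) < b / (2 * D)"
    by (rule order_tendstoD(2)) (use b D in simp)
  then have "\<forall>\<^sub>F M in at_top. exp (- M / 2) < b / (2 * D) \<and> 1 \<le> M"
    by (intro eventually_conj eventually_ge_at_top)
  \<comment> \<open>So large that the term subtracted in \<open>small_prob_ge\<close> is at most
    half of the main one; both carry the same power of \<open>a\<close>, so \<open>M\<close> depends
    on \<open>K\<close> only.\<close>
  then obtain M where M: "exp (- M / 2) < b / (2 * D)" "1 \<le> M"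
    using eventually_happens'[OF trivial_limit_at_top_linorder] by blast
  define d where "d = b / 2 * M powr (- 2 * \<beta>)"
  have d: "0 < d" using b M by (simp add: d_def)
  have "d * measure X0 UNIV * t powr (- 1 - \<beta>) * a powr (2 * \<beta>)
       \<le> measure (Q X0 t) (small x a)"
    if X: "fin_meas X0" "0 < t" and mass: "measure X0 UNIV \<le> K * t"
      and ratio: "K powr (- 2) * measure X0 UNIV \<le> measure X0 {x - K * sqrt t .. x + K * sqrt t}"
      and a: "0 \<le> a" "a \<le> sqrt t" for X0 t x a
  \<comment> \<open>At \<open>a = 0\<close> the left-hand side is 0, because
    \<open>0 powr (2 * \<beta>) = 0\<close>.\<close>
  proof (cases "a = 0")
    case False
    then have a0: "0 < a" using a by simp
    define m where "m = measure X0 UNIV / t"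
    define s where "s = M / a * sqrt t"
    define I where "I = (\<integral>y. F ((y - x) / sqrt t) / t \<partial>X0)"
    have m: "0 \<le> m" "m \<le> K" using X mass by (simp_all add: m_def pos_divide_le_eq)
    have \<sigma>: "0 \<le> M / a" "0 \<le> M / a / 2" using M a0 by simp_all
    \<comment> \<open>The condition \<open>a \<le> sqrt t\<close> enters here: the lower bound on
      the gap wants a parameter of at least 1.\<close>
    have "1 * 1 \<le> M * (sqrt t / a)" using M a a0 by (intro mult_mono) auto
    then have s: "1 \<le> s" by (simp add: s_def)
    have "I \<le> 2 * m" unfolding I_def m_def by (rule integral_F_le[OF X])
    then have eI: "exp (- 2 * K) \<le> exp (- I)" using m by simp
    have "(c * s powr (- 2 * \<beta>)) * (measure X0 {x - K * sqrt t .. x + K * sqrt t} / t) \<le> gap X0 t x (M / a)"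
    proof (rule gap_ge[OF X \<sigma>(1)])
      show "0 \<le> c * s powr (- 2 * \<beta>)" using c(1) by simp
      show "c * s powr (- 2 * \<beta>) \<le> F z - Vp (M / a * sqrt t) z" if "\<bar>z\<bar> \<le> K" for z
        using c(2)[OF s that] by (simp add: s_def)
    qed
    moreover have "(c * s powr (- 2 * \<beta>)) * (K powr (- 2) * m) \<le> (c * s powr (- 2 * \<beta>)) * (measure X0 {x - K * sqrt t .. x + K * sqrt t} / t)"
      using divide_right_mono[OF ratio, of t] X(2) c(1) by (intro mult_left_mono) (auto simp: m_def)
    ultimately have g: "(c * s powr (- 2 * \<beta>)) * (K powr (- 2) * m) \<le> gap X0 t x (M / a)" by simp
    have "exp (- 2 * K) * ((c * s powr (- 2 * \<beta>)) * (K powr (- 2) * m)) \<le> exp (- I) * gap X0 t x (M / a)"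
      using eI g m c(1) by (intro mult_mono) auto
    also have "\<dots> \<le> pos_laplace X0 t x (M / a)" unfolding I_def by (rule pos_laplace_ge[OF X \<sigma>(1)])
    finally have 1: "b * (s powr (- 2 * \<beta>) * m) \<le> pos_laplace X0 t x (M / a)" by (simp add: b_def mult_ac)
    have s2: "M / a / 2 * sqrt t = s * (1 / 2)" by (simp add: s_def)
    have "pos_laplace X0 t x (M / a / 2) \<le> gap X0 t x (M / a / 2)" by (rule pos_laplace_le[OF X \<sigma>(2)])
    also have "\<dots> \<le> (C * (s * (1 / 2)) powr (- 2 * \<beta>)) * m"
      unfolding m_def
    proof (rule gap_le[OF X \<sigma>(2)])
      show "F z - Vp (M / a / 2 * sqrt t) z \<le> C * (s * (1 / 2)) powr (- 2 * \<beta>)" for z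
        unfolding s2 using s by (intro C(2)) simp
    qed
    also have "(s * (1 / 2)) powr (- 2 * \<beta>) = s powr (- 2 * \<beta>) * (1 / 2) powr (- 2 * \<beta>)"
      using s by (intro powr_mult)
    finally have "pos_laplace X0 t x (M / a / 2) \<le> D * (s powr (- 2 * \<beta>) * m)" by (simp add: D_def mult_ac)
    then have "exp (- M / 2) * pos_laplace X0 t x (M / a / 2) \<le> exp (- M / 2) * (D * (s powr (- 2 * \<beta>) * m))"
      by (rule mult_left_mono) simp
    also have "\<dots> \<le> b / (2 * D) * (D * (s powr (- 2 * \<beta>) * m))"
      using M(1) D m by (intro mult_right_mono) auto
    also have "\<dots> = b / 2 * (s powr (- 2 * \<beta>) * m)" using D by simp
    finally have "b / 2 * (s powr (- 2 * \<beta>) * m) \<le> pos_laplace X0 t x (M / a) - exp (- M / 2) * pos_laplace X0 t x (M / a / 2)"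
      using 1 by simp
    also have "\<dots> \<le> measure (Q X0 t) (small x a)"
      using M(2) by (intro small_prob_ge[OF X a0]) simp
    finally have "b / 2 * (s powr (- 2 * \<beta>) * m) \<le> measure (Q X0 t) (small x a)" .
    moreover have "s powr (- 2 * \<beta>) * m = measure X0 UNIV * ((M / a * sqrt t) powr (- 2 * \<beta>) / t)"
      by (simp add: s_def m_def)
    then have "s powr (- 2 * \<beta>) * m = measure X0 UNIV * (M powr (- 2 * \<beta>) * (t powr (- 1 - \<beta>) * a powr (2 * \<beta>)))"
      unfolding scale_powr[OF less_le_trans[OF zero_less_one M(2)] a0 X(2)] .
    ultimately show ?thesis by (simp add: d_def mult_ac)
  qed simp
  then show ?thesis using d by blast
qed

lemma ground_state_energy: "lambda0 (sbmF Q) = 1 / 2 + \<beta>"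
  by (simp add: sbmF_eq gs.lambda0_eq \<beta>_def)

end

theorem theorem4p8:
  fixes Q :: "real measure \<Rightarrow> real \<Rightarrow> (real \<Rightarrow>\<^sub>C real) measure"
  assumes sbm: "\<And>X0 t. fin_meas X0 \<Longrightarrow> 0 < t \<Longrightarrow> is_sbm_law X0 t (Q X0 t)"
  defines "l0 \<equiv> lambda0 (sbmF Q)"
  shows
   "(\<exists>C>0. \<forall>X0 a t x. fin_meas X0 \<longrightarrow> 0 < a \<longrightarrow> 0 < t \<longrightarrow>
        measure (Q X0 t) {f. 0 < apply_bcontfun f x \<and> apply_bcontfun f x \<le> a}
          \<le> C * measure X0 UNIV * t powr (-(1/2) - l0) * a powr (2 * l0 - 1))
    \<and>
    (\<exists>Cl :: real \<Rightarrow> real. (\<forall>K\<ge>1. 0 < Cl K) \<and>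
      (\<forall>K\<ge>1. \<forall>t>0. \<forall>x X0. fin_meas X0 \<longrightarrow> measure X0 UNIV \<le> K * t \<longrightarrow>
          measure X0 {x - K * sqrt t .. x + K * sqrt t} / measure X0 UNIV \<ge> K powr (-2) \<longrightarrow>
          (\<forall>a. 0 \<le> a \<longrightarrow> a \<le> sqrt t \<longrightarrow>
             measure (Q X0 t) {f. 0 < apply_bcontfun f x \<and> apply_bcontfun f x \<le> a}
               \<ge> Cl K * measure X0 UNIV * t powr (-(1/2) - l0) * a powr (2 * l0 - 1))) \<and>
      (\<forall>K\<ge>1. \<forall>t x x0. \<bar>x - x0\<bar> \<le> K * sqrt t \<longrightarrow> t \<ge> 1 / K \<longrightarrow>
          (\<forall>a. 0 \<le> a \<longrightarrow> a \<le> sqrt t \<longrightarrow>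
             measure (Q (return borel x0) t) {f. 0 < apply_bcontfun f x \<and> apply_bcontfun f x \<le> a}
               \<ge> Cl K * t powr (-(1/2) - l0) * a powr (2 * l0 - 1))) \<and>
      (\<forall>K\<ge>1. \<forall>t x X0. fin_meas X0 \<longrightarrow> measure X0 UNIV \<le> K \<longrightarrow>
          measure X0 {-K..K} \<ge> 1 / K \<longrightarrow> t \<ge> 1 / K \<longrightarrow> \<bar>x\<bar> \<le> K \<longrightarrow>
          (\<forall>a. 0 \<le> a \<longrightarrow> a \<le> sqrt t \<longrightarrow>
             measure (Q X0 t) {f. 0 < apply_bcontfun f x \<and> apply_bcontfun f x \<le> a}
               \<ge> Cl (K^2) * (1 / K) * t powr (-(1/2) - l0) * a powr (2 * l0 - 1))))"
proof -
  interpret sbm_laws Q by unfold_locales (rule sbm)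
  have l0: "- (1 / 2) - l0 = - 1 - \<beta>" "2 * l0 - 1 = 2 * \<beta>"
    by (simp_all add: l0_def ground_state_energy)
  define G where "G K c \<longleftrightarrow> 0 < c \<and> (\<forall>X0 t x a. fin_meas X0 \<longrightarrow> 0 < t \<longrightarrow> measure X0 UNIV \<le> K * t \<longrightarrow>
     K powr (- 2) * measure X0 UNIV \<le> measure X0 {x - K * sqrt t .. x + K * sqrt t} \<longrightarrow> 0 \<le> a \<longrightarrow> a \<le> sqrt t \<longrightarrow>
     c * measure X0 UNIV * t powr (- 1 - \<beta>) * a powr (2 * \<beta>)
       \<le> measure (Q X0 t) (small x a))" for K c
  have ex: "\<exists>c. G K c" if "1 \<le> K" for K using lower_tail[OF that] by (simp only: G_def)
  \<comment> \<open>The factor 4 lets one constant serve all three claims: the interval of the third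
    claim has only half-width K, while its centre may be off by K as well.\<close>
  define Cl where "Cl K = (SOME c. G (4 * K) c)" for K
  have Cl: "G (4 * K) (Cl K)" if "1 \<le> K" for K
    unfolding Cl_def using that by (intro someI_ex[OF ex]) simp
  have Cl_pos: "0 < Cl K" if "1 \<le> K" for K using Cl[OF that] by (simp add: G_def)
  have lower: "Cl K * measure X0 UNIV * t powr (- 1 - \<beta>) * a powr (2 * \<beta>)
       \<le> measure (Q X0 t) (small x a)"
    if "1 \<le> K" "fin_meas X0" "0 < t" "measure X0 UNIV \<le> (4 * K) * t"
      "(4 * K) powr (- 2) * measure X0 UNIV \<le> measure X0 {x - (4 * K) * sqrt t .. x + (4 * K) * sqrt t}"
      "0 \<le> a" "a \<le> sqrt t" for K X0 t x a
    using Cl[OF that(1)] that(2-) by (simp only: G_def)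
  have mono: "measure X0 A \<le> measure X0 {l..u}" if "fin_meas X0" "A \<subseteq> {l..u}" for X0 A and l u :: real
  proof -
    interpret finite_measure X0 by (rule fin_measD(1)[OF that(1)])
    show ?thesis using that fin_measD(3)[OF that(1)] by (intro finite_measure_mono) auto
  qed
  have powr4: "(4 * K) powr (- 2) \<le> K powr (- 2)" "(4 * K) powr (- 2) \<le> 1" if "1 \<le> K" for K :: real
    using powr_mono2'[of "- 2" K "4 * K"] powr_mono2'[of "- 2" 1 "4 * K"] that by simp_all
  show ?thesis
    unfolding l0
  proof (intro conjI exI[of _ Cl] allI impI upper_tail)
    show "0 < Cl K" if "1 \<le> K" for K by (rule Cl_pos[OF that])
  next
    fix K t x X0 a
    assume K: "1 \<le> K" and t: "0 < t" and X: "fin_meas X0" and m: "measure X0 UNIV \<le> K * t"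
      and r: "K powr (- 2) \<le> measure X0 {x - K * sqrt t .. x + K * sqrt t} / measure X0 UNIV"
      and a: "0 \<le> a" "a \<le> sqrt t"
    show "Cl K * measure X0 UNIV * t powr (- 1 - \<beta>) * a powr (2 * \<beta>)
       \<le> measure (Q X0 t) (small x a)"
    proof (rule lower[OF K X t _ _ a])
      have "K * t \<le> 4 * K * t" using K t by simp
      then show "measure X0 UNIV \<le> 4 * K * t" using m by linarith
      \<comment> \<open>For the zero measure the quotient in the hypothesis is
        \<open>0 / 0 = 0\<close>, which is below \<open>K powr (- 2)\<close>.\<close>
      have "measure X0 UNIV \<noteq> 0"
      proof
        assume "measure X0 UNIV = 0"
        then have "K powr (- 2) \<le> 0" using r by simp
        then show False using K by simp
      qed
      then have mp: "0 < measure X0 UNIV" by (simp add: zero_less_measure_iff)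
      have "(4 * K) powr (- 2) * measure X0 UNIV \<le> K powr (- 2) * measure X0 UNIV"
        by (rule mult_right_mono[OF powr4(1)[OF K]]) simp
      also have "\<dots> \<le> measure X0 {x - K * sqrt t .. x + K * sqrt t}" using r mp by (simp add: pos_le_divide_eq)
      also have "\<dots> \<le> measure X0 {x - 4 * K * sqrt t .. x + 4 * K * sqrt t}"
      proof (rule mono[OF X])
        have "0 \<le> K * sqrt t" using K t by simp
        then show "{x - K * sqrt t .. x + K * sqrt t} \<subseteq> {x - 4 * K * sqrt t .. x + 4 * K * sqrt t}" by auto
      qed
      finally show "(4 * K) powr (- 2) * measure X0 UNIV \<le> measure X0 {x - 4 * K * sqrt t .. x + 4 * K * sqrt t}" .
    qed
  next
    fix K t x x0 a :: real
    assume K: "1 \<le> K" and x: "\<bar>x - x0\<bar> \<le> K * sqrt t" and tK: "1 / K \<le> t" and a: "0 \<le> a" "a \<le> sqrt t"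
    have t: "0 < t" using K tK by (intro less_le_trans[OF _ tK]) simp
    have tK': "1 \<le> K * t" using tK K by (simp add: pos_divide_le_eq mult.commute)
    interpret R: prob_space "return borel x0" by (rule prob_space_return) simp
    have one: "measure (return borel x0) UNIV = 1" using R.prob_space by simp
    have "Cl K * measure (return borel x0) UNIV * t powr (- 1 - \<beta>) * a powr (2 * \<beta>)
       \<le> measure (Q (return borel x0) t) (small x a)"
    proof (rule lower[OF K fin_meas_return t _ _ a])
      show "measure (return borel x0) UNIV \<le> 4 * K * t" unfolding one using tK' by linarith
      have "0 \<le> K * sqrt t" using K t by simp
      then have "x0 \<in> {x - 4 * K * sqrt t .. x + 4 * K * sqrt t}" using x unfolding atLeastAtMost_iff by linarith
      then have "measure (return borel x0) {x - 4 * K * sqrt t .. x + 4 * K * sqrt t} = 1"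
        by (simp add: measure_return)
      then show "(4 * K) powr (- 2) * measure (return borel x0) UNIV \<le> measure (return borel x0) {x - 4 * K * sqrt t .. x + 4 * K * sqrt t}"
        using powr4(2)[OF K] by (simp add: one)
    qed
    then show "Cl K * t powr (- 1 - \<beta>) * a powr (2 * \<beta>)
       \<le> measure (Q (return borel x0) t) (small x a)" by (simp add: one)
  next
    fix K t x X0 and a :: real
    assume K: "1 \<le> K" and X: "fin_meas X0" and m: "measure X0 UNIV \<le> K" and mK: "1 / K \<le> measure X0 {-K..K}"
      and tK: "1 / K \<le> t" and x: "\<bar>x\<bar> \<le> K" and a: "0 \<le> a" "a \<le> sqrt t"
    \<comment> \<open>The third claim is an instance with \<open>K^2\<close> in place of
      \<open>K\<close>: the mass is at most \<open>K \<le> K^2 * t\<close>, and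
      \<open>[-K, K]\<close> carries at least the share \<open>1 / K^2\<close> of it.\<close>
    have K2: "1 \<le> K\<^sup>2" using K by (rule one_le_power)
    have t: "0 < t" using K tK by (intro less_le_trans[OF _ tK]) simp
    have tK': "1 \<le> K * t" using tK K by (simp add: pos_divide_le_eq mult.commute)
    have full: "1 / K \<le> measure X0 UNIV"
    proof -
      interpret finite_measure X0 by (rule fin_measD(1)[OF X])
      have "measure X0 {-K..K} \<le> measure X0 UNIV"
        using fin_measD(3)[OF X] by (intro finite_measure_mono) auto
      then show ?thesis using mK by simp
    qed
    have main: "Cl (K\<^sup>2) * measure X0 UNIV * t powr (- 1 - \<beta>) * a powr (2 * \<beta>)
       \<le> measure (Q X0 t) (small x a)"
    proof (rule lower[OF K2 X t _ _ a])
      have "K * 1 \<le> K * (K * t)" using tK' K by (intro mult_left_mono) auto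
      then have "measure X0 UNIV \<le> 4 * (K * (K * t))" using m K by linarith
      then show "measure X0 UNIV \<le> 4 * K\<^sup>2 * t" by (simp add: power2_eq_square mult.assoc)
      have "(4 * K\<^sup>2) powr (- 2) \<le> (K\<^sup>2) powr (- 2)" by (rule powr4(1)[OF K2])
      also have "(K\<^sup>2) powr (- 2) = 1 / (K\<^sup>2 * K\<^sup>2)"
        using K by (simp add: powr_minus_divide powr_numeral power2_eq_square)
      also have "\<dots> \<le> 1 / (K * K)"
      proof (rule divide_left_mono)
        show "K * K \<le> K\<^sup>2 * K\<^sup>2" using mult_left_mono[OF K2, of "K\<^sup>2"] by (simp add: power2_eq_square)
      qed (use K in auto)
      finally have "(4 * K\<^sup>2) powr (- 2) * measure X0 UNIV \<le> 1 / (K * K) * K" using m K by (intro mult_mono) auto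
      also have "\<dots> = 1 / K" using K by simp
      also note mK
      also have "measure X0 {-K..K} \<le> measure X0 {x - 4 * K\<^sup>2 * sqrt t .. x + 4 * K\<^sup>2 * sqrt t}"
      proof (rule mono[OF X])
        \<comment> \<open>Yields \<open>K * sqrt t \<ge> 1\<close>, hence a half-width of at least
          \<open>4 * K\<close>; an interval around a point of \<open>[-K, K]\<close> needs
          \<open>2 * K\<close> to contain \<open>[-K, K]\<close>.\<close>
        have "1 \<le> K\<^sup>2 * t"
        proof -
          have "1 * 1 \<le> K * (K * t)" using K tK' by (intro mult_mono) auto
          then show ?thesis by (simp add: power2_eq_square)
        qed
        then have "1 \<le> sqrt (K\<^sup>2 * t)" by simp
        then have "1 \<le> K * sqrt t" using K by (simp add: real_sqrt_mult)
        then have "(4 * K) * 1 \<le> (4 * K) * (K * sqrt t)" using K by (intro mult_left_mono) auto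
        then have "4 * K \<le> 4 * K\<^sup>2 * sqrt t" by (simp add: power2_eq_square)
        then show "{-K..K} \<subseteq> {x - 4 * K\<^sup>2 * sqrt t .. x + 4 * K\<^sup>2 * sqrt t}"
          using x K unfolding atLeastatMost_subset_iff by (intro disjI2 conjI; linarith)
      qed
      finally show "(4 * K\<^sup>2) powr (- 2) * measure X0 UNIV \<le> measure X0 {x - 4 * K\<^sup>2 * sqrt t .. x + 4 * K\<^sup>2 * sqrt t}" .
    qed
    have "Cl (K\<^sup>2) * (1 / K) * t powr (- 1 - \<beta>) * a powr (2 * \<beta>) \<le> Cl (K\<^sup>2) * measure X0 UNIV * t powr (- 1 - \<beta>) * a powr (2 * \<beta>)"
      using full Cl_pos[OF K2] by (intro mult_right_mono mult_left_mono) auto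
    then show "Cl (K\<^sup>2) * (1 / K) * t powr (- 1 - \<beta>) * a powr (2 * \<beta>)
       \<le> measure (Q X0 t) (small x a)"
      using main by (rule order_trans)
  qed
qed

end
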